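(* Let $G$ be a locally compact group, let $\phi\in\Delta(L^1(G))$ (regarded as a character on $M(G)$ by extension) and let $\psi\in\Delta(A(G))$. Then $M(G)\otimes_pA(G)$ is left $\phi\otimes\psi$-biprojective if and only if $G$ is finite.
   Context: For a Banach algebra $A$, $\Delta(A)$ is the set of all non-zero multiplicative linear functionals on $A$. $A\otimes_pB$ is the projective tensor product of Banach algebras; for $\phi\in\Delta(A)$, $\psi\in\Delta(B)$, $\phi\otimes\psi\in\Delta(A\otimes_pB)$ is given by $(\phi\otimes\psi)(a\otimes b)=\phi(a)\psi(b)$. $A\otimes_pA$ is a Banach $A$-bimodule via $a\cdot(b\otimes c)=ab\otimes c$, $(b\otimes c)\cdot a=b\otimes ca$, and $\pi_A:A\otimes_pA\to A$ is the bounded linear map with $\pi_A(a\otimes b)=ab$. For $\phi\in\Delta(A)$, $A$ is left $\phi$-biprojective if there is a bounded linear map $\rho:A\to A\otimes_pA$ with $\rho(ab)=a\cdot\rho(b)=\phi(b)\rho(a)$ and $\phi\circ\pi_A\circ\rho(a)=\phi(a)$ for all $a,b\in A$. $M(G)$ is the measure algebra and $A(G)$ the Fourier algebra of $G$; $\Delta(A(G))$ consists of the point evaluations $f\mapsto f(x)$, $x\in G$. Each $\phi\in\Delta(L^1(G))$ has the form $\phi(f)=\int_G\overline{\rho(x)}f(x)\,dx$ for a continuous homomorphism $\rho:G\to\mathbb{T}$ ($dx$ a Haar measure), and, since $L^1(G)$ is a closed ideal of $M(G)$, it extends to a character on $M(G)$, again denoted $\phi$. *)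

theory Defs
  imports "HOL-Analysis.Analysis"
begin

section \<open>Normed spaces and algebras over the complex numbers\<close>

text \<open>
  The library has no class of complex normed spaces, and the algebras below depend on a Haar
  measure, so spaces are records with an explicit carrier. Values of operations and of maps outside
  the carriers are irrelevant.
\<close>

record 'a nspace =
  carrier :: "'a set"
  vadd :: "'a \<Rightarrow> 'a \<Rightarrow> 'a"
  vscale :: "complex \<Rightarrow> 'a \<Rightarrow> 'a"
  vnorm :: "'a \<Rightarrow> real"

record 'a nalgebra = "'a nspace" +
  vmult :: "'a \<Rightarrow> 'a \<Rightarrow> 'a"

definition complex_space :: "complex nspace" where
  "complex_space = \<lparr>carrier = UNIV, vadd = (+), vscale = (*), vnorm = cmod\<rparr>"

definition linear_maps :: "('a, 'm) nspace_scheme \<Rightarrow> ('b, 'n) nspace_scheme \<Rightarrow> ('a \<Rightarrow> 'b) set" where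
  "linear_maps X Y = {T.
     (\<forall>x\<in>carrier X. T x \<in> carrier Y) \<and>
     (\<forall>x\<in>carrier X. \<forall>y\<in>carrier X. T (vadd X x y) = vadd Y (T x) (T y)) \<and>
     (\<forall>c. \<forall>x\<in>carrier X. T (vscale X c x) = vscale Y c (T x))}"

definition bounded_linear_maps ::
  "('a, 'm) nspace_scheme \<Rightarrow> ('b, 'n) nspace_scheme \<Rightarrow> ('a \<Rightarrow> 'b) set" where
  "bounded_linear_maps X Y =
     {T \<in> linear_maps X Y. \<exists>C. \<forall>x\<in>carrier X. vnorm Y (T x) \<le> C * vnorm X x}"

text \<open>The character space $\Delta(A)$: non-zero multiplicative linear functionals.\<close>

definition characters :: "('a, 'm) nalgebra_scheme \<Rightarrow> ('a \<Rightarrow> complex) set" where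
  "characters A = {\<phi> \<in> linear_maps A complex_space.
     (\<forall>a\<in>carrier A. \<forall>b\<in>carrier A. \<phi> (vmult A a b) = \<phi> a * \<phi> b) \<and>
     (\<exists>a\<in>carrier A. \<phi> a \<noteq> 0)}"


section \<open>The projective tensor product\<close>

definition bilinear_forms ::
  "('a, 'm) nspace_scheme \<Rightarrow> ('b, 'n) nspace_scheme \<Rightarrow> ('a \<Rightarrow> 'b \<Rightarrow> complex) set" where
  "bilinear_forms A B = {\<Phi>.
     (\<forall>a\<in>carrier A. \<Phi> a \<in> linear_maps B complex_space) \<and>
     (\<forall>b\<in>carrier B. (\<lambda>a. \<Phi> a b) \<in> linear_maps A complex_space) \<and>
     (\<exists>C. \<forall>a\<in>carrier A. \<forall>b\<in>carrier B. cmod (\<Phi> a b) \<le> C * vnorm A a * vnorm B b)}"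

text \<open>
  As in Ryan's book on tensor products, $a \otimes b$ is realised as the functional
  $\Phi \mapsto \Phi(a,b)$ on the bounded bilinear forms on $A \times B$, and tensors are functionals
  on these forms. They are set to 0 outside the set of bounded bilinear forms, so that equality of
  tensors is equality of functions.
\<close>

type_synonym ('a, 'b) tensor = "('a \<Rightarrow> 'b \<Rightarrow> complex) \<Rightarrow> complex"

definition elem_tensor ::
  "('a, 'm) nspace_scheme \<Rightarrow> ('b, 'n) nspace_scheme \<Rightarrow> 'a \<Rightarrow> 'b \<Rightarrow> ('a, 'b) tensor" where
  "elem_tensor A B a b = (\<lambda>\<Phi>. if \<Phi> \<in> bilinear_forms A B then \<Phi> a b else 0)"

definition tensor_rep ::
  "('a, 'm) nspace_scheme \<Rightarrow> ('b, 'n) nspace_scheme \<Rightarrow> (nat \<Rightarrow> 'a) \<Rightarrow> (nat \<Rightarrow> 'b) \<Rightarrow> ('a, 'b) tensor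
     \<Rightarrow> bool" where
  "tensor_rep A B a b t \<longleftrightarrow>
     (\<forall>n. a n \<in> carrier A \<and> b n \<in> carrier B) \<and>
     summable (\<lambda>n. vnorm A (a n) * vnorm B (b n)) \<and>
     t = (\<lambda>\<Phi>. \<Sum>n. elem_tensor A B (a n) (b n) \<Phi>)"

text \<open>
  Every element of the completed projective tensor product of Banach spaces is a series
  $\sum_n a_n \otimes b_n$ with $\sum_n \|a_n\|\,\|b_n\| < \infty$, and its norm is the infimum of
  these sums over all such representations.
\<close>

definition ptensor_space ::
  "('a, 'm) nspace_scheme \<Rightarrow> ('b, 'n) nspace_scheme \<Rightarrow> ('a, 'b) tensor nspace" where
  "ptensor_space A B = \<lparr>
     carrier = {t. \<exists>a b. tensor_rep A B a b t},
     vadd = (\<lambda>s t \<Phi>. s \<Phi> + t \<Phi>),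
     vscale = (\<lambda>c t \<Phi>. c * t \<Phi>),
     vnorm = (\<lambda>t. Inf {(\<Sum>n. vnorm A (a n) * vnorm B (b n)) | a b. tensor_rep A B a b t})\<rparr>"

text \<open>
  The unique bounded linear map $T$ from the projective tensor product of $A$ and $B$ to $C$ with
  $T(a \otimes b) = f(a,b)$, for $f$ a bounded bilinear map and $C$ complete.
\<close>

definition linearization ::
  "('a, 'm) nspace_scheme \<Rightarrow> ('b, 'n) nspace_scheme \<Rightarrow> ('c, 'k) nspace_scheme \<Rightarrow>
     ('a \<Rightarrow> 'b \<Rightarrow> 'c) \<Rightarrow> ('a, 'b) tensor \<Rightarrow> 'c" where
  "linearization A B C f = (THE T.
     T \<in> bounded_linear_maps (ptensor_space A B) C \<and>
     T \<in> extensional (carrier (ptensor_space A B)) \<and>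
     (\<forall>a\<in>carrier A. \<forall>b\<in>carrier B. T (elem_tensor A B a b) = f a b))"

text \<open>The multiplication is determined by $(a \otimes b)(c \otimes d) = ac \otimes bd$.\<close>

definition ptensor ::
  "('a, 'm) nalgebra_scheme \<Rightarrow> ('b, 'n) nalgebra_scheme \<Rightarrow> ('a, 'b) tensor nalgebra"
  (infixr "\<otimes>\<^sub>p" 70) where
  "A \<otimes>\<^sub>p B = nspace.extend (ptensor_space A B) (nalgebra.fields
     (\<lambda>s t. linearization A B (ptensor_space A B)
        (\<lambda>a b. linearization A B (ptensor_space A B)
           (\<lambda>c d. elem_tensor A B (vmult A a c) (vmult B b d)) t) s))"

definition tensor_functional ::
  "('a, 'm) nalgebra_scheme \<Rightarrow> ('b, 'n) nalgebra_scheme \<Rightarrow> ('a \<Rightarrow> complex) \<Rightarrow> ('b \<Rightarrow> complex) \<Rightarrow>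
     ('a, 'b) tensor \<Rightarrow> complex" where
  "tensor_functional A B \<phi> \<psi> = linearization A B complex_space (\<lambda>a b. \<phi> a * \<psi> b)"

definition left_action ::
  "('a, 'm) nalgebra_scheme \<Rightarrow> 'a \<Rightarrow> ('a, 'a) tensor \<Rightarrow> ('a, 'a) tensor" where
  "left_action A a =
     linearization A A (ptensor_space A A) (\<lambda>b c. elem_tensor A A (vmult A a b) c)"

definition product_map :: "('a, 'm) nalgebra_scheme \<Rightarrow> ('a, 'a) tensor \<Rightarrow> 'a" where
  "product_map A = linearization A A A (vmult A)"

definition left_biprojective :: "('a, 'm) nalgebra_scheme \<Rightarrow> ('a \<Rightarrow> complex) \<Rightarrow> bool" where
  "left_biprojective A \<phi> \<longleftrightarrow>
     (\<exists>\<rho> \<in> bounded_linear_maps A (ptensor_space A A).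
        \<forall>a\<in>carrier A. \<forall>b\<in>carrier A.
          \<rho> (vmult A a b) = left_action A a (\<rho> b) \<and>
          left_action A a (\<rho> b) = vscale (ptensor_space A A) (\<phi> b) (\<rho> a) \<and>
          \<phi> (product_map A (\<rho> a)) = \<phi> a)"


section \<open>The measure algebra\<close>

text \<open>
  Groups are written additively, because the library's class \<open>topological_group_add\<close> is; it does
  not assume commutativity. Thus \<open>x + y\<close> stands for $xy$ and \<open>- x + y\<close> for $x^{-1}y$.
\<close>

text \<open>A complex measure is a function on sets, equal to 0 off the Borel sets.\<close>

definition complex_measure :: "('g::topological_space set \<Rightarrow> complex) \<Rightarrow> bool" where
  "complex_measure \<mu> \<longleftrightarrow>
     (\<forall>E. E \<notin> sets borel \<longrightarrow> \<mu> E = 0) \<and>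
     (\<forall>E::nat \<Rightarrow> 'g set. range E \<subseteq> sets borel \<longrightarrow> disjoint_family E \<longrightarrow>
        (\<lambda>n. \<mu> (E n)) sums \<mu> (\<Union>n. E n))"

definition total_variation :: "('g::topological_space set \<Rightarrow> complex) \<Rightarrow> 'g set \<Rightarrow> ennreal" where
  "total_variation \<mu> E =
     (SUP P \<in> {P. finite P \<and> P \<subseteq> sets borel \<and> partition_on E P}. \<Sum>F\<in>P. ennreal (cmod (\<mu> F)))"

definition regular_complex_measure :: "('g::topological_space set \<Rightarrow> complex) \<Rightarrow> bool" where
  "regular_complex_measure \<mu> \<longleftrightarrow> complex_measure \<mu> \<and> total_variation \<mu> UNIV < \<infinity> \<and>
     (\<forall>E\<in>sets borel. \<forall>e>0. \<exists>K U. compact K \<and> open U \<and> K \<subseteq> E \<and> E \<subseteq> U \<and>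
        total_variation \<mu> (U - K) < ennreal e)"

text \<open>
  The positive part of a finite signed measure in its Jordan decomposition. The supremum includes
  \<open>F = {}\<close>, and \<open>ennreal\<close> maps negative values to 0.
\<close>

definition positive_part :: "('g::topological_space set \<Rightarrow> real) \<Rightarrow> 'g measure" where
  "positive_part \<nu> =
     measure_of UNIV (sets borel) (\<lambda>E. SUP F \<in> {F \<in> sets borel. F \<subseteq> E}. ennreal (\<nu> F))"

definition integral_complex_measure ::
  "('g::topological_space set \<Rightarrow> complex) \<Rightarrow> ('g \<Rightarrow> complex) \<Rightarrow> complex" where
  "integral_complex_measure \<mu> f =
     ((\<integral>x. f x \<partial>positive_part (\<lambda>E. Re (\<mu> E))) - (\<integral>x. f x \<partial>positive_part (\<lambda>E. - Re (\<mu> E)))) +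
     \<i> * ((\<integral>x. f x \<partial>positive_part (\<lambda>E. Im (\<mu> E))) - (\<integral>x. f x \<partial>positive_part (\<lambda>E. - Im (\<mu> E))))"

text \<open>$(\mu * \nu)(E) = \int \nu(x^{-1}E)\,d\mu(x)$\<close>

definition convolution ::
  "('g::topological_group_add set \<Rightarrow> complex) \<Rightarrow> ('g set \<Rightarrow> complex) \<Rightarrow> 'g set \<Rightarrow> complex" where
  "convolution \<mu> \<nu> E =
     (if E \<in> sets borel then integral_complex_measure \<mu> (\<lambda>x. \<nu> {y. x + y \<in> E}) else 0)"

definition measure_algebra :: "('g::topological_group_add set \<Rightarrow> complex) nalgebra" where
  "measure_algebra = \<lparr>
     carrier = {\<mu>. regular_complex_measure \<mu>},
     vadd = (\<lambda>\<mu> \<nu> E. \<mu> E + \<nu> E),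
     vscale = (\<lambda>c \<mu> E. c * \<mu> E),
     vnorm = (\<lambda>\<mu>. enn2real (total_variation \<mu> UNIV)),
     vmult = convolution\<rparr>"


section \<open>Haar measure, the group algebra and the Fourier algebra\<close>

text \<open>A left Haar measure: a non-zero left-invariant Radon measure on the Borel sets.\<close>

definition left_haar_measure :: "'g::topological_group_add measure \<Rightarrow> bool" where
  "left_haar_measure m \<longleftrightarrow>
     sets m = sets borel \<and>
     emeasure m UNIV \<noteq> 0 \<and>
     (\<forall>K. compact K \<longrightarrow> emeasure m K < \<infinity>) \<and>
     (\<forall>E\<in>sets borel. emeasure m E = (INF U \<in> {U. open U \<and> E \<subseteq> U}. emeasure m U)) \<and>
     (\<forall>U. open U \<longrightarrow> emeasure m U = (SUP K \<in> {K. compact K \<and> K \<subseteq> U}. emeasure m K)) \<and>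
     (\<forall>x. \<forall>E\<in>sets borel. emeasure m ((+) x ` E) = emeasure m E)"

text \<open>
  $L^1(G)$ as a closed ideal of $M(G)$: an integrable function $f$ is identified with the measure
  $f\,dx$, and norm and multiplication are those of $M(G)$.
\<close>

definition L1_algebra ::
  "'g::topological_group_add measure \<Rightarrow> ('g set \<Rightarrow> complex) nalgebra" where
  "L1_algebra m = measure_algebra\<lparr>carrier :=
     {\<mu>. \<exists>f::'g \<Rightarrow> complex. integrable m f \<and>
        \<mu> = (\<lambda>E. if E \<in> sets borel then set_lebesgue_integral m E f else 0)}\<rparr>"

definition L2_functions :: "'g::topological_space measure \<Rightarrow> ('g \<Rightarrow> complex) set" where
  "L2_functions m = {f \<in> borel_measurable m. integrable m (\<lambda>x. (cmod (f x))\<^sup>2)}"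

definition L2_norm :: "'g::topological_space measure \<Rightarrow> ('g \<Rightarrow> complex) \<Rightarrow> real" where
  "L2_norm m f = sqrt (\<integral>x. (cmod (f x))\<^sup>2 \<partial>m)"

text \<open>
  $\langle\lambda(x)f, h\rangle$ for the left regular representation $(\lambda(x)f)(y) = f(x^{-1}y)$
  on $L^2(G)$.
\<close>

definition regular_coefficient ::
  "'g::topological_group_add measure \<Rightarrow> ('g \<Rightarrow> complex) \<Rightarrow> ('g \<Rightarrow> complex) \<Rightarrow> 'g \<Rightarrow> complex" where
  "regular_coefficient m f h x = (\<integral>y. f (- x + y) * cnj (h y) \<partial>m)"

text \<open>
  The Fourier algebra as the space of coefficient functions of the left regular representation, in
  the form used by Arsac and by Herz (for $A(G) = A_2(G)$): $u = \sum_n \langle\lambda(\cdot)f_n,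
  h_n\rangle$ with $\sum_n \|f_n\|_2\,\|h_n\|_2 < \infty$, normed by the infimum of these sums.
  By Eymard's theorem one summand suffices and the norm is still the same.
\<close>

definition fourier_rep ::
  "'g::topological_group_add measure \<Rightarrow> (nat \<Rightarrow> 'g \<Rightarrow> complex) \<Rightarrow> (nat \<Rightarrow> 'g \<Rightarrow> complex) \<Rightarrow>
     ('g \<Rightarrow> complex) \<Rightarrow> bool" where
  "fourier_rep m f h u \<longleftrightarrow>
     (\<forall>n. f n \<in> L2_functions m \<and> h n \<in> L2_functions m) \<and>
     summable (\<lambda>n. L2_norm m (f n) * L2_norm m (h n)) \<and>
     u = (\<lambda>x. \<Sum>n. regular_coefficient m (f n) (h n) x)"

definition fourier_algebra ::
  "'g::topological_group_add measure \<Rightarrow> ('g \<Rightarrow> complex) nalgebra" where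
  "fourier_algebra m = \<lparr>
     carrier = {u. \<exists>f h. fourier_rep m f h u},
     vadd = (\<lambda>u v x. u x + v x),
     vscale = (\<lambda>c u x. c * u x),
     vnorm = (\<lambda>u. Inf {(\<Sum>n. L2_norm m (f n) * L2_norm m (h n)) | f h. fourier_rep m f h u}),
     vmult = (\<lambda>u v x. u x * v x)\<rparr>"

end

theory Submission
  imports Defs
begin

text \<open>
  Left \<open>\<phi>\<close>-biprojectivity can be read off from a single element of the algebra. If \<open>\<rho>\<close> is a map as in its
  definition and \<open>\<phi> b = 1\<close>, then \<open>n = (id \<otimes> \<phi>) (\<rho> b)\<close> satisfies \<open>\<phi> n = 1\<close> and \<open>(a c) n = \<phi>(c) (a n)\<close> for all \<open>a\<close>
  and \<open>c\<close> (\<open>biprojective_imp_absorbs\<close>). Conversely, an element with \<open>\<phi> n = 1\<close> and \<open>a n = \<phi>(a) n\<close> for all \<open>a\<close> yields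
  the map \<open>\<rho> a = \<phi>(a) (n \<otimes> n)\<close> (\<open>biprojectiveI\<close>). Elements of the first kind pass to homomorphic images through
  which the character factors. For a tensor product with the character \<open>\<phi> \<otimes> \<psi>\<close>, the slice maps \<open>\<phi> \<otimes> id\<close> and
  \<open>id \<otimes> \<psi>\<close> are such homomorphisms onto the factors, so left biprojectivity provides an absorbing element in
  M(G) for \<open>\<phi>\<close> and one in A(G) for \<open>\<psi>\<close> (\<open>biprojective_imp_factors_absorb\<close>).

  The element \<open>n\<close> in A(G) forces G to be discrete: pointwise, \<open>g x = \<psi> g\<close> for all \<open>g\<close> in A(G) wherever \<open>n x \<noteq> 0\<close>.
  As A(G) separates points, \<open>n\<close> is supported at one point, which is open by continuity of \<open>n\<close>
  (\<open>absorbs_imp_discrete\<close>). The element \<open>n\<close> in M(G) then forces G to be finite: translating \<open>n\<close> by \<open>x\<close> multiplies it by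
  \<open>\<phi> (dirac x)\<close>, and these numbers are bounded because characters are automatically continuous. So the points of
  G have \<open>n\<close>-masses bounded away from 0, while the total variation is finite (\<open>absorbs_imp_finite\<close>). If G is finite,
  an averaged sum of point masses and the indicator of one point are absorbing elements in the stronger sense, and
  their tensor product is one for \<open>\<phi> \<otimes> \<psi>\<close> (\<open>tensor_biprojectiveI\<close>).

  This presupposes that M(G), A(G) and their projective tensor product are Banach algebras. They are all Banach
  spaces of complex functions on some set with bounded point evaluations, and A(G) and the tensor product moreover
  consist of the absolutely convergent series of certain atoms (\<open>atomic_series\<close>). In M(G) the main point is that the
  convolution of regular measures is regular. For positive measures this is an approximation from inside
  (\<open>conv_measure_inner\<close>), and the complex case follows because a finitely additive set function dominated by a finite
  Radon measure is a regular complex measure (\<open>regularI\<close>). In A(G) the main point is that products of coefficient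
  functions of the regular representation are again in A(G). This is Fell's absorption principle, which is made explicit
  by writing the product as an integral of coefficient functions and this integral as a limit of Riemann sums that
  converge in the norm of A(G) (\<open>coefficient_product\<close>).
\<close>

section \<open>Banach spaces of functions and spaces of series\<close>

text \<open>
  Absolute convergence allows summation in any order; the order given by
  \<open>prod_decode\<close> turns a sequence of sequences into one sequence, as is needed to
  concatenate countably many series representations.
\<close>

lemma double_series:
  fixes f :: "nat \<Rightarrow> nat \<Rightarrow> 'a::banach"
  assumes row: "\<And>n. summable (\<lambda>k. norm (f n k))"
    and total: "summable (\<lambda>n. \<Sum>k. norm (f n k))"
  shows "summable (\<lambda>m. norm (case prod_decode m of (n, k) \<Rightarrow> f n k))"
    and "(\<Sum>m. case prod_decode m of (n, k) \<Rightarrow> f n k) = (\<Sum>n. \<Sum>k. f n k)"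
proof -
  define F where "F = (\<lambda>(n, k). f n k)"
  have bij: "bij_betw prod_decode (UNIV :: nat set) (UNIV \<times> UNIV)"
    using bij_prod_decode by simp
  have "((\<lambda>k. norm (f n k)) has_sum (\<Sum>k. norm (f n k))) UNIV" for n
    using row[of n] by (intro norm_summable_imp_has_sum summable_sums) auto
  then have abs: "(\<lambda>p. norm (F p)) summable_on (UNIV \<times> UNIV)"
    using total
    by (intro summable_on_SigmaI[where g = "\<lambda>n. \<Sum>k. norm (f n k)"])
       (auto simp: F_def intro!: norm_summable_imp_summable_on suminf_nonneg row
          simp: abs_of_nonneg suminf_nonneg[OF row])
  then have "(\<lambda>m. norm (F (prod_decode m))) summable_on UNIV"
    by (subst summable_on_reindex_bij_betw[OF bij])
  then show "summable (\<lambda>m. norm (case prod_decode m of (n, k) \<Rightarrow> f n k))"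
    unfolding F_def by (rule summable_on_imp_summable)
  have "F summable_on (UNIV \<times> UNIV)"
    using abs by (rule abs_summable_summable)
  then have sumF: "(F has_sum infsum F (UNIV \<times> UNIV)) (UNIV \<times> UNIV)"
    by (rule has_sum_infsum)
  then have "((\<lambda>m. F (prod_decode m)) has_sum infsum F (UNIV \<times> UNIV)) UNIV"
    by (subst has_sum_reindex_bij_betw[OF bij])
  then have 1: "(\<lambda>m. F (prod_decode m)) sums infsum F (UNIV \<times> UNIV)"
    by (rule has_sum_imp_sums)
  have "((\<lambda>k. F (n, k)) has_sum (\<Sum>k. f n k)) UNIV" for n
    using row[of n] summable_norm_cancel[OF row[of n]]
    by (auto simp: F_def intro!: norm_summable_imp_has_sum summable_sums)
  then have "((\<lambda>n. \<Sum>k. f n k) has_sum infsum F (UNIV \<times> UNIV)) UNIV"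
    by (intro has_sum_SigmaD[OF sumF]) auto
  then have "(\<lambda>n. \<Sum>k. f n k) sums infsum F (UNIV \<times> UNIV)"
    by (rule has_sum_imp_sums)
  with 1 show "(\<Sum>m. case prod_decode m of (n, k) \<Rightarrow> f n k) = (\<Sum>n. \<Sum>k. f n k)"
    unfolding F_def by (simp add: sums_iff)
qed

text \<open>
  Measures are functions of sets, tensors are functions of bilinear forms, and elements of the
  Fourier algebra are functions on the group. All three spaces are therefore Banach spaces of
  complex functions with pointwise operations and bounded point evaluations, and are treated
  together. Completeness is stated in terms of absolutely convergent series, whose sum is the
  pointwise sum.
\<close>

locale banach_function_space =
  fixes X :: "('z \<Rightarrow> complex, 'm) nspace_scheme"
  assumes vadd_eq: "vadd X = (\<lambda>s t z. s z + t z)"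
    and vscale_eq: "vscale X = (\<lambda>c t z. c * t z)"
    and carrier_nonempty: "carrier X \<noteq> {}"
    and scale_closed: "t \<in> carrier X \<Longrightarrow> (\<lambda>z. c * t z) \<in> carrier X"
    and norm_scale_le: "t \<in> carrier X \<Longrightarrow> vnorm X (\<lambda>z. c * t z) \<le> cmod c * vnorm X t"
    and norm_nonneg: "t \<in> carrier X \<Longrightarrow> 0 \<le> vnorm X t"
    and eval_bounded: "\<exists>C. \<forall>t\<in>carrier X. cmod (t z) \<le> C * vnorm X t"
    and series_closed:
      "(\<And>n. a n \<in> carrier X) \<Longrightarrow> summable (\<lambda>n. vnorm X (a n)) \<Longrightarrow> (\<lambda>z. \<Sum>n. a n z) \<in> carrier X"
    and norm_series_le:
      "(\<And>n. a n \<in> carrier X) \<Longrightarrow> summable (\<lambda>n. vnorm X (a n)) \<Longrightarrow>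
        vnorm X (\<lambda>z. \<Sum>n. a n z) \<le> (\<Sum>n. vnorm X (a n))"
begin

lemma eval_bound:
  obtains C where "C \<ge> 0" "\<And>t. t \<in> carrier X \<Longrightarrow> cmod (t z) \<le> C * vnorm X t"
proof -
  obtain C where C: "\<forall>t\<in>carrier X. cmod (t z) \<le> C * vnorm X t"
    using eval_bounded by blast
  have "cmod (t z) \<le> max C 0 * vnorm X t" if "t \<in> carrier X" for t
    using C that norm_nonneg[OF that] by (smt (verit) mult_right_mono)
  then show thesis using that[of "max C 0"] by auto
qed

lemma zero_closed: "(\<lambda>z. 0) \<in> carrier X"
proof -
  obtain t where "t \<in> carrier X" using carrier_nonempty by blast
  from scale_closed[OF this, of 0] show ?thesis by simp
qed

lemma norm_zero: "vnorm X (\<lambda>z. 0) = 0"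
  using norm_scale_le[OF zero_closed, of 0] norm_nonneg[OF zero_closed] by simp

lemma summable_eval:
  assumes "\<And>n. a n \<in> carrier X" "summable (\<lambda>n. vnorm X (a n))"
  shows "summable (\<lambda>n. cmod (a n z))"
proof -
  obtain C where "\<And>t. t \<in> carrier X \<Longrightarrow> cmod (t z) \<le> C * vnorm X t"
    by (rule eval_bound[of z]) blast
  then show ?thesis
    using assms by (intro summable_comparison_test'[OF summable_mult[OF assms(2), of C], of 0]) auto
qed

lemma add_closed_norm:
  assumes "s \<in> carrier X" "t \<in> carrier X"
  shows "(\<lambda>z. s z + t z) \<in> carrier X \<and> vnorm X (\<lambda>z. s z + t z) \<le> vnorm X s + vnorm X t"
proof -
  (* Closure under sums and the triangle inequality are the case of a series with two non-zero
     terms. *)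
  define a where "a = (\<lambda>n::nat. if n = 0 then s else if n = 1 then t else (\<lambda>z. 0))"
  have a: "a n \<in> carrier X" for n
    using assms zero_closed by (auto simp: a_def)
  have two: "(\<lambda>n. g (a n)) sums (g s + g t)" if "g (\<lambda>z. 0) = 0"
    for g :: "('z \<Rightarrow> complex) \<Rightarrow> 'b::real_normed_vector"
  proof -
    have "(\<lambda>n. g (a n)) sums (\<Sum>n\<in>{0,1}. g (a n))"
      by (rule sums_finite) (auto simp: a_def that)
    then show ?thesis by (simp add: a_def)
  qed
  have "(\<lambda>z. \<Sum>n. a n z) = (\<lambda>z. s z + t z)"
    using two[of "\<lambda>u. u _"] by (auto simp: fun_eq_iff sums_iff)
  with series_closed[of a] norm_series_le[of a] a two[of "vnorm X"] norm_zero show ?thesis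
    by (auto simp: sums_iff)
qed

lemmas add_closed = add_closed_norm[THEN conjunct1]
lemmas norm_triangle = add_closed_norm[THEN conjunct2]

lemma diff_closed: "s \<in> carrier X \<Longrightarrow> t \<in> carrier X \<Longrightarrow> (\<lambda>z. s z - t z) \<in> carrier X"
  using add_closed[of s "\<lambda>z. (-1) * t z"] scale_closed[of t "-1"] by simp

lemma norm_scale:
  assumes "t \<in> carrier X"
  shows "vnorm X (\<lambda>z. c * t z) = cmod c * vnorm X t"
proof (cases "c = 0")
  case True
  then show ?thesis using norm_zero by simp
next
  case False
  have "vnorm X (\<lambda>z. inverse c * (c * t z)) \<le> cmod (inverse c) * vnorm X (\<lambda>z. c * t z)"
    by (rule norm_scale_le[OF scale_closed[OF assms]])
  moreover have "(\<lambda>z. inverse c * (c * t z)) = t" using False by (auto simp: fun_eq_iff)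
  ultimately have "cmod c * vnorm X t \<le> vnorm X (\<lambda>z. c * t z)"
    using False by (simp add: norm_inverse norm_divide field_simps)
  with norm_scale_le[OF assms, of c] show ?thesis by simp
qed

lemma sum_closed_norm:
  assumes "finite I" "\<And>i. i \<in> I \<Longrightarrow> a i \<in> carrier X"
  shows "(\<lambda>z. \<Sum>i\<in>I. a i z) \<in> carrier X \<and> vnorm X (\<lambda>z. \<Sum>i\<in>I. a i z) \<le> (\<Sum>i\<in>I. vnorm X (a i))"
  using assms
proof (induction I rule: finite_induct)
  case empty
  then show ?case using zero_closed norm_zero by simp
next
  case (insert i I)
  then show ?case
    using add_closed[of "a i" "\<lambda>z. \<Sum>i\<in>I. a i z"] norm_triangle[of "a i" "\<lambda>z. \<Sum>i\<in>I. a i z"]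
    by auto
qed

lemma linear_maps_from:
  assumes "T \<in> linear_maps X Y" "s \<in> carrier X" "t \<in> carrier X"
  shows "T s \<in> carrier Y" "T (\<lambda>z. s z + t z) = vadd Y (T s) (T t)"
    "T (\<lambda>z. c * t z) = vscale Y c (T t)"
  using assms by (auto simp: linear_maps_def vadd_eq vscale_eq)

lemma norm_tail_tendsto:
  assumes a: "\<And>n. a n \<in> carrier X" and sm: "summable (\<lambda>n. vnorm X (a n))"
  shows "(\<lambda>z. (\<Sum>n. a n z) - (\<Sum>n<N. a n z)) \<in> carrier X"
    and "(\<lambda>N. vnorm X (\<lambda>z. (\<Sum>n. a n z) - (\<Sum>n<N. a n z))) \<longlonglongrightarrow> 0"
proof -
  have tail: "(\<lambda>z. (\<Sum>n. a n z) - (\<Sum>n<N. a n z)) = (\<lambda>z. \<Sum>n. a (n + N) z)" for N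
    using suminf_split_initial_segment[OF summable_norm_cancel[OF summable_eval[OF a sm]], of _ N]
    by (auto simp: fun_eq_iff)
  have sN: "summable (\<lambda>n. vnorm X (a (n + N)))" for N
    using sm by (subst summable_iff_shift)
  have c: "(\<lambda>z. \<Sum>n. a (n + N) z) \<in> carrier X" for N
    by (rule series_closed[OF a sN])
  then show "(\<lambda>z. (\<Sum>n. a n z) - (\<Sum>n<N. a n z)) \<in> carrier X"
    by (simp add: tail)
  have le: "vnorm X (\<lambda>z. \<Sum>n. a (n + N) z) \<le> (\<Sum>n. vnorm X (a (n + N)))" for N
    by (rule norm_series_le[OF a sN])
  have "(\<lambda>N. \<Sum>n. vnorm X (a (n + N))) \<longlonglongrightarrow> 0"
    using suminf_exist_split2[OF sm] .
  then show "(\<lambda>N. vnorm X (\<lambda>z. (\<Sum>n. a n z) - (\<Sum>n<N. a n z))) \<longlonglongrightarrow> 0"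
    unfolding tail
    by (rule tendsto_sandwich[OF _ _ tendsto_const, rotated 2])
       (auto intro!: always_eventually le norm_nonneg c)
qed

text \<open>
  A bounded functional commutes with finite sums, and the tails of the series tend to 0 in norm.
\<close>

lemma bounded_functional_sums:
  assumes L: "L \<in> bounded_linear_maps X complex_space"
    and a: "\<And>n. a n \<in> carrier X" and sm: "summable (\<lambda>n. vnorm X (a n))"
  shows "(\<lambda>n. L (a n)) sums L (\<lambda>z. \<Sum>n. a n z)"
proof -
  have lin: "L \<in> linear_maps X complex_space" and "\<exists>C. \<forall>x\<in>carrier X. cmod (L x) \<le> C * vnorm X x"
    using L by (auto simp: bounded_linear_maps_def complex_space_def)
  then obtain C where C: "\<And>x. x \<in> carrier X \<Longrightarrow> cmod (L x) \<le> C * vnorm X x" by blast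
  have fin: "(\<lambda>z. \<Sum>n<N. a n z) \<in> carrier X \<and> L (\<lambda>z. \<Sum>n<N. a n z) = (\<Sum>n<N. L (a n))" for N
  proof (induction N)
    case 0
    have "L (\<lambda>z. 0 * 0) = 0 * L (\<lambda>z. 0)"
      using linear_maps_from(3)[OF lin zero_closed zero_closed, of 0] by (simp add: complex_space_def)
    then show ?case using zero_closed by simp
  next
    case (Suc N)
    then show ?case
      using linear_maps_from(2)[OF lin, of "\<lambda>z. \<Sum>n<N. a n z" "a N"] a add_closed
      by (simp add: complex_space_def)
  qed
  define t where "t = (\<lambda>z. \<Sum>n. a n z)"
  have t: "t \<in> carrier X" unfolding t_def by (rule series_closed[OF a sm])
  have split: "L t = L (\<lambda>z. t z - (\<Sum>n<N. a n z)) + (\<Sum>n<N. L (a n))" for N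
    using linear_maps_from(2)[OF lin, of "\<lambda>z. t z - (\<Sum>n<N. a n z)" "\<lambda>z. \<Sum>n<N. a n z"] fin[of N]
      norm_tail_tendsto(1)[OF a sm, of N]
    by (simp add: complex_space_def t_def)
  have "(\<lambda>N. C * vnorm X (\<lambda>z. t z - (\<Sum>n<N. a n z))) \<longlonglongrightarrow> C * 0"
    unfolding t_def by (intro tendsto_mult tendsto_const norm_tail_tendsto(2)[OF a sm])
  then have "(\<lambda>N. C * vnorm X (\<lambda>z. t z - (\<Sum>n<N. a n z))) \<longlonglongrightarrow> 0"
    by simp
  then have "(\<lambda>N. L (\<lambda>z. t z - (\<Sum>n<N. a n z))) \<longlonglongrightarrow> 0"
    by (rule Lim_null_comparison[OF always_eventually, rotated])
       (auto simp: t_def intro!: C norm_tail_tendsto(1)[OF a sm])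
  then have "(\<lambda>N. L t - L (\<lambda>z. t z - (\<Sum>n<N. a n z))) \<longlonglongrightarrow> L t - 0"
    by (intro tendsto_diff tendsto_const)
  moreover have "(\<lambda>N. L t - L (\<lambda>z. t z - (\<Sum>n<N. a n z))) = (\<lambda>N. \<Sum>n<N. L (a n))"
    using split by (auto simp: fun_eq_iff algebra_simps)
  ultimately show ?thesis by (simp add: sums_def t_def)
qed

lemma eval_functional: "(\<lambda>t. t z) \<in> bounded_linear_maps X complex_space"
  using eval_bounded[of z]
  by (auto simp: bounded_linear_maps_def linear_maps_def complex_space_def vadd_eq vscale_eq)

text \<open>
  Telescoping from any index \<open>N\<close> writes \<open>r\<close> as \<open>R N\<close> plus
  an absolutely convergent series of differences, so \<open>r\<close> belongs to the space; the
  norm of that series is a tail of the sum of \<open>d\<close>, which vanishes as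
  \<open>N\<close> grows, so the bound on \<open>R\<close> passes to the limit.
\<close>

lemma limit_closed_norm:
  assumes R: "\<And>k. R k \<in> carrier X"
    and dist: "\<And>k. vnorm X (\<lambda>z. R (Suc k) z - R k z) \<le> d k" and d: "summable d"
    and lim: "\<And>z. (\<lambda>k. R k z) \<longlonglongrightarrow> r z"
    and B: "\<And>k. vnorm X (R k) \<le> B k" "B \<longlonglongrightarrow> b"
  shows "r \<in> carrier X \<and> vnorm X r \<le> b"
proof -
  define D where "D = (\<lambda>N k z. R (Suc (k + N)) z - R (k + N) z)"
  have D: "D N k \<in> carrier X" for N k
    unfolding D_def by (rule diff_closed[OF R R])
  have nD: "vnorm X (D N k) \<le> d (k + N)" for N k
    unfolding D_def by (rule dist)
  have sd: "summable (\<lambda>k. d (k + N))" for N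
    using d by (subst summable_iff_shift)
  have sD: "summable (\<lambda>k. vnorm X (D N k))" for N
    by (rule summable_comparison_test'[OF sd, of 0]) (use nD norm_nonneg[OF D] in auto)
  have sumD: "(\<lambda>k. D N k z) sums (r z - R N z)" for N z
  proof -
    have "(\<lambda>k. R (k + N) z) \<longlonglongrightarrow> r z"
      using LIMSEQ_ignore_initial_segment[OF lim] .
    from telescope_sums[OF this] show ?thesis by (simp add: D_def)
  qed
  have dec: "r = (\<lambda>z. R N z + (\<Sum>k. D N k z))" for N
    using sumD[of N] by (auto simp: fun_eq_iff sums_iff)
  have S: "(\<lambda>z. \<Sum>k. D N k z) \<in> carrier X" for N
    by (rule series_closed[OF D sD])
  have mem: "r \<in> carrier X"
    by (subst dec[of 0]) (rule add_closed[OF R S])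
  have "vnorm X r \<le> B N + (\<Sum>k. d (k + N))" for N
  proof -
    have "vnorm X (\<lambda>z. R N z + (\<Sum>k. D N k z)) \<le> vnorm X (R N) + vnorm X (\<lambda>z. \<Sum>k. D N k z)"
      by (rule norm_triangle[OF R S])
    also have "\<dots> \<le> B N + (\<Sum>k. vnorm X (D N k))"
      by (intro add_mono B norm_series_le D sD)
    also have "\<dots> \<le> B N + (\<Sum>k. d (k + N))"
      by (intro add_mono order_refl suminf_le nD sD sd)
    finally show ?thesis using dec[of N] by simp
  qed
  moreover have "(\<lambda>N. B N + (\<Sum>k. d (k + N))) \<longlonglongrightarrow> b + 0"
    by (intro tendsto_add B(2) suminf_exist_split2[OF d])
  ultimately have "vnorm X r \<le> b"
    by (intro LIMSEQ_le_const[of "\<lambda>N. B N + (\<Sum>k. d (k + N))" b]) auto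
  with mem show ?thesis by simp
qed

end

text \<open>
  Point evaluations reduce a map with values in a function space to bounded functionals.
\<close>

lemma bounded_map_series:
  assumes "banach_function_space X" "banach_function_space Y"
    and T: "T \<in> bounded_linear_maps X Y"
    and a: "\<And>n. a n \<in> carrier X" "summable (\<lambda>n. vnorm X (a n))"
  shows "(\<lambda>n. T (a n) z) sums T (\<lambda>z. \<Sum>n. a n z) z"
proof -
  interpret X: banach_function_space X by fact
  interpret Y: banach_function_space Y by fact
  obtain C where C: "\<forall>x\<in>carrier X. vnorm Y (T x) \<le> C * vnorm X x"
    using T by (auto simp: bounded_linear_maps_def)
  obtain K where K: "K \<ge> 0" "\<And>y. y \<in> carrier Y \<Longrightarrow> cmod (y z) \<le> K * vnorm Y y"
    by (rule Y.eval_bound[of z]) blast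
  have TY: "T x \<in> carrier Y" if "x \<in> carrier X" for x
    using T that by (auto simp: bounded_linear_maps_def linear_maps_def)
  have le: "cmod (T x z) \<le> (K * C) * vnorm X x" if "x \<in> carrier X" for x
    using K(2)[OF TY[OF that]] mult_left_mono[OF C[rule_format, OF that] K(1)]
    by (simp add: mult.assoc)
  have "(\<lambda>x. T x z) \<in> linear_maps X complex_space"
    using T
    by (auto simp: bounded_linear_maps_def linear_maps_def complex_space_def X.vadd_eq X.vscale_eq
        Y.vadd_eq Y.vscale_eq)
  with le have "(\<lambda>x. T x z) \<in> bounded_linear_maps X complex_space"
    by (auto simp: bounded_linear_maps_def complex_space_def)
  from X.bounded_functional_sums[OF this a] show ?thesis .
qed

text \<open>
  The projective tensor product and the Fourier algebra are constructed in the same way: one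
  takes all series of atoms with finite total weight, and the infimum of the total weights as
  the norm. Here \<open>S\<close> parametrises the atoms, \<open>e p\<close> is the atom with
  parameter \<open>p\<close> and \<open>w p\<close> is its weight.
\<close>

locale atomic_series =
  fixes S :: "'p set" and w :: "'p \<Rightarrow> real" and e :: "'p \<Rightarrow> 'z \<Rightarrow> complex"
  assumes atoms_nonempty: "S \<noteq> {}"
    and weight_nonneg: "p \<in> S \<Longrightarrow> 0 \<le> w p"
    and atom_bound: "\<exists>C. \<forall>p\<in>S. cmod (e p z) \<le> C * w p"
    and atom_scale: "p \<in> S \<Longrightarrow> \<exists>q\<in>S. w q = cmod c * w p \<and> e q = (\<lambda>z. c * e p z)"
begin

definition represents :: "(nat \<Rightarrow> 'p) \<Rightarrow> ('z \<Rightarrow> complex) \<Rightarrow> bool" where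
  "represents p t \<longleftrightarrow> (\<forall>n. p n \<in> S) \<and> summable (\<lambda>n. w (p n)) \<and> t = (\<lambda>z. \<Sum>n. e (p n) z)"

definition space :: "('z \<Rightarrow> complex) nspace" where
  "space = \<lparr>carrier = {t. \<exists>p. represents p t}, vadd = (\<lambda>s t z. s z + t z),
     vscale = (\<lambda>c t z. c * t z), vnorm = (\<lambda>t. Inf {(\<Sum>n. w (p n)) | p. represents p t})\<rparr>"

lemma representsD:
  assumes "represents p t"
  shows "p n \<in> S" "summable (\<lambda>n. w (p n))" "t z = (\<Sum>n. e (p n) z)"
  using assms by (auto simp: represents_def)

lemma summable_atoms:
  assumes "\<And>n. p n \<in> S" "summable (\<lambda>n. w (p n))"
  shows "summable (\<lambda>n. cmod (e (p n) z))"
proof -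
  obtain C where C: "\<forall>p\<in>S. cmod (e p z) \<le> C * w p" using atom_bound by blast
  show ?thesis
    by (rule summable_comparison_test'[OF summable_mult[OF assms(2), of C], of 0])
       (use C assms in auto)
qed

lemma represents_nonneg: "represents p t \<Longrightarrow> 0 \<le> (\<Sum>n. w (p n))"
  by (intro suminf_nonneg) (auto dest: representsD intro: weight_nonneg)

lemma norm_le: "represents p t \<Longrightarrow> vnorm space t \<le> (\<Sum>n. w (p n))"
  unfolding space_def
  by (auto intro!: cInf_lower bdd_belowI[of _ 0] dest: represents_nonneg)

lemma norm_greatest:
  "t \<in> carrier space \<Longrightarrow> (\<And>p. represents p t \<Longrightarrow> b \<le> (\<Sum>n. w (p n))) \<Longrightarrow> b \<le> vnorm space t"
  unfolding space_def by (auto intro!: cInf_greatest)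

lemma near_representation:
  assumes "t \<in> carrier space" "d > 0"
  obtains p where "represents p t" "(\<Sum>n. w (p n)) \<le> vnorm space t + d"
proof -
  have "\<exists>p. represents p t \<and> (\<Sum>n. w (p n)) \<le> vnorm space t + d"
  proof (rule ccontr)
    assume "\<nexists>p. represents p t \<and> (\<Sum>n. w (p n)) \<le> vnorm space t + d"
    then have "vnorm space t + d \<le> vnorm space t"
      by (intro norm_greatest[OF assms(1)]) force
    then show False using assms(2) by simp
  qed
  then show thesis using that by blast
qed

lemma zero_atom: "\<exists>q\<in>S. w q = 0 \<and> e q = (\<lambda>z. 0)"
  using atom_scale[of _ 0] atoms_nonempty by fastforce

lemma atom_closed_norm:
  assumes "p \<in> S"
  shows "e p \<in> carrier space \<and> vnorm space (e p) \<le> w p"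
proof -
  obtain q where q: "q \<in> S" "w q = 0" "e q = (\<lambda>z. 0)" using zero_atom by blast
  define P where "P = (\<lambda>n::nat. if n = 0 then p else q)"
  have one: "(\<lambda>n. g (P n)) sums g p" if "g q = 0" for g :: "'p \<Rightarrow> 'b::real_normed_vector"
  proof -
    have "(\<lambda>n. g (P n)) sums (\<Sum>n\<in>{0}. g (P n))"
      by (rule sums_finite) (auto simp: P_def that)
    then show ?thesis by (simp add: P_def)
  qed
  have "represents P (e p)"
    unfolding represents_def using one[of w] one[of "\<lambda>p. e p _"] q assms
    by (auto simp: sums_iff P_def fun_eq_iff)
  then show ?thesis
    using norm_le[of P "e p"] one[of w] q by (auto simp: space_def sums_iff)
qed

text \<open>
  Completeness: representations of the \<open>t n\<close> that are optimal up to \<open>d / 2 ^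
  (n + 1)\<close> are concatenated into a single representation of the sum, whose weight exceeds
  the sum of the norms by at most \<open>d\<close>.
\<close>

lemma carrier_series:
  assumes t: "\<And>n. t n \<in> carrier space" "summable (\<lambda>n. vnorm space (t n))"
  shows "(\<lambda>z. \<Sum>n. t n z) \<in> carrier space \<and>
    vnorm space (\<lambda>z. \<Sum>n. t n z) \<le> (\<Sum>n. vnorm space (t n))"
proof -
  have *: "\<exists>p. represents p (\<lambda>z. \<Sum>n. t n z) \<and> (\<Sum>m. w (p m)) \<le> (\<Sum>n. vnorm space (t n)) + d"
    if d: "d > 0" for d :: real
  proof -
    have "\<exists>p. represents p (t n) \<and> (\<Sum>k. w (p k)) \<le> vnorm space (t n) + d * (1/2) ^ Suc n" for n
      using near_representation[OF t(1)[of n], of "d * (1/2) ^ Suc n"] d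
      by (auto simp del: power_Suc)
    then obtain P where P: "\<And>n. represents (P n) (t n)"
      and Pw: "\<And>n. (\<Sum>k. w (P n k)) \<le> vnorm space (t n) + d * (1/2) ^ Suc n"
      by metis
    have half: "(\<lambda>n. d * (1/2::real) ^ Suc n) sums d"
      using sums_mult[OF power_half_series, of d] by simp
    have PS: "P n k \<in> S" for n k using P by (rule representsD)
    have wP: "\<bar>w (P n k)\<bar> = w (P n k)" for n k
      using weight_nonneg[OF PS] by simp
    have row: "summable (\<lambda>k. norm (w (P n k)))" for n
      unfolding real_norm_def wP by (rule representsD(2)[OF P])
    have sb: "summable (\<lambda>n. vnorm space (t n) + d * (1/2) ^ Suc n)"
      using summable_add[OF t(2)] half by (auto simp: sums_iff simp del: power_Suc)
    have total: "summable (\<lambda>n. \<Sum>k. norm (w (P n k)))"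
      by (rule summable_comparison_test'[OF sb, of 0])
         (use Pw represents_nonneg[OF P] in \<open>auto simp: wP simp del: power_Suc\<close>)
    define p where "p m = (case prod_decode m of (n, k) \<Rightarrow> P n k)" for m
    note dbl = double_series[of "\<lambda>n k. w (P n k)", OF row total]
    have wp: "(case prod_decode m of (n, k) \<Rightarrow> w (P n k)) = w (p m)" for m
      by (simp add: p_def split: prod.split)
    have pS: "p m \<in> S" for m by (simp add: p_def PS split: prod.split)
    have sp: "summable (\<lambda>m. w (p m))"
      using dbl(1) weight_nonneg[OF pS] by (simp add: wp)
    have val: "(\<Sum>m. e (p m) z) = (\<Sum>n. t n z)" for z
    proof -
      obtain C where C: "\<forall>p\<in>S. cmod (e p z) \<le> C * w p" using atom_bound by blast
      have rowe: "summable (\<lambda>k. cmod (e (P n k) z))" for n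
        by (rule summable_atoms[OF PS representsD(2)[OF P]])
      have "(\<Sum>k. cmod (e (P n k) z)) \<le> C * (\<Sum>k. w (P n k))" for n
        using C PS rowe representsD(2)[OF P]
        by (subst suminf_mult[symmetric]) (auto intro!: suminf_le summable_mult)
      then have tot: "summable (\<lambda>n. \<Sum>k. cmod (e (P n k) z))"
        using total
        by (intro summable_comparison_test'[OF summable_mult[OF total, of C], of 0])
           (auto simp: wP suminf_nonneg rowe)
      have "(\<Sum>m. e (p m) z) = (\<Sum>m. case prod_decode m of (n, k) \<Rightarrow> e (P n k) z)"
        by (intro suminf_cong) (simp add: p_def split: prod.split)
      also have "\<dots> = (\<Sum>n. \<Sum>k. e (P n k) z)"
        by (rule double_series(2)[of "\<lambda>n k. e (P n k) z", OF rowe tot])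
      finally show ?thesis using representsD(3)[OF P] by simp
    qed
    have "(\<Sum>m. w (p m)) = (\<Sum>n. \<Sum>k. w (P n k))"
      using dbl(2) by (simp add: wp)
    also have "\<dots> \<le> (\<Sum>n. vnorm space (t n) + d * (1/2) ^ Suc n)"
      using total sb Pw by (intro suminf_le) (auto simp: wP simp del: power_Suc)
    also have "\<dots> = (\<Sum>n. vnorm space (t n)) + d"
      using suminf_add[OF t(2), of "\<lambda>n. d * (1/2) ^ Suc n"] half
      by (simp add: sums_iff del: power_Suc)
    finally show ?thesis
      using pS sp val by (intro exI[of _ p]) (auto simp: represents_def)
  qed
  have mem: "(\<lambda>z. \<Sum>n. t n z) \<in> carrier space"
    using *[of 1] by (auto simp: space_def)
  moreover have "vnorm space (\<lambda>z. \<Sum>n. t n z) \<le> (\<Sum>n. vnorm space (t n))"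
  proof (rule field_le_epsilon)
    fix d :: real assume "d > 0"
    from *[OF this] obtain p where "represents p (\<lambda>z. \<Sum>n. t n z)"
      "(\<Sum>m. w (p m)) \<le> (\<Sum>n. vnorm space (t n)) + d" by blast
    with norm_le[of p] show "vnorm space (\<lambda>z. \<Sum>n. t n z) \<le> (\<Sum>n. vnorm space (t n)) + d"
      by fastforce
  qed
  ultimately show ?thesis by simp
qed

lemma eval_le_norm:
  assumes C: "\<And>p. p \<in> S \<Longrightarrow> cmod (e p z) \<le> C * w p" "C \<ge> 0" and t: "t \<in> carrier space"
  shows "cmod (t z) \<le> C * vnorm space t"
proof (cases "C = 0")
  case True
  obtain p where p: "represents p t" using t by (auto simp: space_def)
  have "e (p n) z = 0" for n using C(1)[OF representsD(1)[OF p]] True by simp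
  then show ?thesis using True by (simp add: representsD(3)[OF p])
next
  case False
  have "cmod (t z) / C \<le> vnorm space t"
  proof (rule norm_greatest[OF t])
    fix p assume p: "represents p t"
    have "cmod (t z) \<le> (\<Sum>n. cmod (e (p n) z))"
      unfolding representsD(3)[OF p]
      by (rule summable_norm[OF summable_atoms]) (auto intro: representsD[OF p])
    also have "\<dots> \<le> (\<Sum>n. C * w (p n))"
      by (intro suminf_le C summable_mult summable_atoms) (auto intro: representsD[OF p])
    also have "\<dots> = C * (\<Sum>n. w (p n))"
      by (rule suminf_mult[OF representsD(2)[OF p]])
    finally show "cmod (t z) / C \<le> (\<Sum>n. w (p n))"
      using C(2) False by (simp add: divide_le_eq mult.commute)
  qed
  then show ?thesis using C(2) False by (simp add: divide_le_eq mult.commute)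
qed

sublocale banach_function_space space
proof
  show "vadd space = (\<lambda>s t z. s z + t z)" "vscale space = (\<lambda>c t z. c * t z)"
    by (simp_all add: space_def)
  show "carrier space \<noteq> {}"
    using atom_closed_norm atoms_nonempty by blast
next
  fix t and c :: complex assume t: "t \<in> carrier space"
  have *: "\<exists>q. represents q (\<lambda>z. c * t z) \<and> (\<Sum>n. w (q n)) = cmod c * (\<Sum>n. w (p n))"
    if p: "represents p t" for p
  proof -
    have "\<exists>q\<in>S. w q = cmod c * w (p n) \<and> e q = (\<lambda>z. c * e (p n) z)" for n
      by (rule atom_scale[OF representsD(1)[OF p]])
    then obtain q where q: "\<And>n. q n \<in> S" "\<And>n. w (q n) = cmod c * w (p n)"
      "\<And>n. e (q n) = (\<lambda>z. c * e (p n) z)" by metis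
    have "represents q (\<lambda>z. c * t z)"
      using q representsD(2)[OF p]
        suminf_mult[OF summable_norm_cancel[OF summable_atoms[OF representsD(1,2)[OF p]]]]
      by (auto simp: represents_def representsD(3)[OF p] fun_eq_iff intro!: summable_mult)
    then show ?thesis
      using q suminf_mult[OF representsD(2)[OF p]] by (intro exI[of _ q]) auto
  qed
  obtain p where "represents p t" using t by (auto simp: space_def)
  with * show "(\<lambda>z. c * t z) \<in> carrier space" by (fastforce simp: space_def)
  show "vnorm space (\<lambda>z. c * t z) \<le> cmod c * vnorm space t"
  proof (cases "c = 0")
    case True
    obtain q where "q \<in> S" "w q = 0" "e q = (\<lambda>z. 0)" using zero_atom by blast
    with atom_closed_norm[of q] True show ?thesis by simp
  next
    case False
    have "vnorm space (\<lambda>z. c * t z) / cmod c \<le> vnorm space t"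
    proof (rule norm_greatest[OF t])
      fix p assume "represents p t"
      from *[OF this] norm_le have "vnorm space (\<lambda>z. c * t z) \<le> cmod c * (\<Sum>n. w (p n))"
        by fastforce
      then show "vnorm space (\<lambda>z. c * t z) / cmod c \<le> (\<Sum>n. w (p n))"
        using False by (simp add: divide_le_eq mult.commute)
    qed
    then show ?thesis using False by (simp add: divide_le_eq mult.commute)
  qed
next
  fix t assume "t \<in> carrier space"
  then show "0 \<le> vnorm space t" by (rule norm_greatest) (rule represents_nonneg)
next
  fix z
  obtain C where C: "\<forall>p\<in>S. cmod (e p z) \<le> C * w p" using atom_bound by blast
  then have "cmod (e p z) \<le> max C 0 * w p" if "p \<in> S" for p
    using that weight_nonneg[OF that] by (smt (verit) mult_right_mono)
  then show "\<exists>C. \<forall>t\<in>carrier space. cmod (t z) \<le> C * vnorm space t"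
    using eval_le_norm[of z "max C 0"] by auto
qed (use carrier_series in blast)+

text \<open>
  How an estimate on atoms passes to the infimum norm: if every representation of
  \<open>t\<close> yields a series for \<open>s\<close> with terms bounded by \<open>K\<close>
  times the weights, the infimum over representations gives the bound for \<open>s\<close>. In
  the applications, \<open>s\<close> is the image of \<open>t\<close> under a linear map or a
  product with \<open>t\<close>.
\<close>

lemma norm_map_le:
  assumes Y: "banach_function_space Y"
    and t: "t \<in> carrier space" and K: "K \<ge> 0"
    and img: "\<And>p. represents p t \<Longrightarrow> \<exists>q. (\<forall>n. q n \<in> carrier Y \<and> vnorm Y (q n) \<le> K * w (p n)) \<and>
      s = (\<lambda>z. \<Sum>n. q n z)"
  shows "s \<in> carrier Y \<and> vnorm Y s \<le> K * vnorm space t"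
proof -
  interpret Y: banach_function_space Y by fact
  have *: "s \<in> carrier Y \<and> vnorm Y s \<le> K * (\<Sum>n. w (p n))" if p: "represents p t" for p
  proof -
    obtain q where q: "\<And>n. q n \<in> carrier Y" "\<And>n. vnorm Y (q n) \<le> K * w (p n)"
      "s = (\<lambda>z. \<Sum>n. q n z)" using img[OF p] by blast
    have sw: "summable (\<lambda>n. K * w (p n))" by (intro summable_mult representsD[OF p])
    have sq: "summable (\<lambda>n. vnorm Y (q n))"
      by (rule summable_comparison_test'[OF sw, of 0]) (use q Y.norm_nonneg in auto)
    have "vnorm Y s \<le> (\<Sum>n. vnorm Y (q n))"
      unfolding q(3) by (rule Y.norm_series_le[OF q(1) sq])
    also have "\<dots> \<le> (\<Sum>n. K * w (p n))" by (intro suminf_le q sq sw)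
    also have "\<dots> = K * (\<Sum>n. w (p n))" by (rule suminf_mult[OF representsD(2)[OF p]])
    finally show ?thesis using Y.series_closed[OF q(1) sq] q(3) by simp
  qed
  obtain p where p: "represents p t" using t by (auto simp: space_def)
  have "vnorm Y s \<le> K * vnorm space t"
  proof (cases "K = 0")
    case True
    then show ?thesis using *[OF p] by simp
  next
    case False
    have "vnorm Y s / K \<le> vnorm space t"
      by (rule norm_greatest[OF t]) (use * K False in \<open>simp add: divide_le_eq mult.commute\<close>)
    then show ?thesis using K False by (simp add: divide_le_eq mult.commute)
  qed
  with *[OF p] show ?thesis by simp
qed

end

section \<open>Tensors and linearizations of bilinear maps\<close>

definition bounded_bilinear_maps ::
  "('a, 'k) nspace_scheme \<Rightarrow> ('b, 'm) nspace_scheme \<Rightarrow> ('c, 'n) nspace_scheme \<Rightarrow> ('a \<Rightarrow> 'b \<Rightarrow> 'c) set" where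
  "bounded_bilinear_maps A B C = {f.
     (\<forall>a\<in>carrier A. f a \<in> linear_maps B C) \<and>
     (\<forall>b\<in>carrier B. (\<lambda>a. f a b) \<in> linear_maps A C) \<and>
     (\<exists>K. \<forall>a\<in>carrier A. \<forall>b\<in>carrier B. vnorm C (f a b) \<le> K * vnorm A a * vnorm B b)}"

lemma bilinear_forms_eq: "bilinear_forms A B = bounded_bilinear_maps A B complex_space"
  by (simp add: bilinear_forms_def bounded_bilinear_maps_def complex_space_def)

lemma complex_space_simps [simp]:
  "carrier complex_space = UNIV" "vadd complex_space = (+)" "vscale complex_space = (*)"
  "vnorm complex_space = cmod"
  by (simp_all add: complex_space_def)

lemma bounded_bilinear_mapsD:
  assumes "f \<in> bounded_bilinear_maps A B C"
  shows "a \<in> carrier A \<Longrightarrow> f a \<in> linear_maps B C"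
    and "b \<in> carrier B \<Longrightarrow> (\<lambda>a. f a b) \<in> linear_maps A C"
    and "a \<in> carrier A \<Longrightarrow> b \<in> carrier B \<Longrightarrow> f a b \<in> carrier C"
  using assms by (auto simp: bounded_bilinear_maps_def linear_maps_def)

lemma bounded_linear_mapsD:
  assumes "T \<in> bounded_linear_maps X Y"
  shows "T \<in> linear_maps X Y" "x \<in> carrier X \<Longrightarrow> T x \<in> carrier Y"
  using assms by (auto simp: bounded_linear_maps_def linear_maps_def)

lemma linear_mapsD:
  assumes "T \<in> linear_maps X Y" "x \<in> carrier X"
  shows "T x \<in> carrier Y"
    "y \<in> carrier X \<Longrightarrow> T (vadd X x y) = vadd Y (T x) (T y)"
    "T (vscale X c x) = vscale Y c (T x)"
  using assms by (auto simp: linear_maps_def)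

context banach_function_space
begin

lemma linear_maps_into:
  "T \<in> linear_maps Z X \<longleftrightarrow>
    (\<forall>x\<in>carrier Z. T x \<in> carrier X) \<and> (\<forall>z. (\<lambda>x. T x z) \<in> linear_maps Z complex_space)"
  by (auto simp: linear_maps_def vadd_eq vscale_eq fun_eq_iff)

lemma bounded_mapE:
  assumes "T \<in> bounded_linear_maps X Y"
  obtains K where "K \<ge> 0" "\<And>x. x \<in> carrier X \<Longrightarrow> vnorm Y (T x) \<le> K * vnorm X x"
proof -
  obtain K where K: "\<forall>x\<in>carrier X. vnorm Y (T x) \<le> K * vnorm X x"
    using assms by (auto simp: bounded_linear_maps_def)
  have "vnorm Y (T x) \<le> max K 0 * vnorm X x" if "x \<in> carrier X" for x
    using K that norm_nonneg[OF that] by (smt (verit) mult_right_mono)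
  then show thesis using that[of "max K 0"] by auto
qed

lemma bounded_bilinear_comp:
  assumes f: "f \<in> bounded_bilinear_maps A B X" and L: "L \<in> bounded_linear_maps X Y"
  shows "(\<lambda>a b. L (f a b)) \<in> bounded_bilinear_maps A B Y"
proof -
  obtain C where C: "C \<ge> 0" "\<And>x. x \<in> carrier X \<Longrightarrow> vnorm Y (L x) \<le> C * vnorm X x"
    by (rule bounded_mapE[OF L]) blast
  obtain K where K: "\<forall>a\<in>carrier A. \<forall>b\<in>carrier B. vnorm X (f a b) \<le> K * vnorm A a * vnorm B b"
    using f by (auto simp: bounded_bilinear_maps_def)
  have "vnorm Y (L (f a b)) \<le> (C * K) * vnorm A a * vnorm B b"
    if "a \<in> carrier A" "b \<in> carrier B" for a b
    using C(2)[OF bounded_bilinear_mapsD(3)[OF f that]] mult_left_mono[OF K[rule_format, OF that] C(1)]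
    by (simp add: mult.assoc)
  then show ?thesis
    using f L unfolding bounded_bilinear_maps_def bounded_linear_maps_def linear_maps_def by auto
qed

end

locale tensor_pair = A: banach_function_space A + B: banach_function_space B
  for A :: "('x \<Rightarrow> complex, 'm) nspace_scheme" and B :: "('y \<Rightarrow> complex, 'n) nspace_scheme"
begin

lemma bilinear_boundE:
  assumes "f \<in> bounded_bilinear_maps A B C"
  obtains K where "K \<ge> 0"
    "\<And>a b. a \<in> carrier A \<Longrightarrow> b \<in> carrier B \<Longrightarrow> vnorm C (f a b) \<le> K * (vnorm A a * vnorm B b)"
proof -
  obtain K where K: "\<forall>a\<in>carrier A. \<forall>b\<in>carrier B. vnorm C (f a b) \<le> K * vnorm A a * vnorm B b"
    using assms by (auto simp: bounded_bilinear_maps_def)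
  have "vnorm C (f a b) \<le> max K 0 * (vnorm A a * vnorm B b)"
    if "a \<in> carrier A" "b \<in> carrier B" for a b
    using K[rule_format, OF that] A.norm_nonneg[OF that(1)] B.norm_nonneg[OF that(2)]
    by (smt (verit, best) mult.assoc mult_nonneg_nonneg mult_right_mono)
  then show thesis using that[of "max K 0"] by auto
qed

lemma form_cong:
  assumes "\<And>a b. a \<in> carrier A \<Longrightarrow> b \<in> carrier B \<Longrightarrow> \<Phi> a b = \<Psi> a b" "\<Phi> \<in> bilinear_forms A B"
  shows "\<Psi> \<in> bilinear_forms A B"
  using assms
  by (auto simp: bilinear_forms_def linear_maps_def A.vadd_eq A.vscale_eq B.vadd_eq B.vscale_eq
      A.add_closed A.scale_closed B.add_closed B.scale_closed)

lemma form_eval: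
  assumes "f \<in> bounded_bilinear_maps A B C" "banach_function_space C"
  shows "(\<lambda>a b. f a b z) \<in> bilinear_forms A B"
  using banach_function_space.bounded_bilinear_comp[OF assms(2,1)
      banach_function_space.eval_functional[OF assms(2)]]
  by (simp add: bilinear_forms_eq)

lemma form_add:
  assumes "\<Phi> \<in> bilinear_forms A B" "\<Psi> \<in> bilinear_forms A B"
  shows "(\<lambda>a b. \<Phi> a b + \<Psi> a b) \<in> bilinear_forms A B"
proof -
  obtain K where K: "\<And>a b. a \<in> carrier A \<Longrightarrow> b \<in> carrier B \<Longrightarrow> cmod (\<Phi> a b) \<le> K * (vnorm A a * vnorm B b)"
    by (rule bilinear_boundE[OF assms(1)[unfolded bilinear_forms_eq]]) auto
  obtain M where M: "\<And>a b. a \<in> carrier A \<Longrightarrow> b \<in> carrier B \<Longrightarrow> cmod (\<Psi> a b) \<le> M * (vnorm A a * vnorm B b)"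
    by (rule bilinear_boundE[OF assms(2)[unfolded bilinear_forms_eq]]) auto
  have "cmod (\<Phi> a b + \<Psi> a b) \<le> (K + M) * vnorm A a * vnorm B b"
    if "a \<in> carrier A" "b \<in> carrier B" for a b
    using norm_triangle_ineq[of "\<Phi> a b" "\<Psi> a b"] K[OF that] M[OF that] by (simp add: algebra_simps)
  then have "\<exists>C. \<forall>a\<in>carrier A. \<forall>b\<in>carrier B. cmod (\<Phi> a b + \<Psi> a b) \<le> C * vnorm A a * vnorm B b"
    by blast
  then show ?thesis
    using assms unfolding bilinear_forms_def linear_maps_def by (auto simp: algebra_simps)
qed

lemma form_scale:
  assumes "\<Phi> \<in> bilinear_forms A B"
  shows "(\<lambda>a b. c * \<Phi> a b) \<in> bilinear_forms A B"
proof -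
  obtain K where K: "\<And>a b. a \<in> carrier A \<Longrightarrow> b \<in> carrier B \<Longrightarrow> cmod (\<Phi> a b) \<le> K * (vnorm A a * vnorm B b)"
    by (rule bilinear_boundE[OF assms(1)[unfolded bilinear_forms_eq]]) auto
  have "cmod (c * \<Phi> a b) \<le> (cmod c * K) * vnorm A a * vnorm B b"
    if "a \<in> carrier A" "b \<in> carrier B" for a b
    using mult_left_mono[OF K[OF that], of "cmod c"] by (simp add: norm_mult algebra_simps)
  then have "\<exists>C. \<forall>a\<in>carrier A. \<forall>b\<in>carrier B. cmod (c * \<Phi> a b) \<le> C * vnorm A a * vnorm B b"
    by blast
  then show ?thesis
    using assms unfolding bilinear_forms_def linear_maps_def by (auto simp: algebra_simps)
qed

lemma product_form:
  assumes "\<phi> \<in> bounded_linear_maps A complex_space" "\<psi> \<in> bounded_linear_maps B complex_space"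
  shows "(\<lambda>a b. \<phi> a * \<psi> b) \<in> bilinear_forms A B"
proof -
  obtain K where K: "K \<ge> 0" "\<And>a. a \<in> carrier A \<Longrightarrow> cmod (\<phi> a) \<le> K * vnorm A a"
    by (rule A.bounded_mapE[OF assms(1)]) auto
  obtain M where M: "M \<ge> 0" "\<And>b. b \<in> carrier B \<Longrightarrow> cmod (\<psi> b) \<le> M * vnorm B b"
    by (rule B.bounded_mapE[OF assms(2)]) auto
  have "cmod (\<phi> a * \<psi> b) \<le> (K * M) * vnorm A a * vnorm B b"
    if "a \<in> carrier A" "b \<in> carrier B" for a b
    using mult_mono[OF K(2)[OF that(1)] M(2)[OF that(2)]] K(1) A.norm_nonneg[OF that(1)]
    by (simp add: norm_mult algebra_simps)
  then have "\<exists>C. \<forall>a\<in>carrier A. \<forall>b\<in>carrier B. cmod (\<phi> a * \<psi> b) \<le> C * vnorm A a * vnorm B b"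
    by blast
  then show ?thesis
    using assms unfolding bilinear_forms_def linear_maps_def bounded_linear_maps_def
    by (auto simp: algebra_simps)
qed

sublocale T: atomic_series "carrier A \<times> carrier B" "\<lambda>(a, b). vnorm A a * vnorm B b"
  "\<lambda>(a, b). elem_tensor A B a b"
proof
  show "carrier A \<times> carrier B \<noteq> {}"
    using A.carrier_nonempty B.carrier_nonempty by auto
  show "0 \<le> (case p of (a, b) \<Rightarrow> vnorm A a * vnorm B b)" if "p \<in> carrier A \<times> carrier B" for p
    using that A.norm_nonneg B.norm_nonneg by auto
next
  fix \<Phi>
  show "\<exists>C. \<forall>p\<in>carrier A \<times> carrier B.
      cmod ((case p of (a, b) \<Rightarrow> elem_tensor A B a b) \<Phi>) \<le> C * (case p of (a, b) \<Rightarrow> vnorm A a * vnorm B b)"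
  proof (cases "\<Phi> \<in> bilinear_forms A B")
    case True
    obtain K where "\<And>a b. a \<in> carrier A \<Longrightarrow> b \<in> carrier B \<Longrightarrow> cmod (\<Phi> a b) \<le> K * (vnorm A a * vnorm B b)"
      by (rule bilinear_boundE[OF True[unfolded bilinear_forms_eq]]) auto
    with True show ?thesis by (auto simp: elem_tensor_def)
  next
    case False
    then show ?thesis by (intro exI[of _ 0]) (auto simp: elem_tensor_def)
  qed
next
  fix p c assume p: "p \<in> carrier A \<times> carrier B"
  obtain a b where ab: "p = (a, b)" "a \<in> carrier A" "b \<in> carrier B" using p by auto
  have "\<Phi> (\<lambda>z. c * a z) b = c * \<Phi> a b" if "\<Phi> \<in> bilinear_forms A B" for \<Phi>
  proof -
    have "(\<lambda>a. \<Phi> a b) \<in> linear_maps A complex_space"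
      using that ab(3) by (simp add: bilinear_forms_def)
    from linear_mapsD(3)[OF this ab(2)] show ?thesis by (simp add: A.vscale_eq)
  qed
  then have "elem_tensor A B (\<lambda>z. c * a z) b = (\<lambda>\<Phi>. c * elem_tensor A B a b \<Phi>)"
    by (simp add: elem_tensor_def fun_eq_iff)
  with ab show "\<exists>q\<in>carrier A \<times> carrier B.
      (case q of (a, b) \<Rightarrow> vnorm A a * vnorm B b) = cmod c * (case p of (a, b) \<Rightarrow> vnorm A a * vnorm B b) \<and>
      (case q of (a, b) \<Rightarrow> elem_tensor A B a b) = (\<lambda>z. c * (case p of (a, b) \<Rightarrow> elem_tensor A B a b) z)"
    by (intro bexI[of _ "(\<lambda>z. c * a z, b)"]) (auto simp: A.norm_scale A.scale_closed)
qed

lemma tensor_rep_iff: "tensor_rep A B a b t \<longleftrightarrow> T.represents (\<lambda>n. (a n, b n)) t"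
  by (auto simp: tensor_rep_def T.represents_def)

lemma represents_iff: "T.represents p t \<longleftrightarrow> tensor_rep A B (\<lambda>n. fst (p n)) (\<lambda>n. snd (p n)) t"
  by (simp add: tensor_rep_iff)

lemma ptensor_space_eq: "ptensor_space A B = T.space"
proof -
  have "{t. \<exists>a b. tensor_rep A B a b t} = {t. \<exists>p. T.represents p t}"
    using represents_iff tensor_rep_iff by blast
  moreover have "{(\<Sum>n. vnorm A (a n) * vnorm B (b n)) | a b. tensor_rep A B a b t} =
      {(\<Sum>n. case p n of (a, b) \<Rightarrow> vnorm A a * vnorm B b) | p. T.represents p t}" for t
  proof (intro set_eqI iffI; clarsimp)
    fix a b assume "tensor_rep A B a b t"
    then show "\<exists>p. (\<Sum>n. vnorm A (a n) * vnorm B (b n)) =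
        (\<Sum>n. case p n of (a, b) \<Rightarrow> vnorm A a * vnorm B b) \<and> T.represents p t"
      by (intro exI[of _ "\<lambda>n. (a n, b n)"]) (simp add: tensor_rep_iff)
  next
    fix p assume "T.represents p t"
    then show "\<exists>a b. (\<Sum>n. case p n of (a, b) \<Rightarrow> vnorm A a * vnorm B b) =
        (\<Sum>n. vnorm A (a n) * vnorm B (b n)) \<and> tensor_rep A B a b t"
      by (intro exI[of _ "\<lambda>n. fst (p n)"] exI[of _ "\<lambda>n. snd (p n)"])
         (simp add: represents_iff case_prod_beta)
  qed
  ultimately show ?thesis
    by (simp add: ptensor_space_def T.space_def)
qed

lemma tensor_space: "banach_function_space (ptensor_space A B)"
  unfolding ptensor_space_eq by (rule T.banach_function_space_axioms)

lemma elem_closed: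
  assumes "a \<in> carrier A" "b \<in> carrier B"
  shows "elem_tensor A B a b \<in> carrier (ptensor_space A B)"
    "vnorm (ptensor_space A B) (elem_tensor A B a b) \<le> vnorm A a * vnorm B b"
  using T.atom_closed_norm[of "(a, b)"] assms by (auto simp: ptensor_space_eq)

lemma tensorE:
  assumes "t \<in> carrier (ptensor_space A B)"
  obtains a b where "\<And>n. a n \<in> carrier A" "\<And>n. b n \<in> carrier B"
    "summable (\<lambda>n. vnorm A (a n) * vnorm B (b n))" "t = (\<lambda>\<Phi>. \<Sum>n. elem_tensor A B (a n) (b n) \<Phi>)"
  using assms by (auto simp: ptensor_space_def tensor_rep_def)

lemma tensor_eval:
  assumes t: "t \<in> carrier (ptensor_space A B)"
  obtains a b where "\<And>n. a n \<in> carrier A" "\<And>n. b n \<in> carrier B"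
    "summable (\<lambda>n. vnorm A (a n) * vnorm B (b n))"
    "\<And>\<Phi>. \<Phi> \<in> bilinear_forms A B \<Longrightarrow> (\<lambda>n. \<Phi> (a n) (b n)) sums t \<Phi>"
proof -
  from tensorE[OF t] obtain a b where ab: "\<And>n. a n \<in> carrier A" "\<And>n. b n \<in> carrier B"
    "summable (\<lambda>n. vnorm A (a n) * vnorm B (b n))" "t = (\<lambda>\<Phi>. \<Sum>n. elem_tensor A B (a n) (b n) \<Phi>)"
    by blast
  have "(\<lambda>n. \<Phi> (a n) (b n)) sums t \<Phi>" if "\<Phi> \<in> bilinear_forms A B" for \<Phi>
  proof -
    have "summable (\<lambda>n. cmod (case (a n, b n) of (a, b) \<Rightarrow> elem_tensor A B a b \<Phi>))"
      using T.summable_atoms[of "\<lambda>n. (a n, b n)" \<Phi>] ab(1-3) by simp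
    then have "summable (\<lambda>n. \<Phi> (a n) (b n))"
      using that by (intro summable_norm_cancel[of "\<lambda>n. \<Phi> (a n) (b n)"]) (simp add: elem_tensor_def)
    then show ?thesis
      using that by (simp add: ab(4) elem_tensor_def summable_sums)
  qed
  with ab show thesis using that by blast
qed

lemma tensor_outside: "t \<in> carrier (ptensor_space A B) \<Longrightarrow> \<Phi> \<notin> bilinear_forms A B \<Longrightarrow> t \<Phi> = 0"
  by (auto simp: ptensor_space_def tensor_rep_def elem_tensor_def)

text \<open>
  A bilinear form is a function on whole types, but a tensor, being a series of elementary
  tensors of members of the carriers, depends only on the values of the form on the carriers.
\<close>

lemma tensor_cong:
  assumes t: "t \<in> carrier (ptensor_space A B)"
    and eq: "\<And>a b. a \<in> carrier A \<Longrightarrow> b \<in> carrier B \<Longrightarrow> \<Phi> a b = \<Psi> a b"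
  shows "t \<Phi> = t \<Psi>"
proof (cases "\<Phi> \<in> bilinear_forms A B")
  case True
  have \<Psi>: "\<Psi> \<in> bilinear_forms A B" by (rule form_cong[OF eq True])
  from tensor_eval[OF t] obtain a b where ab: "\<And>n. a n \<in> carrier A" "\<And>n. b n \<in> carrier B"
    and sums: "\<And>\<Phi>. \<Phi> \<in> bilinear_forms A B \<Longrightarrow> (\<lambda>n. \<Phi> (a n) (b n)) sums t \<Phi>"
    by metis
  have "(\<lambda>n. \<Phi> (a n) (b n)) sums t \<Psi>"
    using sums[OF \<Psi>] by (simp add: eq[OF ab])
  with sums[OF True] show ?thesis by (rule sums_unique2)
next
  case False
  have "\<Psi> \<notin> bilinear_forms A B" using form_cong[of \<Psi> \<Phi>] eq False by auto
  then show ?thesis using False tensor_outside[OF t] by simp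
qed

lemma tensor_form_add:
  assumes t: "t \<in> carrier (ptensor_space A B)" and "\<Phi> \<in> bilinear_forms A B" "\<Psi> \<in> bilinear_forms A B"
  shows "t (\<lambda>a b. \<Phi> a b + \<Psi> a b) = t \<Phi> + t \<Psi>"
proof -
  from tensor_eval[OF t] obtain a b where
    sums: "\<And>\<Phi>. \<Phi> \<in> bilinear_forms A B \<Longrightarrow> (\<lambda>n. \<Phi> (a n) (b n)) sums t \<Phi>" by metis
  show ?thesis
    by (rule sums_unique2[OF sums[OF form_add[OF assms(2,3)]] sums_add[OF sums[OF assms(2)] sums[OF assms(3)]]])
qed

lemma tensor_form_scale:
  assumes t: "t \<in> carrier (ptensor_space A B)" and "\<Phi> \<in> bilinear_forms A B"
  shows "t (\<lambda>a b. c * \<Phi> a b) = c * t \<Phi>"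
proof -
  from tensor_eval[OF t] obtain a b where
    sums: "\<And>\<Phi>. \<Phi> \<in> bilinear_forms A B \<Longrightarrow> (\<lambda>n. \<Phi> (a n) (b n)) sums t \<Phi>" by metis
  show ?thesis
    by (rule sums_unique2[OF sums[OF form_scale[OF assms(2)]] sums_mult[OF sums[OF assms(2)]]])
qed

lemma elem_bilinear: "elem_tensor A B \<in> bounded_bilinear_maps A B (ptensor_space A B)"
proof -
  interpret P: banach_function_space "ptensor_space A B" by (rule tensor_space)
  have "\<exists>K. \<forall>a\<in>carrier A. \<forall>b\<in>carrier B.
      vnorm (ptensor_space A B) (elem_tensor A B a b) \<le> K * vnorm A a * vnorm B b"
    by (intro exI[of _ 1]) (auto intro: elem_closed)
  then show ?thesis
    unfolding bounded_bilinear_maps_def P.linear_maps_into mem_Collect_eq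
  proof (intro conjI ballI allI)
    fix a \<Phi> assume "a \<in> carrier A"
    then have "(\<lambda>b. \<Phi> a b) \<in> linear_maps B complex_space" if "\<Phi> \<in> bilinear_forms A B"
      using that by (simp add: bilinear_forms_def)
    then show "(\<lambda>b. elem_tensor A B a b \<Phi>) \<in> linear_maps B complex_space"
      by (cases "\<Phi> \<in> bilinear_forms A B") (simp_all add: elem_tensor_def linear_maps_def)
  next
    fix b \<Phi> assume "b \<in> carrier B"
    then have "(\<lambda>a. \<Phi> a b) \<in> linear_maps A complex_space" if "\<Phi> \<in> bilinear_forms A B"
      using that by (simp add: bilinear_forms_def)
    then show "(\<lambda>a. elem_tensor A B a b \<Phi>) \<in> linear_maps A complex_space"
      by (cases "\<Phi> \<in> bilinear_forms A B") (simp_all add: elem_tensor_def linear_maps_def)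
  qed (simp_all add: elem_closed)
qed

text \<open>
  Every bounded functional on the tensor product is evaluation at a bilinear form. Both sides of
  the equation are given by series that agree term by term, because a tensor is a series of
  elementary tensors. This is the uniqueness half of the universal property.
\<close>

lemma functional_eq_form:
  assumes L: "L \<in> bounded_linear_maps (ptensor_space A B) complex_space"
    and t: "t \<in> carrier (ptensor_space A B)"
  shows "(\<lambda>a b. L (elem_tensor A B a b)) \<in> bilinear_forms A B"
    and "L t = t (\<lambda>a b. L (elem_tensor A B a b))"
proof -
  interpret P: banach_function_space "ptensor_space A B" by (rule tensor_space)
  show F: "(\<lambda>a b. L (elem_tensor A B a b)) \<in> bilinear_forms A B"
    using P.bounded_bilinear_comp[OF elem_bilinear L] by (simp add: bilinear_forms_eq)
  from tensorE[OF t] obtain a b where ab: "\<And>n. a n \<in> carrier A" "\<And>n. b n \<in> carrier B"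
    "summable (\<lambda>n. vnorm A (a n) * vnorm B (b n))" "t = (\<lambda>\<Phi>. \<Sum>n. elem_tensor A B (a n) (b n) \<Phi>)"
    by blast
  have "summable (\<lambda>n. vnorm (ptensor_space A B) (elem_tensor A B (a n) (b n)))"
    by (rule summable_comparison_test'[OF ab(3), of 0])
       (use elem_closed[OF ab(1,2)] P.norm_nonneg in auto)
  from P.bounded_functional_sums[OF L elem_closed(1)[OF ab(1,2)] this]
  have "(\<lambda>n. L (elem_tensor A B (a n) (b n))) sums L t" by (simp add: ab(4))
  moreover have "t (\<lambda>a b. L (elem_tensor A B a b)) = (\<Sum>n. L (elem_tensor A B (a n) (b n)))"
    by (subst ab(4)) (subst (1) elem_tensor_def, simp add: F)
  ultimately show "L t = t (\<lambda>a b. L (elem_tensor A B a b))" by (simp add: sums_iff)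
qed

text \<open>
  Since tensors are functionals on bilinear forms, the linearization of a bilinear map into a
  space of functions has an explicit formula: its value at \<open>t\<close>, evaluated at
  \<open>z\<close>, is \<open>t\<close> applied to the form \<open>\<lambda>a b. f a b
  z\<close>. The restriction matches the extensionality required of a linearization.
\<close>

definition lift :: "(('x \<Rightarrow> complex) \<Rightarrow> ('y \<Rightarrow> complex) \<Rightarrow> 'z \<Rightarrow> complex) \<Rightarrow>
    ('x \<Rightarrow> complex, 'y \<Rightarrow> complex) tensor \<Rightarrow> 'z \<Rightarrow> complex" where
  "lift f = restrict (\<lambda>t z. t (\<lambda>a b. f a b z)) (carrier (ptensor_space A B))"

lemma lift_closed_norm:
  assumes C: "banach_function_space C" and f: "f \<in> bounded_bilinear_maps A B C"
    and K: "K \<ge> 0" "\<And>a b. a \<in> carrier A \<Longrightarrow> b \<in> carrier B \<Longrightarrow> vnorm C (f a b) \<le> K * (vnorm A a * vnorm B b)"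
    and t: "t \<in> carrier (ptensor_space A B)"
  shows "lift f t \<in> carrier C \<and> vnorm C (lift f t) \<le> K * vnorm (ptensor_space A B) t"
  unfolding ptensor_space_eq
proof (rule T.norm_map_le[OF C t[unfolded ptensor_space_eq] K(1)])
  fix p assume p: "T.represents p t"
  define q where "q = (\<lambda>n. f (fst (p n)) (snd (p n)))"
  have pc: "fst (p n) \<in> carrier A" "snd (p n) \<in> carrier B" for n
    using T.representsD(1)[OF p, of n] by auto
  have "lift f t = (\<lambda>z. \<Sum>n. q n z)"
    using t form_eval[OF f C]
    by (auto simp: lift_def q_def fun_eq_iff T.representsD(3)[OF p] case_prod_beta elem_tensor_def)
  moreover have "q n \<in> carrier C" "vnorm C (q n) \<le> K * (case p n of (a, b) \<Rightarrow> vnorm A a * vnorm B b)" for n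
    using K(2)[OF pc] bounded_bilinear_mapsD(3)[OF f pc] by (auto simp: q_def case_prod_beta)
  ultimately show "\<exists>q. (\<forall>n. q n \<in> carrier C \<and>
      vnorm C (q n) \<le> K * (case p n of (a, b) \<Rightarrow> vnorm A a * vnorm B b)) \<and> lift f t = (\<lambda>z. \<Sum>n. q n z)"
    by blast
qed

lemma lift_bounded:
  assumes C: "banach_function_space C" and f: "f \<in> bounded_bilinear_maps A B C"
  shows "lift f \<in> bounded_linear_maps (ptensor_space A B) C"
proof -
  interpret C: banach_function_space C by fact
  interpret P: banach_function_space "ptensor_space A B" by (rule tensor_space)
  obtain K where K: "K \<ge> 0"
    "\<And>a b. a \<in> carrier A \<Longrightarrow> b \<in> carrier B \<Longrightarrow> vnorm C (f a b) \<le> K * (vnorm A a * vnorm B b)"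
    by (rule bilinear_boundE[OF f]) blast
  note L = lift_closed_norm[OF C f K]
  have "lift f \<in> linear_maps (ptensor_space A B) C"
    unfolding C.linear_maps_into
    using L by (auto simp: linear_maps_def P.vadd_eq P.vscale_eq P.add_closed P.scale_closed)
       (auto simp: lift_def P.add_closed P.scale_closed)
  with L show ?thesis
    unfolding bounded_linear_maps_def by (intro CollectI conjI exI[of _ K]) auto
qed

lemma lift_elem:
  assumes C: "banach_function_space C" and f: "f \<in> bounded_bilinear_maps A B C"
    and "a \<in> carrier A" "b \<in> carrier B"
  shows "lift f (elem_tensor A B a b) = f a b"
  using form_eval[OF f C] elem_closed(1)[OF assms(3,4)]
  by (auto simp: lift_def fun_eq_iff elem_tensor_def)

text \<open>
  Uniqueness: composed with evaluation at \<open>z\<close>, a linearization becomes a bounded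
  functional, hence evaluation at a form, and that form is \<open>f\<close> followed by
  evaluation at \<open>z\<close>.
\<close>

lemma linearization_eq:
  assumes C: "banach_function_space C" and f: "f \<in> bounded_bilinear_maps A B C"
  shows "linearization A B C f = lift f"
  unfolding linearization_def
proof (rule the_equality)
  show "lift f \<in> bounded_linear_maps (ptensor_space A B) C \<and>
      lift f \<in> extensional (carrier (ptensor_space A B)) \<and>
      (\<forall>a\<in>carrier A. \<forall>b\<in>carrier B. lift f (elem_tensor A B a b) = f a b)"
    using lift_bounded[OF C f] lift_elem[OF C f] by (auto simp: lift_def)
next
  interpret P: banach_function_space "ptensor_space A B" by (rule tensor_space)
  interpret C: banach_function_space C by fact
  fix U assume U: "U \<in> bounded_linear_maps (ptensor_space A B) C \<and>
      U \<in> extensional (carrier (ptensor_space A B)) \<and>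
      (\<forall>a\<in>carrier A. \<forall>b\<in>carrier B. U (elem_tensor A B a b) = f a b)"
  show "U = lift f"
  proof
    fix t
    show "U t = lift f t"
    proof (cases "t \<in> carrier (ptensor_space A B)")
      case True
      have "U t z = t (\<lambda>a b. f a b z)" for z
      proof -
        have "(\<lambda>t. U t z) \<in> bounded_linear_maps (ptensor_space A B) complex_space"
        proof -
          obtain K where K: "K \<ge> 0" "\<And>x. x \<in> carrier (ptensor_space A B) \<Longrightarrow>
              vnorm C (U x) \<le> K * vnorm (ptensor_space A B) x"
            by (rule P.bounded_mapE[of U C]) (use U in auto)
          obtain M where M: "M \<ge> 0" "\<And>x. x \<in> carrier C \<Longrightarrow> cmod (x z) \<le> M * vnorm C x"
            by (rule C.eval_bound[of z]) blast
          have UC: "U x \<in> carrier C" if "x \<in> carrier (ptensor_space A B)" for x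
            using bounded_linear_mapsD(2)[OF conjunct1[OF U] that] .
          have "cmod (U x z) \<le> (M * K) * vnorm (ptensor_space A B) x"
            if "x \<in> carrier (ptensor_space A B)" for x
            using M(2)[OF UC[OF that]] mult_left_mono[OF K(2)[OF that] M(1)] by (simp add: mult.assoc)
          moreover have "(\<lambda>t. U t z) \<in> linear_maps (ptensor_space A B) complex_space"
            using U bounded_linear_mapsD(1) C.linear_maps_into by blast
          ultimately show ?thesis unfolding bounded_linear_maps_def by auto
        qed
        from functional_eq_form(2)[OF this True]
        have "U t z = t (\<lambda>a b. U (elem_tensor A B a b) z)" .
        also have "\<dots> = t (\<lambda>a b. f a b z)"
          using U by (intro tensor_cong[OF True]) simp
        finally show ?thesis .
      qed
      then show ?thesis using True by (simp add: lift_def fun_eq_iff)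
    next
      case False
      then show ?thesis using U by (auto simp: lift_def extensional_def)
    qed
  qed
qed

text \<open>
  The scalar case: complex numbers are not functions, so this is not an instance of
  \<open>linearization_eq\<close>.
\<close>

lemma linearization_form:
  assumes g: "g \<in> bilinear_forms A B"
  shows "linearization A B complex_space g = restrict (\<lambda>t. t g) (carrier (ptensor_space A B))"
  unfolding linearization_def
proof (rule the_equality)
  interpret P: banach_function_space "ptensor_space A B" by (rule tensor_space)
  show "restrict (\<lambda>t. t g) (carrier (ptensor_space A B)) \<in> bounded_linear_maps (ptensor_space A B) complex_space \<and>
      restrict (\<lambda>t. t g) (carrier (ptensor_space A B)) \<in> extensional (carrier (ptensor_space A B)) \<and>
      (\<forall>a\<in>carrier A. \<forall>b\<in>carrier B.
        restrict (\<lambda>t. t g) (carrier (ptensor_space A B)) (elem_tensor A B a b) = g a b)"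
    using P.eval_functional[of g] g
    by (auto simp: bounded_linear_maps_def linear_maps_def P.vadd_eq P.vscale_eq P.add_closed
        P.scale_closed elem_closed) (auto simp: elem_tensor_def)
next
  fix L assume L: "L \<in> bounded_linear_maps (ptensor_space A B) complex_space \<and>
      L \<in> extensional (carrier (ptensor_space A B)) \<and>
      (\<forall>a\<in>carrier A. \<forall>b\<in>carrier B. L (elem_tensor A B a b) = g a b)"
  show "L = restrict (\<lambda>t. t g) (carrier (ptensor_space A B))"
  proof
    fix t
    show "L t = restrict (\<lambda>t. t g) (carrier (ptensor_space A B)) t"
    proof (cases "t \<in> carrier (ptensor_space A B)")
      case True
      have "L t = t (\<lambda>a b. L (elem_tensor A B a b))"
        using functional_eq_form(2)[of L t] L True by blast
      also have "\<dots> = t g" using L by (intro tensor_cong[OF True]) simp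
      finally show ?thesis using True by simp
    next
      case False
      then show ?thesis using L by (auto simp: extensional_def)
    qed
  qed
qed

text \<open>
  The left side is a bounded functional of \<open>t\<close>, so it is evaluation at the form
  that it induces on elementary tensors. All computations with slices and products of tensors go
  through this rule.
\<close>

lemma functional_lift:
  assumes C: "banach_function_space C" and f: "f \<in> bounded_bilinear_maps A B C"
    and L: "L \<in> bounded_linear_maps C complex_space" and t: "t \<in> carrier (ptensor_space A B)"
  shows "L (lift f t) = t (\<lambda>a b. L (f a b))"
proof -
  interpret C: banach_function_space C by fact
  interpret P: banach_function_space "ptensor_space A B" by (rule tensor_space)
  obtain K where K: "K \<ge> 0" "\<And>x. x \<in> carrier (ptensor_space A B) \<Longrightarrow>
      vnorm C (lift f x) \<le> K * vnorm (ptensor_space A B) x"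
    by (rule P.bounded_mapE[OF lift_bounded[OF C f]]) blast
  obtain M where M: "M \<ge> 0" "\<And>x. x \<in> carrier C \<Longrightarrow> vnorm complex_space (L x) \<le> M * vnorm C x"
    by (rule C.bounded_mapE[OF L]) blast
  note lc = bounded_linear_mapsD(2)[OF lift_bounded[OF C f]]
  have "cmod (L (lift f x)) \<le> (M * K) * vnorm (ptensor_space A B) x"
    if "x \<in> carrier (ptensor_space A B)" for x
    using M(2)[OF lc[OF that]] mult_left_mono[OF K(2)[OF that] M(1)] by (simp add: mult.assoc)
  moreover have "(\<lambda>t. L (lift f t)) \<in> linear_maps (ptensor_space A B) complex_space"
    using bounded_linear_mapsD(1)[OF lift_bounded[OF C f]] bounded_linear_mapsD(1)[OF L]
    unfolding linear_maps_def by auto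
  ultimately have "(\<lambda>t. L (lift f t)) \<in> bounded_linear_maps (ptensor_space A B) complex_space"
    unfolding bounded_linear_maps_def by auto
  from functional_eq_form(2)[OF this t]
  have "L (lift f t) = t (\<lambda>a b. L (lift f (elem_tensor A B a b)))" .
  also have "\<dots> = t (\<lambda>a b. L (f a b))"
    by (intro tensor_cong[OF t]) (simp add: lift_elem[OF C f])
  finally show ?thesis .
qed

end

section \<open>Banach function algebras and left biprojectivity\<close>

text \<open>
  The product is bounded by some constant, not by 1: the estimates for convolution and for
  products in the Fourier algebra are proved with constants 4 and 162.
\<close>

locale banach_function_algebra = banach_function_space X
  for X :: "('z \<Rightarrow> complex, 'm) nalgebra_scheme" +
  assumes mult_bilinear: "vmult X \<in> bounded_bilinear_maps X X X"
begin

lemma mult_closed: "a \<in> carrier X \<Longrightarrow> b \<in> carrier X \<Longrightarrow> vmult X a b \<in> carrier X"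
  using bounded_bilinear_mapsD(3)[OF mult_bilinear] .

sublocale XX: tensor_pair X X by unfold_locales

lemma mult_boundE:
  obtains K where "K > 0"
    "\<And>a b. a \<in> carrier X \<Longrightarrow> b \<in> carrier X \<Longrightarrow> vnorm X (vmult X a b) \<le> K * (vnorm X a * vnorm X b)"
proof -
  obtain K where K: "K \<ge> 0"
    "\<And>a b. a \<in> carrier X \<Longrightarrow> b \<in> carrier X \<Longrightarrow> vnorm X (vmult X a b) \<le> K * (vnorm X a * vnorm X b)"
    by (rule XX.bilinear_boundE[OF mult_bilinear]) blast
  have "vnorm X (vmult X a b) \<le> (K + 1) * (vnorm X a * vnorm X b)"
    if "a \<in> carrier X" "b \<in> carrier X" for a b
    using K(2)[OF that] norm_nonneg[OF that(1)] norm_nonneg[OF that(2)]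
    by (smt (verit) mult_nonneg_nonneg mult_right_mono)
  then show thesis using that[of "K + 1"] K(1) by simp
qed

lemma left_mult_bounded: "a \<in> carrier X \<Longrightarrow> vmult X a \<in> bounded_linear_maps X X"
proof -
  assume a: "a \<in> carrier X"
  obtain K where K: "K > 0"
    "\<And>a b. a \<in> carrier X \<Longrightarrow> b \<in> carrier X \<Longrightarrow> vnorm X (vmult X a b) \<le> K * (vnorm X a * vnorm X b)"
    by (rule mult_boundE) blast
  show "vmult X a \<in> bounded_linear_maps X X"
    using bounded_bilinear_mapsD(1)[OF mult_bilinear a] K(2)[OF a]
    unfolding bounded_linear_maps_def
    by (intro CollectI conjI exI[of _ "K * vnorm X a"]) (auto simp: mult.assoc)
qed

lemma right_mult_bounded: "b \<in> carrier X \<Longrightarrow> (\<lambda>a. vmult X a b) \<in> bounded_linear_maps X X"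
proof -
  assume b: "b \<in> carrier X"
  obtain K where K: "K > 0"
    "\<And>a b. a \<in> carrier X \<Longrightarrow> b \<in> carrier X \<Longrightarrow> vnorm X (vmult X a b) \<le> K * (vnorm X a * vnorm X b)"
    by (rule mult_boundE) blast
  show "(\<lambda>a. vmult X a b) \<in> bounded_linear_maps X X"
    using bounded_bilinear_mapsD(2)[OF mult_bilinear b] K(2)[OF _ b]
    unfolding bounded_linear_maps_def
    by (intro CollectI conjI exI[of _ "K * vnorm X b"]) (auto simp: mult_ac)
qed

lemma map_functional:
  assumes T: "T \<in> bounded_linear_maps X X" and L: "L \<in> bounded_linear_maps X complex_space"
  shows "(\<lambda>x. L (T x)) \<in> bounded_linear_maps X complex_space"
proof -
  obtain K where K: "K \<ge> 0" "\<And>x. x \<in> carrier X \<Longrightarrow> vnorm X (T x) \<le> K * vnorm X x"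
    by (rule bounded_mapE[OF T]) blast
  obtain M where M: "M \<ge> 0" "\<And>x. x \<in> carrier X \<Longrightarrow> cmod (L x) \<le> M * vnorm X x"
    by (rule bounded_mapE[OF L]) auto
  note TX = bounded_linear_mapsD(2)[OF T]
  have "cmod (L (T x)) \<le> (M * K) * vnorm X x" if "x \<in> carrier X" for x
    using M(2)[OF TX[OF that]] mult_left_mono[OF K(2)[OF that] M(1)] by (simp add: mult.assoc)
  moreover have "(\<lambda>x. L (T x)) \<in> linear_maps X complex_space"
    using bounded_linear_mapsD(1)[OF T] bounded_linear_mapsD(1)[OF L]
    unfolding linear_maps_def by auto
  ultimately show ?thesis unfolding bounded_linear_maps_def by auto
qed

lemma left_mult_eval: "a \<in> carrier X \<Longrightarrow> (\<lambda>b. vmult X a b z) \<in> bounded_linear_maps X complex_space"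
  by (rule map_functional[OF left_mult_bounded eval_functional])

lemma right_mult_eval: "b \<in> carrier X \<Longrightarrow> (\<lambda>a. vmult X a b z) \<in> bounded_linear_maps X complex_space"
  by (rule map_functional[OF right_mult_bounded eval_functional])

lemma mult_scale:
  assumes "a \<in> carrier X" "b \<in> carrier X"
  shows "vmult X a (\<lambda>z. c * b z) = (\<lambda>z. c * vmult X a b z)"
    "vmult X (\<lambda>z. c * a z) b = (\<lambda>z. c * vmult X a b z)"
  using linear_mapsD(3)[OF bounded_bilinear_mapsD(1)[OF mult_bilinear assms(1)] assms(2), of c]
    linear_mapsD(3)[OF bounded_bilinear_mapsD(2)[OF mult_bilinear assms(2)] assms(1), of c]
  by (simp_all add: vscale_eq)

text \<open>
  The Neumann series \<open>a + a\<^sup>2 + a\<^sup>3 + \<dots>\<close>, which in an algebra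
  without unit takes the place of the inverse of \<open>1 - a\<close>.
\<close>

lemma quasi_inverse:
  assumes K: "\<And>a b. a \<in> carrier X \<Longrightarrow> b \<in> carrier X \<Longrightarrow>
      vnorm X (vmult X a b) \<le> K * (vnorm X a * vnorm X b)"
    and a: "a \<in> carrier X" and small: "K * vnorm X a \<le> 1/2"
  shows "\<exists>b\<in>carrier X. b = (\<lambda>z. a z + vmult X a b z)"
proof -
  define p where "p = (\<lambda>n. (vmult X a ^^ n) a)"
  have p: "p n \<in> carrier X" for n
    by (induction n) (auto simp: p_def a mult_closed)
  have le: "vnorm X (p n) \<le> (1/2) ^ n * vnorm X a" for n
  proof (induction n)
    case 0
    then show ?case by (simp add: p_def)
  next
    case (Suc n)
    have "vnorm X (p (Suc n)) \<le> (K * vnorm X a) * vnorm X (p n)"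
      using K[OF a p[of n]] by (simp add: p_def mult.assoc)
    also have "\<dots> \<le> 1/2 * vnorm X (p n)"
      by (intro mult_right_mono small norm_nonneg p)
    finally show ?case using Suc by simp
  qed
  have sm: "summable (\<lambda>n. vnorm X (p n))"
    by (rule summable_comparison_test'[OF summable_mult2[OF summable_geometric], of "1/2" 0])
       (use le norm_nonneg[OF p] in auto)
  define b where "b = (\<lambda>z. \<Sum>n. p n z)"
  have b: "b \<in> carrier X" unfolding b_def by (rule series_closed[OF p sm])
  have "b z = a z + vmult X a b z" for z
  proof -
    have "(\<lambda>n. vmult X a (p n) z) sums vmult X a b z"
      unfolding b_def
      by (rule bounded_map_series[OF banach_function_space_axioms banach_function_space_axioms
            left_mult_bounded[OF a] p sm])
    then have "(\<lambda>n. p (Suc n) z) sums vmult X a b z" by (simp add: p_def)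
    then have "(\<lambda>n. p n z) sums (vmult X a b z + p 0 z)" by (subst (asm) sums_Suc_iff) simp
    then show ?thesis by (simp add: b_def p_def sums_iff)
  qed
  then show ?thesis using b by (intro bexI[of _ b]) auto
qed

text \<open>
  Automatic continuity. If \<open>\<phi>\<close> were not bounded by \<open>2 * K\<close>, with
  \<open>K\<close> a bound for the product, some \<open>u\<close> with \<open>\<phi> u =
  1\<close> would satisfy \<open>K * norm u \<le> 1/2\<close>; its quasi-inverse \<open>b = u +
  u b\<close> would give \<open>\<phi> b = 1 + \<phi> b\<close>.
\<close>

lemma character_bounded:
  assumes \<phi>: "\<phi> \<in> characters X"
  shows "\<phi> \<in> bounded_linear_maps X complex_space"
proof -
  have lin: "\<phi> \<in> linear_maps X complex_space"
    and mult: "\<And>a b. a \<in> carrier X \<Longrightarrow> b \<in> carrier X \<Longrightarrow> \<phi> (vmult X a b) = \<phi> a * \<phi> b"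
    using \<phi> by (auto simp: characters_def)
  obtain K where K: "K > 0" "\<And>a b. a \<in> carrier X \<Longrightarrow> b \<in> carrier X \<Longrightarrow>
      vnorm X (vmult X a b) \<le> K * (vnorm X a * vnorm X b)"
    by (rule mult_boundE) blast
  have "cmod (\<phi> a) \<le> (2 * K) * vnorm X a" if a: "a \<in> carrier X" for a
  proof (rule ccontr)
    assume "\<not> cmod (\<phi> a) \<le> (2 * K) * vnorm X a"
    then have big: "2 * K * vnorm X a < cmod (\<phi> a)" by simp
    then have nz: "\<phi> a \<noteq> 0"
      using K(1) norm_nonneg[OF a] by (metis mult_nonneg_nonneg norm_zero less_le_not_le zero_le_numeral
          norm_eq_zero linorder_not_less less_imp_le)
    define u where "u = (\<lambda>z. inverse (\<phi> a) * a z)"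
    have u: "u \<in> carrier X" unfolding u_def by (rule scale_closed[OF a])
    have u1: "\<phi> u = 1"
      unfolding u_def using linear_maps_from(3)[OF lin a a, of "inverse (\<phi> a)"] nz by simp
    have "vnorm X u = vnorm X a / cmod (\<phi> a)"
      unfolding u_def norm_scale[OF a] by (simp add: norm_inverse divide_inverse mult.commute)
    then have "K * vnorm X u = (K * vnorm X a) / cmod (\<phi> a)" by simp
    then have "K * vnorm X u \<le> 1/2"
      using big nz by (simp add: divide_le_eq)
    from quasi_inverse[OF K(2) u this] obtain b where b: "b \<in> carrier X"
      "b = (\<lambda>z. u z + vmult X u b z)" by auto
    have "\<phi> b = \<phi> (\<lambda>z. u z + vmult X u b z)" using b(2) by simp
    also have "\<dots> = \<phi> u + \<phi> (vmult X u b)"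
      using linear_maps_from(2)[OF lin u mult_closed[OF u b(1)]] by simp
    also have "\<dots> = 1 + \<phi> b" using mult[OF u b(1)] u1 by simp
    finally show False by simp
  qed
  then show ?thesis using lin unfolding bounded_linear_maps_def by auto
qed

lemma characterD:
  assumes "\<phi> \<in> characters X"
  shows "\<phi> \<in> linear_maps X complex_space"
    and "a \<in> carrier X \<Longrightarrow> b \<in> carrier X \<Longrightarrow> \<phi> (vmult X a b) = \<phi> a * \<phi> b"
    and "a \<in> carrier X \<Longrightarrow> \<phi> (\<lambda>z. c * a z) = c * \<phi> a"
    and "\<exists>a\<in>carrier X. \<phi> a = 1"
proof -
  show lin: "\<phi> \<in> linear_maps X complex_space"
    and "a \<in> carrier X \<Longrightarrow> b \<in> carrier X \<Longrightarrow> \<phi> (vmult X a b) = \<phi> a * \<phi> b"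
    using assms by (auto simp: characters_def)
  show sc: "\<phi> (\<lambda>z. c * a z) = c * \<phi> a" if "a \<in> carrier X" for a c
    using linear_maps_from(3)[OF lin that that] by simp
  obtain a where a: "a \<in> carrier X" "\<phi> a \<noteq> 0" using assms by (auto simp: characters_def)
  then show "\<exists>a\<in>carrier X. \<phi> a = 1"
    using sc[OF a(1), of "inverse (\<phi> a)"] scale_closed[OF a(1)]
    by (intro bexI[of _ "\<lambda>z. inverse (\<phi> a) * a z"]) auto
qed

subsection \<open>Left biprojectivity\<close>

text \<open>
  The trace that left biprojectivity leaves in the algebra itself. In an algebra with a left
  unit the identity says that \<open>a n = \<phi>(a) n\<close>; in general it is weaker, and it
  is what slicing a left biprojective map yields.
\<close>

definition absorbs :: "(('z \<Rightarrow> complex) \<Rightarrow> complex) \<Rightarrow> ('z \<Rightarrow> complex) \<Rightarrow> bool" where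
  "absorbs \<phi> n \<longleftrightarrow> n \<in> carrier X \<and> \<phi> n = 1 \<and>
     (\<forall>a\<in>carrier X. \<forall>b\<in>carrier X. vmult X (vmult X a b) n = (\<lambda>z. \<phi> b * vmult X a n z))"

lemma action_bilinear:
  assumes a: "a \<in> carrier X"
  shows "(\<lambda>b c. elem_tensor X X (vmult X a b) c) \<in> bounded_bilinear_maps X X (ptensor_space X X)"
proof -
  obtain K where K: "K > 0"
    "\<And>a b. a \<in> carrier X \<Longrightarrow> b \<in> carrier X \<Longrightarrow> vnorm X (vmult X a b) \<le> K * (vnorm X a * vnorm X b)"
    by (rule mult_boundE) blast
  have "vnorm (ptensor_space X X) (elem_tensor X X (vmult X a b) c) \<le> (K * vnorm X a) * vnorm X b * vnorm X c"
    if "b \<in> carrier X" "c \<in> carrier X" for b c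
    using order_trans[OF XX.elem_closed(2)[OF mult_closed[OF a that(1)] that(2)]
      mult_right_mono[OF K(2)[OF a that(1)] norm_nonneg[OF that(2)]]]
    by (simp add: mult.assoc)
  then show ?thesis
    using bounded_bilinear_mapsD(1,2)[OF XX.elem_bilinear] mult_closed[OF a]
      bounded_bilinear_mapsD(1)[OF mult_bilinear a]
    unfolding bounded_bilinear_maps_def
    by (intro CollectI conjI exI[of _ "K * vnorm X a"]) (auto simp: linear_maps_def)
qed

lemma left_action_eq: "a \<in> carrier X \<Longrightarrow> left_action X a = XX.lift (\<lambda>b c. elem_tensor X X (vmult X a b) c)"
  unfolding left_action_def by (rule XX.linearization_eq[OF XX.tensor_space action_bilinear])

lemma product_map_eq: "product_map X = XX.lift (vmult X)"
  unfolding product_map_def by (rule XX.linearization_eq[OF banach_function_space_axioms mult_bilinear])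

lemma right_slice_bilinear:
  assumes \<phi>: "\<phi> \<in> bounded_linear_maps X complex_space"
  shows "(\<lambda>s t z. \<phi> t * s z) \<in> bounded_bilinear_maps X X X"
proof -
  obtain M where M: "M \<ge> 0" "\<And>x. x \<in> carrier X \<Longrightarrow> cmod (\<phi> x) \<le> M * vnorm X x"
    by (rule bounded_mapE[OF \<phi>]) auto
  have "vnorm X (\<lambda>z. \<phi> t * s z) \<le> M * vnorm X s * vnorm X t"
    if "s \<in> carrier X" "t \<in> carrier X" for s t
    unfolding norm_scale[OF that(1)]
    using mult_right_mono[OF M(2)[OF that(2)] norm_nonneg[OF that(1)]] by (simp add: mult_ac)
  then show ?thesis
    using bounded_linear_mapsD(1)[OF \<phi>] scale_closed
    unfolding bounded_bilinear_maps_def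
    by (intro CollectI conjI exI[of _ M])
       (auto simp: linear_maps_def vadd_eq vscale_eq distrib_left distrib_right mult.assoc mult.left_commute)
qed

text \<open>
  The element is the slice of \<open>\<rho> b0\<close> under \<open>id \<otimes> \<phi>\<close>,
  where \<open>\<phi> b0 = 1\<close>. Slicing in the second factor commutes with the left
  action, so that \<open>a n\<close> is the slice of \<open>\<rho> a\<close> and the identities
  for \<open>\<rho> (a b)\<close> become those for \<open>n\<close>; and \<open>\<phi>\<close>
  of the slice is \<open>\<phi> \<circ> \<pi>\<close>, because both are given by the form
  \<open>\<phi> s * \<phi> t\<close>.
\<close>

lemma biprojective_imp_absorbs:
  assumes \<phi>: "\<phi> \<in> characters X" and bp: "left_biprojective X \<phi>"
  shows "\<exists>n. absorbs \<phi> n"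
proof -
  let ?P = "ptensor_space X X"
  interpret P: banach_function_space ?P by (rule XX.tensor_space)
  note \<phi>b = character_bounded[OF \<phi>]
  note bfs = banach_function_space_axioms
  obtain \<rho> where \<rho>: "\<rho> \<in> bounded_linear_maps X ?P"
    and \<rho>1: "\<And>a b. a \<in> carrier X \<Longrightarrow> b \<in> carrier X \<Longrightarrow> \<rho> (vmult X a b) = left_action X a (\<rho> b)"
    and \<rho>2: "\<And>a b. a \<in> carrier X \<Longrightarrow> b \<in> carrier X \<Longrightarrow> left_action X a (\<rho> b) = (\<lambda>z. \<phi> b * \<rho> a z)"
    and \<rho>3: "\<And>a. a \<in> carrier X \<Longrightarrow> \<phi> (product_map X (\<rho> a)) = \<phi> a"
    using bp unfolding left_biprojective_def P.vscale_eq by blast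
  note \<rho>P = bounded_linear_mapsD(2)[OF \<rho>]
  define sl where "sl = XX.lift (\<lambda>s t z. \<phi> t * s z)"
  note slb = right_slice_bilinear[OF \<phi>b]
  have slX: "sl u \<in> carrier X" if "u \<in> carrier ?P" for u
    unfolding sl_def using bounded_linear_mapsD(2)[OF XX.lift_bounded[OF bfs slb] that] .
  have sl_eval: "L (sl u) = u (\<lambda>s t. \<phi> t * L s)"
    if "u \<in> carrier ?P" "L \<in> bounded_linear_maps X complex_space" for u L
  proof -
    have "L (sl u) = u (\<lambda>s t. L (\<lambda>z. \<phi> t * s z))"
      unfolding sl_def by (rule XX.functional_lift[OF bfs slb that(2,1)])
    also have "\<dots> = u (\<lambda>s t. \<phi> t * L s)"
      by (rule XX.tensor_cong[OF that(1)])
         (simp add: linear_maps_from(3)[OF bounded_linear_mapsD(1)[OF that(2)]])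
    finally show ?thesis .
  qed
  have sl_action: "sl (left_action X a u) = vmult X a (sl u)" if a: "a \<in> carrier X" and u: "u \<in> carrier ?P" for a u
  proof
    fix z
    have au: "left_action X a u \<in> carrier ?P"
      unfolding left_action_eq[OF a]
      by (rule bounded_linear_mapsD(2)[OF XX.lift_bounded[OF XX.tensor_space action_bilinear[OF a]] u])
    have F: "(\<lambda>s t. \<phi> t * s z) \<in> bilinear_forms X X"
      using XX.product_form[OF eval_functional \<phi>b] by (simp add: mult.commute)
    have "sl (left_action X a u) z = left_action X a u (\<lambda>s t. \<phi> t * s z)"
      using sl_eval[OF au eval_functional] .
    also have "\<dots> = u (\<lambda>b c. elem_tensor X X (vmult X a b) c (\<lambda>s t. \<phi> t * s z))"
      unfolding left_action_eq[OF a] using u by (simp add: XX.lift_def)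
    also have "\<dots> = u (\<lambda>b c. \<phi> c * vmult X a b z)"
      by (simp add: elem_tensor_def F)
    also have "\<dots> = vmult X a (sl u) z"
      using sl_eval[OF u left_mult_eval[OF a]] by simp
    finally show "sl (left_action X a u) z = vmult X a (sl u) z" .
  qed
  have sl_scale: "sl (\<lambda>z. c * u z) = (\<lambda>z. c * sl u z)" if "u \<in> carrier ?P" for u c
    unfolding sl_def using P.linear_maps_from(3)[OF bounded_linear_mapsD(1)[OF XX.lift_bounded[OF bfs slb]] that that]
    by (simp add: vscale_eq)
  obtain b0 where b0: "b0 \<in> carrier X" "\<phi> b0 = 1" using characterD(4)[OF \<phi>] by blast
  define n where "n = sl (\<rho> b0)"
  have n: "n \<in> carrier X" unfolding n_def by (rule slX[OF \<rho>P[OF b0(1)]])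
  have an: "vmult X a n = sl (\<rho> a)" if "a \<in> carrier X" for a
    unfolding n_def using sl_action[OF that \<rho>P[OF b0(1)]] \<rho>2[OF that b0(1)] b0(2) by simp
  have abn: "vmult X (vmult X a b) n = (\<lambda>z. \<phi> b * vmult X a n z)"
    if a: "a \<in> carrier X" and b: "b \<in> carrier X" for a b
    unfolding an[OF a] an[OF mult_closed[OF a b]] \<rho>1[OF a b] \<rho>2[OF a b] by (rule sl_scale[OF \<rho>P[OF a]])
  have "\<phi> n = \<rho> b0 (\<lambda>s t. \<phi> t * \<phi> s)"
    unfolding n_def by (rule sl_eval[OF \<rho>P[OF b0(1)] \<phi>b])
  also have "\<dots> = \<rho> b0 (\<lambda>s t. \<phi> (vmult X s t))"
    by (rule XX.tensor_cong[OF \<rho>P[OF b0(1)]]) (simp add: characterD(2)[OF \<phi>])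
  also have "\<dots> = \<phi> (product_map X (\<rho> b0))"
    unfolding product_map_eq by (rule XX.functional_lift[OF bfs mult_bilinear \<phi>b \<rho>P[OF b0(1)], symmetric])
  also have "\<dots> = 1" using \<rho>3[OF b0(1)] b0(2) by simp
  finally show ?thesis unfolding absorbs_def using n abn by auto
qed

text \<open>
  The map is \<open>\<rho> a = \<phi>(a) (n \<otimes> n)\<close>: the left action of
  \<open>a\<close> on \<open>n \<otimes> n\<close> multiplies it by \<open>\<phi> a\<close>, and
  its product \<open>n\<^sup>2\<close> has \<open>\<phi>\<close>-value 1.
\<close>

lemma biprojectiveI:
  assumes \<phi>: "\<phi> \<in> characters X" and n: "n \<in> carrier X" "\<phi> n = 1"
    and absorb: "\<And>a. a \<in> carrier X \<Longrightarrow> vmult X a n = (\<lambda>z. \<phi> a * n z)"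
  shows "left_biprojective X \<phi>"
proof -
  let ?P = "ptensor_space X X"
  interpret P: banach_function_space ?P by (rule XX.tensor_space)
  note \<phi>b = character_bounded[OF \<phi>]
  note bfs = banach_function_space_axioms
  define e where "e = elem_tensor X X n n"
  have e: "e \<in> carrier ?P" unfolding e_def by (rule XX.elem_closed(1)[OF n(1) n(1)])
  define \<rho> where "\<rho> = (\<lambda>a z. \<phi> a * e z)"
  have \<rho>P: "\<rho> a \<in> carrier ?P" for a unfolding \<rho>_def by (rule P.scale_closed[OF e])
  obtain M where M: "M \<ge> 0" "\<And>x. x \<in> carrier X \<Longrightarrow> cmod (\<phi> x) \<le> M * vnorm X x"
    by (rule bounded_mapE[OF \<phi>b]) auto
  have "vnorm ?P (\<rho> a) \<le> (M * vnorm ?P e) * vnorm X a" if "a \<in> carrier X" for a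
    unfolding \<rho>_def P.norm_scale[OF e]
    using mult_right_mono[OF M(2)[OF that] P.norm_nonneg[OF e]] by (simp add: mult_ac)
  moreover have "\<rho> \<in> linear_maps X ?P"
    unfolding P.linear_maps_into
    using \<rho>P characterD(1)[OF \<phi>] by (auto simp: linear_maps_def \<rho>_def algebra_simps)
  ultimately have \<rho>b: "\<rho> \<in> bounded_linear_maps X ?P"
    unfolding bounded_linear_maps_def by auto
  have act: "left_action X a (\<rho> b) = (\<lambda>z. \<phi> b * \<rho> a z)" if a: "a \<in> carrier X" for a b
  proof -
    have "left_action X a \<in> linear_maps ?P ?P"
      unfolding left_action_eq[OF a]
      by (rule bounded_linear_mapsD(1)[OF XX.lift_bounded[OF XX.tensor_space action_bilinear[OF a]]])
    from P.linear_maps_from(3)[OF this e e, of "\<phi> b"]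
    have "left_action X a (\<rho> b) = (\<lambda>z. \<phi> b * left_action X a e z)"
      by (simp add: \<rho>_def P.vscale_eq)
    moreover have "left_action X a e = elem_tensor X X (vmult X a n) n"
      unfolding left_action_eq[OF a] e_def
      by (rule XX.lift_elem[OF XX.tensor_space action_bilinear[OF a] n(1) n(1)])
    moreover have "elem_tensor X X (\<lambda>z. \<phi> a * n z) n = \<rho> a"
      using linear_mapsD(3)[OF bounded_bilinear_mapsD(2)[OF XX.elem_bilinear n(1)] n(1), of "\<phi> a"]
      by (simp add: vscale_eq P.vscale_eq \<rho>_def e_def)
    ultimately show ?thesis by (simp add: absorb[OF a])
  qed
  have prod: "\<phi> (product_map X (\<rho> a)) = \<phi> a" for a
  proof -
    have "product_map X (\<rho> a) = (\<lambda>z. \<phi> a * product_map X e z)"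
      using P.linear_maps_from(3)[OF bounded_linear_mapsD(1)[OF XX.lift_bounded[OF bfs mult_bilinear]] e e]
      by (simp add: product_map_eq \<rho>_def vscale_eq)
    moreover have "product_map X e = vmult X n n"
      unfolding product_map_eq e_def by (rule XX.lift_elem[OF bfs mult_bilinear n(1) n(1)])
    ultimately show ?thesis
      using characterD(2)[OF \<phi> n(1) n(1)] characterD(3)[OF \<phi> mult_closed[OF n(1) n(1)]] n(2) by simp
  qed
  have "\<rho> (vmult X a b) = (\<lambda>z. \<phi> b * \<rho> a z)" if "a \<in> carrier X" "b \<in> carrier X" for a b
    unfolding \<rho>_def by (simp add: characterD(2)[OF \<phi> that] mult_ac)
  then show ?thesis
    unfolding left_biprojective_def P.vscale_eq
    using act prod by (intro bexI[OF _ \<rho>b]) auto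
qed

end

text \<open>
  This carries absorbing elements from a tensor product to its two factors.
\<close>

lemma (in banach_function_algebra) absorbs_image:
  assumes C: "banach_function_algebra C"
    and h: "h \<in> linear_maps X C"
    and hom: "\<And>s t. s \<in> carrier X \<Longrightarrow> t \<in> carrier X \<Longrightarrow> h (vmult X s t) = vmult C (h s) (h t)"
    and surj: "\<And>c. c \<in> carrier C \<Longrightarrow> \<exists>s\<in>carrier X. h s = c"
    and \<phi>: "\<And>s. s \<in> carrier X \<Longrightarrow> \<phi> s = \<theta> (h s)"
    and n: "absorbs \<phi> n"
  shows "banach_function_algebra.absorbs C \<theta> (h n)"
proof -
  interpret C: banach_function_algebra C by fact
  have nX: "n \<in> carrier X" and n1: "\<phi> n = 1"
    and abn: "\<And>a b. a \<in> carrier X \<Longrightarrow> b \<in> carrier X \<Longrightarrow>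
      vmult X (vmult X a b) n = (\<lambda>z. \<phi> b * vmult X a n z)"
    using n unfolding absorbs_def by auto
  have "vmult C (vmult C c d) (h n) = (\<lambda>z. \<theta> d * vmult C c (h n) z)"
    if cd: "c \<in> carrier C" "d \<in> carrier C" for c d
  proof -
    obtain a b where ab: "a \<in> carrier X" "h a = c" "b \<in> carrier X" "h b = d"
      using surj cd by metis
    have "h (vmult X (vmult X a b) n) = h (\<lambda>z. \<phi> b * vmult X a n z)"
      using abn ab by simp
    also have "\<dots> = (\<lambda>z. \<phi> b * h (vmult X a n) z)"
      using linear_maps_from(3)[OF h mult_closed[OF ab(1) nX] mult_closed[OF ab(1) nX]]
      by (simp add: C.vscale_eq)
    finally show ?thesis using ab nX by (simp add: hom mult_closed \<phi>)
  qed
  then show ?thesis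
    unfolding C.absorbs_def using linear_maps_from(1)[OF h nX nX] n1 \<phi>[OF nX] by auto
qed

subsection \<open>The projective tensor product of two algebras\<close>

lemma ptensor_simps [simp]:
  "carrier (A \<otimes>\<^sub>p B) = carrier (ptensor_space A B)" "vadd (A \<otimes>\<^sub>p B) = vadd (ptensor_space A B)"
  "vscale (A \<otimes>\<^sub>p B) = vscale (ptensor_space A B)" "vnorm (A \<otimes>\<^sub>p B) = vnorm (ptensor_space A B)"
  "vmult (A \<otimes>\<^sub>p B) = (\<lambda>s t. linearization A B (ptensor_space A B)
        (\<lambda>a b. linearization A B (ptensor_space A B)
           (\<lambda>c d. elem_tensor A B (vmult A a c) (vmult B b d)) t) s)"
  by (simp_all add: ptensor_def nspace.extend_def nalgebra.fields_def)

lemma linearization_cong: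
  assumes "\<And>a b. a \<in> carrier A \<Longrightarrow> b \<in> carrier B \<Longrightarrow> f a b = g a b"
  shows "linearization A B C f = linearization A B C g"
  unfolding linearization_def using assms by (intro arg_cong[of _ _ The] ext) auto

locale tensor_algebra_pair = A: banach_function_algebra A + B: banach_function_algebra B
  for A :: "('x \<Rightarrow> complex, 'm) nalgebra_scheme" and B :: "('y \<Rightarrow> complex, 'n) nalgebra_scheme"
begin

sublocale tensor_pair A B by unfold_locales

abbreviation P :: "('x \<Rightarrow> complex, 'y \<Rightarrow> complex) tensor nspace" where
  "P \<equiv> ptensor_space A B"

sublocale P: banach_function_space P by (rule tensor_space)

definition elem_mult :: "('x \<Rightarrow> complex) \<Rightarrow> ('y \<Rightarrow> complex) \<Rightarrow> ('x \<Rightarrow> complex) \<Rightarrow> ('y \<Rightarrow> complex) \<Rightarrow>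
    ('x \<Rightarrow> complex, 'y \<Rightarrow> complex) tensor" where
  "elem_mult a b c d = elem_tensor A B (vmult A a c) (vmult B b d)"

lemma elem_mult_boundE:
  obtains K where "K \<ge> 0" "\<And>a b c d. a \<in> carrier A \<Longrightarrow> b \<in> carrier B \<Longrightarrow> c \<in> carrier A \<Longrightarrow> d \<in> carrier B \<Longrightarrow>
    vnorm P (elem_mult a b c d) \<le> K * (vnorm A a * vnorm B b) * (vnorm A c * vnorm B d)"
proof -
  obtain K where K: "K > 0"
    "\<And>a b. a \<in> carrier A \<Longrightarrow> b \<in> carrier A \<Longrightarrow> vnorm A (vmult A a b) \<le> K * (vnorm A a * vnorm A b)"
    by (rule A.mult_boundE) blast
  obtain M where M: "M > 0"
    "\<And>a b. a \<in> carrier B \<Longrightarrow> b \<in> carrier B \<Longrightarrow> vnorm B (vmult B a b) \<le> M * (vnorm B a * vnorm B b)"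
    by (rule B.mult_boundE) blast
  have "vnorm P (elem_mult a b c d) \<le> (K * M) * (vnorm A a * vnorm B b) * (vnorm A c * vnorm B d)"
    if "a \<in> carrier A" "b \<in> carrier B" "c \<in> carrier A" "d \<in> carrier B" for a b c d
  proof -
    have "vnorm P (elem_mult a b c d) \<le> vnorm A (vmult A a c) * vnorm B (vmult B b d)"
      unfolding elem_mult_def using that by (intro elem_closed A.mult_closed B.mult_closed)
    also have "\<dots> \<le> (K * (vnorm A a * vnorm A c)) * (M * (vnorm B b * vnorm B d))"
      using K M that by (intro mult_mono mult_nonneg_nonneg)
        (auto intro: A.norm_nonneg B.norm_nonneg B.mult_closed)
    finally show ?thesis by (simp add: mult_ac)
  qed
  then show thesis using that[of "K * M"] K(1) M(1) by simp
qed

lemma elem_mult_bilinear: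
  assumes ab: "a \<in> carrier A" "b \<in> carrier B"
  shows "elem_mult a b \<in> bounded_bilinear_maps A B P"
proof -
  obtain K where K: "K \<ge> 0" "\<And>a b c d. a \<in> carrier A \<Longrightarrow> b \<in> carrier B \<Longrightarrow> c \<in> carrier A \<Longrightarrow> d \<in> carrier B \<Longrightarrow>
    vnorm P (elem_mult a b c d) \<le> K * (vnorm A a * vnorm B b) * (vnorm A c * vnorm B d)"
    by (rule elem_mult_boundE) blast
  note E = bounded_bilinear_mapsD(1,2)[OF elem_bilinear]
  have 1: "elem_mult a b c \<in> linear_maps B P" if "c \<in> carrier A" for c
    using E(1)[OF A.mult_closed[OF ab(1) that]] bounded_bilinear_mapsD(1)[OF B.mult_bilinear ab(2)]
    unfolding elem_mult_def linear_maps_def by auto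
  have 2: "(\<lambda>c. elem_mult a b c d) \<in> linear_maps A P" if "d \<in> carrier B" for d
    using E(2)[OF B.mult_closed[OF ab(2) that]] bounded_bilinear_mapsD(1)[OF A.mult_bilinear ab(1)]
    unfolding elem_mult_def linear_maps_def by auto
  show ?thesis
    unfolding bounded_bilinear_maps_def
    using 1 2 K(2)[OF ab]
    by (intro CollectI conjI exI[of _ "K * (vnorm A a * vnorm B b)"]) (auto simp: mult.assoc)
qed

text \<open>
  The product of tensors is a linearization of linearizations. The inner one, as a function of
  the outer variables, is the product of the elementary tensor of \<open>a\<close> and
  \<open>b\<close> with \<open>t\<close>.
\<close>

definition partial_mult where "partial_mult t a b = lift (elem_mult a b) t"

lemma partial_mult_eval:
  "t \<in> carrier P \<Longrightarrow> partial_mult t a b \<Phi> = t (\<lambda>c d. elem_mult a b c d \<Phi>)"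
  by (simp add: partial_mult_def lift_def)

lemma partial_mult_boundE:
  obtains K where "K \<ge> 0" "\<And>a b t. a \<in> carrier A \<Longrightarrow> b \<in> carrier B \<Longrightarrow> t \<in> carrier P \<Longrightarrow>
    partial_mult t a b \<in> carrier P \<and> vnorm P (partial_mult t a b) \<le> (K * vnorm P t) * (vnorm A a * vnorm B b)"
proof -
  obtain K where K: "K \<ge> 0" "\<And>a b c d. a \<in> carrier A \<Longrightarrow> b \<in> carrier B \<Longrightarrow> c \<in> carrier A \<Longrightarrow> d \<in> carrier B \<Longrightarrow>
    vnorm P (elem_mult a b c d) \<le> K * (vnorm A a * vnorm B b) * (vnorm A c * vnorm B d)"
    by (rule elem_mult_boundE) blast
  have "partial_mult t a b \<in> carrier P \<and> vnorm P (partial_mult t a b) \<le> (K * vnorm P t) * (vnorm A a * vnorm B b)"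
    if ab: "a \<in> carrier A" "b \<in> carrier B" and t: "t \<in> carrier P" for a b t
    using lift_closed_norm[OF tensor_space elem_mult_bilinear[OF ab] _ K(2)[OF ab] t] K(1)
      A.norm_nonneg[OF ab(1)] B.norm_nonneg[OF ab(2)]
    unfolding partial_mult_def by (simp add: mult_ac)
  then show thesis using that K(1) by blast
qed

lemma partial_mult_bilinear:
  assumes t: "t \<in> carrier P"
  shows "partial_mult t \<in> bounded_bilinear_maps A B P"
proof -
  obtain K where K: "K \<ge> 0" "\<And>a b t. a \<in> carrier A \<Longrightarrow> b \<in> carrier B \<Longrightarrow> t \<in> carrier P \<Longrightarrow>
    partial_mult t a b \<in> carrier P \<and> vnorm P (partial_mult t a b) \<le> (K * vnorm P t) * (vnorm A a * vnorm B b)"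
    by (rule partial_mult_boundE) blast
  note ev = partial_mult_eval[OF t]
  note form = form_eval[OF elem_mult_bilinear tensor_space]
  note E = bounded_bilinear_mapsD(1,2)[OF elem_bilinear]
  have 1: "(\<lambda>b. partial_mult t a b \<Phi>) \<in> linear_maps B complex_space" if a: "a \<in> carrier A" for a \<Phi>
  proof -
    have add: "elem_mult a (vadd B b b') c d \<Phi> = elem_mult a b c d \<Phi> + elem_mult a b' c d \<Phi>"
      and sc: "elem_mult a (vscale B k b) c d \<Phi> = k * elem_mult a b c d \<Phi>"
      if "b \<in> carrier B" "b' \<in> carrier B" "c \<in> carrier A" "d \<in> carrier B" for b b' c d k
      using that E(1)[OF A.mult_closed[OF a that(3)]] bounded_bilinear_mapsD(2)[OF B.mult_bilinear that(4)]
      unfolding elem_mult_def linear_maps_def P.vadd_eq P.vscale_eq by auto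
    have "partial_mult t a (vadd B b b') \<Phi> = partial_mult t a b \<Phi> + partial_mult t a b' \<Phi>"
      if "b \<in> carrier B" "b' \<in> carrier B" for b b'
      unfolding ev tensor_form_add[OF t form[OF a that(1)] form[OF a that(2)], symmetric]
      by (rule tensor_cong[OF t]) (simp add: add that)
    moreover have "partial_mult t a (vscale B k b) \<Phi> = k * partial_mult t a b \<Phi>"
      if "b \<in> carrier B" for b k
      unfolding ev tensor_form_scale[OF t form[OF a that], symmetric]
      by (rule tensor_cong[OF t]) (simp add: sc that)
    ultimately show ?thesis by (simp add: linear_maps_def)
  qed
  have 2: "(\<lambda>a. partial_mult t a b \<Phi>) \<in> linear_maps A complex_space" if b: "b \<in> carrier B" for b \<Phi>
  proof -
    have add: "elem_mult (vadd A a a') b c d \<Phi> = elem_mult a b c d \<Phi> + elem_mult a' b c d \<Phi>"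
      and sc: "elem_mult (vscale A k a) b c d \<Phi> = k * elem_mult a b c d \<Phi>"
      if "a \<in> carrier A" "a' \<in> carrier A" "c \<in> carrier A" "d \<in> carrier B" for a a' c d k
      using that E(2)[OF B.mult_closed[OF b that(4)]] bounded_bilinear_mapsD(2)[OF A.mult_bilinear that(3)]
      unfolding elem_mult_def linear_maps_def P.vadd_eq P.vscale_eq by auto
    have "partial_mult t (vadd A a a') b \<Phi> = partial_mult t a b \<Phi> + partial_mult t a' b \<Phi>"
      if "a \<in> carrier A" "a' \<in> carrier A" for a a'
      unfolding ev tensor_form_add[OF t form[OF that(1) b] form[OF that(2) b], symmetric]
      by (rule tensor_cong[OF t]) (simp add: add that)
    moreover have "partial_mult t (vscale A k a) b \<Phi> = k * partial_mult t a b \<Phi>"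
      if "a \<in> carrier A" for a k
      unfolding ev tensor_form_scale[OF t form[OF that b], symmetric]
      by (rule tensor_cong[OF t]) (simp add: sc that)
    ultimately show ?thesis by (simp add: linear_maps_def)
  qed
  show ?thesis
    unfolding bounded_bilinear_maps_def P.linear_maps_into
    using 1 2 K(2)[OF _ _ t] by (intro CollectI conjI exI[of _ "K * vnorm P t"]) (auto simp: mult.assoc)
qed

lemma mult_eq: "t \<in> carrier P \<Longrightarrow> vmult (A \<otimes>\<^sub>p B) s t = lift (partial_mult t) s"
proof -
  assume t: "t \<in> carrier P"
  have "linearization A B P (elem_mult a b) t = partial_mult t a b" if "a \<in> carrier A" "b \<in> carrier B" for a b
    unfolding partial_mult_def linearization_eq[OF tensor_space elem_mult_bilinear[OF that]] ..
  then have "linearization A B P (\<lambda>a b. linearization A B P (elem_mult a b) t) =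
      linearization A B P (partial_mult t)"
    by (rule linearization_cong)
  then show ?thesis
    by (simp add: elem_mult_def[abs_def] linearization_eq[OF tensor_space partial_mult_bilinear[OF t]])
qed

text \<open>
  The explicit value of a product of tensors at a bilinear form, from which identities between
  products are read off.
\<close>

lemma mult_eval:
  assumes "s \<in> carrier P" "t \<in> carrier P" and \<Phi>: "\<Phi> \<in> bilinear_forms A B"
  shows "vmult (A \<otimes>\<^sub>p B) s t \<Phi> = s (\<lambda>a b. t (\<lambda>c d. \<Phi> (vmult A a c) (vmult B b d)))"
  unfolding mult_eq[OF assms(2)]
  using assms by (simp add: lift_def partial_mult_eval elem_mult_def elem_tensor_def)

lemma tensor_algebra: "banach_function_algebra (A \<otimes>\<^sub>p B)"
proof -
  interpret D: banach_function_space "A \<otimes>\<^sub>p B"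
    using tensor_space unfolding banach_function_space_def by simp
  obtain K where K: "K \<ge> 0" "\<And>a b t. a \<in> carrier A \<Longrightarrow> b \<in> carrier B \<Longrightarrow> t \<in> carrier P \<Longrightarrow>
    partial_mult t a b \<in> carrier P \<and> vnorm P (partial_mult t a b) \<le> (K * vnorm P t) * (vnorm A a * vnorm B b)"
    by (rule partial_mult_boundE) blast
  have bound: "lift (partial_mult t) s \<in> carrier P \<and>
      vnorm P (lift (partial_mult t) s) \<le> K * vnorm P s * vnorm P t"
    if "s \<in> carrier P" "t \<in> carrier P" for s t
    using lift_closed_norm[OF tensor_space partial_mult_bilinear[OF that(2)] _ conjunct2[OF K(2)[OF _ _ that(2)]] that(1)]
      K(1) P.norm_nonneg[OF that(2)] by (simp add: mult_ac)
  have lin1: "(\<lambda>t. lift (partial_mult t) s \<Phi>) \<in> linear_maps P complex_space" if s: "s \<in> carrier P" for s \<Phi>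
  proof -
    note form = form_eval[OF partial_mult_bilinear tensor_space]
    have ev: "lift (partial_mult t) s \<Phi> = s (\<lambda>a b. partial_mult t a b \<Phi>)" for t
      using s by (simp add: lift_def)
    have "lift (partial_mult (\<lambda>z. t z + t' z)) s \<Phi> = lift (partial_mult t) s \<Phi> + lift (partial_mult t') s \<Phi>"
      if "t \<in> carrier P" "t' \<in> carrier P" for t t'
      unfolding ev tensor_form_add[OF s form[OF that(1)] form[OF that(2)], symmetric]
      by (rule tensor_cong[OF s]) (simp add: partial_mult_eval that P.add_closed)
    moreover have "lift (partial_mult (\<lambda>z. k * t z)) s \<Phi> = k * lift (partial_mult t) s \<Phi>"
      if "t \<in> carrier P" for t k
      unfolding ev tensor_form_scale[OF s form[OF that], symmetric]
      by (rule tensor_cong[OF s]) (simp add: partial_mult_eval that P.scale_closed)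
    ultimately show ?thesis by (simp add: linear_maps_def P.vadd_eq P.vscale_eq)
  qed
  have lin2: "(\<lambda>s. lift (partial_mult t) s \<Phi>) \<in> linear_maps P complex_space" if t: "t \<in> carrier P" for t \<Phi>
    using bounded_linear_mapsD(1)[OF lift_bounded[OF tensor_space partial_mult_bilinear[OF t]]]
    unfolding P.linear_maps_into by blast
  have cong: "f \<in> linear_maps (A \<otimes>\<^sub>p B) (A \<otimes>\<^sub>p B) \<longleftrightarrow> g \<in> linear_maps P P"
    if "\<And>t. t \<in> carrier P \<Longrightarrow> f t = g t" for f g
    using that unfolding linear_maps_def P.vadd_eq P.vscale_eq ptensor_simps
    by (simp add: P.add_closed P.scale_closed)
  have b: "(\<forall>a\<in>carrier P. vmult (A \<otimes>\<^sub>p B) a \<in> linear_maps (A \<otimes>\<^sub>p B) (A \<otimes>\<^sub>p B)) \<and>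
      (\<forall>b\<in>carrier P. (\<lambda>a. vmult (A \<otimes>\<^sub>p B) a b) \<in> linear_maps (A \<otimes>\<^sub>p B) (A \<otimes>\<^sub>p B)) \<and>
      (\<exists>K. \<forall>a\<in>carrier P. \<forall>b\<in>carrier P. vnorm P (vmult (A \<otimes>\<^sub>p B) a b) \<le> K * vnorm P a * vnorm P b)"
  proof (intro conjI ballI)
    fix s assume s: "s \<in> carrier P"
    have "(\<lambda>t. lift (partial_mult t) s) \<in> linear_maps P P"
      unfolding P.linear_maps_into using lin1[OF s] bound[OF s] by blast
    with cong[of "vmult (A \<otimes>\<^sub>p B) s" "\<lambda>t. lift (partial_mult t) s"] mult_eq
    show "vmult (A \<otimes>\<^sub>p B) s \<in> linear_maps (A \<otimes>\<^sub>p B) (A \<otimes>\<^sub>p B)" by blast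
  next
    fix t assume t: "t \<in> carrier P"
    have "lift (partial_mult t) \<in> linear_maps P P"
      unfolding P.linear_maps_into using lin2[OF t] bound[OF _ t] by blast
    with cong[of "\<lambda>s. vmult (A \<otimes>\<^sub>p B) s t" "lift (partial_mult t)"] mult_eq[OF t]
    show "(\<lambda>s. vmult (A \<otimes>\<^sub>p B) s t) \<in> linear_maps (A \<otimes>\<^sub>p B) (A \<otimes>\<^sub>p B)" by blast
  next
    show "\<exists>K. \<forall>a\<in>carrier P. \<forall>b\<in>carrier P. vnorm P (vmult (A \<otimes>\<^sub>p B) a b) \<le> K * vnorm P a * vnorm P b"
      using bound mult_eq by (intro exI[of _ K]) (simp del: ptensor_simps)
  qed
  show ?thesis
    by unfold_locales (use b in \<open>simp add: bounded_bilinear_maps_def del: ptensor_simps(5)\<close>)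
qed

sublocale D: banach_function_algebra "A \<otimes>\<^sub>p B" by (rule tensor_algebra)

text \<open>
  A bilinear map that is multiplicative on elementary tensors has a multiplicative
  linearization: after evaluation at \<open>z\<close>, both sides are the value of
  \<open>s\<close> at a form given by values of \<open>t\<close> at forms, and the innermost
  forms agree by assumption.
\<close>

lemma lift_multiplicative:
  assumes C: "banach_function_algebra C" and f: "f \<in> bounded_bilinear_maps A B C"
    and hom: "\<And>a b c d. a \<in> carrier A \<Longrightarrow> b \<in> carrier B \<Longrightarrow> c \<in> carrier A \<Longrightarrow> d \<in> carrier B \<Longrightarrow>
      f (vmult A a c) (vmult B b d) = vmult C (f a b) (f c d)"
    and s: "s \<in> carrier P" and t: "t \<in> carrier P"
  shows "lift f (vmult (A \<otimes>\<^sub>p B) s t) = vmult C (lift f s) (lift f t)"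
proof
  fix z
  interpret C: banach_function_algebra C by fact
  note bfs = C.banach_function_space_axioms
  note lc = bounded_linear_mapsD(2)[OF lift_bounded[OF bfs f]]
  have st: "vmult (A \<otimes>\<^sub>p B) s t \<in> carrier P"
    using D.mult_closed[of s t] s t by (simp del: ptensor_simps(5))
  have "lift f (vmult (A \<otimes>\<^sub>p B) s t) z = vmult (A \<otimes>\<^sub>p B) s t (\<lambda>a b. f a b z)"
    using st by (simp add: lift_def del: ptensor_simps)
  also have "\<dots> = s (\<lambda>a b. t (\<lambda>c d. f (vmult A a c) (vmult B b d) z))"
    by (rule mult_eval[OF s t form_eval[OF f bfs]])
  also have "\<dots> = s (\<lambda>a b. t (\<lambda>c d. vmult C (f a b) (f c d) z))"
    by (intro tensor_cong[OF s] tensor_cong[OF t]) (simp add: hom)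
  also have "\<dots> = s (\<lambda>a b. vmult C (f a b) (lift f t) z)"
    by (intro tensor_cong[OF s])
       (rule functional_lift[OF bfs f C.left_mult_eval t, symmetric], rule bounded_bilinear_mapsD(3)[OF f])
  also have "\<dots> = vmult C (lift f s) (lift f t) z"
    by (rule functional_lift[OF bfs f C.right_mult_eval[OF lc[OF t]] s, symmetric])
  finally show "lift f (vmult (A \<otimes>\<^sub>p B) s t) z = vmult C (lift f s) (lift f t) z" .
qed

lemma tensor_functional_eq:
  assumes "\<phi> \<in> bounded_linear_maps A complex_space" "\<psi> \<in> bounded_linear_maps B complex_space" "t \<in> carrier P"
  shows "tensor_functional A B \<phi> \<psi> t = t (\<lambda>a b. \<phi> a * \<psi> b)"
  unfolding tensor_functional_def linearization_form[OF product_form[OF assms(1,2)]]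
  using assms(3) by simp

lemma slice_bilinear:
  assumes "\<phi> \<in> bounded_linear_maps A complex_space"
  shows "(\<lambda>a b z. \<phi> a * b z) \<in> bounded_bilinear_maps A B B"
proof -
  obtain M where M: "M \<ge> 0" "\<And>x. x \<in> carrier A \<Longrightarrow> cmod (\<phi> x) \<le> M * vnorm A x"
    by (rule A.bounded_mapE[OF assms]) auto
  have "vnorm B (\<lambda>z. \<phi> a * b z) \<le> M * vnorm A a * vnorm B b"
    if "a \<in> carrier A" "b \<in> carrier B" for a b
    unfolding B.norm_scale[OF that(2)]
    using mult_right_mono[OF M(2)[OF that(1)] B.norm_nonneg[OF that(2)]] by (simp add: mult_ac)
  then show ?thesis
    using bounded_linear_mapsD(1)[OF assms] B.scale_closed
    unfolding bounded_bilinear_maps_def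
    by (intro CollectI conjI exI[of _ M])
       (auto simp: linear_maps_def B.vadd_eq B.vscale_eq distrib_left distrib_right mult.assoc mult.left_commute)
qed

lemma slice_bilinear':
  assumes "\<psi> \<in> bounded_linear_maps B complex_space"
  shows "(\<lambda>a b z. \<psi> b * a z) \<in> bounded_bilinear_maps A B A"
proof -
  obtain M where M: "M \<ge> 0" "\<And>x. x \<in> carrier B \<Longrightarrow> cmod (\<psi> x) \<le> M * vnorm B x"
    by (rule B.bounded_mapE[OF assms]) auto
  have "vnorm A (\<lambda>z. \<psi> b * a z) \<le> M * vnorm A a * vnorm B b"
    if "a \<in> carrier A" "b \<in> carrier B" for a b
    unfolding A.norm_scale[OF that(1)]
    using mult_right_mono[OF M(2)[OF that(2)] A.norm_nonneg[OF that(1)]] by (simp add: mult_ac)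
  then show ?thesis
    using bounded_linear_mapsD(1)[OF assms] A.scale_closed
    unfolding bounded_bilinear_maps_def
    by (intro CollectI conjI exI[of _ M])
       (auto simp: linear_maps_def A.vadd_eq A.vscale_eq distrib_left distrib_right mult.assoc mult.left_commute)
qed

context
  fixes \<phi> \<psi>
  assumes \<phi>: "\<phi> \<in> characters A" and \<psi>: "\<psi> \<in> characters B"
begin

private lemmas \<phi>b = A.character_bounded[OF \<phi>]
private lemmas \<psi>b = B.character_bounded[OF \<psi>]

text \<open>
  \<open>\<phi> \<otimes> id\<close> is a homomorphism onto the second factor through which
  \<open>\<phi> \<otimes> \<psi>\<close> factors; it is onto because \<open>a \<otimes>
  b\<close> with \<open>\<phi> a = 1\<close> is mapped to \<open>b\<close>.
\<close>

lemma left_slice: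
  defines "h \<equiv> lift (\<lambda>a b z. \<phi> a * b z)"
  shows "h \<in> linear_maps (A \<otimes>\<^sub>p B) B"
    and "s \<in> carrier P \<Longrightarrow> t \<in> carrier P \<Longrightarrow> h (vmult (A \<otimes>\<^sub>p B) s t) = vmult B (h s) (h t)"
    and "b \<in> carrier B \<Longrightarrow> \<exists>s\<in>carrier P. h s = b"
    and "s \<in> carrier P \<Longrightarrow> tensor_functional A B \<phi> \<psi> s = \<psi> (h s)"
proof -
  note bfs = B.banach_function_space_axioms
  note f = slice_bilinear[OF \<phi>b]
  show "h \<in> linear_maps (A \<otimes>\<^sub>p B) B"
    using bounded_linear_mapsD(1)[OF lift_bounded[OF bfs f]] unfolding h_def linear_maps_def by simp
  show "h (vmult (A \<otimes>\<^sub>p B) s t) = vmult B (h s) (h t)" if "s \<in> carrier P" "t \<in> carrier P"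
    unfolding h_def
  proof (rule lift_multiplicative[OF B.banach_function_algebra_axioms f _ that])
    fix a b c d assume "a \<in> carrier A" "b \<in> carrier B" "c \<in> carrier A" "d \<in> carrier B"
    then show "(\<lambda>z. \<phi> (vmult A a c) * vmult B b d z) = vmult B (\<lambda>z. \<phi> a * b z) (\<lambda>z. \<phi> c * d z)"
      by (simp add: A.characterD(2)[OF \<phi>] B.mult_scale B.scale_closed mult_ac)
  qed
  show "\<exists>s\<in>carrier P. h s = b" if b: "b \<in> carrier B"
  proof -
    obtain a where "a \<in> carrier A" "\<phi> a = 1" using A.characterD(4)[OF \<phi>] by blast
    then show ?thesis
      using lift_elem[OF bfs f _ b] elem_closed(1)[OF _ b] unfolding h_def by (intro bexI) auto
  qed
  show "tensor_functional A B \<phi> \<psi> s = \<psi> (h s)" if s: "s \<in> carrier P"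
    unfolding tensor_functional_eq[OF \<phi>b \<psi>b s] h_def functional_lift[OF bfs f \<psi>b s]
    by (rule tensor_cong[OF s]) (simp add: B.characterD(3)[OF \<psi>])
qed

lemma right_slice:
  defines "h \<equiv> lift (\<lambda>a b z. \<psi> b * a z)"
  shows "h \<in> linear_maps (A \<otimes>\<^sub>p B) A"
    and "s \<in> carrier P \<Longrightarrow> t \<in> carrier P \<Longrightarrow> h (vmult (A \<otimes>\<^sub>p B) s t) = vmult A (h s) (h t)"
    and "a \<in> carrier A \<Longrightarrow> \<exists>s\<in>carrier P. h s = a"
    and "s \<in> carrier P \<Longrightarrow> tensor_functional A B \<phi> \<psi> s = \<phi> (h s)"
proof -
  note bfs = A.banach_function_space_axioms
  note f = slice_bilinear'[OF \<psi>b]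
  show "h \<in> linear_maps (A \<otimes>\<^sub>p B) A"
    using bounded_linear_mapsD(1)[OF lift_bounded[OF bfs f]] unfolding h_def linear_maps_def by simp
  show "h (vmult (A \<otimes>\<^sub>p B) s t) = vmult A (h s) (h t)" if "s \<in> carrier P" "t \<in> carrier P"
    unfolding h_def
  proof (rule lift_multiplicative[OF A.banach_function_algebra_axioms f _ that])
    fix a b c d assume "a \<in> carrier A" "b \<in> carrier B" "c \<in> carrier A" "d \<in> carrier B"
    then show "(\<lambda>z. \<psi> (vmult B b d) * vmult A a c z) = vmult A (\<lambda>z. \<psi> b * a z) (\<lambda>z. \<psi> d * c z)"
      by (simp add: B.characterD(2)[OF \<psi>] A.mult_scale A.scale_closed mult_ac)
  qed
  show "\<exists>s\<in>carrier P. h s = a" if a: "a \<in> carrier A"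
  proof -
    obtain b where "b \<in> carrier B" "\<psi> b = 1" using B.characterD(4)[OF \<psi>] by blast
    then show ?thesis
      using lift_elem[OF bfs f a] elem_closed(1)[OF a] unfolding h_def by (intro bexI) auto
  qed
  show "tensor_functional A B \<phi> \<psi> s = \<phi> (h s)" if s: "s \<in> carrier P"
    unfolding tensor_functional_eq[OF \<phi>b \<psi>b s] h_def functional_lift[OF bfs f \<phi>b s]
    by (rule tensor_cong[OF s]) (subst A.characterD(3)[OF \<phi>], assumption, rule mult.commute)
qed

lemma tensor_character: "tensor_functional A B \<phi> \<psi> \<in> characters (A \<otimes>\<^sub>p B)"
proof -
  define h where "h = lift (\<lambda>a b z. \<phi> a * b z)"
  note h = left_slice[folded h_def]
  have hB: "h s \<in> carrier B" if "s \<in> carrier P" for s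
    using linear_mapsD(1)[OF h(1)] that by simp
  have "tensor_functional A B \<phi> \<psi> \<in> linear_maps (A \<otimes>\<^sub>p B) complex_space"
    using P.eval_functional[of "\<lambda>a b. \<phi> a * \<psi> b"]
    by (auto simp: linear_maps_def bounded_linear_maps_def tensor_functional_eq[OF \<phi>b \<psi>b]
        P.vadd_eq P.vscale_eq P.add_closed P.scale_closed)
  moreover have "tensor_functional A B \<phi> \<psi> (vmult (A \<otimes>\<^sub>p B) s t) =
      tensor_functional A B \<phi> \<psi> s * tensor_functional A B \<phi> \<psi> t" if "s \<in> carrier P" "t \<in> carrier P" for s t
  proof -
    have "vmult (A \<otimes>\<^sub>p B) s t \<in> carrier P"
      using D.mult_closed[of s t] that by (simp del: ptensor_simps(5))
    then show ?thesis
      using that by (simp add: h(4) h(2) B.characterD(2)[OF \<psi>] hB del: ptensor_simps)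
  qed
  moreover have "\<exists>s\<in>carrier P. tensor_functional A B \<phi> \<psi> s \<noteq> 0"
    using B.characterD(4)[OF \<psi>] h(3,4) by (metis one_neq_zero)
  ultimately show ?thesis by (simp add: characters_def del: ptensor_simps(5))
qed

lemma biprojective_imp_factors_absorb:
  assumes "left_biprojective (A \<otimes>\<^sub>p B) (tensor_functional A B \<phi> \<psi>)"
  shows "(\<exists>n. A.absorbs \<phi> n) \<and> (\<exists>n. B.absorbs \<psi> n)"
proof -
  obtain n where n: "D.absorbs (tensor_functional A B \<phi> \<psi>) n"
    using D.biprojective_imp_absorbs[OF tensor_character assms] by blast
  have "A.absorbs \<phi> (lift (\<lambda>a b z. \<psi> b * a z) n)"
    by (rule D.absorbs_image[OF A.banach_function_algebra_axioms right_slice(1) _ _ _ n])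
       (simp_all add: right_slice(2-4) del: ptensor_simps(5))
  moreover have "B.absorbs \<psi> (lift (\<lambda>a b z. \<phi> a * b z) n)"
    by (rule D.absorbs_image[OF B.banach_function_algebra_axioms left_slice(1) _ _ _ n])
       (simp_all add: left_slice(2-4) del: ptensor_simps(5))
  ultimately show ?thesis by blast
qed

text \<open>
  The absorbing element is \<open>n \<otimes> k\<close>. As a tensor is evaluated at a form, it
  suffices that \<open>(a \<otimes> b)(n \<otimes> k)\<close> equals \<open>\<phi>(a) \<psi>(b)
  (n \<otimes> k)\<close>.
\<close>

lemma tensor_biprojectiveI:
  assumes n: "n \<in> carrier A" "\<phi> n = 1" "\<And>a. a \<in> carrier A \<Longrightarrow> vmult A a n = (\<lambda>z. \<phi> a * n z)"
    and k: "k \<in> carrier B" "\<psi> k = 1" "\<And>b. b \<in> carrier B \<Longrightarrow> vmult B b k = (\<lambda>z. \<psi> b * k z)"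
  shows "left_biprojective (A \<otimes>\<^sub>p B) (tensor_functional A B \<phi> \<psi>)"
proof (rule D.biprojectiveI[OF tensor_character])
  let ?e = "elem_tensor A B n k"
  have e: "?e \<in> carrier P" by (rule elem_closed(1)[OF n(1) k(1)])
  then show "?e \<in> carrier (A \<otimes>\<^sub>p B)" by simp
  show "tensor_functional A B \<phi> \<psi> ?e = 1"
    unfolding tensor_functional_eq[OF \<phi>b \<psi>b e] using product_form[OF \<phi>b \<psi>b] n(2) k(2)
    by (simp add: elem_tensor_def)
  fix t assume "t \<in> carrier (A \<otimes>\<^sub>p B)"
  then have t: "t \<in> carrier P" by simp
  have te: "vmult (A \<otimes>\<^sub>p B) t ?e \<in> carrier P"
    using D.mult_closed[of t ?e] t e by (simp del: ptensor_simps(5))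
  have "vmult (A \<otimes>\<^sub>p B) t ?e \<Phi> = tensor_functional A B \<phi> \<psi> t * ?e \<Phi>" for \<Phi>
  proof (cases "\<Phi> \<in> bilinear_forms A B")
    case True
    have lin: "\<Phi> (\<lambda>z. c * a z) (\<lambda>z. d * b z) = c * (d * \<Phi> a b)"
      if "a \<in> carrier A" "b \<in> carrier B" for a b c d
    proof -
      have 1: "(\<lambda>a. \<Phi> a (\<lambda>z. d * b z)) \<in> linear_maps A complex_space" "\<Phi> a \<in> linear_maps B complex_space"
        using True that B.scale_closed by (auto simp: bilinear_forms_def)
      from linear_mapsD(3)[OF 1(1) that(1)] linear_mapsD(3)[OF 1(2) that(2)]
      show ?thesis by (simp add: A.vscale_eq B.vscale_eq)
    qed
    have "vmult (A \<otimes>\<^sub>p B) t ?e \<Phi> = t (\<lambda>a b. ?e (\<lambda>c d. \<Phi> (vmult A a c) (vmult B b d)))"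
      by (rule mult_eval[OF t e True])
    also have "\<dots> = t (\<lambda>a b. \<Phi> n k * (\<phi> a * \<psi> b))"
    proof (rule tensor_cong[OF t])
      fix a b assume ab: "a \<in> carrier A" "b \<in> carrier B"
      have "(\<lambda>c d. \<Phi> (vmult A a c) (vmult B b d)) \<in> bilinear_forms A B"
        using form_eval[OF elem_mult_bilinear[OF ab] tensor_space, of \<Phi>] True
        by (simp add: elem_mult_def elem_tensor_def)
      then show "?e (\<lambda>c d. \<Phi> (vmult A a c) (vmult B b d)) = \<Phi> n k * (\<phi> a * \<psi> b)"
        using ab by (simp add: elem_tensor_def n(3) k(3) lin n(1) k(1))
    qed
    also have "\<dots> = \<Phi> n k * t (\<lambda>a b. \<phi> a * \<psi> b)"
      by (rule tensor_form_scale[OF t product_form[OF \<phi>b \<psi>b]])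
    finally show ?thesis
      using True by (simp add: tensor_functional_eq[OF \<phi>b \<psi>b t] elem_tensor_def del: ptensor_simps)
  next
    case False
    then show ?thesis using tensor_outside[OF te] tensor_outside[OF e] by simp
  qed
  then show "vmult (A \<otimes>\<^sub>p B) t ?e = (\<lambda>z. tensor_functional A B \<phi> \<psi> t * ?e z)" by blast
qed

end

end

section \<open>Set functions and finite Radon measures\<close>

lemma ennreal_suminf_swap:
  fixes f :: "nat \<Rightarrow> nat \<Rightarrow> ennreal"
  shows "(\<Sum>n. \<Sum>k. f n k) = (\<Sum>k. \<Sum>n. f n k)"
proof -
  have "(\<integral>\<^sup>+n. (\<Sum>k. f n k) \<partial>count_space UNIV) = (\<Sum>k. \<integral>\<^sup>+n. f n k \<partial>count_space UNIV)"
    by (rule nn_integral_suminf) simp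
  then show ?thesis by (simp add: nn_integral_count_space_nat)
qed

lemma ennreal_norm_sums_le:
  fixes f :: "nat \<Rightarrow> 'a::real_normed_vector"
  assumes "f sums s"
  shows "ennreal (norm s) \<le> (\<Sum>k. ennreal (norm (f k)))"
proof -
  have lim: "(\<lambda>n. ennreal (norm (\<Sum>k<n. f k))) \<longlonglongrightarrow> ennreal (norm s)"
    using assms unfolding sums_def by (intro tendsto_ennrealI tendsto_norm)
  have "ennreal (norm (\<Sum>k<n. f k)) \<le> (\<Sum>k. ennreal (norm (f k)))" for n
  proof -
    have "ennreal (norm (\<Sum>k<n. f k)) \<le> (\<Sum>k<n. ennreal (norm (f k)))"
      by (simp add: norm_sum ennreal_leI)
    also have "\<dots> \<le> (\<Sum>k. ennreal (norm (f k)))" by (rule sum_le_suminf) auto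
    finally show ?thesis .
  qed
  then show ?thesis by (intro LIMSEQ_le_const2[OF lim]) auto
qed

lemma ennreal_sums_le:
  fixes f :: "nat \<Rightarrow> real"
  assumes "f sums s"
  shows "ennreal s \<le> (\<Sum>k. ennreal (f k))"
proof -
  have lim: "(\<lambda>n. ennreal (\<Sum>k<n. f k)) \<longlonglongrightarrow> ennreal s"
    using assms unfolding sums_def by (intro tendsto_ennrealI)
  have "ennreal (\<Sum>k<n. f k) \<le> (\<Sum>k. ennreal (f k))" for n
  proof -
    have "ennreal (\<Sum>k<n. f k) \<le> (\<Sum>k<n. ennreal (f k))"
    proof (induction n)
      case (Suc n)
      have "ennreal ((\<Sum>k<n. f k) + f n) \<le> ennreal (\<Sum>k<n. f k) + ennreal (f n)"
        by (auto simp: ennreal_plus_if intro!: ennreal_leI)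
      also have "\<dots> \<le> (\<Sum>k<n. ennreal (f k)) + ennreal (f n)" by (rule add_right_mono[OF Suc])
      finally show ?case by simp
    qed simp
    also have "\<dots> \<le> (\<Sum>k. ennreal (f k))" by (rule sum_le_suminf) auto
    finally show ?thesis .
  qed
  then show ?thesis by (intro LIMSEQ_le_const2[OF lim]) auto
qed

text \<open>
  Finite superadditivity makes the set function monotone and bounds the partial sums over a
  disjoint sequence by the value on the union; countable subadditivity is the other inequality.
  Positive parts, total variations, sums and convolutions of measures are all recognised as
  measures in this way.
\<close>

lemma borel_measure_of:
  fixes f :: "'g::topological_space set \<Rightarrow> ennreal"
  assumes empty: "f {} = 0"
    and super: "\<And>A B. A \<in> sets borel \<Longrightarrow> B \<in> sets borel \<Longrightarrow> A \<inter> B = {} \<Longrightarrow> f A + f B \<le> f (A \<union> B)"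
    and sub: "\<And>A :: nat \<Rightarrow> 'g set. range A \<subseteq> sets borel \<Longrightarrow> disjoint_family A \<Longrightarrow> f (\<Union>n. A n) \<le> (\<Sum>n. f (A n))"
  shows "sets (measure_of UNIV (sets borel) f) = sets borel"
    and "E \<in> sets borel \<Longrightarrow> emeasure (measure_of UNIV (sets borel) f) E = f E"
proof -
  have sa: "sigma_algebra UNIV (sets (borel :: 'g measure))"
    using sets.sigma_algebra_axioms[of "borel :: 'g measure"] by simp
  show "sets (measure_of UNIV (sets borel) f) = sets borel"
    using sigma_algebra.sets_measure_of_eq[OF sa] .
  have mono: "f A \<le> f B" if "A \<in> sets borel" "B \<in> sets borel" "A \<subseteq> B" for A B
  proof -
    have "f A \<le> f A + f (B - A)" by simp
    also have "\<dots> \<le> f (A \<union> (B - A))" using that by (intro super) auto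
    finally show ?thesis using that(3) by (simp add: Un_absorb1)
  qed
  have "countably_additive (sets borel) f"
    unfolding countably_additive_def
  proof (intro allI impI)
    fix A :: "nat \<Rightarrow> 'g set"
    assume A: "range A \<subseteq> sets borel" "disjoint_family A" "(\<Union>n. A n) \<in> sets borel"
    have "(\<Sum>k<n. f (A k)) \<le> f (\<Union>k<n. A k)" for n
    proof (induction n)
      case (Suc n)
      have "A k \<inter> A n = {}" if "k < n" for k
        using disjoint_family_onD[OF A(2), of k n] that by simp
      then have "(\<Union>k<n. A k) \<inter> A n = {}" by blast
      then have "f (\<Union>k<n. A k) + f (A n) \<le> f ((\<Union>k<n. A k) \<union> A n)"
        using A(1) by (intro super) auto
      moreover have "(\<Sum>k<Suc n. f (A k)) \<le> f (\<Union>k<n. A k) + f (A n)"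
        using Suc by (simp add: add_right_mono)
      ultimately have "(\<Sum>k<Suc n. f (A k)) \<le> f ((\<Union>k<n. A k) \<union> A n)" by order
      then show ?case by (simp add: lessThan_Suc Un_commute)
    qed (simp add: empty)
    also have "f (\<Union>k<n. A k) \<le> f (\<Union>k. A k)" for n
      using A by (intro mono) auto
    finally have "(\<Sum>k. f (A k)) \<le> f (\<Union>k. A k)"
      by (intro suminf_le_const) auto
    then show "(\<Sum>k. f (A k)) = f (\<Union> (range A))"
      using sub[OF A(1,2)] by (intro antisym) auto
  qed
  then show "E \<in> sets borel \<Longrightarrow> emeasure (measure_of UNIV (sets borel) f) E = f E"
    using emeasure_measure_of_sigma[OF sa, of f E] empty by (simp add: positive_def)
qed

definition finite_radon :: "'g::topological_space measure \<Rightarrow> bool" where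
  "finite_radon M \<longleftrightarrow> sets M = sets borel \<and> emeasure M UNIV < \<infinity> \<and>
     (\<forall>E\<in>sets borel. \<forall>e>0. \<exists>K U. compact K \<and> open U \<and> K \<subseteq> E \<and> E \<subseteq> U \<and> emeasure M (U - K) < ennreal e)"

lemma finite_radonD:
  fixes M :: "'g::topological_space measure"
  assumes "finite_radon M"
  shows "sets M = sets borel" "space M = UNIV" "finite_measure M"
    "E \<in> sets borel \<Longrightarrow> e > 0 \<Longrightarrow> \<exists>K U. compact K \<and> open U \<and> K \<subseteq> E \<and> E \<subseteq> U \<and> emeasure M (U - K) < ennreal e"
proof -
  show s: "sets M = sets borel" using assms by (simp add: finite_radon_def)
  show sp: "space M = UNIV" using sets_eq_imp_space_eq[OF s] by simp
  show "finite_measure M"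
    using assms sp by (intro finite_measureI) (auto simp: finite_radon_def)
  show "E \<in> sets borel \<Longrightarrow> e > 0 \<Longrightarrow> \<exists>K U. compact K \<and> open U \<and> K \<subseteq> E \<and> E \<subseteq> U \<and> emeasure M (U - K) < ennreal e"
    using assms by (simp add: finite_radon_def)
qed

lemma finite_radon_mono:
  assumes "finite_radon M" "sets N = sets borel" "\<And>E. E \<in> sets borel \<Longrightarrow> emeasure N E \<le> emeasure M E"
  shows "finite_radon (N :: 'g::t2_space measure)"
  unfolding finite_radon_def
proof (intro conjI ballI allI impI)
  show "emeasure N UNIV < \<infinity>" using assms(1) assms(3)[of UNIV] by (auto simp: finite_radon_def)
  fix E :: "'g set" and e :: real assume "E \<in> sets borel" "e > 0"
  from finite_radonD(4)[OF assms(1) this] obtain K U where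
    "compact K" "open U" "K \<subseteq> E" "E \<subseteq> U" "emeasure M (U - K) < ennreal e" by blast
  moreover have "U - K \<in> sets borel" using calculation by (auto intro: borel_compact)
  ultimately show "\<exists>K U. compact K \<and> open U \<and> K \<subseteq> E \<and> E \<subseteq> U \<and> emeasure N (U - K) < ennreal e"
    using assms(3)[of "U - K"] by (meson order.strict_trans1)
qed (use assms in auto)

text \<open>
  Inner regularity of open sets is enough. The sets that can be approximated from both sides
  form a \<open>\<sigma>\<close>-algebra: for a complement, the closed set coming from the outer
  approximation is intersected with a compact set that carries almost all of the mass; for a
  countable union, finitely many of the compact sets suffice up to a small error.
\<close>

lemma finite_radonI:
  fixes M :: "'g::t2_space measure"
  assumes s: "sets M = sets borel" and fin: "emeasure M UNIV < \<infinity>"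
    and inner: "\<And>U e. open U \<Longrightarrow> e > 0 \<Longrightarrow> \<exists>K. compact K \<and> K \<subseteq> U \<and> emeasure M (U - K) < ennreal e"
  shows "finite_radon M"
proof -
  have sp: "space M = UNIV" using sets_eq_imp_space_eq[OF s] by simp
  interpret finite_measure M by (rule finite_measureI) (use fin sp in auto)
  have tight: "\<exists>K. compact K \<and> emeasure M (- K) < ennreal e" if "e > 0" for e
    using inner[OF open_UNIV that] by (auto simp: Compl_eq_Diff_UNIV)
  have "\<forall>e>0. \<exists>K U. compact K \<and> open U \<and> K \<subseteq> E \<and> E \<subseteq> U \<and> emeasure M (U - K) < ennreal e"
    if "E \<in> sigma_sets UNIV {S :: 'g set. open S}" for E
    using that
  proof (induction E rule: sigma_sets.induct)
    case (Basic U)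
    then have U: "open U" by simp
    show ?case
    proof (intro allI impI)
      fix e :: real assume "e > 0"
      from inner[OF U this] obtain K where "compact K" "K \<subseteq> U" "emeasure M (U - K) < ennreal e" by blast
      with U show "\<exists>K V. compact K \<and> open V \<and> K \<subseteq> U \<and> U \<subseteq> V \<and> emeasure M (V - K) < ennreal e"
        by (intro exI[of _ K] exI[of _ U]) simp
    qed
  next
    case Empty
    then show ?case by (intro allI impI exI[of _ "{}"]) auto
  next
    case (Compl E)
    show ?case
    proof (intro allI impI)
      fix e :: real assume "e > 0"
      then have e2: "e/2 > 0" by simp
      obtain K U where KU: "compact K" "open U" "K \<subseteq> E" "E \<subseteq> U" "emeasure M (U - K) < ennreal (e/2)"
        using Compl.IH[rule_format, OF e2] by blast
      (* The complement of U is closed but perhaps not compact; its intersection with L is. *)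
      obtain L where L: "compact L" "emeasure M (- L) < ennreal (e/2)" using tight[OF e2] by blast
      have KLU: "K \<in> sets M" "L \<in> sets M" "U \<in> sets M"
        using KU(1,2) L(1) by (simp_all add: s borel_compact)
      have "- K - (L \<inter> - U) \<subseteq> (U - K) \<union> (- L)" by auto
      then have "emeasure M (- K - (L \<inter> - U)) \<le> emeasure M ((U - K) \<union> (- L))"
        using sets.compl_sets[OF KLU(2)] KLU by (intro emeasure_mono) (auto simp: sp Compl_eq_Diff_UNIV)
      also have "\<dots> \<le> emeasure M (U - K) + emeasure M (- L)"
        using sets.compl_sets[OF KLU(2)] KLU by (intro emeasure_subadditive) (auto simp: sp Compl_eq_Diff_UNIV)
      also have "\<dots> < ennreal (e/2) + ennreal (e/2)"
        by (rule add_strict_mono[OF KU(5) L(2)])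
      also have "\<dots> = ennreal e" using e2 by (simp flip: ennreal_plus)
      finally have "emeasure M (- K - (L \<inter> - U)) < ennreal e" .
      then show "\<exists>K U. compact K \<and> open U \<and> K \<subseteq> UNIV - E \<and> UNIV - E \<subseteq> U \<and> emeasure M (U - K) < ennreal e"
        using KU(3,4) compact_Int_closed[OF L(1) closed_Compl[OF KU(2)]]
          open_Compl[OF compact_imp_closed[OF KU(1)]]
        by - (rule exI[of _ "L \<inter> - U"], rule exI[of _ "- K"], auto)
    qed
  next
    case (Union A)
    show ?case
    proof (intro allI impI)
      fix e :: real assume e: "e > 0"
      have "\<exists>K U. compact K \<and> open U \<and> K \<subseteq> A n \<and> A n \<subseteq> U \<and> emeasure M (U - K) < ennreal (e/2 * (1/2) ^ Suc n)" for n
        using Union.IH[of n] e by simp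
      then obtain K U where KU: "\<And>n. compact (K n)" "\<And>n. open (U n)" "\<And>n. K n \<subseteq> A n" "\<And>n. A n \<subseteq> U n"
        "\<And>n. emeasure M (U n - K n) < ennreal (e/2 * (1/2) ^ Suc n)" by metis
      have Kb: "K n \<in> sets M" for n using KU(1) by (simp add: s borel_compact)
      have Ub: "U n \<in> sets M" for n using KU(2) by (simp add: s)
      have "emeasure M ((\<Union>n. U n) - (\<Union>n. K n)) \<le> emeasure M (\<Union>n. U n - K n)"
        by (rule emeasure_mono) (use Kb Ub in auto)
      also have "\<dots> \<le> (\<Sum>n. emeasure M (U n - K n))"
        by (rule emeasure_subadditive_countably) (use Kb Ub in auto)
      also have "\<dots> \<le> (\<Sum>n. ennreal (e/2 * (1/2) ^ Suc n))"
        by (intro suminf_le less_imp_le KU) auto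
      also have "\<dots> = ennreal (e/2)"
        using sums_mult[OF power_half_series, of "e/2"] e by (intro suminf_ennreal_eq) auto
      finally have 1: "emeasure M ((\<Union>n. U n) - (\<Union>n. K n)) \<le> ennreal (e/2)" .
      (* The union of all K n need not be compact; continuity from above of M allows to stop at a
         finite N. *)
      define D where "D N = (\<Union>n. K n) - (\<Union>n\<le>N. K n)" for N :: nat
      have "(\<lambda>N. emeasure M (D N)) \<longlonglongrightarrow> emeasure M (\<Inter>N. D N)"
        by (rule Lim_emeasure_decseq) (use Kb in \<open>auto simp: D_def decseq_def\<close>)
      moreover have "(\<Inter>N. D N) = {}" unfolding D_def by auto
      ultimately have "(\<lambda>N. emeasure M (D N)) \<longlonglongrightarrow> 0" by simp
      then have "\<forall>\<^sub>F N in sequentially. emeasure M (D N) < ennreal (e/2)"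
        by (rule order_tendstoD(2)) (use e in simp)
      then obtain N where N: "emeasure M (D N) < ennreal (e/2)"
        by (auto simp: eventually_sequentially)
      have "emeasure M ((\<Union>n. U n) - (\<Union>n\<le>N. K n)) \<le> emeasure M (((\<Union>n. U n) - (\<Union>n. K n)) \<union> D N)"
        by (rule emeasure_mono) (use Kb Ub in \<open>auto simp: D_def\<close>)
      also have "\<dots> \<le> emeasure M ((\<Union>n. U n) - (\<Union>n. K n)) + emeasure M (D N)"
        by (rule emeasure_subadditive) (use Kb Ub in \<open>auto simp: D_def\<close>)
      also have "\<dots> < ennreal (e/2) + ennreal (e/2)"
        using 1 N by (intro ennreal_add_left_cancel_less[THEN iffD2, THEN le_less_trans[rotated]] add_right_mono) auto
      also have "\<dots> = ennreal e" using e by (simp flip: ennreal_plus)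
      finally have "emeasure M ((\<Union>n. U n) - (\<Union>n\<le>N. K n)) < ennreal e" .
      moreover have "compact (\<Union>n\<le>N. K n)" using KU(1) by (intro compact_UN) auto
      ultimately show "\<exists>K U. compact K \<and> open U \<and> K \<subseteq> (\<Union>n. A n) \<and> (\<Union>n. A n) \<subseteq> U \<and> emeasure M (U - K) < ennreal e"
        using KU(2,3,4) by (intro exI[of _ "\<Union>n\<le>N. K n"] exI[of _ "\<Union>n. U n"]) (auto, fast+)
    qed
  qed
  then show ?thesis
    unfolding finite_radon_def using s fin by (auto simp: borel_def)
qed

definition sum_measure :: "(nat \<Rightarrow> 'g::topological_space measure) \<Rightarrow> 'g measure" where
  "sum_measure M = measure_of UNIV (sets borel) (\<lambda>E. \<Sum>n. emeasure (M n) E)"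

lemma sum_measure:
  fixes M :: "nat \<Rightarrow> 'g::topological_space measure"
  assumes "\<And>n. sets (M n) = sets borel"
  shows "sets (sum_measure M) = sets borel"
    and "E \<in> sets borel \<Longrightarrow> emeasure (sum_measure M) E = (\<Sum>n. emeasure (M n) E)"
proof -
  have super: "(\<Sum>n. emeasure (M n) A) + (\<Sum>n. emeasure (M n) B) \<le> (\<Sum>n. emeasure (M n) (A \<union> B))"
    if "A \<in> sets borel" "B \<in> sets borel" "A \<inter> B = {}" for A B
    using that by (subst suminf_add) (auto simp: plus_emeasure assms)
  have sub: "(\<Sum>n. emeasure (M n) (\<Union>k. A k)) \<le> (\<Sum>k. \<Sum>n. emeasure (M n) (A k))"
    if "range A \<subseteq> sets borel" "disjoint_family A" for A :: "nat \<Rightarrow> 'g set"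
    using that by (subst ennreal_suminf_swap) (simp add: suminf_emeasure assms)
  show "sets (sum_measure M) = sets borel"
    "E \<in> sets borel \<Longrightarrow> emeasure (sum_measure M) E = (\<Sum>n. emeasure (M n) E)"
    unfolding sum_measure_def using borel_measure_of[of "\<lambda>E. \<Sum>n. emeasure (M n) E"] super sub by auto
qed

text \<open>
  Up to a tail of total mass below \<open>e / 2\<close>, the sum involves only the first
  \<open>N\<close> measures, for which compact subsets of \<open>U\<close> are chosen separately
  and united.
\<close>

lemma sum_measure_radon:
  fixes M :: "nat \<Rightarrow> 'g::t2_space measure"
  assumes M: "\<And>n. finite_radon (M n)" and sm: "summable (\<lambda>n. measure (M n) UNIV)"
  shows "finite_radon (sum_measure M)" "measure (sum_measure M) UNIV = (\<Sum>n. measure (M n) UNIV)"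
proof -
  note s = finite_radonD(1)[OF M] and sp = finite_radonD(2)[OF M]
  note S = sum_measure[OF s]
  have em: "emeasure (M n) E = ennreal (measure (M n) E)" for n E
    using finite_measure.emeasure_eq_measure[OF finite_radonD(3)[OF M]] .
  have tot: "emeasure (sum_measure M) UNIV = ennreal (\<Sum>n. measure (M n) UNIV)"
    unfolding S(2)[of UNIV, simplified] em by (rule suminf_ennreal2[OF _ sm]) simp
  then show "measure (sum_measure M) UNIV = (\<Sum>n. measure (M n) UNIV)"
    using sm by (simp add: measure_def suminf_nonneg)
  show "finite_radon (sum_measure M)"
  proof (rule finite_radonI[OF S(1)])
    show "emeasure (sum_measure M) UNIV < \<infinity>" by (simp add: tot)
    fix U :: "'g set" and e :: real assume U: "open U" and e: "e > 0"
    have "(\<lambda>N. \<Sum>n. measure (M (n + N)) UNIV) \<longlonglongrightarrow> 0" by (rule suminf_exist_split2[OF sm])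
    then have "\<forall>\<^sub>F N in sequentially. (\<Sum>n. measure (M (n + N)) UNIV) < e/2"
      by (rule order_tendstoD(2)) (use e in simp)
    then obtain N where N: "(\<Sum>n. measure (M (n + N)) UNIV) < e/2" by (auto simp: eventually_sequentially)
    have "\<exists>K. compact K \<and> K \<subseteq> U \<and> emeasure (M n) (U - K) < ennreal (e / (2 * (real N + 1)))" for n
    proof -
      have "U \<in> sets borel" "e / (2 * (real N + 1)) > 0" using U e by (auto intro!: divide_pos_pos)
      from finite_radonD(4)[OF M[of n] this] obtain K V where KV: "compact K" "open V" "K \<subseteq> U" "U \<subseteq> V"
        "emeasure (M n) (V - K) < ennreal (e / (2 * (real N + 1)))" by blast
      have "emeasure (M n) (U - K) \<le> emeasure (M n) (V - K)"
        using KV by (intro emeasure_mono) (auto simp: s borel_compact)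
      then show ?thesis using KV by (intro exI[of _ K]) auto
    qed
    then obtain K where K: "\<And>n. compact (K n)" "\<And>n. K n \<subseteq> U"
      "\<And>n. emeasure (M n) (U - K n) < ennreal (e / (2 * (real N + 1)))" by metis
    define L where "L = (\<Union>n<N. K n)"
    have L: "compact L" unfolding L_def using K(1) by (intro compact_UN) auto
    have LU: "L \<subseteq> U" unfolding L_def using K(2) by auto
    have b: "U - L \<in> sets borel" using U L by (auto intro: borel_compact)
    have "(\<Sum>n<N. measure (M n) (U - L)) \<le> (\<Sum>n<N. e / (2 * (real N + 1)))"
    proof (rule sum_mono)
      fix n assume n: "n \<in> {..<N}"
      have "emeasure (M n) (U - L) \<le> emeasure (M n) (U - K n)"
        using n U K(1) by (intro emeasure_mono) (auto simp: L_def s borel_compact)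
      also note K(3)[of n]
      finally show "measure (M n) (U - L) \<le> e / (2 * (real N + 1))"
        using e by (simp add: em ennreal_less_iff)
    qed
    also have "\<dots> = e/2 * (real N / (real N + 1))" by simp
    also have "\<dots> \<le> e/2 * 1" using e by (intro mult_left_mono) auto
    finally have 1: "(\<Sum>n<N. measure (M n) (U - L)) \<le> e/2" by simp
    have le: "measure (M n) (U - L) \<le> measure (M n) UNIV" for n
      by (rule finite_measure.finite_measure_mono[OF finite_radonD(3)[OF M]]) (auto simp: s)
    have smL: "summable (\<lambda>n. measure (M n) (U - L))"
      by (rule summable_comparison_test'[OF sm, of 0]) (use le in auto)
    have "(\<Sum>n. measure (M (n + N)) (U - L)) \<le> (\<Sum>n. measure (M (n + N)) UNIV)"
      using le smL sm by (intro suminf_le) (auto simp: summable_iff_shift[of "\<lambda>n. measure (M n) _"])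
    with 1 N have "(\<Sum>n. measure (M n) (U - L)) < e"
      using suminf_split_initial_segment[OF smL, of N] by linarith
    moreover have "(\<Sum>n. ennreal (measure (M n) (U - L))) = ennreal (\<Sum>n. measure (M n) (U - L))"
      by (rule suminf_ennreal2[OF _ smL]) simp
    ultimately have "emeasure (sum_measure M) (U - L) < ennreal e"
      unfolding S(2)[OF b] em using e by (simp add: ennreal_lessI)
    then show "\<exists>K. compact K \<and> K \<subseteq> U \<and> emeasure (sum_measure M) (U - K) < ennreal e"
      using L LU by blast
  qed
qed

section \<open>Total variation\<close>

lemma complex_measureD:
  assumes "complex_measure \<mu>"
  shows "E \<notin> sets borel \<Longrightarrow> \<mu> E = 0"
    and "range A \<subseteq> sets borel \<Longrightarrow> disjoint_family A \<Longrightarrow> (\<lambda>n::nat. \<mu> (A n)) sums \<mu> (\<Union>n. A n)"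
    and "\<mu> {} = 0"
    and "A' \<in> sets borel \<Longrightarrow> B \<in> sets borel \<Longrightarrow> A' \<inter> B = {} \<Longrightarrow> \<mu> (A' \<union> B) = \<mu> A' + \<mu> B"
proof -
  show "E \<notin> sets borel \<Longrightarrow> \<mu> E = 0" using assms by (simp add: complex_measure_def)
  show ca: "(\<lambda>n. \<mu> (A n)) sums \<mu> (\<Union>n. A n)" if "range A \<subseteq> sets borel" "disjoint_family A"
    for A :: "nat \<Rightarrow> 'a set"
    using assms that by (simp add: complex_measure_def)
  have "(\<lambda>n::nat. \<mu> {}) sums \<mu> {}" using ca[of "\<lambda>_. {}"] by (simp add: disjoint_family_on_def)
  then show e: "\<mu> {} = 0" using sums_summable summable_const_iff by blast
  show "\<mu> (A \<union> B) = \<mu> A + \<mu> B" if "A \<in> sets borel" "B \<in> sets borel" "A \<inter> B = {}" for A B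
  proof -
    have "(\<lambda>n. \<mu> (binaryset A B n)) sums \<mu> (\<Union>n. binaryset A B n)"
      using that by (intro ca) (auto simp: binaryset_def disjoint_family_on_def)
    moreover have "(\<Union>n. binaryset A B n) = A \<union> B" by (rule UN_binaryset_eq)
    ultimately show ?thesis using binaryset_sums[of \<mu> A B, OF e] sums_unique2 by metis
  qed
qed

text \<open>
  A finite disjoint family inside \<open>E\<close> becomes a partition of \<open>E\<close> after
  deletion of empty members and addition of the remainder.
\<close>

lemma total_variation_family:
  assumes \<mu>: "\<mu> {} = 0" and I: "finite I" "disjoint_family_on A I"
    and A: "\<And>i. i \<in> I \<Longrightarrow> A i \<in> sets borel" "\<And>i. i \<in> I \<Longrightarrow> A i \<subseteq> E" and E: "E \<in> sets borel"
  shows "(\<Sum>i\<in>I. ennreal (cmod (\<mu> (A i)))) \<le> total_variation \<mu> E"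
proof -
  define J where "J = {i \<in> I. A i \<noteq> {}}"
  define R where "R = E - (\<Union>i\<in>I. A i)"
  define Q where "Q = A ` J \<union> ({R} - {{}})"
  have inj: "inj_on A J"
    using I(2) by (auto simp: inj_on_def J_def disjoint_family_on_def)
  have "(\<Sum>i\<in>I. ennreal (cmod (\<mu> (A i)))) = (\<Sum>i\<in>J. ennreal (cmod (\<mu> (A i))))"
    using I(1) by (intro sum.mono_neutral_right) (auto simp: J_def \<mu>)
  also have "\<dots> = (\<Sum>F\<in>A ` J. ennreal (cmod (\<mu> F)))" by (simp add: sum.reindex[OF inj])
  also have "\<dots> \<le> (\<Sum>F\<in>Q. ennreal (cmod (\<mu> F)))"
    using I(1) by (intro sum_mono2) (auto simp: Q_def J_def)
  also have "\<dots> \<le> total_variation \<mu> E"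
    unfolding total_variation_def
  proof (rule SUP_upper, intro CollectI conjI)
    show "finite Q" using I(1) by (auto simp: Q_def J_def)
    have "R \<in> sets borel" unfolding R_def using I(1) A E by (intro sets.Diff sets.finite_UN) auto
    then show "Q \<subseteq> sets borel" using A(1) by (auto simp: Q_def J_def)
    show "partition_on E Q"
    proof (rule partition_onI)
      have "\<Union>Q = (\<Union>i\<in>I. A i) \<union> R" unfolding Q_def J_def by auto
      then show "\<Union>Q = E" using A(2) unfolding R_def by blast
      show "{} \<notin> Q" by (auto simp: Q_def J_def)
      have dA: "disjnt (A i) (A j)" if "i \<in> I" "j \<in> I" "A i \<noteq> A j" for i j
        using disjoint_family_onD[OF I(2) that(1,2)] that(3) by (auto simp: disjnt_def)
      have dR: "disjnt (A i) R" "disjnt R (A i)" if "i \<in> I" for i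
        using that by (auto simp: R_def disjnt_def)
      show "disjnt p q" if pq: "p \<in> Q" "q \<in> Q" "p \<noteq> q" for p q
      proof -
        consider i j where "i \<in> I" "p = A i" "j \<in> I" "q = A j" | i where "i \<in> I" "p = A i" "q = R"
          | i where "i \<in> I" "q = A i" "p = R"
          using pq unfolding Q_def J_def by blast
        then show ?thesis using dA dR pq(3) by cases auto
      qed
    qed
  qed
  finally show ?thesis .
qed

lemma total_variation_ge: "\<mu> {} = 0 \<Longrightarrow> E \<in> sets borel \<Longrightarrow> F \<in> sets borel \<Longrightarrow> F \<subseteq> E \<Longrightarrow>
    ennreal (cmod (\<mu> F)) \<le> total_variation \<mu> E"
  using total_variation_family[of \<mu> "{()}" "\<lambda>_. F" E] by (simp add: disjoint_family_on_def)

lemma total_variation_le: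
  assumes "\<And>P. finite P \<Longrightarrow> P \<subseteq> sets borel \<Longrightarrow> partition_on E P \<Longrightarrow> (\<Sum>F\<in>P. ennreal (cmod (\<mu> F))) \<le> b"
  shows "total_variation \<mu> E \<le> b"
  unfolding total_variation_def using assms by (intro SUP_least) auto

definition variation_measure :: "('g::topological_space set \<Rightarrow> complex) \<Rightarrow> 'g measure" where
  "variation_measure \<mu> = measure_of UNIV (sets borel) (total_variation \<mu>)"

text \<open>
  Superadditivity: partitions of two disjoint sets unite to a partition of the union.
  Subadditivity: a partition of a union of sets \<open>A k\<close> is cut into partitions of the
  \<open>A k\<close>.
\<close>

lemma variation_measure:
  assumes \<mu>: "complex_measure (\<mu> :: 'g::topological_space set \<Rightarrow> complex)"
  shows "sets (variation_measure \<mu>) = sets borel"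
    and "E \<in> sets borel \<Longrightarrow> emeasure (variation_measure \<mu>) E = total_variation \<mu> E"
proof -
  note c = complex_measureD[OF \<mu>]
  have empty: "total_variation \<mu> {} = 0"
    unfolding total_variation_def by (rule antisym) (auto simp: partition_on_empty intro!: SUP_least)
  have super: "total_variation \<mu> A + total_variation \<mu> B \<le> total_variation \<mu> (A \<union> B)"
    if AB: "A \<in> sets borel" "B \<in> sets borel" "A \<inter> B = {}" for A B
  proof -
    have ne: "{P. finite P \<and> P \<subseteq> sets borel \<and> partition_on E P} \<noteq> {}" if "E \<in> sets borel" for E :: "'g set"
    proof (cases "E = {}")
      case True
      then have "{} \<in> {P. finite P \<and> P \<subseteq> sets borel \<and> partition_on E P}"
        by (simp add: partition_on_empty)
      then show ?thesis by blast
    next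
      case False
      then have "{E} \<in> {P. finite P \<and> P \<subseteq> sets borel \<and> partition_on E P}"
        using that by (simp add: partition_on_space)
      then show ?thesis by blast
    qed
    have *: "(\<Sum>F\<in>P. ennreal (cmod (\<mu> F))) + (\<Sum>F\<in>Q. ennreal (cmod (\<mu> F))) \<le> total_variation \<mu> (A \<union> B)"
      if P: "finite P" "P \<subseteq> sets borel" "partition_on A P" and Q: "finite Q" "Q \<subseteq> sets borel" "partition_on B Q"
      for P Q
    proof -
      have PQ: "P \<inter> Q = {}"
      proof -
        have "X = {}" if "X \<in> P" "X \<in> Q" for X
          using partition_onD1[OF P(3)] partition_onD1[OF Q(3)] that AB(3) by blast
        then show ?thesis using partition_onD3[OF P(3)] by blast
      qed
      have "(\<Sum>F\<in>P. ennreal (cmod (\<mu> F))) + (\<Sum>F\<in>Q. ennreal (cmod (\<mu> F))) = (\<Sum>F\<in>P \<union> Q. ennreal (cmod (\<mu> F)))"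
        by (rule sum.union_disjoint[OF P(1) Q(1) PQ, symmetric])
      also have "\<dots> \<le> total_variation \<mu> (A \<union> B)"
      proof (rule total_variation_family[of \<mu> "P \<union> Q" "\<lambda>F. F", OF c(3)])
        show "disjoint_family_on (\<lambda>F. F) (P \<union> Q)"
          unfolding disjoint_family_on_def
        proof (intro ballI impI)
          fix F H assume FH: "F \<in> P \<union> Q" "H \<in> P \<union> Q" "F \<noteq> H"
          have sub: "X \<subseteq> A" if "X \<in> P" for X using partition_onD1[OF P(3)] that by blast
          have sub': "X \<subseteq> B" if "X \<in> Q" for X using partition_onD1[OF Q(3)] that by blast
          consider "F \<in> P" "H \<in> P" | "F \<in> Q" "H \<in> Q" | "F \<in> P" "H \<in> Q" | "F \<in> Q" "H \<in> P"
            using FH by blast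
          then show "F \<inter> H = {}"
          proof cases
            case 1
            then show ?thesis using disjointD[OF partition_onD2[OF P(3)]] FH(3) by blast
          next
            case 2
            then show ?thesis using disjointD[OF partition_onD2[OF Q(3)]] FH(3) by blast
          next
            case 3
            then show ?thesis using sub[of F] sub'[of H] AB(3) by blast
          next
            case 4
            then show ?thesis using sub[of H] sub'[of F] AB(3) by blast
          qed
        qed
      qed (use P Q AB partition_onD1[OF P(3)] partition_onD1[OF Q(3)] in auto)
      finally show ?thesis .
    qed
    have "(\<Sum>F\<in>P. ennreal (cmod (\<mu> F))) + total_variation \<mu> B \<le> total_variation \<mu> (A \<union> B)"
      if P: "finite P" "P \<subseteq> sets borel" "partition_on A P" for P
    proof -
      have "total_variation \<mu> B + (\<Sum>F\<in>P. ennreal (cmod (\<mu> F))) =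
          (SUP Q \<in> {Q. finite Q \<and> Q \<subseteq> sets borel \<and> partition_on B Q}.
            (\<Sum>F\<in>Q. ennreal (cmod (\<mu> F))) + (\<Sum>F\<in>P. ennreal (cmod (\<mu> F))))"
        unfolding total_variation_def[of \<mu> B] by (rule ennreal_SUP_add_left[OF ne[OF AB(2)], symmetric])
      also have "\<dots> \<le> total_variation \<mu> (A \<union> B)"
        by (rule SUP_least) (use *[OF P] in \<open>auto simp: add.commute\<close>)
      finally show ?thesis by (simp add: add.commute)
    qed
    then show ?thesis
      unfolding total_variation_def[of \<mu> A]
      by (subst ennreal_SUP_add_left[OF ne[OF AB(1)], symmetric]) (auto intro!: SUP_least)
  qed
  have sub: "total_variation \<mu> (\<Union>n. A n) \<le> (\<Sum>n. total_variation \<mu> (A n))"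
    if A: "range A \<subseteq> sets borel" "disjoint_family A" for A :: "nat \<Rightarrow> 'g set"
  proof (rule total_variation_le)
    fix P assume P: "finite P" "P \<subseteq> sets borel" "partition_on (\<Union>n. A n) P"
    have "ennreal (cmod (\<mu> F)) \<le> (\<Sum>k. ennreal (cmod (\<mu> (F \<inter> A k))))" if F: "F \<in> P" for F
    proof (rule ennreal_norm_sums_le)
      have "F = (\<Union>k. F \<inter> A k)" using partition_onD1[OF P(3)] F by auto
      moreover have "(\<lambda>k. \<mu> (F \<inter> A k)) sums \<mu> (\<Union>k. F \<inter> A k)"
        using A P(2) F by (intro c(2)) (auto simp: disjoint_family_on_def)
      ultimately show "(\<lambda>k. \<mu> (F \<inter> A k)) sums \<mu> F" by simp
    qed
    then have "(\<Sum>F\<in>P. ennreal (cmod (\<mu> F))) \<le> (\<Sum>F\<in>P. \<Sum>k. ennreal (cmod (\<mu> (F \<inter> A k))))"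
      by (rule sum_mono)
    also have "\<dots> = (\<Sum>k. \<Sum>F\<in>P. ennreal (cmod (\<mu> (F \<inter> A k))))"
      by (rule suminf_sum[symmetric]) auto
    also have "\<dots> \<le> (\<Sum>k. total_variation \<mu> (A k))"
    proof (intro suminf_le)
      fix k
      show "(\<Sum>F\<in>P. ennreal (cmod (\<mu> (F \<inter> A k)))) \<le> total_variation \<mu> (A k)"
      proof (rule total_variation_family[of \<mu> P "\<lambda>F. F \<inter> A k", OF c(3) P(1)])
        show "disjoint_family_on (\<lambda>F. F \<inter> A k) P"
          using disjointD[OF partition_onD2[OF P(3)]] unfolding disjoint_family_on_def by blast
      qed (use P(2) A(1) in auto)
    qed auto
    finally show "(\<Sum>F\<in>P. ennreal (cmod (\<mu> F))) \<le> (\<Sum>n. total_variation \<mu> (A n))" .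
  qed
  show "sets (variation_measure \<mu>) = sets borel"
    "E \<in> sets borel \<Longrightarrow> emeasure (variation_measure \<mu>) E = total_variation \<mu> E"
    unfolding variation_measure_def
    using borel_measure_of[where f = "total_variation \<mu>", OF empty super sub] by - assumption+
qed

lemma regularD:
  fixes \<mu> :: "'g::t2_space set \<Rightarrow> complex"
  assumes "regular_complex_measure \<mu>"
  shows "complex_measure \<mu>" "finite_radon (variation_measure \<mu>)"
    "ennreal (cmod (\<mu> E)) \<le> emeasure (variation_measure \<mu>) E"
    "cmod (\<mu> E) \<le> measure (variation_measure \<mu>) E"
    "enn2real (total_variation \<mu> UNIV) = measure (variation_measure \<mu>) UNIV"
proof -
  show c: "complex_measure \<mu>" using assms by (simp add: regular_complex_measure_def)
  note v = variation_measure[OF c]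
  show r: "finite_radon (variation_measure \<mu>)"
    unfolding finite_radon_def
  proof (intro conjI ballI allI impI)
    show "emeasure (variation_measure \<mu>) UNIV < \<infinity>"
      using assms v(2)[of UNIV] by (simp add: regular_complex_measure_def)
    fix E :: "'g set" and e :: real assume "E \<in> sets borel" "e > 0"
    moreover have "\<forall>E\<in>sets borel. \<forall>e>0. \<exists>K U. compact K \<and> open U \<and> K \<subseteq> E \<and> E \<subseteq> U \<and>
        total_variation \<mu> (U - K) < ennreal e"
      using assms by (simp add: regular_complex_measure_def)
    ultimately obtain K U where KU: "compact K" "open U" "K \<subseteq> E" "E \<subseteq> U" "total_variation \<mu> (U - K) < ennreal e"
      by metis
    moreover have "U - K \<in> sets borel" using KU by (auto intro: borel_compact)
    ultimately show "\<exists>K U. compact K \<and> open U \<and> K \<subseteq> E \<and> E \<subseteq> U \<and> emeasure (variation_measure \<mu>) (U - K) < ennreal e"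
      using v(2) by (intro exI[of _ K] exI[of _ U]) auto
  qed (rule v(1))
  show *: "ennreal (cmod (\<mu> E)) \<le> emeasure (variation_measure \<mu>) E"
    using total_variation_ge[of \<mu> E E] complex_measureD(1,3)[OF c] v(2)[of E]
    by (cases "E \<in> sets borel") auto
  show "cmod (\<mu> E) \<le> measure (variation_measure \<mu>) E"
    using * finite_measure.emeasure_eq_measure[OF finite_radonD(3)[OF r]] by simp
  show "enn2real (total_variation \<mu> UNIV) = measure (variation_measure \<mu>) UNIV"
    by (simp add: measure_def v(2))
qed

text \<open>
  The criterion by which multiples, series, point masses and convolutions of regular measures
  are seen to be regular: domination by a finite Radon measure upgrades finite to countable
  additivity, transfers regularity, and bounds the norm.
\<close>

lemma regularI:
  fixes \<mu> :: "'g::t2_space set \<Rightarrow> complex"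
  assumes out: "\<And>E. E \<notin> sets borel \<Longrightarrow> \<mu> E = 0"
    and add: "\<And>A B. A \<in> sets borel \<Longrightarrow> B \<in> sets borel \<Longrightarrow> A \<inter> B = {} \<Longrightarrow> \<mu> (A \<union> B) = \<mu> A + \<mu> B"
    and M: "finite_radon M" and C: "C \<ge> 0" "\<And>E. E \<in> sets borel \<Longrightarrow> cmod (\<mu> E) \<le> C * measure M E"
  shows "regular_complex_measure \<mu>" "enn2real (total_variation \<mu> UNIV) \<le> C * measure M UNIV"
proof -
  interpret M: finite_measure M by (rule finite_radonD(3)[OF M])
  note s = finite_radonD(1)[OF M]
  have e: "\<mu> {} = 0" using C(2)[of "{}"] by simp
  have ca: "(\<lambda>n. \<mu> (A n)) sums \<mu> (\<Union>n. A n)" if A: "range A \<subseteq> sets borel" "disjoint_family A"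
    for A :: "nat \<Rightarrow> 'g set"
  proof -
    have Ab: "A n \<in> sets borel" for n using A by auto
    have fin: "(\<Sum>k<n. \<mu> (A k)) = \<mu> (\<Union>k<n. A k)" for n
    proof (induction n)
      case (Suc n)
      have "A k \<inter> A n = {}" if "k < n" for k
        using disjoint_family_onD[OF A(2), of k n] that by simp
      then have "(\<Union>k<n. A k) \<inter> A n = {}" by blast
      then have "\<mu> ((\<Union>k<n. A k) \<union> A n) = \<mu> (\<Union>k<n. A k) + \<mu> (A n)"
        using Ab by (intro add) auto
      then show ?case using Suc by (simp add: lessThan_Suc Un_commute)
    qed (simp add: e)
    define D where "D n = (\<Union>k. A k) - (\<Union>k<n. A k)" for n
    have D: "D n \<in> sets borel" for n unfolding D_def using Ab by auto
    have dec: "\<mu> (\<Union>k. A k) = (\<Sum>k<n. \<mu> (A k)) + \<mu> (D n)" for n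
    proof -
      have "(\<Union>k<n. A k) \<union> D n = (\<Union>k. A k)" by (auto simp: D_def)
      then show ?thesis
        using add[of "\<Union>k<n. A k" "D n"] Ab D[of n] by (auto simp: fin D_def)
    qed
    have "(\<lambda>n. measure M (D n)) \<longlonglongrightarrow> measure M (\<Inter>n. D n)"
      by (rule M.finite_Lim_measure_decseq) (use D in \<open>auto simp: s D_def decseq_def\<close>)
    moreover have "(\<Inter>n. D n) = {}" unfolding D_def by auto
    ultimately have "(\<lambda>n. C * measure M (D n)) \<longlonglongrightarrow> C * 0" by (intro tendsto_mult tendsto_const) simp
    then have "(\<lambda>n. C * measure M (D n)) \<longlonglongrightarrow> 0" by simp
    then have "(\<lambda>n. \<mu> (D n)) \<longlonglongrightarrow> 0"
      by (rule Lim_null_comparison[rotated]) (use C(2)[OF D] in auto)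
    then have "(\<lambda>n. \<mu> (\<Union>k. A k) - \<mu> (D n)) \<longlonglongrightarrow> \<mu> (\<Union>k. A k) - 0" by (intro tendsto_intros)
    moreover have "(\<lambda>n. \<mu> (\<Union>k. A k) - \<mu> (D n)) = (\<lambda>n. \<Sum>k<n. \<mu> (A k))"
      using dec by (auto simp: fun_eq_iff algebra_simps)
    ultimately show ?thesis by (simp add: sums_def)
  qed
  have c: "complex_measure \<mu>" unfolding complex_measure_def using out ca by blast
  have tv: "total_variation \<mu> E \<le> ennreal (C * measure M E)" if E: "E \<in> sets borel" for E
  proof (rule total_variation_le)
    fix P assume P: "finite P" "P \<subseteq> sets borel" "partition_on E P"
    have "(\<Sum>F\<in>P. ennreal (cmod (\<mu> F))) \<le> (\<Sum>F\<in>P. ennreal (C * measure M F))"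
      using P C(2) by (intro sum_mono ennreal_leI) auto
    also have "\<dots> = ennreal (C * (\<Sum>F\<in>P. measure M F))"
      using C(1) by (simp add: sum_distrib_left)
    also have "(\<Sum>F\<in>P. measure M F) = measure M (\<Union>F\<in>P. F)"
      using P(2) partition_onD2[OF P(3)]
      by (intro M.finite_measure_finite_Union[symmetric] P(1)) (auto simp: s disjoint_def disjoint_family_on_def)
    also have "(\<Union>F\<in>P. F) = E" using partition_onD1[OF P(3)] by simp
    finally show "(\<Sum>F\<in>P. ennreal (cmod (\<mu> F))) \<le> ennreal (C * measure M E)" .
  qed
  show "regular_complex_measure \<mu>"
    unfolding regular_complex_measure_def
  proof (intro conjI ballI allI impI)
    show "total_variation \<mu> UNIV < \<infinity>" using tv[of UNIV] by (auto intro: le_less_trans)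
    fix E :: "'g set" and d :: real assume E: "E \<in> sets borel" "d > 0"
    then have "d / (C + 1) > 0" using C(1) by simp
    from finite_radonD(4)[OF M E(1) this] obtain K U where KU: "compact K" "open U" "K \<subseteq> E" "E \<subseteq> U"
      "emeasure M (U - K) < ennreal (d / (C + 1))" by blast
    have b: "U - K \<in> sets borel" using KU by (auto intro: borel_compact)
    have "measure M (U - K) < d / (C + 1)" using KU(5) by (simp add: M.emeasure_eq_measure ennreal_less_iff)
    then have "measure M (U - K) * (C + 1) < d" using C(1) by (simp add: pos_less_divide_eq)
    moreover have "C * measure M (U - K) \<le> measure M (U - K) * (C + 1)" by (simp add: algebra_simps)
    ultimately have "C * measure M (U - K) < d" by linarith
    then have "total_variation \<mu> (U - K) < ennreal d"
      using tv[OF b] C(1) by (intro le_less_trans[OF tv[OF b]]) (simp add: ennreal_less_iff)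
    then show "\<exists>K U. compact K \<and> open U \<and> K \<subseteq> E \<and> E \<subseteq> U \<and> total_variation \<mu> (U - K) < ennreal d"
      using KU by blast
  qed (rule c)
  show "enn2real (total_variation \<mu> UNIV) \<le> C * measure M UNIV"
    using tv[of UNIV] C(1) by (auto intro!: enn2real_leI)
qed

section \<open>Integration against a complex measure\<close>

text \<open>
  Superadditivity: subsets of two disjoint sets unite to a subset of the union. If one of the
  values is negative, it counts as 0 in the supremum, and the other set alone will do.
\<close>

lemma positive_part:
  fixes \<nu> :: "'g::topological_space set \<Rightarrow> real"
  assumes ca: "\<And>A :: nat \<Rightarrow> 'g set. range A \<subseteq> sets borel \<Longrightarrow> disjoint_family A \<Longrightarrow>
      (\<lambda>n. \<nu> (A n)) sums \<nu> (\<Union>n. A n)"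
    and add: "\<And>A B. A \<in> sets borel \<Longrightarrow> B \<in> sets borel \<Longrightarrow> A \<inter> B = {} \<Longrightarrow> \<nu> (A \<union> B) = \<nu> A + \<nu> B"
    and empty: "\<nu> {} = 0"
  shows "sets (positive_part \<nu>) = sets borel"
    and "E \<in> sets borel \<Longrightarrow> emeasure (positive_part \<nu>) E = (SUP F \<in> {F \<in> sets borel. F \<subseteq> E}. ennreal (\<nu> F))"
proof -
  define p where "p E = (SUP F \<in> {F \<in> sets borel. F \<subseteq> E}. ennreal (\<nu> F))" for E
  have upper: "ennreal (\<nu> F) \<le> p E" if "F \<in> sets borel" "F \<subseteq> E" for E F
    unfolding p_def using that by (intro SUP_upper) auto
  have p0: "p {} = 0"
  proof -
    have "{F \<in> sets borel. F \<subseteq> {}} = {{} :: 'g set}" by auto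
    then show ?thesis by (simp add: p_def empty)
  qed
  have super: "p A + p B \<le> p (A \<union> B)" if AB: "A \<in> sets borel" "B \<in> sets borel" "A \<inter> B = {}" for A B
  proof -
    have "{} \<in> {F \<in> sets borel. F \<subseteq> E}" for E :: "'g set" by simp
    then have ne: "{F \<in> sets borel. F \<subseteq> E} \<noteq> {}" for E :: "'g set" by blast
    have *: "ennreal (\<nu> F) + ennreal (\<nu> H) \<le> p (A \<union> B)"
      if F: "F \<in> sets borel" "F \<subseteq> A" and H: "H \<in> sets borel" "H \<subseteq> B" for F H
    proof -
      have "F \<inter> H = {}" using F(2) H(2) AB(3) by blast
      then have "\<nu> (F \<union> H) = \<nu> F + \<nu> H" by (rule add[OF F(1) H(1)])
      moreover have "ennreal (\<nu> (F \<union> H)) \<le> p (A \<union> B)"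
        by (rule upper[OF sets.Un[OF F(1) H(1)] Un_mono[OF F(2) H(2)]])
      moreover have "ennreal (\<nu> F) \<le> p (A \<union> B)" by (rule upper[OF F(1)]) (use F(2) in blast)
      moreover have "ennreal (\<nu> H) \<le> p (A \<union> B)" by (rule upper[OF H(1)]) (use H(2) in blast)
      ultimately show ?thesis
        by (cases "0 \<le> \<nu> F"; cases "0 \<le> \<nu> H") (simp_all add: ennreal_neg)
    qed
    have "ennreal (\<nu> F) + p B \<le> p (A \<union> B)" if F: "F \<in> sets borel" "F \<subseteq> A" for F
    proof -
      have "p B + ennreal (\<nu> F) = (SUP H \<in> {H \<in> sets borel. H \<subseteq> B}. ennreal (\<nu> H) + ennreal (\<nu> F))"
        unfolding p_def[of B] by (rule ennreal_SUP_add_left[OF ne, symmetric])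
      also have "\<dots> \<le> p (A \<union> B)"
        by (rule SUP_least) (use *[OF F] in \<open>auto simp: add.commute\<close>)
      finally show ?thesis by (simp add: add.commute)
    qed
    then show ?thesis
      unfolding p_def[of A] by (subst ennreal_SUP_add_left[OF ne, symmetric]) (auto intro!: SUP_least)
  qed
  have sub: "p (\<Union>n. A n) \<le> (\<Sum>n. p (A n))"
    if A: "range A \<subseteq> sets borel" "disjoint_family A" for A :: "nat \<Rightarrow> 'g set"
    unfolding p_def[of "\<Union>n. A n"]
  proof (rule SUP_least)
    fix F assume F: "F \<in> {F \<in> sets borel. F \<subseteq> (\<Union>n. A n)}"
    then have "F = (\<Union>k. F \<inter> A k)" by auto
    moreover have "(\<lambda>k. \<nu> (F \<inter> A k)) sums \<nu> (\<Union>k. F \<inter> A k)"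
      using A F by (intro ca) (auto simp: disjoint_family_on_def)
    ultimately have "(\<lambda>k. \<nu> (F \<inter> A k)) sums \<nu> F" by simp
    from ennreal_sums_le[OF this] have "ennreal (\<nu> F) \<le> (\<Sum>k. ennreal (\<nu> (F \<inter> A k)))" .
    also have "\<dots> \<le> (\<Sum>k. p (A k))"
      using A F by (intro suminf_le upper) auto
    finally show "ennreal (\<nu> F) \<le> (\<Sum>k. p (A k))" .
  qed
  show "sets (positive_part \<nu>) = sets borel"
    "E \<in> sets borel \<Longrightarrow> emeasure (positive_part \<nu>) E = (SUP F \<in> {F \<in> sets borel. F \<subseteq> E}. ennreal (\<nu> F))"
    unfolding positive_part_def
    using borel_measure_of[where f = p, OF p0 super sub] unfolding p_def[abs_def] by - assumption+
qed

text \<open>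
  For the real and the imaginary part of a regular complex measure, \<open>M\<close> is the variation measure. The
  domination makes the positive parts finite and regular.
\<close>

definition dominated :: "('g::topological_space set \<Rightarrow> real) \<Rightarrow> 'g measure \<Rightarrow> bool" where
  "dominated \<nu> M \<longleftrightarrow> finite_radon M \<and> (\<forall>E\<in>sets borel. \<bar>\<nu> E\<bar> \<le> measure M E) \<and>
     (\<forall>A :: nat \<Rightarrow> 'g set. range A \<subseteq> sets borel \<longrightarrow> disjoint_family A \<longrightarrow> (\<lambda>n. \<nu> (A n)) sums \<nu> (\<Union>n. A n)) \<and>
     (\<forall>A B. A \<in> sets borel \<longrightarrow> B \<in> sets borel \<longrightarrow> A \<inter> B = {} \<longrightarrow> \<nu> (A \<union> B) = \<nu> A + \<nu> B)"

lemma dominated_uminus: "dominated \<nu> M \<Longrightarrow> dominated (\<lambda>E. - \<nu> E) M"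
  unfolding dominated_def by (auto intro: sums_minus)

lemma positive_part_dominated:
  fixes \<nu> :: "'g::t2_space set \<Rightarrow> real"
  assumes d: "dominated \<nu> M"
  shows "finite_radon (positive_part \<nu>)"
    and "E \<in> sets borel \<Longrightarrow> emeasure (positive_part \<nu>) E \<le> emeasure M E"
    and "E \<in> sets borel \<Longrightarrow> F \<in> sets borel \<Longrightarrow> F \<subseteq> E \<Longrightarrow> \<nu> F \<le> measure (positive_part \<nu>) E"
    and "E \<in> sets borel \<Longrightarrow> 0 \<le> b \<Longrightarrow> (\<And>F. F \<in> sets borel \<Longrightarrow> F \<subseteq> E \<Longrightarrow> \<nu> F \<le> b) \<Longrightarrow>
      measure (positive_part \<nu>) E \<le> b"
proof -
  have M: "finite_radon M" and le: "\<And>E. E \<in> sets borel \<Longrightarrow> \<bar>\<nu> E\<bar> \<le> measure M E"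
    and ca: "\<And>A :: nat \<Rightarrow> 'g set. range A \<subseteq> sets borel \<Longrightarrow> disjoint_family A \<Longrightarrow>
      (\<lambda>n. \<nu> (A n)) sums \<nu> (\<Union>n. A n)"
    and add: "\<And>A B. A \<in> sets borel \<Longrightarrow> B \<in> sets borel \<Longrightarrow> A \<inter> B = {} \<Longrightarrow> \<nu> (A \<union> B) = \<nu> A + \<nu> B"
    using d by (auto simp: dominated_def)
  have empty: "\<nu> {} = 0" using le[of "{}"] by simp
  interpret M: finite_measure M by (rule finite_radonD(3)[OF M])
  have p: "sets (positive_part \<nu>) = sets borel"
    "\<And>E. E \<in> sets borel \<Longrightarrow> emeasure (positive_part \<nu>) E = (SUP F \<in> {F \<in> sets borel. F \<subseteq> E}. ennreal (\<nu> F))"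
    by (rule positive_part(1); rule ca add empty; assumption)
       (rule positive_part(2); (rule ca add empty)?; assumption)
  show lem: "emeasure (positive_part \<nu>) E \<le> emeasure M E" if E: "E \<in> sets borel" for E
    unfolding p(2)[OF E]
  proof (rule SUP_least)
    fix F assume F: "F \<in> {F \<in> sets borel. F \<subseteq> E}"
    have "\<nu> F \<le> measure M F" using le[of F] F by auto
    then have "ennreal (\<nu> F) \<le> emeasure M F" by (simp add: M.emeasure_eq_measure ennreal_leI)
    also have "\<dots> \<le> emeasure M E" using F E by (intro emeasure_mono) (auto simp: finite_radonD(1)[OF M])
    finally show "ennreal (\<nu> F) \<le> emeasure M E" .
  qed
  show r: "finite_radon (positive_part \<nu>)"
    by (rule finite_radon_mono[OF M p(1) lem])
  interpret P: finite_measure "positive_part \<nu>" by (rule finite_radonD(3)[OF r])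
  show "\<nu> F \<le> measure (positive_part \<nu>) E" if "E \<in> sets borel" "F \<in> sets borel" "F \<subseteq> E" for E F
  proof -
    have "ennreal (\<nu> F) \<le> ennreal (measure (positive_part \<nu>) E)"
      unfolding P.emeasure_eq_measure[symmetric] p(2)[OF that(1)] using that by (intro SUP_upper) auto
    then show ?thesis by simp
  qed
  show "measure (positive_part \<nu>) E \<le> b"
    if "E \<in> sets borel" "0 \<le> b" "\<And>F. F \<in> sets borel \<Longrightarrow> F \<subseteq> E \<Longrightarrow> \<nu> F \<le> b" for E b
  proof -
    have "ennreal (measure (positive_part \<nu>) E) \<le> ennreal b"
      unfolding P.emeasure_eq_measure[symmetric] p(2)[OF that(1)]
      by (rule SUP_least) (use that(3) in \<open>auto intro: ennreal_leI\<close>)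
    then show ?thesis using that(2) by simp
  qed
qed

text \<open>
  Both inequalities follow from \<open>\<nu> E = \<nu> F + \<nu> (E - F)\<close> by taking the
  supremum over \<open>F\<close>.
\<close>

lemma jordan_decomposition:
  fixes \<nu> :: "'g::t2_space set \<Rightarrow> real"
  assumes d: "dominated \<nu> M" and E: "E \<in> sets borel"
  shows "measure (positive_part \<nu>) E - measure (positive_part (\<lambda>E. - \<nu> E)) E = \<nu> E"
proof -
  note p = positive_part_dominated[OF d] and q = positive_part_dominated[OF dominated_uminus[OF d]]
  have split: "\<nu> E = \<nu> F + \<nu> (E - F)" if "F \<in> sets borel" "F \<subseteq> E" for F
  proof -
    have "\<nu> (F \<union> (E - F)) = \<nu> F + \<nu> (E - F)"
      using d that E unfolding dominated_def by blast
    moreover have "F \<union> (E - F) = E" using that by auto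
    ultimately show ?thesis by simp
  qed
  have "measure (positive_part \<nu>) E \<le> \<nu> E + measure (positive_part (\<lambda>E. - \<nu> E)) E"
  proof (rule p(4)[OF E])
    show "0 \<le> \<nu> E + measure (positive_part (\<lambda>E. - \<nu> E)) E" using q(3)[OF E E] by simp
    show "\<nu> F \<le> \<nu> E + measure (positive_part (\<lambda>E. - \<nu> E)) E" if "F \<in> sets borel" "F \<subseteq> E" for F
      using split[OF that] q(3)[OF E, of "E - F"] that E by auto
  qed
  moreover have "measure (positive_part (\<lambda>E. - \<nu> E)) E \<le> measure (positive_part \<nu>) E - \<nu> E"
  proof (rule q(4)[OF E])
    show "0 \<le> measure (positive_part \<nu>) E - \<nu> E" using p(3)[OF E E] by simp
    show "- \<nu> F \<le> measure (positive_part \<nu>) E - \<nu> E" if "F \<in> sets borel" "F \<subseteq> E" for F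
      using split[OF that] p(3)[OF E, of "E - F"] that E by auto
  qed
  ultimately show ?thesis by simp
qed

lemma regular_dominated:
  assumes \<mu>: "regular_complex_measure (\<mu> :: 'g::t2_space set \<Rightarrow> complex)"
  shows "dominated (\<lambda>E. Re (\<mu> E)) (variation_measure \<mu>)" "dominated (\<lambda>E. Im (\<mu> E)) (variation_measure \<mu>)"
proof -
  note r = regularD[OF \<mu>] and c = complex_measureD[OF regularD(1)[OF \<mu>]]
  have "\<bar>Re (\<mu> E)\<bar> \<le> measure (variation_measure \<mu>) E" "\<bar>Im (\<mu> E)\<bar> \<le> measure (variation_measure \<mu>) E" for E
    using r(4)[of E] abs_Re_le_cmod[of "\<mu> E"] abs_Im_le_cmod[of "\<mu> E"] by linarith+
  then show "dominated (\<lambda>E. Re (\<mu> E)) (variation_measure \<mu>)" "dominated (\<lambda>E. Im (\<mu> E)) (variation_measure \<mu>)"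
    unfolding dominated_def using r(2) c(2,4) by (auto intro: sums_Re sums_Im)
qed

definition bounded_borel :: "('g::topological_space \<Rightarrow> complex) \<Rightarrow> bool" where
  "bounded_borel f \<longleftrightarrow> f \<in> borel_measurable borel \<and> (\<exists>B. \<forall>x. cmod (f x) \<le> B)"

lemma bounded_borel_add:
  assumes "bounded_borel f" "bounded_borel g"
  shows "bounded_borel (\<lambda>x. f x + g x)"
proof -
  obtain B C where "\<forall>x. cmod (f x) \<le> B" "\<forall>x. cmod (g x) \<le> C" using assms by (auto simp: bounded_borel_def)
  then have "\<forall>x. cmod (f x + g x) \<le> B + C" by (meson norm_triangle_mono)
  then show ?thesis using assms by (auto simp: bounded_borel_def)
qed

lemma bounded_borel_scale:
  assumes "bounded_borel f"
  shows "bounded_borel (\<lambda>x. c * f x)"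
proof -
  obtain B where "\<forall>x. cmod (f x) \<le> B" using assms by (auto simp: bounded_borel_def)
  then have "\<forall>x. cmod (c * f x) \<le> cmod c * B" by (simp add: norm_mult mult_left_mono)
  then show ?thesis using assms by (auto simp: bounded_borel_def)
qed

lemma bounded_borel_indicator: "E \<in> sets borel \<Longrightarrow> bounded_borel (\<lambda>x. of_real (indicator E x))"
  unfolding bounded_borel_def by (auto intro!: exI[of _ 1] simp: indicator_def)

lemma bounded_borel_integrable:
  assumes "bounded_borel f" "finite_radon M"
  shows "integrable M f"
proof -
  interpret finite_measure M by (rule finite_radonD(3)[OF assms(2)])
  obtain B where "\<forall>x. cmod (f x) \<le> B" using assms(1) by (auto simp: bounded_borel_def)
  moreover have "f \<in> borel_measurable M"
    using assms(1) measurable_cong_sets[OF finite_radonD(1)[OF assms(2)] refl] by (auto simp: bounded_borel_def)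
  ultimately show ?thesis by (intro integrable_const_bound[of _ B]) auto
qed

text \<open>
  Rounding the real and the imaginary part of \<open>f\<close> down to multiples of \<open>e\<close> gives a Borel function with
  finitely many values, on which \<open>J\<close> vanishes, at uniform distance at most \<open>2 * e\<close> from \<open>f\<close>.
\<close>

lemma functional_zero:
  fixes J :: "('g::topological_space \<Rightarrow> complex) \<Rightarrow> complex"
  assumes add: "\<And>f g. bounded_borel f \<Longrightarrow> bounded_borel g \<Longrightarrow> J (\<lambda>x. f x + g x) = J f + J g"
    and scale: "\<And>f c. bounded_borel f \<Longrightarrow> J (\<lambda>x. c * f x) = c * J f"
    and bound: "\<And>f B. bounded_borel f \<Longrightarrow> (\<And>x. cmod (f x) \<le> B) \<Longrightarrow> cmod (J f) \<le> C * B"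
    and ind: "\<And>E. E \<in> sets borel \<Longrightarrow> J (\<lambda>x. of_real (indicator E x)) = 0"
    and f: "bounded_borel f"
  shows "J f = 0"
proof -
  obtain B where B: "\<And>x. cmod (f x) \<le> B" using f by (auto simp: bounded_borel_def)
  have fm[measurable]: "f \<in> borel_measurable borel" using f by (simp add: bounded_borel_def)
  have z: "J (\<lambda>x. 0) = 0"
    using scale[OF f, of 0] by simp
  have sum: "bounded_borel (\<lambda>x. \<Sum>i\<in>I. c i * of_real (indicator (E i) x)) \<and>
      J (\<lambda>x. \<Sum>i\<in>I. c i * of_real (indicator (E i) x)) = 0"
    if "finite I" "\<And>i. i \<in> I \<Longrightarrow> E i \<in> sets borel" for I :: "complex set" and c E
    using that
  proof (induction I rule: finite_induct)
    case empty
    then show ?case using z bounded_borel_scale[OF f, of 0] by simp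
  next
    case (insert i I)
    have "bounded_borel (\<lambda>x. c i * of_real (indicator (E i) x))"
      using insert.prems by (intro bounded_borel_scale bounded_borel_indicator) auto
    then show ?case
      using insert add[of "\<lambda>x. c i * of_real (indicator (E i) x)" "\<lambda>x. \<Sum>i\<in>I. c i * of_real (indicator (E i) x)"]
        scale[OF bounded_borel_indicator, of "E i" "c i"] ind[of "E i"]
      by (auto intro: bounded_borel_add)
  qed
  have small: "cmod (J f) \<le> C * (2 * e)" if e: "e > 0" for e :: real
  proof -
    define r where "r t = e * of_int \<lfloor>t / e\<rfloor>" for t :: real
    have r: "\<bar>t - r t\<bar> \<le> e" for t
    proof -
      have "r t \<le> t"
        using mult_left_mono[OF of_int_floor_le[of "t / e"], of e] e by (simp add: r_def)
      moreover have "t < r t + e"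
        using e floor_correct[of "t / e"] by (simp add: r_def field_simps)
      ultimately show ?thesis by simp
    qed
    have rm[measurable]: "r \<in> borel_measurable borel" unfolding r_def[abs_def] by measurable
    define s where "s x = Complex (r (Re (f x))) (r (Im (f x)))" for x
    have sm[measurable]: "s \<in> borel_measurable borel"
      unfolding s_def[abs_def] Complex_eq by measurable
    define I where "I = (\<lambda>(k, l). Complex (e * of_int k) (e * of_int l)) `
      ({\<lfloor>- B / e\<rfloor>..\<lfloor>B / e\<rfloor>} \<times> {\<lfloor>- B / e\<rfloor>..\<lfloor>B / e\<rfloor>})"
    have fin: "finite I" unfolding I_def by simp
    have sI: "s x \<in> I" for x
    proof -
      have "\<bar>Re (f x)\<bar> \<le> B" "\<bar>Im (f x)\<bar> \<le> B"
        using B[of x] abs_Re_le_cmod[of "f x"] abs_Im_le_cmod[of "f x"] by linarith+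
      then have "- B / e \<le> Re (f x) / e" "Re (f x) / e \<le> B / e" "- B / e \<le> Im (f x) / e" "Im (f x) / e \<le> B / e"
        using e by - (rule divide_right_mono; linarith)+
      then have "\<lfloor>Re (f x) / e\<rfloor> \<in> {\<lfloor>- B / e\<rfloor>..\<lfloor>B / e\<rfloor>}" "\<lfloor>Im (f x) / e\<rfloor> \<in> {\<lfloor>- B / e\<rfloor>..\<lfloor>B / e\<rfloor>}"
        by (auto intro: floor_mono)
      then show ?thesis unfolding I_def s_def r_def by force
    qed
    have s_eq: "s = (\<lambda>x. \<Sum>y\<in>I. y * of_real (indicator (s -` {y}) x))"
    proof
      fix x
      have "(\<Sum>y\<in>I. y * of_real (indicator (s -` {y}) x)) = (\<Sum>y\<in>I. if y = s x then y else 0)"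
        by (intro sum.cong) (auto simp: indicator_def)
      then show "s x = (\<Sum>y\<in>I. y * of_real (indicator (s -` {y}) x))" using fin sI by simp
    qed
    have vs: "s -` {y} \<in> sets borel" for y
      using measurable_sets[OF sm, of "{y}"] by simp
    have s0: "bounded_borel s" "J s = 0"
      using sum[OF fin, of "\<lambda>y. s -` {y}" "\<lambda>y. y"] vs s_eq by simp_all
    have d: "cmod (f x - s x) \<le> 2 * e" for x
    proof -
      have "cmod (f x - s x) \<le> \<bar>Re (f x - s x)\<bar> + \<bar>Im (f x - s x)\<bar>" by (rule cmod_le)
      also have "\<dots> \<le> e + e" using r[of "Re (f x)"] r[of "Im (f x)"] by (auto simp: s_def intro!: add_mono)
      finally show ?thesis by simp
    qed
    have ms: "bounded_borel (\<lambda>x. (-1) * s x)" by (rule bounded_borel_scale[OF s0(1)])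
    have "J (\<lambda>x. f x + (-1) * s x) = J f"
      using add[OF f ms] scale[OF s0(1), of "-1"] s0(2) by simp
    moreover have "cmod (J (\<lambda>x. f x + (-1) * s x)) \<le> C * (2 * e)"
      by (rule bound[OF bounded_borel_add[OF f ms]]) (use d in simp)
    ultimately show ?thesis by simp
  qed
  have "cmod (J f) \<le> 0 + e" if e: "e > 0" for e :: real
  proof -
    (* The bound holds for every grid size; this one makes it at most e whatever the sign of C. *)
    have "cmod (J f) \<le> C * (2 * (e / (2 * (\<bar>C\<bar> + 1))))" by (rule small) (use e in \<open>simp add: add_nonneg_pos\<close>)
    also have "\<dots> = (C / (\<bar>C\<bar> + 1)) * e" by (simp add: field_simps)
    also have "\<dots> \<le> 1 * e" using e by (intro mult_right_mono) (auto simp: divide_le_eq)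
    finally show ?thesis by simp
  qed
  then have "cmod (J f) \<le> 0" by (rule field_le_epsilon)
  then show ?thesis by simp
qed

context
  fixes \<mu> :: "'g::t2_space set \<Rightarrow> complex"
  assumes \<mu>: "regular_complex_measure \<mu>"
begin

private lemmas re = regular_dominated(1)[OF \<mu>] and im = regular_dominated(2)[OF \<mu>]
private lemmas parts = positive_part_dominated[OF re] positive_part_dominated[OF dominated_uminus[OF re]]
  positive_part_dominated[OF im] positive_part_dominated[OF dominated_uminus[OF im]]

lemma integral_complex_measure_add:
  assumes "bounded_borel f" "bounded_borel g"
  shows "integral_complex_measure \<mu> (\<lambda>x. f x + g x) = integral_complex_measure \<mu> f + integral_complex_measure \<mu> g"
  unfolding integral_complex_measure_def
  by (simp add: Bochner_Integration.integral_add[OF bounded_borel_integrable[OF assms(1)] bounded_borel_integrable[OF assms(2)]]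
      parts(1,5,9,13) algebra_simps)

lemma integral_complex_measure_scale:
  "integral_complex_measure \<mu> (\<lambda>x. c * f x) = c * integral_complex_measure \<mu> f"
  unfolding integral_complex_measure_def by (simp add: algebra_simps)

lemma integral_complex_measure_indicator:
  assumes E: "E \<in> sets borel"
  shows "integral_complex_measure \<mu> (\<lambda>x. of_real (indicator E x)) = \<mu> E"
proof -
  have "(\<integral>x. complex_of_real (indicator E x) \<partial>M) = of_real (measure M E)" if "finite_radon M" for M
    using finite_radonD(2)[OF that] by simp
  then have "integral_complex_measure \<mu> (\<lambda>x. of_real (indicator E x)) =
    of_real (measure (positive_part (\<lambda>E. Re (\<mu> E))) E - measure (positive_part (\<lambda>E. - Re (\<mu> E))) E) +
    \<i> * of_real (measure (positive_part (\<lambda>E. Im (\<mu> E))) E - measure (positive_part (\<lambda>E. - Im (\<mu> E))) E)"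
    unfolding integral_complex_measure_def by (simp add: parts(1,5,9,13))
  then show ?thesis
    unfolding jordan_decomposition[OF re E] jordan_decomposition[OF im E] by (simp add: complex_eq_iff)
qed

text \<open>
  The factor 4 is the number of positive parts in the definition of the integral, each of which
  is dominated by the variation.
\<close>

lemma integral_complex_measure_bound:
  assumes f: "bounded_borel f"
  shows "ennreal (cmod (integral_complex_measure \<mu> f)) \<le> 4 * (\<integral>\<^sup>+x. ennreal (cmod (f x)) \<partial>variation_measure \<mu>)"
proof -
  define N where "N = (\<integral>\<^sup>+x. ennreal (cmod (f x)) \<partial>variation_measure \<mu>)"
  have *: "ennreal (cmod (\<integral>x. f x \<partial>M)) \<le> N"
    if M: "finite_radon M" "\<And>E. E \<in> sets borel \<Longrightarrow> emeasure M E \<le> emeasure (variation_measure \<mu>) E" for M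
  proof -
    have s: "sets M = sets (variation_measure \<mu>)"
      using finite_radonD(1)[OF M(1)] finite_radonD(1)[OF regularD(2)[OF \<mu>]] by simp
    have "ennreal (cmod (\<integral>x. f x \<partial>M)) \<le> (\<integral>\<^sup>+x. ennreal (cmod (f x)) \<partial>M)"
      by (rule integral_norm_bound_ennreal[OF bounded_borel_integrable[OF f M(1)]])
    also have "\<dots> \<le> N"
      unfolding N_def using s M(2) finite_radonD(1)[OF M(1)]
      by (intro nn_integral_mono_measure) (auto simp: le_measure)
    finally show ?thesis .
  qed
  have tri: "cmod ((a - b) + \<i> * (c - d)) \<le> cmod a + cmod b + (cmod c + cmod d)" for a b c d
    by (rule order_trans[OF norm_triangle_ineq]) (auto simp: norm_mult intro!: add_mono norm_triangle_ineq4)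
  let ?a = "\<integral>x. f x \<partial>positive_part (\<lambda>E. Re (\<mu> E))" and ?b = "\<integral>x. f x \<partial>positive_part (\<lambda>E. - Re (\<mu> E))"
    and ?c = "\<integral>x. f x \<partial>positive_part (\<lambda>E. Im (\<mu> E))" and ?d = "\<integral>x. f x \<partial>positive_part (\<lambda>E. - Im (\<mu> E))"
  have "ennreal (cmod (integral_complex_measure \<mu> f)) \<le> ennreal (cmod ?a + cmod ?b + (cmod ?c + cmod ?d))"
    unfolding integral_complex_measure_def by (intro ennreal_leI tri)
  also have "\<dots> = ennreal (cmod ?a) + ennreal (cmod ?b) + (ennreal (cmod ?c) + ennreal (cmod ?d))"
    by (simp only: ennreal_plus norm_ge_zero add_nonneg_nonneg)
  also have "\<dots> \<le> N + N + (N + N)"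
    by (intro add_mono * parts(1,2,5,6,9,10,13,14))
  also have "\<dots> = 4 * N" using distrib_right[of 2 2 N] distrib_right[of 1 1 N] by (simp add: one_add_one)
  finally show ?thesis unfolding N_def .
qed

lemma integral_complex_measure_sup_bound:
  assumes f: "bounded_borel f" and B: "\<And>x. cmod (f x) \<le> B"
  shows "cmod (integral_complex_measure \<mu> f) \<le> (4 * measure (variation_measure \<mu>) UNIV) * B"
proof -
  interpret finite_measure "variation_measure \<mu>" by (rule finite_radonD(3)[OF regularD(2)[OF \<mu>]])
  have B0: "B \<ge> 0" using B[of undefined] norm_ge_zero order_trans by blast
  have "ennreal (cmod (integral_complex_measure \<mu> f)) \<le> 4 * (\<integral>\<^sup>+x. ennreal (cmod (f x)) \<partial>variation_measure \<mu>)"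
    by (rule integral_complex_measure_bound[OF f])
  also have "\<dots> \<le> 4 * (\<integral>\<^sup>+x. ennreal B \<partial>variation_measure \<mu>)"
    by (intro mult_left_mono nn_integral_mono ennreal_leI B) auto
  also have "\<dots> = ennreal 4 * (ennreal B * ennreal (measure (variation_measure \<mu>) UNIV))"
    using finite_radonD(2)[OF regularD(2)[OF \<mu>]] by (simp add: emeasure_eq_measure)
  also have "\<dots> = ennreal ((4 * measure (variation_measure \<mu>) UNIV) * B)"
    using B0 by (simp add: ennreal_mult[symmetric] mult_ac del: ennreal_numeral)
  finally show ?thesis using B0 by simp
qed

end

text \<open>
  The positive parts do not depend linearly on the measure, so linearity of the integral in the
  measure and the integral against a point mass are not immediate from the definition. They
  follow from the fact that a bounded linear functional is determined by its values on
  indicators.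
\<close>

lemma integral_complex_measure_unique:
  fixes J :: "('g::t2_space \<Rightarrow> complex) \<Rightarrow> complex"
  assumes \<mu>: "regular_complex_measure \<mu>"
    and add: "\<And>f g. bounded_borel f \<Longrightarrow> bounded_borel g \<Longrightarrow> J (\<lambda>x. f x + g x) = J f + J g"
    and scale: "\<And>f c. bounded_borel f \<Longrightarrow> J (\<lambda>x. c * f x) = c * J f"
    and bound: "\<And>f B. bounded_borel f \<Longrightarrow> (\<And>x. cmod (f x) \<le> B) \<Longrightarrow> cmod (J f) \<le> C * B"
    and ind: "\<And>E. E \<in> sets borel \<Longrightarrow> J (\<lambda>x. of_real (indicator E x)) = \<mu> E"
    and f: "bounded_borel f"
  shows "integral_complex_measure \<mu> f = J f"
proof -
  have "integral_complex_measure \<mu> f - J f = 0"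
  proof (rule functional_zero[where J = "\<lambda>f. integral_complex_measure \<mu> f - J f"
        and C = "4 * measure (variation_measure \<mu>) UNIV + C", OF _ _ _ _ f])
    show "cmod (integral_complex_measure \<mu> f - J f) \<le> (4 * measure (variation_measure \<mu>) UNIV + C) * B"
      if "bounded_borel f" "\<And>x. cmod (f x) \<le> B" for f B
      using norm_triangle_ineq4[of "integral_complex_measure \<mu> f" "J f"]
        integral_complex_measure_sup_bound[OF \<mu> that] bound[OF that] by (simp add: distrib_right)
  qed (simp_all add: integral_complex_measure_add[OF \<mu>] integral_complex_measure_scale[OF \<mu>]
      integral_complex_measure_indicator[OF \<mu>] add scale ind right_diff_distrib)
  then show ?thesis by simp
qed

section \<open>Convolution of measures\<close>

lemma continuous_group_plus: "continuous_on UNIV (\<lambda>(x, y). x + y :: 'g::topological_group_add)"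
  unfolding case_prod_beta by (intro continuous_intros)

lemma Hausdorff_space_t2: "Hausdorff_space (euclidean :: 'a::t2_space topology)"
  unfolding Hausdorff_space_def using hausdorff by (fastforce simp: disjnt_def)

lemma translate_open:
  fixes U :: "'g::topological_group_add set"
  assumes "open U" shows "open {y. x + y \<in> U}"
proof -
  have "continuous_on UNIV (\<lambda>y. x + y)" by (intro continuous_intros)
  from open_vimage[OF assms this] show ?thesis by (simp add: vimage_def)
qed

lemma translate_borel:
  fixes E :: "'g::topological_group_add set"
  assumes "E \<in> sets borel" shows "{y. x + y \<in> E} \<in> sets borel"
proof -
  have "(\<lambda>y. x + y) \<in> borel_measurable borel"
    by (intro borel_measurable_continuous_onI continuous_intros)
  from measurable_sets[OF this assms] show ?thesis by (simp add: vimage_def)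
qed

lemma compact_plus:
  fixes K L :: "'g::topological_group_add set"
  assumes "compact K" "compact L" shows "compact ((\<lambda>(x, y). x + y) ` (K \<times> L))"
  by (rule compact_continuous_image[OF continuous_on_subset[OF continuous_group_plus] compact_Times[OF assms]]) simp

text \<open>
  The tube lemma, applied to the preimage of \<open>U\<close> under addition.
\<close>

lemma translate_tube:
  fixes L :: "'g::topological_group_add set"
  assumes "compact L" "open U" "\<forall>y\<in>L. x + y \<in> U"
  obtains X where "open X" "x \<in> X" "\<And>z y. z \<in> X \<Longrightarrow> y \<in> L \<Longrightarrow> z + y \<in> U"
proof -
  have "open ((\<lambda>(x, y). x + y) -` U)" by (rule open_vimage[OF assms(2) continuous_group_plus])
  moreover have "{x} \<times> L \<subseteq> (\<lambda>(x, y). x + y) -` U" using assms(3) by auto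
  ultimately have "\<exists>X. x \<in> X \<and> open X \<and> X \<times> L \<subseteq> (\<lambda>(x, y). x + y) -` U"
    by (rule Elementary_Topology.tube_lemma[OF assms(1)])
  then obtain X where X: "x \<in> X" "open X" "X \<times> L \<subseteq> (\<lambda>(x, y). x + y) -` U" by blast
  have "z + y \<in> U" if "z \<in> X" "y \<in> L" for z y
    using subsetD[OF X(3), of "(z, y)"] that by simp
  then show thesis using that[OF X(2,1)] by blast
qed

lemma radon_inner_open:
  fixes N :: "'g::t2_space measure"
  assumes N: "finite_radon N" and U: "open U" and a: "a < measure N U"
  obtains L where "compact L" "L \<subseteq> U" "a < measure N L"
proof -
  interpret finite_measure N by (rule finite_radonD(3)[OF N])
  note s = finite_radonD(1)[OF N]
  have "U \<in> sets borel" "measure N U - a > 0" using U a by auto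
  from finite_radonD(4)[OF N this] obtain K V where KV: "compact K" "open V" "K \<subseteq> U" "U \<subseteq> V"
    "emeasure N (V - K) < ennreal (measure N U - a)" by blast
  have b: "K \<in> sets N" "U \<in> sets N" "V \<in> sets N" using KV U by (auto simp: s borel_compact)
  have "measure N U - measure N K = measure N (U - K)"
    by (rule finite_measure_Diff[OF b(2,1) KV(3), symmetric])
  also have "\<dots> \<le> measure N (V - K)" using b KV by (intro finite_measure_mono) auto
  also have "\<dots> < measure N U - a" using KV(5) by (simp add: emeasure_eq_measure ennreal_less_iff)
  finally show thesis using that KV by simp
qed

text \<open>
  For open \<open>E\<close> the function is lower semicontinuous: a compact set \<open>L\<close>
  in the translate at \<open>x\<close> that carries more than \<open>a\<close> is contained in
  the translates at all points near \<open>x\<close>. The other Borel sets follow because open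
  sets are a generator closed under intersections.
\<close>

lemma translate_measurable:
  fixes N :: "'g::{topological_group_add,t2_space} measure"
  assumes N: "finite_radon N" and E: "E \<in> sets borel"
  shows "(\<lambda>x. emeasure N {y. x + y \<in> E}) \<in> borel_measurable borel"
proof -
  interpret finite_measure N by (rule finite_radonD(3)[OF N])
  note s = finite_radonD(1)[OF N] and sp = finite_radonD(2)[OF N]
  have tb: "{y. x + y \<in> A} \<in> sets N" if "A \<in> sets borel" for x A
    using translate_borel[OF that] by (simp add: s)
  have op: "(\<lambda>x. emeasure N {y. x + y \<in> U}) \<in> borel_measurable borel" if U: "open U" for U :: "'g set"
  proof -
    have "(\<lambda>x. measure N {y. x + y \<in> U}) \<in> borel_measurable borel"
    proof (rule borel_measurableI_greater)
      fix a :: real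
      have "open {x. a < measure N {y. x + y \<in> U}}"
      proof (subst open_subopen, rule ballI)
        fix x assume "x \<in> {x. a < measure N {y. x + y \<in> U}}"
        then have "a < measure N {y. x + y \<in> U}" by simp
        from radon_inner_open[OF N translate_open[OF U] this] obtain L where
          L: "compact L" "L \<subseteq> {y. x + y \<in> U}" "a < measure N L" by blast
        obtain X where X: "open X" "x \<in> X" "\<And>z y. z \<in> X \<Longrightarrow> y \<in> L \<Longrightarrow> z + y \<in> U"
          by (rule translate_tube[OF L(1) U, of x]) (use L(2) in auto)
        have "a < measure N {y. z + y \<in> U}" if "z \<in> X" for z
        proof -
          have "measure N L \<le> measure N {y. z + y \<in> U}"
            using X(3)[OF that] tb[OF borel_open[OF U]] by (intro finite_measure_mono) auto
          then show ?thesis using L(3) by simp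
        qed
        then show "\<exists>T. open T \<and> x \<in> T \<and> T \<subseteq> {x. a < measure N {y. x + y \<in> U}}"
          using X by (intro exI[of _ X]) auto
      qed
      then show "{x \<in> space borel. a < measure N {y. x + y \<in> U}} \<in> sets borel" by simp
    qed
    then show ?thesis by (simp add: emeasure_eq_measure)
  qed
  have "Int_stable {S :: 'g set. open S}" by (auto simp: Int_stable_def)
  moreover have "{S :: 'g set. open S} \<subseteq> Pow UNIV" by simp
  moreover have "E \<in> sigma_sets UNIV {S :: 'g set. open S}" using E by (simp add: borel_def)
  ultimately show ?thesis
  proof (induction E rule: sigma_sets_induct_disjoint)
    case (basic A)
    then show ?case using op by simp
  next
    case empty
    then show ?case by simp
  next
    case (compl A)
    have "A \<in> sets borel" using compl(1) by (simp add: borel_def)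
    then have "emeasure N {y. x + y \<in> UNIV - A} = emeasure N UNIV - emeasure N {y. x + y \<in> A}" for x
      using emeasure_compl[OF tb, of A x] sp by (simp add: set_diff_eq)
    then show ?case using compl(2) by simp
  next
    case (union A)
    have Ab: "A i \<in> sets borel" for i using union(2) by (auto simp: borel_def)
    have "emeasure N {y. x + y \<in> (\<Union>i. A i)} = (\<Sum>i. emeasure N {y. x + y \<in> A i})" for x
    proof -
      have "(\<Sum>i. emeasure N {y. x + y \<in> A i}) = emeasure N (\<Union>i. {y. x + y \<in> A i})"
      proof (rule suminf_emeasure)
        show "disjoint_family (\<lambda>i. {y. x + y \<in> A i})"
          using disjoint_family_onD[OF union(1)] unfolding disjoint_family_on_def by blast
      qed (use tb[OF Ab] in auto)
      moreover have "(\<Union>i. {y. x + y \<in> A i}) = {y. x + y \<in> (\<Union>i. A i)}" by auto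
      ultimately show ?thesis by simp
    qed
    then show ?case using union(3) by simp
  qed
qed

definition conv_measure :: "'g::topological_group_add measure \<Rightarrow> 'g measure \<Rightarrow> 'g measure" where
  "conv_measure M N = measure_of UNIV (sets borel) (\<lambda>E. \<integral>\<^sup>+x. emeasure N {y. x + y \<in> E} \<partial>M)"

lemma conv_measure:
  fixes M N :: "'g::{topological_group_add,t2_space} measure"
  assumes M: "finite_radon M" and N: "finite_radon N"
  shows "sets (conv_measure M N) = sets borel"
    and "E \<in> sets borel \<Longrightarrow> emeasure (conv_measure M N) E = (\<integral>\<^sup>+x. emeasure N {y. x + y \<in> E} \<partial>M)"
proof -
  note s = finite_radonD(1)[OF N]
  have tb: "{y. x + y \<in> A} \<in> sets N" if "A \<in> sets borel" for x A
    using translate_borel[OF that] by (simp add: s)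
  have m: "(\<lambda>x. emeasure N {y. x + y \<in> A}) \<in> borel_measurable M" if "A \<in> sets borel" for A
    using translate_measurable[OF N that] measurable_cong_sets[OF finite_radonD(1)[OF M] refl] by blast
  have empty: "(\<integral>\<^sup>+x. emeasure N {y. x + y \<in> {}} \<partial>M) = 0" by simp
  have super: "(\<integral>\<^sup>+x. emeasure N {y. x + y \<in> A} \<partial>M) + (\<integral>\<^sup>+x. emeasure N {y. x + y \<in> B} \<partial>M)
      \<le> (\<integral>\<^sup>+x. emeasure N {y. x + y \<in> A \<union> B} \<partial>M)"
    if AB: "A \<in> sets borel" "B \<in> sets borel" "A \<inter> B = {}" for A B
  proof -
    have "emeasure N {y. x + y \<in> A} + emeasure N {y. x + y \<in> B} = emeasure N {y. x + y \<in> A \<union> B}" for x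
    proof -
      have "{y. x + y \<in> A} \<inter> {y. x + y \<in> B} = {}" using AB(3) by auto
      then have "emeasure N {y. x + y \<in> A} + emeasure N {y. x + y \<in> B} =
          emeasure N ({y. x + y \<in> A} \<union> {y. x + y \<in> B})"
        by (rule plus_emeasure[OF tb[OF AB(1)] tb[OF AB(2)]])
      then show ?thesis by (simp add: Collect_disj_eq)
    qed
    then show ?thesis
      using nn_integral_add[OF m[OF AB(1)] m[OF AB(2)]] by simp
  qed
  have sub: "(\<integral>\<^sup>+x. emeasure N {y. x + y \<in> (\<Union>n. A n)} \<partial>M) \<le> (\<Sum>n. \<integral>\<^sup>+x. emeasure N {y. x + y \<in> A n} \<partial>M)"
    if A: "range A \<subseteq> sets borel" "disjoint_family A" for A :: "nat \<Rightarrow> 'g set"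
  proof -
    have Ab: "A i \<in> sets borel" for i using A(1) by auto
    have "emeasure N {y. x + y \<in> (\<Union>i. A i)} \<le> (\<Sum>i. emeasure N {y. x + y \<in> A i})" for x
    proof -
      have "emeasure N (\<Union>i. {y. x + y \<in> A i}) \<le> (\<Sum>i. emeasure N {y. x + y \<in> A i})"
        using tb[OF Ab] by (intro emeasure_subadditive_countably) auto
      moreover have "(\<Union>i. {y. x + y \<in> A i}) = {y. x + y \<in> (\<Union>i. A i)}" by auto
      ultimately show ?thesis by simp
    qed
    then have "(\<integral>\<^sup>+x. emeasure N {y. x + y \<in> (\<Union>n. A n)} \<partial>M) \<le> (\<integral>\<^sup>+x. (\<Sum>i. emeasure N {y. x + y \<in> A i}) \<partial>M)"
      by (intro nn_integral_mono) simp
    also have "\<dots> = (\<Sum>n. \<integral>\<^sup>+x. emeasure N {y. x + y \<in> A n} \<partial>M)"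
      by (rule nn_integral_suminf[OF m[OF Ab]])
    finally show ?thesis .
  qed
  show "sets (conv_measure M N) = sets borel"
    "E \<in> sets borel \<Longrightarrow> emeasure (conv_measure M N) E = (\<integral>\<^sup>+x. emeasure N {y. x + y \<in> E} \<partial>M)"
    unfolding conv_measure_def
    using borel_measure_of[where f = "\<lambda>E. \<integral>\<^sup>+x. emeasure N {y. x + y \<in> E} \<partial>M", OF empty super sub]
    by - assumption+
qed

text \<open>
  Near each \<open>x\<close> in \<open>C\<close> there is a compact \<open>L\<close> with
  \<open>N L > a\<close> and \<open>Q + L\<close> inside \<open>U\<close>, where
  \<open>Q\<close> is a compact neighbourhood of \<open>x\<close> in \<open>C\<close>; then
  \<open>Q + L\<close> serves all points of \<open>Q\<close>. Finitely many of these
  neighbourhoods cover \<open>C\<close>.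
\<close>

lemma compact_band:
  fixes N :: "'g::{topological_group_add,t2_space} measure"
  assumes N: "finite_radon N" and U: "open U" and C: "compact C"
    and a: "\<And>x. x \<in> C \<Longrightarrow> a < measure N {y. x + y \<in> U}"
  obtains K where "compact K" "K \<subseteq> U" "\<And>x. x \<in> C \<Longrightarrow> a < measure N {y. x + y \<in> K}"
proof -
  interpret finite_measure N by (rule finite_radonD(3)[OF N])
  have "\<exists>X K. open X \<and> x \<in> X \<and> compact K \<and> K \<subseteq> U \<and> (\<forall>z\<in>C \<inter> X. a < measure N {y. z + y \<in> K})"
    if x: "x \<in> C" for x
  proof -
    from radon_inner_open[OF N translate_open[OF U] a[OF x]] obtain L where
      L: "compact L" "L \<subseteq> {y. x + y \<in> U}" "a < measure N L" by blast
    obtain X where X: "open X" "x \<in> X" "\<And>z y. z \<in> X \<Longrightarrow> y \<in> L \<Longrightarrow> z + y \<in> U"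
      by (rule translate_tube[OF L(1) U, of x]) (use L(2) in auto)
    have CX: "compact (C - X)" using compact_Int_closed[OF C closed_Compl[OF X(1)]] by (simp add: Diff_eq)
    (* Separating x from C - X makes Q = C - W a compact subset of X that contains C \<inter> V.
       *)
    obtain V W where VW: "open V" "open W" "{x} \<subseteq> V" "C - X \<subseteq> W" "disjnt V W"
      by (rule Hausdorff_space_compact_separation[OF Hausdorff_space_t2, of "{x}" "C - X"])
         (use X(2) CX in auto)
    define Q where "Q = C - W"
    have Q: "compact Q" unfolding Q_def
      using compact_Int_closed[OF C closed_Compl[OF VW(2)]] by (simp add: Diff_eq)
    define K where "K = (\<lambda>(x, y). x + y) ` (Q \<times> L)"
    have K: "compact K" unfolding K_def by (rule compact_plus[OF Q L(1)])
    have "K \<subseteq> U" unfolding K_def Q_def using VW(4) X(3) by auto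
    moreover have "a < measure N {y. z + y \<in> K}" if z: "z \<in> C \<inter> V" for z
    proof -
      have "z \<in> Q" using z VW(5) by (auto simp: Q_def disjnt_def)
      then have "L \<subseteq> {y. z + y \<in> K}" unfolding K_def by force
      then have "measure N L \<le> measure N {y. z + y \<in> K}"
        using translate_borel[OF borel_compact[OF K]] finite_radonD(1)[OF N]
        by (intro finite_measure_mono) auto
      then show ?thesis using L(3) by simp
    qed
    ultimately show ?thesis using VW(1,3) K by blast
  qed
  then have "\<forall>x\<in>C. \<exists>X K. open X \<and> x \<in> X \<and> compact K \<and> K \<subseteq> U \<and> (\<forall>z\<in>C \<inter> X. a < measure N {y. z + y \<in> K})"
    by blast
  from bchoice[OF this] obtain X where
    "\<forall>x\<in>C. \<exists>K. open (X x) \<and> x \<in> X x \<and> compact K \<and> K \<subseteq> U \<and> (\<forall>z\<in>C \<inter> X x. a < measure N {y. z + y \<in> K})"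
    by blast
  from bchoice[OF this] obtain K where XK: "\<And>x. x \<in> C \<Longrightarrow> open (X x)" "\<And>x. x \<in> C \<Longrightarrow> x \<in> X x"
    "\<And>x. x \<in> C \<Longrightarrow> compact (K x)" "\<And>x. x \<in> C \<Longrightarrow> K x \<subseteq> U"
    "\<And>x z. x \<in> C \<Longrightarrow> z \<in> C \<inter> X x \<Longrightarrow> a < measure N {y. z + y \<in> K x}" by blast
  obtain D where D: "D \<subseteq> C" "finite D" "C \<subseteq> (\<Union>x\<in>D. X x)"
    by (rule compactE_image[OF C, of C X]) (use XK(1,2) in auto)
  define L where "L = (\<Union>x\<in>D. K x)"
  have L: "compact L" unfolding L_def using D XK(3) by (intro compact_UN) auto
  have "a < measure N {y. z + y \<in> L}" if z: "z \<in> C" for z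
  proof -
    obtain x where x: "x \<in> D" "z \<in> X x" using z D(3) by auto
    have "measure N {y. z + y \<in> K x} \<le> measure N {y. z + y \<in> L}"
      using translate_borel[OF borel_compact[OF L]] finite_radonD(1)[OF N] x
      by (intro finite_measure_mono) (auto simp: L_def)
    moreover have "a < measure N {y. z + y \<in> K x}" using XK(5)[of x z] x z D(1) by blast
    ultimately show ?thesis by simp
  qed
  moreover have "L \<subseteq> U" unfolding L_def using D(1) XK(4) by blast
  ultimately show thesis using that[of L] L by simp
qed

text \<open>
  The range of \<open>g x = N {y. x + y \<in> U}\<close> is cut into finitely many bands of
  height \<open>\<eta>\<close>. The part of the group where \<open>g\<close> lies in a given
  band is exhausted by a compact set up to a small \<open>M\<close>-measure, and over that
  compact set a single compact subset of \<open>U\<close> loses at most \<open>\<eta>\<close> of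
  the value of \<open>g\<close>.
\<close>

lemma conv_measure_inner:
  fixes M N :: "'g::{topological_group_add,t2_space} measure"
  assumes M: "finite_radon M" and N: "finite_radon N" and U: "open U" and e: "e > 0"
  shows "\<exists>K. compact K \<and> K \<subseteq> U \<and> emeasure (conv_measure M N) (U - K) < ennreal e"
proof -
  interpret M: finite_measure M by (rule finite_radonD(3)[OF M])
  interpret N: finite_measure N by (rule finite_radonD(3)[OF N])
  note sM = finite_radonD(1)[OF M] and sN = finite_radonD(1)[OF N]
  define c where "c = measure N UNIV"
  define m where "m = measure M UNIV"
  have c0: "c \<ge> 0" and m0: "m \<ge> 0" by (simp_all add: c_def m_def)
  (* The losses add up to at most \<eta> per unit of M-mass, from the compact parts of the bands,
     and c on a set D of M-measure at most \<delta>; the choice gives less than e / 2 and at most e /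
     2. *)
  define \<eta> where "\<eta> = e / (2 * (m + 1))"
  define \<delta> where "\<delta> = e / (2 * (c + 1))"
  have \<eta>: "\<eta> > 0" and \<delta>: "\<delta> > 0" using e c0 m0 by (simp_all add: \<eta>_def \<delta>_def)
  define g where "g x = measure N {y. x + y \<in> U}" for x
  have gm: "g \<in> borel_measurable borel"
    unfolding g_def[abs_def] measure_def using translate_measurable[OF N borel_open[OF U]] by measurable
  have tb: "{y. x + y \<in> A} \<in> sets N" if "A \<in> sets borel" for x A
    using translate_borel[OF that] by (simp add: sN)
  have gc: "g x \<le> c" for x
    unfolding g_def c_def using finite_radonD(2)[OF N] by (metis N.bounded_measure)
  define n where "n = nat \<lceil>c / \<eta>\<rceil>"
  define S where "S k = {x. real k * \<eta> < g x \<and> g x \<le> (real k + 1) * \<eta>}" for k :: nat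
  have Sb: "S k \<in> sets borel" for k
  proof -
    have "S k = g -` {real k * \<eta> <.. (real k + 1) * \<eta>} \<inter> space borel" by (auto simp: S_def)
    then show ?thesis using measurable_sets[OF gm, of "{real k * \<eta> <.. (real k + 1) * \<eta>}"] by simp
  qed
  have cover: "\<exists>k<n. x \<in> S k" if x: "g x > 0" for x
  proof -
    define j where "j = nat (\<lceil>g x / \<eta>\<rceil> - 1)"
    have pos: "g x / \<eta> > 0" using x \<eta> by simp
    then have j: "real j = of_int \<lceil>g x / \<eta>\<rceil> - 1" by (simp add: j_def)
    have "real j < g x / \<eta>" "g x / \<eta> \<le> real j + 1" unfolding j by linarith+
    then have "x \<in> S j" using \<eta> by (simp add: S_def pos_less_divide_eq pos_divide_le_eq)
    moreover have "j < n"
    proof -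
      have "real j < c / \<eta>"
        using \<open>real j < g x / \<eta>\<close> divide_right_mono[OF gc[of x], of \<eta>] \<eta> by simp
      then show ?thesis unfolding n_def by linarith
    qed
    ultimately show ?thesis by blast
  qed
  have "\<exists>C. compact C \<and> C \<subseteq> S k \<and> measure M (S k - C) < \<delta> / (real n + 1)" for k
  proof -
    have "\<delta> / (real n + 1) > 0" using \<delta> by simp
    from finite_radonD(4)[OF M Sb[of k] this] obtain C V where CV: "compact C" "open V" "C \<subseteq> S k" "S k \<subseteq> V"
      "emeasure M (V - C) < ennreal (\<delta> / (real n + 1))" by blast
    have "measure M (S k - C) \<le> measure M (V - C)"
      using CV by (intro M.finite_measure_mono) (auto simp: sM borel_compact)
    also have "\<dots> < \<delta> / (real n + 1)" using CV(5) by (simp add: M.emeasure_eq_measure ennreal_less_iff)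
    finally show ?thesis using CV by blast
  qed
  then have "\<forall>k. \<exists>C. compact C \<and> C \<subseteq> S k \<and> measure M (S k - C) < \<delta> / (real n + 1)" by blast
  from choice[OF this] obtain C where C: "\<And>k. compact (C k)" "\<And>k. C k \<subseteq> S k"
    "\<And>k. measure M (S k - C k) < \<delta> / (real n + 1)" by blast
  have "\<exists>K. compact K \<and> K \<subseteq> U \<and> (\<forall>x\<in>C k. real k * \<eta> < measure N {y. x + y \<in> K})" for k
  proof -
    have "real k * \<eta> < measure N {y. x + y \<in> U}" if "x \<in> C k" for x
      using C(2)[of k] that by (auto simp: S_def g_def)
    then obtain K where "compact K" "K \<subseteq> U" "\<And>x. x \<in> C k \<Longrightarrow> real k * \<eta> < measure N {y. x + y \<in> K}"
      by (rule compact_band[OF N U C(1)[of k]]) auto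
    then show ?thesis by (intro exI[of _ K]) simp
  qed
  then have "\<forall>k. \<exists>K. compact K \<and> K \<subseteq> U \<and> (\<forall>x\<in>C k. real k * \<eta> < measure N {y. x + y \<in> K})" by blast
  from choice[OF this] obtain K where K: "\<And>k. compact (K k)" "\<And>k. K k \<subseteq> U"
    "\<And>k x. x \<in> C k \<Longrightarrow> real k * \<eta> < measure N {y. x + y \<in> K k}" by blast
  define L where "L = (\<Union>k<n. K k)"
  have L: "compact L" unfolding L_def using K(1) by (intro compact_UN) auto
  have LU: "L \<subseteq> U" unfolding L_def using K(2) by auto
  have Lb: "L \<in> sets borel" by (rule borel_compact[OF L])
  define D where "D = (\<Union>k<n. S k - C k)"
  have Db: "D \<in> sets M" unfolding D_def sM
    by (intro sets.finite_UN sets.Diff Sb borel_compact[OF C(1)]) auto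
  have "measure M D \<le> (\<Sum>k<n. measure M (S k - C k))"
    unfolding D_def using Sb C(1) by (intro M.finite_measure_subadditive_finite) (auto simp: sM borel_compact)
  also have "\<dots> \<le> (\<Sum>k<n. \<delta> / (real n + 1))" by (intro sum_mono less_imp_le C(3))
  also have "\<dots> = \<delta> * (real n / (real n + 1))" by simp
  also have "\<dots> \<le> \<delta> * 1" using \<delta> by (intro mult_left_mono) auto
  finally have MD: "measure M D \<le> \<delta>" by simp
  have pt: "measure N {y. x + y \<in> U - L} \<le> \<eta> + c * indicator D x" for x
  proof -
    have le: "measure N {y. x + y \<in> U - L} \<le> g x"
      unfolding g_def using tb[OF borel_open[OF U]] by (intro N.finite_measure_mono) auto
    show ?thesis
    proof (cases "g x > 0")
      case False
      then show ?thesis using le \<eta> c0 by (auto simp: indicator_def)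
    next
      case True
      obtain k where k: "k < n" "x \<in> S k" using cover[OF True] by blast
      show ?thesis
      proof (cases "x \<in> C k")
        case True
        have "measure N {y. x + y \<in> K k} \<le> measure N {y. x + y \<in> L}"
          using tb[OF Lb] k(1) by (intro N.finite_measure_mono) (auto simp: L_def)
        moreover have "measure N {y. x + y \<in> U - L} = g x - measure N {y. x + y \<in> L}"
        proof -
          have "{y. x + y \<in> U - L} = {y. x + y \<in> U} - {y. x + y \<in> L}" by auto
          then show ?thesis
            unfolding g_def using LU
            by (simp add: N.finite_measure_Diff[OF tb[OF borel_open[OF U]] tb[OF Lb]] Collect_mono subset_iff)
        qed
        ultimately have "measure N {y. x + y \<in> U - L} \<le> \<eta>"
          using K(3)[OF True] k(2) by (auto simp: S_def algebra_simps)
        then show ?thesis using c0 by (auto simp: indicator_def)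
      next
        case False
        then have "x \<in> D" using k by (auto simp: D_def)
        then show ?thesis using le gc[of x] \<eta> by simp
      qed
    qed
  qed
  have b: "U - L \<in> sets borel" using U Lb by auto
  have "emeasure (conv_measure M N) (U - L) = (\<integral>\<^sup>+x. emeasure N {y. x + y \<in> U - L} \<partial>M)"
    by (rule conv_measure(2)[OF M N b])
  also have "\<dots> \<le> (\<integral>\<^sup>+x. ennreal \<eta> + ennreal c * indicator D x \<partial>M)"
  proof (rule nn_integral_mono)
    fix x
    have "emeasure N {y. x + y \<in> U - L} \<le> ennreal (\<eta> + c * indicator D x)"
      unfolding N.emeasure_eq_measure by (rule ennreal_leI[OF pt])
    also have "\<dots> = ennreal \<eta> + ennreal c * indicator D x"
      using \<eta> c0 by (simp add: indicator_def)
    finally show "emeasure N {y. x + y \<in> U - L} \<le> ennreal \<eta> + ennreal c * indicator D x" .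
  qed
  also have "\<dots> = ennreal \<eta> * emeasure M (space M) + ennreal c * emeasure M D"
    using Db by (subst nn_integral_add) (auto simp: nn_integral_cmult_indicator)
  also have "\<dots> = ennreal (\<eta> * m + c * measure M D)"
    using \<eta> c0 m0 finite_radonD(2)[OF M] by (simp add: M.emeasure_eq_measure m_def ennreal_mult)
  also have "\<dots> < ennreal e"
  proof (rule ennreal_lessI[OF e])
    have "\<eta> * m < e / 2"
    proof -
      have "\<eta> * m < \<eta> * (m + 1)" using \<eta> by simp
      also have "\<dots> = e / 2" using m0 unfolding \<eta>_def by (simp add: divide_simps)
      finally show ?thesis .
    qed
    moreover have "c * measure M D \<le> e / 2"
    proof -
      have "c * measure M D \<le> (c + 1) * \<delta>" using c0 MD by (intro mult_mono) auto
      also have "\<dots> = e / 2" using c0 unfolding \<delta>_def by (simp add: divide_simps)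
      finally show ?thesis .
    qed
    ultimately show "\<eta> * m + c * measure M D < e" by simp
  qed
  finally show ?thesis using L LU by blast
qed

lemma conv_measure_radon:
  fixes M N :: "'g::{topological_group_add,t2_space} measure"
  assumes M: "finite_radon M" and N: "finite_radon N"
  shows "finite_radon (conv_measure M N)" "measure (conv_measure M N) UNIV = measure M UNIV * measure N UNIV"
proof -
  interpret M: finite_measure M by (rule finite_radonD(3)[OF M])
  interpret N: finite_measure N by (rule finite_radonD(3)[OF N])
  have tot: "emeasure (conv_measure M N) UNIV = ennreal (measure M UNIV * measure N UNIV)"
    using conv_measure(2)[OF M N, of UNIV] finite_radonD(2)[OF M]
    by (simp add: N.emeasure_eq_measure M.emeasure_eq_measure ennreal_mult mult.commute)
  then show "measure (conv_measure M N) UNIV = measure M UNIV * measure N UNIV"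
    by (simp add: measure_def)
  show "finite_radon (conv_measure M N)"
    by (rule finite_radonI[OF conv_measure(1)[OF M N] _ conv_measure_inner[OF M N]]) (simp add: tot)
qed

lemma translate_bounded_borel:
  fixes \<nu> :: "'g::{topological_group_add,t2_space} set \<Rightarrow> complex"
  assumes \<nu>: "regular_complex_measure \<nu>" and E: "E \<in> sets borel"
  shows "bounded_borel (\<lambda>x. \<nu> {y. x + y \<in> E})"
proof -
  have m: "(\<lambda>x. measure P {y. x + y \<in> E}) \<in> borel_measurable borel" if "finite_radon P" for P
    unfolding measure_def using translate_measurable[OF that E] by measurable
  have d: "(\<lambda>x. \<xi> {y. x + y \<in> E}) \<in> borel_measurable borel" if d: "dominated \<xi> (variation_measure \<nu>)" for \<xi>
  proof -
    have "(\<lambda>x. \<xi> {y. x + y \<in> E}) = (\<lambda>x. measure (positive_part \<xi>) {y. x + y \<in> E} -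
        measure (positive_part (\<lambda>E. - \<xi> E)) {y. x + y \<in> E})"
      using jordan_decomposition[OF d translate_borel[OF E]] by simp
    then show ?thesis
      using m[OF positive_part_dominated(1)[OF d]] m[OF positive_part_dominated(1)[OF dominated_uminus[OF d]]]
      by simp
  qed
  have "(\<lambda>x. \<nu> {y. x + y \<in> E}) = (\<lambda>x. complex_of_real (Re (\<nu> {y. x + y \<in> E})) + \<i> * complex_of_real (Im (\<nu> {y. x + y \<in> E})))"
    by (simp add: complex_eq_iff fun_eq_iff)
  also have "\<dots> \<in> borel_measurable borel"
    using d[OF regular_dominated(1)[OF \<nu>]] d[OF regular_dominated(2)[OF \<nu>]] by measurable
  finally have "(\<lambda>x. \<nu> {y. x + y \<in> E}) \<in> borel_measurable borel" .
  moreover have "cmod (\<nu> A) \<le> measure (variation_measure \<nu>) UNIV" for A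
    using regularD(4)[OF \<nu>, of A] finite_measure.bounded_measure[OF finite_radonD(3)[OF regularD(2)[OF \<nu>]], of A]
      finite_radonD(2)[OF regularD(2)[OF \<nu>]] by simp
  ultimately show ?thesis unfolding bounded_borel_def by blast
qed

text \<open>
  The convolution is dominated by 4 times the convolution of the variation measures, which is a
  finite Radon measure.
\<close>

lemma convolution_regular:
  fixes \<mu> \<nu> :: "'g::{topological_group_add,t2_space} set \<Rightarrow> complex"
  assumes \<mu>: "regular_complex_measure \<mu>" and \<nu>: "regular_complex_measure \<nu>"
  shows "regular_complex_measure (convolution \<mu> \<nu>)"
    and "enn2real (total_variation (convolution \<mu> \<nu>) UNIV) \<le>
      4 * (enn2real (total_variation \<mu> UNIV) * enn2real (total_variation \<nu> UNIV))"
proof -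
  let ?M = "variation_measure \<mu>" and ?N = "variation_measure \<nu>"
  note M = regularD(2)[OF \<mu>] and N = regularD(2)[OF \<nu>]
  note K = conv_measure_radon[OF M N]
  interpret K: finite_measure "conv_measure ?M ?N" by (rule finite_radonD(3)[OF K(1)])
  have bound: "cmod (convolution \<mu> \<nu> E) \<le> 4 * measure (conv_measure ?M ?N) E" if E: "E \<in> sets borel" for E
  proof -
    have "ennreal (cmod (convolution \<mu> \<nu> E)) \<le> 4 * (\<integral>\<^sup>+x. ennreal (cmod (\<nu> {y. x + y \<in> E})) \<partial>?M)"
      using integral_complex_measure_bound[OF \<mu> translate_bounded_borel[OF \<nu> E]] E by (simp add: convolution_def)
    also have "\<dots> \<le> 4 * (\<integral>\<^sup>+x. emeasure ?N {y. x + y \<in> E} \<partial>?M)"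
      by (intro mult_left_mono nn_integral_mono regularD(3)[OF \<nu>]) auto
    also have "\<dots> = ennreal 4 * ennreal (measure (conv_measure ?M ?N) E)"
      by (simp add: conv_measure(2)[OF M N E, symmetric] K.emeasure_eq_measure)
    also have "\<dots> = ennreal (4 * measure (conv_measure ?M ?N) E)"
      by (rule ennreal_mult[symmetric]) auto
    finally show ?thesis by simp
  qed
  have add: "convolution \<mu> \<nu> (A \<union> B) = convolution \<mu> \<nu> A + convolution \<mu> \<nu> B"
    if AB: "A \<in> sets borel" "B \<in> sets borel" "A \<inter> B = {}" for A B
  proof -
    have "\<nu> {y. x + y \<in> A \<union> B} = \<nu> {y. x + y \<in> A} + \<nu> {y. x + y \<in> B}" for x
    proof -
      have "{y. x + y \<in> A} \<inter> {y. x + y \<in> B} = {}" using AB(3) by auto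
      then show ?thesis
        using complex_measureD(4)[OF regularD(1)[OF \<nu>] translate_borel[OF AB(1)] translate_borel[OF AB(2)]]
        by (simp add: Collect_disj_eq)
    qed
    then show ?thesis
      using AB integral_complex_measure_add[OF \<mu> translate_bounded_borel[OF \<nu> AB(1)] translate_bounded_borel[OF \<nu> AB(2)]]
      by (simp add: convolution_def)
  qed
  have out: "convolution \<mu> \<nu> E = 0" if "E \<notin> sets borel" for E using that by (simp add: convolution_def)
  show "regular_complex_measure (convolution \<mu> \<nu>)"
    by (rule regularI(1)[OF out add K(1) _ bound]) auto
  have "enn2real (total_variation (convolution \<mu> \<nu>) UNIV) \<le> 4 * measure (conv_measure ?M ?N) UNIV"
    by (rule regularI(2)[OF out add K(1) _ bound]) auto
  then show "enn2real (total_variation (convolution \<mu> \<nu>) UNIV) \<le>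
      4 * (enn2real (total_variation \<mu> UNIV) * enn2real (total_variation \<nu> UNIV))"
    by (simp add: K(2) regularD(5)[OF \<mu>] regularD(5)[OF \<nu>])
qed

section \<open>The measure algebra\<close>

lemma measure_algebra_simps [simp]:
  "carrier measure_algebra = {\<mu> :: 'g::topological_group_add set \<Rightarrow> complex. regular_complex_measure \<mu>}"
  "vadd (measure_algebra :: ('g set \<Rightarrow> complex) nalgebra) = (\<lambda>\<mu> \<nu> E. \<mu> E + \<nu> E)"
  "vscale (measure_algebra :: ('g set \<Rightarrow> complex) nalgebra) = (\<lambda>c \<mu> E. c * \<mu> E)"
  "vnorm (measure_algebra :: ('g set \<Rightarrow> complex) nalgebra) = (\<lambda>\<mu>. enn2real (total_variation \<mu> UNIV))"
  "vmult (measure_algebra :: ('g set \<Rightarrow> complex) nalgebra) = convolution"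
  by (simp_all add: measure_algebra_def)

lemma regular_scale:
  fixes \<mu> :: "'g::t2_space set \<Rightarrow> complex"
  assumes \<mu>: "regular_complex_measure \<mu>"
  shows "regular_complex_measure (\<lambda>E. c * \<mu> E)"
    "enn2real (total_variation (\<lambda>E. c * \<mu> E) UNIV) \<le> cmod c * enn2real (total_variation \<mu> UNIV)"
proof -
  note cm = complex_measureD[OF regularD(1)[OF \<mu>]]
  have out: "c * \<mu> E = 0" if "E \<notin> sets borel" for E using cm(1)[OF that] by simp
  have add: "c * \<mu> (A \<union> B) = c * \<mu> A + c * \<mu> B" if "A \<in> sets borel" "B \<in> sets borel" "A \<inter> B = {}" for A B
    using cm(4)[OF that] by (simp add: distrib_left)
  have bound: "cmod (c * \<mu> E) \<le> cmod c * measure (variation_measure \<mu>) E" for E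
    using regularD(4)[OF \<mu>, of E] by (simp add: norm_mult mult_left_mono)
  show "regular_complex_measure (\<lambda>E. c * \<mu> E)"
    by (rule regularI(1)[OF out add regularD(2)[OF \<mu>] _ bound]) auto
  show "enn2real (total_variation (\<lambda>E. c * \<mu> E) UNIV) \<le> cmod c * enn2real (total_variation \<mu> UNIV)"
    unfolding regularD(5)[OF \<mu>] by (rule regularI(2)[OF out add regularD(2)[OF \<mu>] _ bound]) auto
qed

text \<open>
  The sum is dominated by the sum of the variation measures.
\<close>

lemma regular_series:
  fixes a :: "nat \<Rightarrow> 'g::t2_space set \<Rightarrow> complex"
  assumes a: "\<And>n. regular_complex_measure (a n)"
    and sm: "summable (\<lambda>n. enn2real (total_variation (a n) UNIV))"
  shows "regular_complex_measure (\<lambda>E. \<Sum>n. a n E)"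
    "enn2real (total_variation (\<lambda>E. \<Sum>n. a n E) UNIV) \<le> (\<Sum>n. enn2real (total_variation (a n) UNIV))"
proof -
  let ?M = "\<lambda>n. variation_measure (a n)"
  note M = regularD(2)[OF a] and cm = complex_measureD[OF regularD(1)[OF a]]
  have smM: "summable (\<lambda>n. measure (?M n) UNIV)" using sm by (simp add: regularD(5)[OF a])
  note R = sum_measure_radon[OF M smM]
  have le: "measure (?M n) E \<le> measure (?M n) UNIV" for n E
    using finite_measure.bounded_measure[OF finite_radonD(3)[OF M[of n]]] finite_radonD(2)[OF M[of n]] by simp
  have smE: "summable (\<lambda>n. measure (?M n) E)" for E
    by (rule summable_comparison_test'[OF smM, of 0]) (use le in auto)
  have smc: "summable (\<lambda>n. cmod (a n E))" for E
    by (rule summable_comparison_test'[OF smE, of 0]) (use regularD(4)[OF a] in auto)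
  have sma: "summable (\<lambda>n. a n E)" for E by (rule summable_norm_cancel[OF smc])
  have out: "(\<Sum>n. a n E) = 0" if "E \<notin> sets borel" for E using cm(1)[OF that] by simp
  have add: "(\<Sum>n. a n (A \<union> B)) = (\<Sum>n. a n A) + (\<Sum>n. a n B)"
    if "A \<in> sets borel" "B \<in> sets borel" "A \<inter> B = {}" for A B
    using cm(4)[OF that] suminf_add[OF sma sma] by simp
  have bound: "cmod (\<Sum>n. a n E) \<le> 1 * measure (sum_measure ?M) E" if E: "E \<in> sets borel" for E
  proof -
    have "cmod (\<Sum>n. a n E) \<le> (\<Sum>n. cmod (a n E))" by (rule summable_norm[OF smc])
    also have "\<dots> \<le> (\<Sum>n. measure (?M n) E)" by (intro suminf_le regularD(4)[OF a] smc smE)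
    also have "ennreal (\<Sum>n. measure (?M n) E) = emeasure (sum_measure ?M) E"
      unfolding sum_measure(2)[OF finite_radonD(1)[OF M] E]
      by (simp add: finite_measure.emeasure_eq_measure[OF finite_radonD(3)[OF M]] suminf_ennreal2[OF _ smE[of E]])
    then have "(\<Sum>n. measure (?M n) E) = measure (sum_measure ?M) E"
      by (metis enn2real_ennreal measure_def measure_nonneg smE suminf_nonneg)
    finally show ?thesis by simp
  qed
  show "regular_complex_measure (\<lambda>E. \<Sum>n. a n E)"
    by (rule regularI(1)[OF out add R(1) _ bound]) auto
  have "enn2real (total_variation (\<lambda>E. \<Sum>n. a n E) UNIV) \<le> 1 * measure (sum_measure ?M) UNIV"
    by (rule regularI(2)[OF out add R(1) _ bound]) auto
  then show "enn2real (total_variation (\<lambda>E. \<Sum>n. a n E) UNIV) \<le> (\<Sum>n. enn2real (total_variation (a n) UNIV))"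
    by (simp add: R(2) regularD(5)[OF a])
qed

definition dirac :: "'g::topological_space \<Rightarrow> 'g set \<Rightarrow> complex" where
  "dirac x E = (if E \<in> sets borel \<and> x \<in> E then 1 else 0)"

lemma dirac_regular:
  fixes x :: "'g::t2_space"
  shows "regular_complex_measure (dirac x)" "enn2real (total_variation (dirac x) UNIV) \<le> 1"
proof -
  define M :: "'g measure" where "M = distr (count_space {x}) borel (\<lambda>y. y)"
  have em: "emeasure M E = (if x \<in> E then 1 else 0)" if "E \<in> sets borel" for E
    using that unfolding M_def by (subst emeasure_distr) (auto simp: emeasure_count_space)
  have "finite_radon M"
    unfolding finite_radon_def
  proof (intro conjI ballI allI impI)
    show "sets M = sets borel" by (simp add: M_def)
    show "emeasure M UNIV < \<infinity>" by (simp add: em)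
    fix E :: "'g set" and e :: real assume "E \<in> sets borel" "e > 0"
    show "\<exists>K U. compact K \<and> open U \<and> K \<subseteq> E \<and> E \<subseteq> U \<and> emeasure M (U - K) < ennreal e"
    proof (cases "x \<in> E")
      case True
      then show ?thesis using \<open>e > 0\<close>
        by - (rule exI[of _ "{x}"], rule exI[of _ UNIV], simp add: em)
    next
      case False
      then show ?thesis using \<open>e > 0\<close>
        by - (rule exI[of _ "{}"], rule exI[of _ "- {x}"], auto simp: em)
    qed
  qed
  note M = this
  have out: "dirac x E = 0" if "E \<notin> sets borel" for E using that by (simp add: dirac_def)
  have add: "dirac x (A \<union> B) = dirac x A + dirac x B" if "A \<in> sets borel" "B \<in> sets borel" "A \<inter> B = {}" for A B
    using that by (auto simp: dirac_def)
  have bound: "cmod (dirac x E) \<le> 1 * measure M E" if "E \<in> sets borel" for E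
    using that by (simp add: dirac_def measure_def em)
  show "regular_complex_measure (dirac x)"
    by (rule regularI(1)[OF out add M _ bound]) auto
  have "enn2real (total_variation (dirac x) UNIV) \<le> 1 * measure M UNIV"
    by (rule regularI(2)[OF out add M _ bound]) auto
  then show "enn2real (total_variation (dirac x) UNIV) \<le> 1" by (simp add: measure_def em)
qed

lemma measure_space: "banach_function_space (measure_algebra :: ('g::{topological_group_add,t2_space} set \<Rightarrow> complex) nalgebra)"
proof
  show "carrier (measure_algebra :: ('g set \<Rightarrow> complex) nalgebra) \<noteq> {}" using dirac_regular(1) by auto
  have "cmod (t E) \<le> 1 * enn2real (total_variation t UNIV)" if t: "regular_complex_measure t"
    for t :: "'g set \<Rightarrow> complex" and E
    using regularD(4)[OF t, of E] finite_measure.bounded_measure[OF finite_radonD(3)[OF regularD(2)[OF t]], of E]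
      finite_radonD(2)[OF regularD(2)[OF t]] by (simp add: regularD(5)[OF t])
  then show "\<exists>C. \<forall>t\<in>carrier (measure_algebra :: ('g set \<Rightarrow> complex) nalgebra). cmod (t E) \<le> C * vnorm measure_algebra t" for E
    unfolding measure_algebra_simps by blast
qed (auto intro: regular_scale regular_series)

text \<open>
  The integral is additive in the measure by uniqueness, not by its definition.
\<close>

lemma convolution_add_left:
  fixes \<mu> \<nu> \<xi> :: "'g::{topological_group_add,t2_space} set \<Rightarrow> complex"
  assumes "regular_complex_measure \<mu>" "regular_complex_measure \<nu>" "regular_complex_measure \<xi>"
  shows "convolution (\<lambda>E. \<mu> E + \<nu> E) \<xi> = (\<lambda>E. convolution \<mu> \<xi> E + convolution \<nu> \<xi> E)"
proof -
  interpret banach_function_space "measure_algebra :: ('g set \<Rightarrow> complex) nalgebra" by (rule measure_space)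
  have "regular_complex_measure (\<lambda>E. \<mu> E + \<nu> E)" using add_closed[of \<mu> \<nu>] assms by simp
  then have "integral_complex_measure (\<lambda>E. \<mu> E + \<nu> E) f = integral_complex_measure \<mu> f + integral_complex_measure \<nu> f"
    if "bounded_borel f" for f
  proof (rule integral_complex_measure_unique[OF _ _ _ _ _ that,
        where J = "\<lambda>f. integral_complex_measure \<mu> f + integral_complex_measure \<nu> f"
        and C = "4 * measure (variation_measure \<mu>) UNIV + 4 * measure (variation_measure \<nu>) UNIV"])
    show "cmod (integral_complex_measure \<mu> f + integral_complex_measure \<nu> f)
        \<le> (4 * measure (variation_measure \<mu>) UNIV + 4 * measure (variation_measure \<nu>) UNIV) * B"
      if "bounded_borel f" "\<And>x. cmod (f x) \<le> B" for f B
      using norm_triangle_ineq[of "integral_complex_measure \<mu> f" "integral_complex_measure \<nu> f"]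
        integral_complex_measure_sup_bound[OF assms(1) that] integral_complex_measure_sup_bound[OF assms(2) that]
      by (simp add: distrib_right)
  qed (simp_all add: integral_complex_measure_add assms integral_complex_measure_scale[OF assms(1)]
      integral_complex_measure_scale[OF assms(2)] integral_complex_measure_indicator distrib_left)
  then show ?thesis
    using translate_bounded_borel[OF assms(3)] by (auto simp: convolution_def fun_eq_iff)
qed

lemma convolution_scale_left:
  fixes \<mu> \<xi> :: "'g::{topological_group_add,t2_space} set \<Rightarrow> complex"
  assumes "regular_complex_measure \<mu>" "regular_complex_measure \<xi>"
  shows "convolution (\<lambda>E. c * \<mu> E) \<xi> = (\<lambda>E. c * convolution \<mu> \<xi> E)"
proof -
  have "integral_complex_measure (\<lambda>E. c * \<mu> E) f = c * integral_complex_measure \<mu> f"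
    if "bounded_borel f" for f
  proof (rule integral_complex_measure_unique[OF regular_scale(1)[OF assms(1)] _ _ _ _ that,
        where J = "\<lambda>f. c * integral_complex_measure \<mu> f" and C = "cmod c * (4 * measure (variation_measure \<mu>) UNIV)"])
    show "cmod (c * integral_complex_measure \<mu> f) \<le> cmod c * (4 * measure (variation_measure \<mu>) UNIV) * B"
      if "bounded_borel f" "\<And>x. cmod (f x) \<le> B" for f B
      using mult_left_mono[OF integral_complex_measure_sup_bound[OF assms(1) that], of "cmod c"]
      by (simp add: norm_mult mult.assoc)
  qed (simp_all add: integral_complex_measure_add assms integral_complex_measure_scale[OF assms(1)]
      integral_complex_measure_indicator distrib_left mult.left_commute)
  then show ?thesis
    using translate_bounded_borel[OF assms(2)] by (auto simp: convolution_def fun_eq_iff)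
qed

lemma measure_banach_algebra:
  "banach_function_algebra (measure_algebra :: ('g::{topological_group_add,t2_space} set \<Rightarrow> complex) nalgebra)"
proof -
  interpret banach_function_space "measure_algebra :: ('g set \<Rightarrow> complex) nalgebra" by (rule measure_space)
  have add: "convolution \<mu> (\<lambda>E. \<nu> E + \<xi> E) = (\<lambda>E. convolution \<mu> \<nu> E + convolution \<mu> \<xi> E)"
    if "regular_complex_measure \<mu>" "regular_complex_measure \<nu>" "regular_complex_measure \<xi>"
    for \<mu> \<nu> \<xi> :: "'g set \<Rightarrow> complex"
    using integral_complex_measure_add[OF that(1) translate_bounded_borel[OF that(2)] translate_bounded_borel[OF that(3)]]
    by (simp add: convolution_def fun_eq_iff)
  have scale: "convolution \<mu> (\<lambda>E. c * \<nu> E) = (\<lambda>E. c * convolution \<mu> \<nu> E)"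
    if "regular_complex_measure \<mu>" for \<mu> \<nu> :: "'g set \<Rightarrow> complex" and c
    using integral_complex_measure_scale[OF that] by (simp add: convolution_def fun_eq_iff)
  show ?thesis
  proof
    show "vmult measure_algebra \<in> bounded_bilinear_maps measure_algebra measure_algebra
        (measure_algebra :: ('g set \<Rightarrow> complex) nalgebra)"
      unfolding bounded_bilinear_maps_def linear_maps_def
      by (intro CollectI conjI exI[of _ 4])
         (auto simp: convolution_regular add scale convolution_add_left convolution_scale_left mult.assoc)
  qed
qed

lemma dirac_convolution:
  fixes \<nu> :: "'g::{topological_group_add,t2_space} set \<Rightarrow> complex"
  assumes \<nu>: "regular_complex_measure \<nu>" and E: "E \<in> sets borel"
  shows "convolution (dirac x) \<nu> E = \<nu> {y. x + y \<in> E}"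
proof -
  (* Evaluation at x is a bounded functional with the values of the point mass on indicators. *)
  have "integral_complex_measure (dirac x) f = f x" if "bounded_borel f" for f
    by (rule integral_complex_measure_unique[OF dirac_regular(1) _ _ _ _ that, where C = 1])
       (auto simp: dirac_def)
  from this[OF translate_bounded_borel[OF \<nu> E]] show ?thesis using E by (simp add: convolution_def)
qed

section \<open>Square-integrable functions\<close>

lemma L2_functionsD:
  assumes "f \<in> L2_functions M"
  shows "f \<in> borel_measurable M" "integrable M (\<lambda>x. (cmod (f x))\<^sup>2)"
  using assms by (auto simp: L2_functions_def)

lemma L2_norm_nonneg [simp]: "0 \<le> L2_norm M f"
  by (simp add: L2_norm_def)

lemma L2_norm_square: "(L2_norm M f)\<^sup>2 = (\<integral>x. (cmod (f x))\<^sup>2 \<partial>M)"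
  by (simp add: L2_norm_def)

lemma L2_dominated:
  assumes "f \<in> L2_functions M" "g \<in> borel_measurable M" "c \<ge> 0" "\<And>x. cmod (g x) \<le> c * cmod (f x)"
  shows "g \<in> L2_functions M" "L2_norm M g \<le> c * L2_norm M f"
proof -
  note f = L2_functionsD[OF assms(1)]
  have le: "(cmod (g x))\<^sup>2 \<le> c\<^sup>2 * (cmod (f x))\<^sup>2" for x
    using power_mono[OF assms(4)[of x], of 2] by (simp add: power_mult_distrib)
  have i: "integrable M (\<lambda>x. (cmod (g x))\<^sup>2)"
    by (rule Bochner_Integration.integrable_bound[OF integrable_mult_right[OF f(2), of "c\<^sup>2"]])
       (use assms(2) le in auto)
  then show "g \<in> L2_functions M" using assms(2) by (simp add: L2_functions_def)
  have "(\<integral>x. (cmod (g x))\<^sup>2 \<partial>M) \<le> (\<integral>x. c\<^sup>2 * (cmod (f x))\<^sup>2 \<partial>M)"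
    by (intro integral_mono i integrable_mult_right f le)
  then have "(L2_norm M g)\<^sup>2 \<le> (c * L2_norm M f)\<^sup>2"
    by (simp add: L2_norm_square power_mult_distrib)
  then show "L2_norm M g \<le> c * L2_norm M f"
    by (rule power2_le_imp_le) (use assms(3) in simp)
qed

lemma L2_scale:
  assumes "f \<in> L2_functions M"
  shows "(\<lambda>x. c * f x) \<in> L2_functions M" "L2_norm M (\<lambda>x. c * f x) = cmod c * L2_norm M f"
proof -
  show "(\<lambda>x. c * f x) \<in> L2_functions M"
    by (rule L2_dominated(1)[OF assms, of _ "cmod c"]) (use L2_functionsD(1)[OF assms] in \<open>auto simp: norm_mult intro: borel_measurable_times\<close>)
  show "L2_norm M (\<lambda>x. c * f x) = cmod c * L2_norm M f"
    by (simp add: L2_norm_def norm_mult power_mult_distrib real_sqrt_mult)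
qed

lemma L2_cnj:
  assumes "f \<in> L2_functions M"
  shows "(\<lambda>x. cnj (f x)) \<in> L2_functions M" "L2_norm M (\<lambda>x. cnj (f x)) = L2_norm M f"
  using assms measurable_compose[OF _ borel_measurable_continuous_onI[OF continuous_on_cnj[OF continuous_on_id]]]
  by (auto simp: L2_functions_def L2_norm_def)

text \<open>
  The Cauchy-Schwarz inequality for extended non-negative integrals shows integrability and the
  bound at the same time.
\<close>

lemma L2_product:
  assumes f: "f \<in> L2_functions M" and g: "g \<in> L2_functions M"
  shows "integrable M (\<lambda>x. f x * g x)" "(\<integral>x. cmod (f x) * cmod (g x) \<partial>M) \<le> L2_norm M f * L2_norm M g"
    "cmod (\<integral>x. f x * g x \<partial>M) \<le> L2_norm M f * L2_norm M g"
proof -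
  note fD = L2_functionsD[OF f] and gD = L2_functionsD[OF g]
  have [measurable]: "f \<in> borel_measurable M" "g \<in> borel_measurable M" using fD gD by auto
  have sq: "(\<integral>\<^sup>+x. ennreal (cmod (h x)) ^ 2 \<partial>M) = ennreal ((L2_norm M h)\<^sup>2)" if "h \<in> L2_functions M" for h
    using nn_integral_eq_integral[OF L2_functionsD(2)[OF that]] by (simp add: L2_norm_square ennreal_power)
  define I where "I = (\<integral>\<^sup>+x. ennreal (cmod (f x)) * ennreal (cmod (g x)) \<partial>M)"
  have "I\<^sup>2 \<le> ennreal ((L2_norm M f)\<^sup>2) * ennreal ((L2_norm M g)\<^sup>2)"
    unfolding I_def sq[OF f, symmetric] sq[OF g, symmetric] by (rule Cauchy_Schwarz_nn_integral) auto
  then have I2: "I\<^sup>2 \<le> ennreal ((L2_norm M f * L2_norm M g)\<^sup>2)"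
    by (simp add: ennreal_mult[symmetric] power_mult_distrib)
  have "I \<noteq> \<infinity>" using I2 by (auto simp: power2_eq_square top_unique)
  then obtain r where r: "I = ennreal r" "r \<ge> 0" by (cases I) auto
  then have "r\<^sup>2 \<le> (L2_norm M f * L2_norm M g)\<^sup>2"
    using I2 by (simp add: ennreal_power)
  then have rle: "r \<le> L2_norm M f * L2_norm M g" by (rule power2_le_imp_le) simp
  have I_eq: "I = (\<integral>\<^sup>+x. ennreal (cmod (f x * g x)) \<partial>M)"
    unfolding I_def by (simp add: norm_mult ennreal_mult)
  show int: "integrable M (\<lambda>x. f x * g x)"
    by (rule integrableI_bounded) (use r in \<open>auto simp: I_eq[symmetric]\<close>)
  have "ennreal (\<integral>x. cmod (f x * g x) \<partial>M) = ennreal r"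
    using nn_integral_eq_integral[OF integrable_norm[OF int]] I_eq r(1) by simp
  then have eq: "(\<integral>x. cmod (f x * g x) \<partial>M) = r"
    using r(2) by (simp add: integral_nonneg_AE)
  then show "(\<integral>x. cmod (f x) * cmod (g x) \<partial>M) \<le> L2_norm M f * L2_norm M g"
    using rle by (simp add: norm_mult)
  show "cmod (\<integral>x. f x * g x \<partial>M) \<le> L2_norm M f * L2_norm M g"
    using integral_norm_bound[of M "\<lambda>x. f x * g x"] eq rle by simp
qed

lemma L2_add:
  assumes f: "f \<in> L2_functions M" and g: "g \<in> L2_functions M"
  shows "(\<lambda>x. f x + g x) \<in> L2_functions M" "L2_norm M (\<lambda>x. f x + g x) \<le> L2_norm M f + L2_norm M g"
proof -
  note fD = L2_functionsD[OF f] and gD = L2_functionsD[OF g]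
  have [measurable]: "f \<in> borel_measurable M" "g \<in> borel_measurable M" using fD gD by auto
  have le: "(cmod (f x + g x))\<^sup>2 \<le> (cmod (f x))\<^sup>2 + 2 * cmod (f x * g x) + (cmod (g x))\<^sup>2" for x
    using power_mono[OF norm_triangle_ineq[of "f x" "g x"], of 2] by (simp add: power2_sum norm_mult)
  have int: "integrable M (\<lambda>x. (cmod (f x))\<^sup>2 + 2 * cmod (f x * g x) + (cmod (g x))\<^sup>2)"
    using fD gD L2_product(1)[OF f g] by (intro Bochner_Integration.integrable_add integrable_mult_right integrable_norm) auto
  have i: "integrable M (\<lambda>x. (cmod (f x + g x))\<^sup>2)"
    by (rule Bochner_Integration.integrable_bound[OF int])
       (auto intro!: AE_I2 order_trans[OF _ abs_ge_self] le)
  then show "(\<lambda>x. f x + g x) \<in> L2_functions M" by (simp add: L2_functions_def)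
  have "(\<integral>x. (cmod (f x + g x))\<^sup>2 \<partial>M) \<le> (\<integral>x. (cmod (f x))\<^sup>2 + 2 * cmod (f x * g x) + (cmod (g x))\<^sup>2 \<partial>M)"
    by (intro integral_mono i int le)
  also have "\<dots> = (L2_norm M f)\<^sup>2 + 2 * (\<integral>x. cmod (f x) * cmod (g x) \<partial>M) + (L2_norm M g)\<^sup>2"
    using fD gD integrable_norm[OF L2_product(1)[OF f g]] by (simp add: L2_norm_square norm_mult)
  also have "\<dots> \<le> (L2_norm M f + L2_norm M g)\<^sup>2"
    using L2_product(2)[OF f g] by (simp add: power2_sum)
  finally have "(L2_norm M (\<lambda>x. f x + g x))\<^sup>2 \<le> (L2_norm M f + L2_norm M g)\<^sup>2" by (simp add: L2_norm_square)
  then show "L2_norm M (\<lambda>x. f x + g x) \<le> L2_norm M f + L2_norm M g"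
    by (rule power2_le_imp_le) simp
qed

lemma L2_diff:
  assumes f: "f \<in> L2_functions M" and g: "g \<in> L2_functions M"
  shows "(\<lambda>x. f x - g x) \<in> L2_functions M" "L2_norm M (\<lambda>x. f x - g x) \<le> L2_norm M f + L2_norm M g"
  using L2_add[OF f L2_scale(1)[OF g, of "-1"]] L2_scale(2)[OF g, of "-1"] by simp_all

lemma L2_norm_commute: "L2_norm M (\<lambda>x. f x - g x) = L2_norm M (\<lambda>x. g x - f x)"
  by (simp add: L2_norm_def norm_minus_commute)

lemma L2_dist_triangle:
  assumes "f \<in> L2_functions M" "g \<in> L2_functions M" "h \<in> L2_functions M"
  shows "L2_norm M (\<lambda>x. f x - h x) \<le> L2_norm M (\<lambda>x. f x - g x) + L2_norm M (\<lambda>x. g x - h x)"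
  using L2_add(2)[OF L2_diff(1)[OF assms(1,2)] L2_diff(1)[OF assms(2,3)]] by simp

lemma L2_indicator:
  assumes "E \<in> sets M" "emeasure M E < \<infinity>"
  shows "(\<lambda>x. complex_of_real (indicator E x)) \<in> L2_functions M"
proof -
  have "integrable M (\<lambda>x. (cmod (complex_of_real (indicator E x)))\<^sup>2)"
  proof -
    have "(\<lambda>x. (cmod (complex_of_real (indicator E x)))\<^sup>2) = indicator E"
      by (auto simp: indicator_def)
    then show ?thesis using integrable_real_indicator[OF assms] by simp
  qed
  then show ?thesis using assms(1) by (simp add: L2_functions_def)
qed

section \<open>Compactly supported functions on a locally compact group\<close>

definition compactly_supported :: "('g::topological_space \<Rightarrow> complex) set" where
  "compactly_supported = {f. continuous_on UNIV f \<and> (\<exists>K. compact K \<and> (\<forall>x. x \<notin> K \<longrightarrow> f x = 0))}"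

lemma compactly_supportedE:
  assumes "f \<in> compactly_supported"
  obtains K where "continuous_on UNIV f" "compact K" "\<And>x. x \<notin> K \<Longrightarrow> f x = 0"
  using assms by (auto simp: compactly_supported_def)

lemma compactly_supportedI:
  "continuous_on UNIV f \<Longrightarrow> compact K \<Longrightarrow> (\<And>x. x \<notin> K \<Longrightarrow> f x = 0) \<Longrightarrow> f \<in> compactly_supported"
  by (auto simp: compactly_supported_def)

lemma compactly_supported_bounded:
  assumes "f \<in> compactly_supported"
  obtains B where "B \<ge> 0" "\<And>x. cmod (f x) \<le> B"
proof -
  obtain K where K: "continuous_on UNIV f" "compact K" "\<And>x. x \<notin> K \<Longrightarrow> f x = 0"
    by (rule compactly_supportedE[OF assms]) blast
  have "compact (f ` K)"
    by (rule compact_continuous_image[OF continuous_on_subset[OF K(1)] K(2)]) simp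
  then obtain B where B: "\<forall>y\<in>f ` K. cmod y \<le> B" using compact_imp_bounded bounded_iff by blast
  have "cmod (f x) \<le> max B 0" for x
    using B K(3)[of x] by (cases "x \<in> K") auto
  then show thesis using that[of "max B 0"] by simp
qed

lemma compactly_supported_add:
  assumes "f \<in> compactly_supported" "g \<in> compactly_supported"
  shows "(\<lambda>x. f x + g x) \<in> compactly_supported"
proof -
  obtain K where K: "continuous_on UNIV f" "compact K" "\<And>x. x \<notin> K \<Longrightarrow> f x = 0"
    by (rule compactly_supportedE[OF assms(1)]) blast
  obtain L where L: "continuous_on UNIV g" "compact L" "\<And>x. x \<notin> L \<Longrightarrow> g x = 0"
    by (rule compactly_supportedE[OF assms(2)]) blast
  show ?thesis
    by (rule compactly_supportedI[OF continuous_on_add[OF K(1) L(1)] compact_Un[OF K(2) L(2)]]) (simp add: K(3) L(3))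
qed

lemma compactly_supported_mult:
  assumes "f \<in> compactly_supported" "continuous_on UNIV g"
  shows "(\<lambda>x. f x * g x) \<in> compactly_supported"
proof -
  obtain K where K: "continuous_on UNIV f" "compact K" "\<And>x. x \<notin> K \<Longrightarrow> f x = 0"
    by (rule compactly_supportedE[OF assms(1)]) blast
  show ?thesis
    by (rule compactly_supportedI[OF continuous_on_mult[OF K(1) assms(2)] K(2)]) (simp add: K(3))
qed

lemma compactly_supported_scale: "f \<in> compactly_supported \<Longrightarrow> (\<lambda>x. c * f x) \<in> compactly_supported"
  using compactly_supported_mult[of f "\<lambda>_. c"] by (simp add: mult.commute)

lemma compactly_supported_zero: "(\<lambda>x. 0) \<in> compactly_supported"
  by (rule compactly_supportedI[of _ "{}"]) auto

text \<open>
  The tube lemma around \<open>{0} \<times> K\<close>, with \<open>K\<close> the support, settles the points \<open>z\<close> of \<open>K\<close>. If only \<open>act v z\<close> lies in \<open>K\<close>, the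
  estimate is used at that point and with \<open>- v\<close>, which is why \<open>V\<close> is made symmetric. An abstract action serves
  for left and right translations alike.
\<close>

lemma uniformly_continuous_action:
  fixes act :: "'g::topological_group_add \<Rightarrow> 'g \<Rightarrow> 'g"
  assumes act: "continuous_on UNIV (\<lambda>(v, z). act v z)" "\<And>z. act 0 z = z" "\<And>v z. act v (act (- v) z) = z"
    and f: "f \<in> compactly_supported" and e: "e > 0"
  shows "\<exists>V. open V \<and> 0 \<in> V \<and> (\<forall>v\<in>V. \<forall>z. cmod (f (act v z) - f z) < e)"
proof -
  obtain K where K: "continuous_on UNIV f" "compact K" "\<And>x. x \<notin> K \<Longrightarrow> f x = 0"
    by (rule compactly_supportedE[OF f]) blast
  define W where "W = {p. cmod (f (act (fst p) (snd p)) - f (snd p)) < e}"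
  have c: "continuous_on UNIV (\<lambda>p. act (fst p) (snd p))"
    using act(1) by (simp add: case_prod_beta)
  have "continuous_on UNIV (\<lambda>p. cmod (f (act (fst p) (snd p)) - f (snd p)))"
    by (intro continuous_on_norm continuous_on_diff continuous_on_compose2[OF K(1) c]
        continuous_on_compose2[OF K(1) continuous_on_snd[OF continuous_on_id]]) auto
  then have "open W" unfolding W_def by (rule open_Collect_less) simp
  moreover have "{0} \<times> K \<subseteq> W" using e by (auto simp: W_def act(2))
  ultimately have "\<exists>X. 0 \<in> X \<and> open X \<and> X \<times> K \<subseteq> W"
    by (rule Elementary_Topology.tube_lemma[OF K(2)])
  then obtain X where X: "0 \<in> X" "open X" "X \<times> K \<subseteq> W" by blast
  define V where "V = X \<inter> uminus -` X"
  have "open V" unfolding V_def by (intro open_Int X(2) open_vimage continuous_intros)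
  moreover have "0 \<in> V" using X(1) by (simp add: V_def)
  moreover have "cmod (f (act v z) - f z) < e" if v: "v \<in> V" for v z
  proof (cases "z \<in> K")
    case True
    then have "(v, z) \<in> W" using v X(3) by (auto simp: V_def)
    then show ?thesis by (simp add: W_def)
  next
    case False
    show ?thesis
    proof (cases "act v z \<in> K")
      case True
      then have "(- v, act v z) \<in> W" using v X(3) by (auto simp: V_def)
      moreover have "act (- v) (act v z) = z" using act(3)[of "- v" z] by simp
      ultimately show ?thesis by (simp add: W_def norm_minus_commute)
    next
      case False
      then show ?thesis using \<open>z \<notin> K\<close> e by (simp add: K(3))
    qed
  qed
  ultimately show ?thesis by blast
qed

lemma uniformly_continuous_right:
  fixes f :: "'g::topological_group_add \<Rightarrow> complex"
  assumes "f \<in> compactly_supported" "e > 0"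
  shows "\<exists>V. open V \<and> 0 \<in> V \<and> (\<forall>v\<in>V. \<forall>z. cmod (f (z + v) - f z) < e)"
  by (rule uniformly_continuous_action[OF _ _ _ assms, of "\<lambda>v z. z + v"])
     (auto simp: case_prod_beta add.assoc intro!: continuous_intros)

lemma uniformly_continuous_left:
  fixes f :: "'g::topological_group_add \<Rightarrow> complex"
  assumes "f \<in> compactly_supported" "e > 0"
  shows "\<exists>V. open V \<and> 0 \<in> V \<and> (\<forall>v\<in>V. \<forall>z. cmod (f (v + z) - f z) < e)"
  by (rule uniformly_continuous_action[OF _ _ _ assms, of "\<lambda>v z. v + z"])
     (auto simp: case_prod_beta add.assoc[symmetric] intro!: continuous_intros)

locale locally_compact_group =
  fixes m :: "'g::{topological_group_add, t2_space} measure"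
  assumes locally_compact: "locally_compact_space (euclidean :: 'g topology)"
    and haar: "left_haar_measure m"
begin

lemma sets_haar: "sets m = sets borel"
  using haar by (simp add: left_haar_measure_def)

lemma space_haar: "space m = UNIV"
  using sets_eq_imp_space_eq[OF sets_haar] by simp

lemma measurable_haar: "borel_measurable m = borel_measurable borel"
  using measurable_cong_sets[OF sets_haar refl] by blast

lemma compact_finite: "compact K \<Longrightarrow> emeasure m K < \<infinity>"
  using haar by (simp add: left_haar_measure_def)

lemma haar_outer:
  "E \<in> sets borel \<Longrightarrow> emeasure m E = (INF U \<in> {U. open U \<and> E \<subseteq> U}. emeasure m U)"
  using haar unfolding left_haar_measure_def by blast

lemma haar_inner: "open U \<Longrightarrow> emeasure m U = (SUP K \<in> {K. compact K \<and> K \<subseteq> U}. emeasure m K)"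
  using haar unfolding left_haar_measure_def by blast

lemma translate_haar: "distr m m ((+) x) = m"
proof (rule measure_eqI)
  have meas: "(+) x \<in> measurable m m"
    by (subst measurable_cong_sets[OF sets_haar sets_haar])
       (intro borel_measurable_continuous_onI continuous_intros)
  fix A assume "A \<in> sets (distr m m ((+) x))"
  then have A: "A \<in> sets m" by simp
  have "(+) x -` A = (+) (- x) ` A"
  proof (intro set_eqI iffI)
    fix y assume "y \<in> (+) x -` A"
    then show "y \<in> (+) (- x) ` A" by (intro image_eqI[of _ _ "x + y"]) (auto simp: add.assoc[symmetric])
  qed (auto simp: add.assoc[symmetric])
  moreover have "emeasure m ((+) (- x) ` A) = emeasure m A"
    using haar A by (simp add: left_haar_measure_def)
  ultimately show "emeasure (distr m m ((+) x)) A = emeasure m A"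
    using emeasure_distr[OF meas A] space_haar by simp
qed simp

lemma translate_measurable_fun: "(\<lambda>y. x + y) \<in> measurable m m"
  by (subst measurable_cong_sets[OF sets_haar sets_haar])
     (intro borel_measurable_continuous_onI continuous_intros)

lemma translate_integrable_iff:
  fixes f :: "'g \<Rightarrow> 'b::{banach, second_countable_topology}"
  assumes "f \<in> borel_measurable m"
  shows "integrable m (\<lambda>y. f (x + y)) \<longleftrightarrow> integrable m f"
  using integrable_distr_eq[OF translate_measurable_fun assms] translate_haar by simp

lemma translate_integral:
  fixes f :: "'g \<Rightarrow> 'b::{banach, second_countable_topology}"
  assumes "f \<in> borel_measurable m"
  shows "(\<integral>y. f (x + y) \<partial>m) = (\<integral>y. f y \<partial>m)"
  using integral_distr[OF translate_measurable_fun assms] translate_haar by simp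

lemma translate_L2:
  assumes f: "f \<in> L2_functions m"
  shows "(\<lambda>y. f (x + y)) \<in> L2_functions m" "L2_norm m (\<lambda>y. f (x + y)) = L2_norm m f"
proof -
  have fm: "f \<in> borel_measurable m" and fm2: "(\<lambda>y. (cmod (f y))\<^sup>2) \<in> borel_measurable m"
    using L2_functionsD[OF f] by auto
  show "(\<lambda>y. f (x + y)) \<in> L2_functions m"
    using translate_integrable_iff[OF fm2, of x] measurable_compose[OF translate_measurable_fun fm] L2_functionsD(2)[OF f]
    by (simp add: L2_functions_def)
  show "L2_norm m (\<lambda>y. f (x + y)) = L2_norm m f"
    using translate_integral[OF fm2, of x] by (simp add: L2_norm_def)
qed

lemma compactly_supported_measurable: "f \<in> compactly_supported \<Longrightarrow> f \<in> borel_measurable m"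
  unfolding measurable_haar by (auto simp: compactly_supported_def intro: borel_measurable_continuous_onI)

lemma compactly_supported_integrable:
  assumes f: "f \<in> compactly_supported"
  shows "integrable m f"
proof -
  obtain K where K: "compact K" "\<And>x. x \<notin> K \<Longrightarrow> f x = 0"
    by (rule compactly_supportedE[OF f]) blast
  obtain B where B: "B \<ge> 0" "\<And>x. cmod (f x) \<le> B" by (rule compactly_supported_bounded[OF f]) blast
  have "integrable m (\<lambda>x. B * indicator K x :: real)"
    using compact_finite[OF K(1)] borel_compact[OF K(1)] by (intro integrable_mult_right integrable_real_indicator) (auto simp: sets_haar)
  then show ?thesis
    by (rule Bochner_Integration.integrable_bound[OF _ compactly_supported_measurable[OF f]])
       (use B K(2) in \<open>auto simp: indicator_def\<close>)
qed

lemma compactly_supported_L2: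
  assumes f: "f \<in> compactly_supported"
  shows "f \<in> L2_functions m"
proof -
  have c: "continuous_on UNIV (\<lambda>x. cnj (f x))"
    using f by (auto simp: compactly_supported_def intro!: continuous_intros)
  have "integrable m (\<lambda>x. f x * cnj (f x))"
    by (rule compactly_supported_integrable[OF compactly_supported_mult[OF f c]])
  then have "integrable m (\<lambda>x. cmod (f x * cnj (f x)))" by (rule integrable_norm)
  then show ?thesis
    using compactly_supported_measurable[OF f] by (simp add: L2_functions_def norm_mult power2_eq_square)
qed

lemma completely_regular: "completely_regular_space (euclidean :: 'g topology)"
  using locally_compact_regular_imp_completely_regular_space[OF locally_compact] Hausdorff_space_t2 by blast

lemma compact_neighbourhood:
  assumes "compact (K :: 'g set)"
  obtains V L where "open V" "compact L" "K \<subseteq> V" "V \<subseteq> L"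
proof -
  have "\<exists>U L. open U \<and> compact L \<and> x \<in> U \<and> U \<subseteq> L" for x :: 'g
    using locally_compact by (auto simp: locally_compact_space_def)
  then have "\<forall>x::'g. \<exists>U L. open U \<and> compact L \<and> x \<in> U \<and> U \<subseteq> L" by blast
  from choice[OF this] obtain U where "\<forall>x::'g. \<exists>L. open (U x) \<and> compact L \<and> x \<in> U x \<and> U x \<subseteq> L" by blast
  from choice[OF this] obtain L where UL: "\<And>x. open (U x)" "\<And>x. compact (L x)" "\<And>x. x \<in> U x" "\<And>x. U x \<subseteq> L x"
    by blast
  obtain D where D: "D \<subseteq> K" "finite D" "K \<subseteq> (\<Union>x\<in>D. U x)"
    by (rule compactE_image[OF assms, of K U]) (use UL in auto)
  show thesis
  proof (rule that[of "\<Union>x\<in>D. U x" "\<Union>x\<in>D. L x"])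
    show "compact (\<Union>x\<in>D. L x)" using D UL by (intro compact_UN) auto
    show "(\<Union>x\<in>D. U x) \<subseteq> (\<Union>x\<in>D. L x)" using UL(4) by (intro UN_mono) auto
  qed (use D UL in auto)
qed

text \<open>
  Intersecting \<open>U\<close> with a relatively compact neighbourhood of \<open>K\<close>
  makes the support compact.
\<close>

lemma urysohn_compactly_supported:
  assumes K: "compact (K :: 'g set)" and U: "open U" "K \<subseteq> U"
  obtains g where "g \<in> compactly_supported" "\<And>x. x \<in> K \<Longrightarrow> g x = 1" "\<And>x. x \<notin> U \<Longrightarrow> g x = 0" "\<And>x. cmod (g x) \<le> 1"
    "\<And>x. cmod (1 - g x) \<le> 1"
proof -
  obtain V L where VL: "open V" "compact L" "K \<subseteq> V" "V \<subseteq> L" by (rule compact_neighbourhood[OF K]) blast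
  have "closedin euclidean (- (U \<inter> V))" using closed_Compl[OF open_Int[OF U(1) VL(1)]] by simp
  moreover have "disjnt K (- (U \<inter> V))" using U VL by (auto simp: disjnt_def)
  ultimately obtain f where f: "continuous_map euclidean (top_of_set {0..1::real}) f" "f ` (- (U \<inter> V)) \<subseteq> {0}" "f ` K \<subseteq> {1}"
    using Urysohn_completely_regular_compact_closed[of 0 1 "euclidean :: 'g topology" K "- (U \<inter> V)"] completely_regular K
    by auto
  have fc: "continuous_on UNIV f" and f01: "\<And>x. f x \<in> {0..1}"
    using f(1) by (auto simp: continuous_map_in_subtopology)
  show thesis
  proof (rule that[of "\<lambda>x. complex_of_real (f x)"])
    show "(\<lambda>x. complex_of_real (f x)) \<in> compactly_supported"
    proof (rule compactly_supportedI[OF continuous_on_of_real[OF fc] VL(2)])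
      fix x assume "x \<notin> L"
      then have "x \<in> - (U \<inter> V)" using VL(4) by auto
      then show "complex_of_real (f x) = 0" using f(2) by auto
    qed
    show "cmod (complex_of_real (f x)) \<le> 1" for x using f01[of x] by simp
    show "cmod (1 - complex_of_real (f x)) \<le> 1" for x
    proof -
      have "1 - complex_of_real (f x) = complex_of_real (1 - f x)" by simp
      then show ?thesis using f01[of x] by (simp only: norm_of_real) simp
    qed
  qed (use f(2,3) in auto)
qed

text \<open>
  Outer regularity gives an open \<open>U\<close> around \<open>E\<close> and inner regularity a
  compact \<open>K\<close> in \<open>U\<close>, each up to measure \<open>e\<^sup>2 / 2\<close>.
  A Urysohn function for \<open>K\<close> and \<open>U\<close> differs from the indicator by at
  most 1, and only on \<open>U - K\<close> and \<open>U - E\<close>.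
\<close>

lemma approximate_indicator:
  assumes E: "E \<in> sets m" "emeasure m E < \<infinity>" and e: "e > 0"
  shows "\<exists>g\<in>compactly_supported. L2_norm m (\<lambda>x. complex_of_real (indicator E x) - g x) \<le> e"
proof -
  have e2: "e\<^sup>2 / 2 > 0" using e by simp
  have "emeasure m E < emeasure m E + ennreal (e\<^sup>2 / 2)" using E(2) e2 by (simp add: ennreal_add_left_cancel_less)
  moreover have "emeasure m E = (INF U \<in> {U. open U \<and> E \<subseteq> U}. emeasure m U)"
    using haar_outer E(1) sets_haar by blast
  ultimately obtain U where U: "open U" "E \<subseteq> U" "emeasure m U < emeasure m E + ennreal (e\<^sup>2 / 2)"
    by (auto simp: INF_less_iff)
  have Um: "U \<in> sets m" using U(1) by (simp add: sets_haar)
  have Ufin: "emeasure m U < \<infinity>" using U(3) E(2) by (auto intro: less_trans)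
  have dUE: "measure m (U - E) \<le> e\<^sup>2 / 2"
  proof -
    have "emeasure m U = ennreal (measure m U)" "emeasure m E = ennreal (measure m E)"
      using Ufin E(2) by (simp_all add: emeasure_eq_ennreal_measure)
    then have "measure m U < measure m E + e\<^sup>2 / 2"
      using U(3) e2 by (simp add: ennreal_plus[symmetric] ennreal_less_iff del: ennreal_plus)
    moreover have "measure m (U - E) = measure m U - measure m E"
      using Ufin U(2) Um E by (intro measure_Diff) auto
    ultimately show ?thesis by simp
  qed
  obtain K where K: "compact K" "K \<subseteq> U" "measure m (U - K) \<le> e\<^sup>2 / 2"
  proof (cases "measure m U \<le> e\<^sup>2 / 2")
    case True
    then show thesis using that[of "{}"] by simp
  next
    case False
    have "ennreal (measure m U - e\<^sup>2 / 2) < emeasure m U"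
      using False Ufin e by (simp add: emeasure_eq_ennreal_measure ennreal_less_iff)
    also have "emeasure m U = (SUP K \<in> {K. compact K \<and> K \<subseteq> U}. emeasure m K)"
      by (rule haar_inner[OF U(1)])
    finally obtain K where K: "compact K" "K \<subseteq> U" "ennreal (measure m U - e\<^sup>2 / 2) < emeasure m K"
      by (auto simp: less_SUP_iff)
    have Km: "K \<in> sets m" using borel_compact[OF K(1)] by (simp add: sets_haar)
    have "measure m U - e\<^sup>2 / 2 < measure m K"
      using K(3) compact_finite[OF K(1)] False by (simp add: emeasure_eq_ennreal_measure ennreal_less_iff)
    moreover have "measure m (U - K) = measure m U - measure m K"
      using Ufin K(2) Um Km by (intro measure_Diff) auto
    ultimately show thesis using that[OF K(1,2)] by simp
  qed
  have Km: "K \<in> sets m" using borel_compact[OF K(1)] by (simp add: sets_haar)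
  obtain g where g: "g \<in> compactly_supported" "\<And>x. x \<in> K \<Longrightarrow> g x = 1" "\<And>x. x \<notin> U \<Longrightarrow> g x = 0"
    "\<And>x. cmod (g x) \<le> 1" "\<And>x. cmod (1 - g x) \<le> 1"
    by (rule urysohn_compactly_supported[OF K(1) U(1) K(2)]) blast
  have d: "(\<lambda>x. complex_of_real (indicator E x) - g x) \<in> L2_functions m"
    by (rule L2_diff(1)[OF L2_indicator[OF E] compactly_supported_L2[OF g(1)]])
  have fin: "emeasure m (U - K) < \<infinity>" "emeasure m (U - E) < \<infinity>"
    using Ufin Um by (meson Diff_subset emeasure_mono le_less_trans)+
  have pt: "(cmod (complex_of_real (indicator E x) - g x))\<^sup>2 \<le> indicator (U - K) x + indicator (U - E) x" for x
  proof -
    have "(cmod (g x))\<^sup>2 \<le> 1" "(cmod (1 - g x))\<^sup>2 \<le> 1"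
      using g(4,5)[of x] by (simp_all add: power_le_one)
    then show ?thesis
      using g(2,3)[of x] U(2) K(2) by (auto simp: indicator_def)
  qed
  have "(L2_norm m (\<lambda>x. complex_of_real (indicator E x) - g x))\<^sup>2 \<le> (\<integral>x. indicator (U - K) x + indicator (U - E) x \<partial>m)"
    unfolding L2_norm_square using fin Um Km E
    by (intro integral_mono L2_functionsD[OF d] pt Bochner_Integration.integrable_add integrable_real_indicator) auto
  also have "\<dots> = measure m (U - K) + measure m (U - E)"
    using fin Um Km E by (subst Bochner_Integration.integral_add) (auto simp: space_haar)
  also have "\<dots> \<le> e\<^sup>2" using K(3) dUE by simp
  finally have "L2_norm m (\<lambda>x. complex_of_real (indicator E x) - g x) \<le> e"
    by (rule power2_le_imp_le) (use e in simp)
  then show ?thesis using g(1) by blast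
qed

lemma approximate_simple:
  assumes s: "simple_function m s" "s \<in> L2_functions m" and e: "e > 0"
  shows "\<exists>g\<in>compactly_supported. L2_norm m (\<lambda>x. s x - g x) \<le> e"
proof -
  define I where "I = range s - {0}"
  have fin: "finite I" using simple_functionD(1)[OF s(1)] by (simp add: I_def space_haar)
  have set: "s -` {y} \<in> sets m" for y
    using simple_functionD(2)[OF s(1), of "{y}"] by (simp add: space_haar)
  have finE: "emeasure m (s -` {y}) < \<infinity>" if y: "y \<in> I" for y
  proof -
    have i: "integrable m (\<lambda>x. inverse ((cmod y)\<^sup>2) * (cmod (s x))\<^sup>2)"
      by (intro integrable_mult_right L2_functionsD[OF s(2)])
    have "integrable m (indicator (s -` {y}) :: 'g \<Rightarrow> real)"
      by (rule Bochner_Integration.integrable_bound[OF i]) (use y set in \<open>auto simp: indicator_def I_def\<close>)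
    then show ?thesis using set by (simp add: integrable_indicator_iff space_haar)
  qed
  have eq: "s x = (\<Sum>y\<in>I. y * of_real (indicator (s -` {y}) x))" for x
  proof -
    have "(\<Sum>y\<in>I. y * of_real (indicator (s -` {y}) x)) = (\<Sum>y\<in>I. if y = s x then y else 0)"
      by (intro sum.cong) (auto simp: indicator_def)
    then show ?thesis using fin by (auto simp: I_def)
  qed
  have "\<exists>g\<in>compactly_supported. (\<lambda>x. \<Sum>y\<in>J. y * of_real (indicator (s -` {y}) x)) \<in> L2_functions m \<and>
      L2_norm m (\<lambda>x. (\<Sum>y\<in>J. y * of_real (indicator (s -` {y}) x)) - g x) \<le> e"
    if "J \<subseteq> I" "e > 0" for J and e :: real
  proof -
    have "finite J" using that(1) fin finite_subset by blast
    then show ?thesis using that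
    proof (induction J arbitrary: e rule: finite_induct)
      case empty
      then show ?case using compactly_supported_L2[OF compactly_supported_zero]
        by (intro bexI[OF _ compactly_supported_zero]) (simp add: L2_norm_def)
    next
      case (insert y J)
      let ?i = "\<lambda>x. complex_of_real (indicator (s -` {y}) x)"
      let ?S = "\<lambda>x. \<Sum>y\<in>J. y * of_real (indicator (s -` {y}) x)"
      have y: "y \<in> I" "y \<noteq> 0" using insert.prems(1) by (auto simp: I_def)
      obtain g where g: "g \<in> compactly_supported" "?S \<in> L2_functions m" "L2_norm m (\<lambda>x. ?S x - g x) \<le> e / 2"
        using insert.IH[of "e/2"] insert.prems by auto
      have "e / (2 * cmod y) > 0" using insert.prems(2) y(2) by simp
      from approximate_indicator[OF set finE[OF y(1)] this] obtain h where
        h: "h \<in> compactly_supported" "L2_norm m (\<lambda>x. ?i x - h x) \<le> e / (2 * cmod y)" by blast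
      have iL: "?i \<in> L2_functions m" by (rule L2_indicator[OF set finE[OF y(1)]])
      have d1: "(\<lambda>x. ?i x - h x) \<in> L2_functions m" by (rule L2_diff(1)[OF iL compactly_supported_L2[OF h(1)]])
      have d2: "(\<lambda>x. ?S x - g x) \<in> L2_functions m" by (rule L2_diff(1)[OF g(2) compactly_supported_L2[OF g(1)]])
      have "L2_norm m (\<lambda>x. y * (?i x - h x) + (?S x - g x)) \<le> cmod y * L2_norm m (\<lambda>x. ?i x - h x) + L2_norm m (\<lambda>x. ?S x - g x)"
        using L2_add(2)[OF L2_scale(1)[OF d1, of y] d2] L2_scale(2)[OF d1, of y] by simp
      also have "\<dots> \<le> cmod y * (e / (2 * cmod y)) + e / 2"
        by (intro add_mono mult_left_mono h g) auto
      also have "\<dots> = e" using y(2) by simp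
      finally have "L2_norm m (\<lambda>x. y * (?i x - h x) + (?S x - g x)) \<le> e" .
      moreover have "(\<lambda>x. y * h x + g x) \<in> compactly_supported"
        by (intro compactly_supported_add compactly_supported_scale h g)
      moreover have "(\<lambda>x. y * ?i x + ?S x) \<in> L2_functions m"
        by (intro L2_add(1) L2_scale(1) iL g(2))
      ultimately show ?case
        using insert.hyps by (intro bexI[of _ "\<lambda>x. y * h x + g x"]) (simp_all add: algebra_simps)
    qed
  qed
  from this[of I, OF order_refl e] show ?thesis unfolding eq[symmetric] by blast
qed

lemma approximate_L2:
  assumes f: "f \<in> L2_functions m" and e: "e > 0"
  shows "\<exists>g\<in>compactly_supported. L2_norm m (\<lambda>x. f x - g x) \<le> e"
proof -
  note fD = L2_functionsD[OF f]
  obtain F where F: "\<And>i. simple_function m (F i)" "\<And>x. (\<lambda>i. F i x) \<longlonglongrightarrow> f x" "\<And>i x. cmod (F i x) \<le> 2 * cmod (f x)"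
    using borel_measurable_implies_sequence_metric[OF fD(1), of 0] by (auto simp: space_haar)
  have Fm: "F i \<in> borel_measurable m" for i by (rule borel_measurable_simple_function[OF F(1)])
  have FL: "F i \<in> L2_functions m" for i by (rule L2_dominated(1)[OF f Fm, of 2]) (use F(3) in auto)
  have "(\<lambda>i. \<integral>x. (cmod (f x - F i x))\<^sup>2 \<partial>m) \<longlonglongrightarrow> (\<integral>x. 0 \<partial>m)"
  (* 9 is the square of 3, as |f - F i| is at most |f| + 2 |f|. *)
  proof (rule integral_dominated_convergence[where w = "\<lambda>x. 9 * (cmod (f x))\<^sup>2"])
    show "integrable m (\<lambda>x. 9 * (cmod (f x))\<^sup>2)" using fD by simp
    show "AE x in m. (\<lambda>i. (cmod (f x - F i x))\<^sup>2) \<longlonglongrightarrow> 0"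
    proof (rule AE_I2)
      fix x
      have "(\<lambda>i. (cmod (f x - F i x))\<^sup>2) \<longlonglongrightarrow> (cmod (f x - f x))\<^sup>2"
        by (intro tendsto_intros F(2))
      then show "(\<lambda>i. (cmod (f x - F i x))\<^sup>2) \<longlonglongrightarrow> 0" by simp
    qed
    show "AE x in m. norm ((cmod (f x - F i x))\<^sup>2) \<le> 9 * (cmod (f x))\<^sup>2" for i
    proof (rule AE_I2)
      fix x
      have "cmod (f x - F i x) \<le> 3 * cmod (f x)"
        using norm_triangle_ineq4[of "f x" "F i x"] F(3)[of i x] by linarith
      from power_mono[OF this, of 2] show "norm ((cmod (f x - F i x))\<^sup>2) \<le> 9 * (cmod (f x))\<^sup>2"
        by (simp add: power_mult_distrib)
    qed
  qed (use fD(1) Fm in measurable)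
  then have "(\<lambda>i. (L2_norm m (\<lambda>x. f x - F i x))\<^sup>2) \<longlonglongrightarrow> 0" by (simp add: L2_norm_square)
  then have "\<forall>\<^sub>F i in sequentially. (L2_norm m (\<lambda>x. f x - F i x))\<^sup>2 < (e / 2)\<^sup>2"
    by (rule order_tendstoD(2)) (use e in simp)
  then obtain i where "(L2_norm m (\<lambda>x. f x - F i x))\<^sup>2 < (e / 2)\<^sup>2" by (auto simp: eventually_sequentially)
  then have i: "L2_norm m (\<lambda>x. f x - F i x) < e / 2" by (rule power2_less_imp_less) (use e in simp)
  obtain g where g: "g \<in> compactly_supported" "L2_norm m (\<lambda>x. F i x - g x) \<le> e / 2"
    using approximate_simple[OF F(1) FL, of "e/2" i] e by auto
  have "L2_norm m (\<lambda>x. f x - g x) \<le> e"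
    using L2_dist_triangle[OF f FL[of i] compactly_supported_L2[OF g(1)]] i g(2) by linarith
  then show ?thesis using g(1) by blast
qed

text \<open>
  Telescoping through approximations \<open>g n\<close> with error at most \<open>N / 2 ^
  n\<close>, where \<open>N\<close> is the norm of \<open>f\<close>: the differences have norm
  at most \<open>3/2 * N / 2 ^ i\<close>, which sums up to \<open>3 * N\<close>.
\<close>

lemma L2_expansion:
  assumes f: "f \<in> L2_functions m"
  obtains p where "\<And>i. p i \<in> compactly_supported" "summable (\<lambda>i. L2_norm m (p i))"
    "(\<Sum>i. L2_norm m (p i)) \<le> 3 * L2_norm m f"
    "(\<lambda>n. L2_norm m (\<lambda>x. f x - (\<Sum>i<n. p i x))) \<longlonglongrightarrow> 0"
proof -
  let ?N = "L2_norm m f"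
  have "\<exists>g\<in>compactly_supported. L2_norm m (\<lambda>x. f x - g x) \<le> ?N * (1/2) ^ n" for n :: nat
  proof (cases "?N = 0")
    case True
    then show ?thesis by (intro bexI[OF _ compactly_supported_zero]) simp
  next
    case False
    then have "?N > 0" using L2_norm_nonneg[of m f] by linarith
    then have "?N * (1/2) ^ n > 0" by simp
    then show ?thesis by (rule approximate_L2[OF f])
  qed
  then have "\<forall>n::nat. \<exists>g. g \<in> compactly_supported \<and> L2_norm m (\<lambda>x. f x - g x) \<le> ?N * (1/2) ^ n"
    unfolding Bex_def by (rule allI)
  from choice[OF this] obtain G where "\<forall>n::nat. G n \<in> compactly_supported \<and>
      L2_norm m (\<lambda>x. f x - G n x) \<le> ?N * (1/2) ^ n" ..
  then have G: "\<And>n::nat. G n \<in> compactly_supported" "\<And>n. L2_norm m (\<lambda>x. f x - G n x) \<le> ?N * (1/2) ^ n"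
    by auto
  (* Starting from 0 lets the differences add up to f itself; the error N is then the norm of f.
     *)
  define g where "g n = (if n = 0 then (\<lambda>x. 0) else G n)" for n
  have g: "g n \<in> compactly_supported" "L2_norm m (\<lambda>x. f x - g n x) \<le> ?N * (1/2) ^ n" for n
    using G compactly_supported_zero by (auto simp: g_def)
  note gL = compactly_supported_L2[OF g(1)]
  define p where "p i = (\<lambda>x. g (Suc i) x - g i x)" for i
  have p: "p i \<in> compactly_supported" for i
    using compactly_supported_add[OF g(1)[of "Suc i"] compactly_supported_scale[OF g(1)[of i], of "-1"]]
    by (simp add: p_def)
  have tele: "(\<Sum>i<n. p i x) = g n x" for n x
    unfolding p_def by (subst sum_lessThan_telescope) (simp add: g_def)
  have le: "L2_norm m (p i) \<le> (3/2 * ?N) * (1/2) ^ i" for i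
  proof -
    have "L2_norm m (p i) \<le> L2_norm m (\<lambda>x. g (Suc i) x - f x) + L2_norm m (\<lambda>x. f x - g i x)"
      unfolding p_def by (rule L2_dist_triangle[OF gL f gL])
    also have "\<dots> \<le> ?N * (1/2) ^ Suc i + ?N * (1/2) ^ i"
      using g(2)[of "Suc i"] g(2)[of i] L2_norm_commute[of m f "g (Suc i)"] by linarith
    finally show ?thesis by simp
  qed
  have geo: "(\<lambda>i. (3/2 * ?N) * (1/2) ^ i) sums (3 * ?N)"
    using sums_mult[OF geometric_sums[of "1/2::real"], of "3/2 * ?N"] by simp
  have sm: "summable (\<lambda>i. L2_norm m (p i))"
    by (rule summable_comparison_test'[OF sums_summable[OF geo], of 0]) (use le in auto)
  show thesis
  proof (rule that[OF p sm])
    show "(\<Sum>i. L2_norm m (p i)) \<le> 3 * ?N"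
      using suminf_le[OF le sm sums_summable[OF geo]] geo by (simp add: sums_iff)
    have "(\<lambda>n. ?N * (1/2::real) ^ n) \<longlonglongrightarrow> ?N * 0" by (intro tendsto_mult tendsto_const LIMSEQ_power_zero) simp
    then have lim: "(\<lambda>n. ?N * (1/2::real) ^ n) \<longlonglongrightarrow> 0" by simp
    show "(\<lambda>n. L2_norm m (\<lambda>x. f x - (\<Sum>i<n. p i x))) \<longlonglongrightarrow> 0"
      unfolding tele
      by (rule Lim_null_comparison[OF _ lim]) (use g(2) in auto)
  qed
qed

end

section \<open>The Fourier algebra\<close>

context atomic_series
begin

text \<open>
  Used to compare the Fourier algebra with the space built from compactly supported functions.
\<close>

lemma inclusion:
  assumes Y: "banach_function_space Y" and K: "K \<ge> 0"
    and atoms: "\<And>p. p \<in> S \<Longrightarrow> e p \<in> carrier Y \<and> vnorm Y (e p) \<le> K * w p"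
    and t: "t \<in> carrier space"
  shows "t \<in> carrier Y \<and> vnorm Y t \<le> K * vnorm space t"
proof (rule norm_map_le[OF Y t K])
  fix p assume p: "represents p t"
  have "e (p n) \<in> carrier Y \<and> vnorm Y (e (p n)) \<le> K * w (p n)" for n
    by (rule atoms[OF representsD(1)[OF p]])
  moreover have "t = (\<lambda>z. \<Sum>n. e (p n) z)" using representsD(3)[OF p] by auto
  ultimately show "\<exists>q. (\<forall>n. q n \<in> carrier Y \<and> vnorm Y (q n) \<le> K * w (p n)) \<and> t = (\<lambda>z. \<Sum>n. q n z)"
    by (intro exI[of _ "\<lambda>n. e (p n)"]) simp
qed

text \<open>
  A space of series is an algebra as soon as products of two atoms are bounded; one factor at a
  time is expanded into atoms.
\<close>

lemma product_closed_norm: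
  assumes K: "K \<ge> 0"
    and atoms: "\<And>p q. p \<in> S \<Longrightarrow> q \<in> S \<Longrightarrow>
      (\<lambda>z. e p z * e q z) \<in> carrier space \<and> vnorm space (\<lambda>z. e p z * e q z) \<le> K * w p * w q"
    and s: "s \<in> carrier space" and t: "t \<in> carrier space"
  shows "(\<lambda>z. s z * t z) \<in> carrier space \<and> vnorm space (\<lambda>z. s z * t z) \<le> K * vnorm space s * vnorm space t"
proof -
  note bfs = banach_function_space_axioms
  have one: "(\<lambda>z. s z * e q z) \<in> carrier space \<and> vnorm space (\<lambda>z. s z * e q z) \<le> (K * w q) * vnorm space s"
    if q: "q \<in> S" for q
  proof (rule norm_map_le[OF bfs s])
    show "0 \<le> K * w q" using K weight_nonneg[OF q] by simp
    fix p assume p: "represents p s"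
    have "(\<lambda>z. s z * e q z) = (\<lambda>z. \<Sum>n. e (p n) z * e q z)"
      using summable_norm_cancel[OF summable_atoms[OF representsD(1,2)[OF p]]]
      by (simp add: representsD(3)[OF p] suminf_mult2)
    moreover have "(\<lambda>z. e (p n) z * e q z) \<in> carrier space \<and>
        vnorm space (\<lambda>z. e (p n) z * e q z) \<le> (K * w q) * w (p n)" for n
      using atoms[OF representsD(1)[OF p, of n] q] by (simp add: mult_ac)
    ultimately show "\<exists>r. (\<forall>n. r n \<in> carrier space \<and> vnorm space (r n) \<le> (K * w q) * w (p n)) \<and>
        (\<lambda>z. s z * e q z) = (\<lambda>z. \<Sum>n. r n z)"
      by (intro exI[of _ "\<lambda>n z. e (p n) z * e q z"]) simp
  qed
  show ?thesis
  proof (rule norm_map_le[OF bfs t])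
    show "0 \<le> K * vnorm space s" using K norm_nonneg[OF s] by simp
    fix p assume p: "represents p t"
    have "(\<lambda>z. s z * t z) = (\<lambda>z. \<Sum>n. s z * e (p n) z)"
      using summable_norm_cancel[OF summable_atoms[OF representsD(1,2)[OF p]]]
      by (simp add: representsD(3)[OF p] suminf_mult)
    moreover have "(\<lambda>z. s z * e (p n) z) \<in> carrier space \<and>
        vnorm space (\<lambda>z. s z * e (p n) z) \<le> (K * vnorm space s) * w (p n)" for n
      using one[OF representsD(1)[OF p, of n]] by (simp add: mult_ac)
    ultimately show "\<exists>r. (\<forall>n. r n \<in> carrier space \<and> vnorm space (r n) \<le> (K * vnorm space s) * w (p n)) \<and>
        (\<lambda>z. s z * t z) = (\<lambda>z. \<Sum>n. r n z)"
      by (intro exI[of _ "\<lambda>n z. s z * e (p n) z"]) simp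
  qed
qed

end

text \<open>
  A measurable choice of a member of a finite cover: among the members that contain the point,
  the one that comes first in a fixed order is chosen.
\<close>

lemma finite_tags:
  fixes A :: "'a \<Rightarrow> 'g::topological_space set"
  assumes "finite T" "\<And>t. t \<in> T \<Longrightarrow> A t \<in> sets borel"
  shows "\<exists>\<tau>. (\<forall>t. {w. \<tau> w = t} \<in> sets borel) \<and> (\<forall>w\<in>(\<Union>t\<in>T. A t). \<tau> w \<in> T \<and> w \<in> A (\<tau> w))"
  using assms
proof (induction T rule: finite_induct)
  case empty
  have "{w :: 'g. (undefined :: 'a) = t} \<in> sets borel" for t by simp
  then show ?case by (intro exI[of _ "\<lambda>_. undefined"]) simp
next
  case (insert s T)
  then obtain \<tau> where \<tau>: "\<And>t. {w. \<tau> w = t} \<in> sets borel" "\<And>w. w \<in> (\<Union>t\<in>T. A t) \<Longrightarrow> \<tau> w \<in> T \<and> w \<in> A (\<tau> w)"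
    by (metis insertI2)
  define \<sigma> where "\<sigma> w = (if w \<in> A s then s else \<tau> w)" for w
  have As: "A s \<in> sets borel" using insert.prems by simp
  have "{w. \<sigma> w = t} = (if t = s then A s \<union> ({w. \<tau> w = t} - A s) else {w. \<tau> w = t} - A s)" for t
    by (auto simp: \<sigma>_def)
  then have "{w. \<sigma> w = t} \<in> sets borel" for t using As \<tau>(1) by auto
  moreover have "\<sigma> w \<in> insert s T \<and> w \<in> A (\<sigma> w)" if "w \<in> (\<Union>t\<in>insert s T. A t)" for w
    using \<tau>(2)[of w] that by (auto simp: \<sigma>_def)
  ultimately show ?case by blast
qed

context locally_compact_group
begin

subsection \<open>Coefficient functions\<close>

lemma coefficient_integrable:
  assumes "f \<in> L2_functions m" "h \<in> L2_functions m"
  shows "integrable m (\<lambda>y. f (- x + y) * cnj (h y))"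
  by (rule L2_product(1)[OF translate_L2(1)[OF assms(1)] L2_cnj(1)[OF assms(2)]])

lemma coefficient_bound:
  assumes "f \<in> L2_functions m" "h \<in> L2_functions m"
  shows "cmod (regular_coefficient m f h x) \<le> L2_norm m f * L2_norm m h"
  unfolding regular_coefficient_def
  using L2_product(3)[OF translate_L2(1)[OF assms(1), of "- x"] L2_cnj(1)[OF assms(2)]]
    translate_L2(2)[OF assms(1)] L2_cnj(2)[OF assms(2)] by simp

lemma coefficient_add_left:
  assumes "f \<in> L2_functions m" "f' \<in> L2_functions m" "h \<in> L2_functions m"
  shows "regular_coefficient m (\<lambda>y. f y + f' y) h x = regular_coefficient m f h x + regular_coefficient m f' h x"
  unfolding regular_coefficient_def
  using coefficient_integrable[OF assms(1,3), of x] coefficient_integrable[OF assms(2,3), of x]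
  by (simp add: distrib_right)

lemma coefficient_add_right:
  assumes "f \<in> L2_functions m" "h \<in> L2_functions m" "h' \<in> L2_functions m"
  shows "regular_coefficient m f (\<lambda>y. h y + h' y) x = regular_coefficient m f h x + regular_coefficient m f h' x"
  unfolding regular_coefficient_def
  using coefficient_integrable[OF assms(1,2), of x] coefficient_integrable[OF assms(1,3), of x]
  by (simp add: distrib_left)

lemma coefficient_scale_left: "regular_coefficient m (\<lambda>y. c * f y) h x = c * regular_coefficient m f h x"
  unfolding regular_coefficient_def by (simp add: mult.assoc)

lemma coefficient_scale_right: "regular_coefficient m f (\<lambda>y. c * h y) x = cnj c * regular_coefficient m f h x"
  unfolding regular_coefficient_def by (simp add: mult.left_commute)

lemma coefficient_diff_left:
  assumes "f \<in> L2_functions m" "f' \<in> L2_functions m" "h \<in> L2_functions m"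
  shows "regular_coefficient m (\<lambda>y. f y - f' y) h x = regular_coefficient m f h x - regular_coefficient m f' h x"
  using coefficient_add_left[OF assms(1) L2_scale(1)[OF assms(2), of "-1"] assms(3)]
    coefficient_scale_left[of "-1" f' h x] by simp

lemma coefficient_diff_right:
  assumes "f \<in> L2_functions m" "h \<in> L2_functions m" "h' \<in> L2_functions m"
  shows "regular_coefficient m f (\<lambda>y. h y - h' y) x = regular_coefficient m f h x - regular_coefficient m f h' x"
  using coefficient_add_right[OF assms(1,2) L2_scale(1)[OF assms(3), of "-1"]]
    coefficient_scale_right[of f "-1" h' x] by simp

lemma L2_sum:
  assumes "\<And>i. p i \<in> L2_functions m" shows "(\<lambda>y. \<Sum>i<(n::nat). p i y) \<in> L2_functions m"
proof (induction n)
  case 0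
  then show ?case using compactly_supported_L2[OF compactly_supported_zero] by simp
next
  case (Suc n)
  then show ?case using L2_add(1)[OF Suc assms] by simp
qed

lemma coefficient_sum_left:
  assumes "\<And>i. p i \<in> L2_functions m" "h \<in> L2_functions m"
  shows "regular_coefficient m (\<lambda>y. \<Sum>i<(n::nat). p i y) h x = (\<Sum>i<n. regular_coefficient m (p i) h x)"
proof (induction n)
  case 0
  then show ?case by (simp add: regular_coefficient_def)
next
  case (Suc n)
  then show ?case using coefficient_add_left[OF L2_sum[OF assms(1)] assms(1,2)] by simp
qed

lemma coefficient_sum_right:
  assumes "\<And>i. p i \<in> L2_functions m" "f \<in> L2_functions m"
  shows "regular_coefficient m f (\<lambda>y. \<Sum>i<(n::nat). p i y) x = (\<Sum>i<n. regular_coefficient m f (p i) x)"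
proof (induction n)
  case 0
  then show ?case by (simp add: regular_coefficient_def)
next
  case (Suc n)
  have "regular_coefficient m f (\<lambda>y. (\<Sum>i<n. p i y) + p n y) x =
      regular_coefficient m f (\<lambda>y. \<Sum>i<n. p i y) x + regular_coefficient m f (p n) x"
    by (rule coefficient_add_right[OF assms(2) L2_sum[OF assms(1)] assms(1)])
  then show ?case using Suc by simp
qed

abbreviation "atom_weight \<equiv> \<lambda>(f, h). L2_norm m f * L2_norm m h"
abbreviation "atom_value \<equiv> \<lambda>(f, h). regular_coefficient m f h"

lemma coefficient_atoms:
  assumes "S \<noteq> {}" "S \<subseteq> L2_functions m" "\<And>f c. f \<in> S \<Longrightarrow> (\<lambda>y. c * f y) \<in> S"
  shows "atomic_series (S \<times> S) atom_weight atom_value"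
proof
  show "S \<times> S \<noteq> {}" using assms(1) by auto
  show "0 \<le> atom_weight p" for p by (cases p) simp
  show "\<exists>C. \<forall>p\<in>S \<times> S. cmod (atom_value p z) \<le> C * atom_weight p" for z
    using coefficient_bound assms(2) by (intro exI[of _ 1]) (auto simp: subset_iff)
next
  fix p c assume "p \<in> S \<times> S"
  then obtain f h where p: "p = (f, h)" "f \<in> S" "h \<in> S" by auto
  have "L2_norm m (\<lambda>y. c * f y) = cmod c * L2_norm m f"
    by (rule L2_scale(2)) (use p(2) assms(2) in blast)
  then show "\<exists>q\<in>S \<times> S. atom_weight q = cmod c * atom_weight p \<and> atom_value q = (\<lambda>z. c * atom_value p z)"
    using p assms(3)[OF p(2)]
    by (intro bexI[of _ "(\<lambda>y. c * f y, h)"]) (auto simp: coefficient_scale_left)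
qed

text \<open>
  \<open>A.space\<close> is the Fourier algebra and \<open>C.space\<close> is the analogous
  space for continuous functions with compact support. The two coincide up to equivalence of
  norms, by \<open>coefficient_in_C\<close>, so that products and continuity need to be studied
  only for functions with compact support.
\<close>

sublocale A: atomic_series "L2_functions m \<times> L2_functions m" atom_weight atom_value
  by (rule coefficient_atoms) (use compactly_supported_L2[OF compactly_supported_zero] L2_scale(1) in auto)

sublocale C: atomic_series "compactly_supported \<times> compactly_supported" atom_weight atom_value
  by (rule coefficient_atoms)
     (use compactly_supported_zero compactly_supported_L2 compactly_supported_scale in auto)

lemma fourier_rep_iff: "fourier_rep m f h u \<longleftrightarrow> A.represents (\<lambda>n. (f n, h n)) u"
  by (auto simp: fourier_rep_def A.represents_def)

lemma fourier_represents_iff: "A.represents p u \<longleftrightarrow> fourier_rep m (\<lambda>n. fst (p n)) (\<lambda>n. snd (p n)) u"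
  by (simp add: fourier_rep_iff)

lemma fourier_algebra_simps:
  "carrier (fourier_algebra m) = carrier A.space" "vadd (fourier_algebra m) = vadd A.space"
  "vscale (fourier_algebra m) = vscale A.space" "vnorm (fourier_algebra m) = vnorm A.space"
  "vmult (fourier_algebra m) = (\<lambda>u v x. u x * v x)"
proof -
  show "carrier (fourier_algebra m) = carrier A.space"
  proof -
    have "(\<exists>f h. fourier_rep m f h u) \<longleftrightarrow> (\<exists>p. A.represents p u)" for u
      using fourier_rep_iff fourier_represents_iff by blast
    then show ?thesis by (simp add: fourier_algebra_def A.space_def)
  qed
  have "{(\<Sum>n. L2_norm m (f n) * L2_norm m (h n)) | f h. fourier_rep m f h u} =
      {(\<Sum>n. atom_weight (p n)) | p. A.represents p u}" for u
  proof (intro set_eqI iffI; clarsimp)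
    fix f h assume "fourier_rep m f h u"
    then show "\<exists>p. (\<Sum>n. L2_norm m (f n) * L2_norm m (h n)) = (\<Sum>n. atom_weight (p n)) \<and> A.represents p u"
      by (intro exI[of _ "\<lambda>n. (f n, h n)"]) (simp add: fourier_rep_iff)
  next
    fix p assume "A.represents p u"
    then show "\<exists>f h. (\<Sum>n. atom_weight (p n)) = (\<Sum>n. L2_norm m (f n) * L2_norm m (h n)) \<and> fourier_rep m f h u"
      by (intro exI[of _ "\<lambda>n. fst (p n)"] exI[of _ "\<lambda>n. snd (p n)"])
         (simp add: fourier_represents_iff case_prod_beta)
  qed
  then show "vnorm (fourier_algebra m) = vnorm A.space"
    by (simp add: fourier_algebra_def A.space_def)
qed (simp_all add: fourier_algebra_def A.space_def)

text \<open>
  Both functions are expanded into series of compactly supported ones, at the cost of a factor 3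
  each.
\<close>

lemma coefficient_in_C:
  assumes f: "f \<in> L2_functions m" and h: "h \<in> L2_functions m"
  shows "regular_coefficient m f h \<in> carrier C.space \<and>
    vnorm C.space (regular_coefficient m f h) \<le> 9 * (L2_norm m f * L2_norm m h)"
proof -
  have one: "regular_coefficient m f k \<in> carrier C.space \<and>
      vnorm C.space (regular_coefficient m f k) \<le> 3 * L2_norm m f * L2_norm m k"
    if k: "k \<in> compactly_supported" for k
  proof -
    obtain p where p: "\<And>i. p i \<in> compactly_supported" "summable (\<lambda>i. L2_norm m (p i))"
      "(\<Sum>i. L2_norm m (p i)) \<le> 3 * L2_norm m f" "(\<lambda>n. L2_norm m (\<lambda>x. f x - (\<Sum>i<n. p i x))) \<longlonglongrightarrow> 0"
      by (rule L2_expansion[OF f]) blast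
    note pL = compactly_supported_L2[OF p(1)] and kL = compactly_supported_L2[OF k]
    have a: "regular_coefficient m (p i) k \<in> carrier C.space"
      "vnorm C.space (regular_coefficient m (p i) k) \<le> L2_norm m (p i) * L2_norm m k" for i
      using C.atom_closed_norm[of "(p i, k)"] p(1) k by auto
    have smw: "summable (\<lambda>i. L2_norm m (p i) * L2_norm m k)" by (intro summable_mult2 p(2))
    have sm: "summable (\<lambda>i. vnorm C.space (regular_coefficient m (p i) k))"
      by (rule summable_comparison_test'[OF smw, of 0]) (use a C.norm_nonneg in auto)
    have "(\<lambda>i. regular_coefficient m (p i) k x) sums regular_coefficient m f k x" for x
    proof -
      have bd: "cmod (regular_coefficient m f k x - (\<Sum>i<n. regular_coefficient m (p i) k x)) \<le>
          L2_norm m (\<lambda>x. f x - (\<Sum>i<n. p i x)) * L2_norm m k" for n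
        using coefficient_bound[OF L2_diff(1)[OF f L2_sum[where p = p and n = n, OF pL]] kL, of x]
        by (simp add: coefficient_diff_left[OF f L2_sum[where p = p, OF pL] kL] coefficient_sum_left[where p = p, OF pL kL])
      have lim: "(\<lambda>n. L2_norm m (\<lambda>x. f x - (\<Sum>i<n. p i x)) * L2_norm m k) \<longlonglongrightarrow> 0"
        using tendsto_mult_right[OF p(4), of "L2_norm m k"] by simp
      have "\<forall>\<^sub>F n in sequentially. cmod (regular_coefficient m f k x - (\<Sum>i<n. regular_coefficient m (p i) k x)) \<le> L2_norm m (\<lambda>x. f x - (\<Sum>i<n. p i x)) * L2_norm m k"
        by (intro always_eventually allI bd)
      from Lim_null_comparison[OF this lim]
      have "(\<lambda>n. regular_coefficient m f k x - (\<Sum>i<n. regular_coefficient m (p i) k x)) \<longlonglongrightarrow> 0" .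
      from tendsto_diff[OF tendsto_const[of "regular_coefficient m f k x"] this] show ?thesis
        by (simp add: sums_def)
    qed
    then have eq: "regular_coefficient m f k = (\<lambda>x. \<Sum>i. regular_coefficient m (p i) k x)"
      by (auto simp: fun_eq_iff sums_iff)
    have "vnorm C.space (regular_coefficient m f k) \<le> (\<Sum>i. vnorm C.space (regular_coefficient m (p i) k))"
      unfolding eq by (rule C.norm_series_le[OF a(1) sm])
    also have "\<dots> \<le> (\<Sum>i. L2_norm m (p i) * L2_norm m k)" by (intro suminf_le a(2) sm smw)
    also have "\<dots> = (\<Sum>i. L2_norm m (p i)) * L2_norm m k" by (rule suminf_mult2[OF p(2), symmetric])
    also have "\<dots> \<le> 3 * L2_norm m f * L2_norm m k" by (intro mult_right_mono p(3)) simp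
    finally show ?thesis using C.series_closed[OF a(1) sm] by (simp add: eq[symmetric])
  qed
  obtain q where q: "\<And>i. q i \<in> compactly_supported" "summable (\<lambda>i. L2_norm m (q i))"
    "(\<Sum>i. L2_norm m (q i)) \<le> 3 * L2_norm m h" "(\<lambda>n. L2_norm m (\<lambda>x. h x - (\<Sum>i<n. q i x))) \<longlonglongrightarrow> 0"
    by (rule L2_expansion[OF h]) blast
  note qL = compactly_supported_L2[OF q(1)]
  have a: "regular_coefficient m f (q i) \<in> carrier C.space"
    "vnorm C.space (regular_coefficient m f (q i)) \<le> 3 * L2_norm m f * L2_norm m (q i)" for i
    using one[OF q(1)] by auto
  have smw: "summable (\<lambda>i. 3 * L2_norm m f * L2_norm m (q i))" by (intro summable_mult q(2))
  have sm: "summable (\<lambda>i. vnorm C.space (regular_coefficient m f (q i)))"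
    by (rule summable_comparison_test'[OF smw, of 0]) (use a C.norm_nonneg in auto)
  have "(\<lambda>i. regular_coefficient m f (q i) x) sums regular_coefficient m f h x" for x
  proof -
    have bd: "cmod (regular_coefficient m f h x - (\<Sum>i<n. regular_coefficient m f (q i) x)) \<le>
        L2_norm m f * L2_norm m (\<lambda>x. h x - (\<Sum>i<n. q i x))" for n
      using coefficient_bound[OF f L2_diff(1)[OF h L2_sum[where p = q and n = n, OF qL]], of x]
      by (simp add: coefficient_diff_right[OF f h L2_sum[where p = q, OF qL]] coefficient_sum_right[where p = q, OF qL f])
    have lim: "(\<lambda>n. L2_norm m f * L2_norm m (\<lambda>x. h x - (\<Sum>i<n. q i x))) \<longlonglongrightarrow> 0"
      using tendsto_mult_left[OF q(4), of "L2_norm m f"] by simp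
    have "\<forall>\<^sub>F n in sequentially. cmod (regular_coefficient m f h x - (\<Sum>i<n. regular_coefficient m f (q i) x)) \<le> L2_norm m f * L2_norm m (\<lambda>x. h x - (\<Sum>i<n. q i x))"
        by (intro always_eventually allI bd)
      from Lim_null_comparison[OF this lim]
      have "(\<lambda>n. regular_coefficient m f h x - (\<Sum>i<n. regular_coefficient m f (q i) x)) \<longlonglongrightarrow> 0" .
    from tendsto_diff[OF tendsto_const[of "regular_coefficient m f h x"] this] show ?thesis
      by (simp add: sums_def)
  qed
  then have eq: "regular_coefficient m f h = (\<lambda>x. \<Sum>i. regular_coefficient m f (q i) x)"
    by (auto simp: fun_eq_iff sums_iff)
  have "vnorm C.space (regular_coefficient m f h) \<le> (\<Sum>i. vnorm C.space (regular_coefficient m f (q i)))"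
    unfolding eq by (rule C.norm_series_le[OF a(1) sm])
  also have "\<dots> \<le> (\<Sum>i. 3 * L2_norm m f * L2_norm m (q i))" by (intro suminf_le a(2) sm smw)
  also have "\<dots> = 3 * L2_norm m f * (\<Sum>i. L2_norm m (q i))" by (rule suminf_mult[OF q(2)])
  also have "\<dots> \<le> 3 * L2_norm m f * (3 * L2_norm m h)" by (intro mult_left_mono q(3)) simp
  finally show ?thesis using C.series_closed[OF a(1) sm] by (simp add: eq[symmetric])
qed

subsection \<open>Riemann sums\<close>

text \<open>
  A Riemann sum over the compact set \<open>W\<close> is the integral of a function \<open>w
  \<mapsto> g (\<tau> w)\<close>, where \<open>\<tau>\<close> is measurable and takes values in
  the finite set \<open>T\<close>. The sets on which \<open>\<tau>\<close> is constant are the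
  cells of the partition, and the value of \<open>\<tau>\<close> is the tag of the cell. In this
  form Riemann sums are compared with each other and with the integral by comparing integrands,
  and common refinements are pairs of tag functions.
\<close>

definition tagging :: "'g set \<Rightarrow> ('g \<Rightarrow> 'j) \<Rightarrow> 'j set \<Rightarrow> bool" where
  "tagging W \<tau> T \<longleftrightarrow> compact W \<and> finite T \<and> (\<forall>t. {w. \<tau> w = t} \<in> sets borel) \<and> (\<forall>w\<in>W. \<tau> w \<in> T)"

definition cell :: "'g set \<Rightarrow> ('g \<Rightarrow> 'j) \<Rightarrow> 'j \<Rightarrow> real" where
  "cell W \<tau> t = measure m {w \<in> W. \<tau> w = t}"

lemma cell_nonneg: "0 \<le> cell W \<tau> t"
  by (simp add: cell_def)

lemma tag_integral:
  fixes g :: "'j \<Rightarrow> 'b::{banach, second_countable_topology}"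
  assumes "tagging W \<tau> T"
  shows "integrable m (\<lambda>w. indicator W w *\<^sub>R g (\<tau> w))"
    and "(\<integral>w. indicator W w *\<^sub>R g (\<tau> w) \<partial>m) = (\<Sum>t\<in>T. cell W \<tau> t *\<^sub>R g t)"
proof -
  have W: "compact W" and T: "finite T" and b: "\<And>t. {w. \<tau> w = t} \<in> sets borel" and \<tau>: "\<And>w. w \<in> W \<Longrightarrow> \<tau> w \<in> T"
    using assms by (auto simp: tagging_def)
  have eq: "indicator W w *\<^sub>R g (\<tau> w) = (\<Sum>t\<in>T. indicator {w \<in> W. \<tau> w = t} w *\<^sub>R g t)" for w
  proof (cases "w \<in> W")
    case True
    have "(\<Sum>t\<in>T. indicator {w \<in> W. \<tau> w = t} w *\<^sub>R g t) = (\<Sum>t\<in>T. if t = \<tau> w then g t else 0)"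
      by (intro sum.cong) (auto simp: indicator_def True)
    then show ?thesis using True T \<tau> by simp
  next
    case False
    then show ?thesis by simp
  qed
  have cm: "{w \<in> W. \<tau> w = t} \<in> sets m" for t
  proof -
    have "{w \<in> W. \<tau> w = t} = W \<inter> {w. \<tau> w = t}" by blast
    then show ?thesis using sets.Int[OF borel_compact[OF W] b[of t]] by (simp only: sets_haar)
  qed
  have fin: "emeasure m {w \<in> W. \<tau> w = t} < \<infinity>" for t
  proof -
    have "emeasure m {w \<in> W. \<tau> w = t} \<le> emeasure m W"
      using borel_compact[OF W] by (intro emeasure_mono) (auto simp: sets_haar)
    then show ?thesis using compact_finite[OF W] by (rule le_less_trans)
  qed
  have i: "integrable m (\<lambda>w. indicator {w \<in> W. \<tau> w = t} w *\<^sub>R g t)" for t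
    using integrable_real_indicator[OF cm fin] by (intro integrable_scaleR_left) auto
  show "integrable m (\<lambda>w. indicator W w *\<^sub>R g (\<tau> w))"
    unfolding eq using i by (intro Bochner_Integration.integrable_sum) auto
  show "(\<integral>w. indicator W w *\<^sub>R g (\<tau> w) \<partial>m) = (\<Sum>t\<in>T. cell W \<tau> t *\<^sub>R g t)"
    unfolding eq cell_def using i integrable_real_indicator[OF cm fin]
    by (subst Bochner_Integration.integral_sum) (auto simp: space_haar intro!: sum.cong)
qed

lemma cell_total: "tagging W \<tau> T \<Longrightarrow> (\<Sum>t\<in>T. cell W \<tau> t) = measure m W"
  using tag_integral(2)[of W \<tau> T "\<lambda>_. 1::real"] by (simp add: space_haar)

lemma tagging_pair:
  assumes "tagging W \<tau> T" "tagging W \<sigma> R"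
  shows "tagging W (\<lambda>w. (\<tau> w, \<sigma> w)) (T \<times> R)"
proof -
  have "{w. (\<tau> w, \<sigma> w) = p} = {w. \<tau> w = fst p} \<inter> {w. \<sigma> w = snd p}" for p by auto
  then show ?thesis using assms by (auto simp: tagging_def)
qed

definition close_tags :: "'g set \<Rightarrow> ('g \<Rightarrow> 'g) \<Rightarrow> real \<Rightarrow> ('g \<Rightarrow> complex) \<Rightarrow> bool" where
  "close_tags W \<tau> d u \<longleftrightarrow> (\<forall>w\<in>W. \<forall>z. cmod (u (z + w) - u (z + \<tau> w)) \<le> d)"

text \<open>
  By uniform continuity under right translations, \<open>W\<close> is covered by finitely many
  translates \<open>t + V\<close> on which \<open>u\<close> and \<open>v\<close> oscillate by at
  most \<open>d\<close>.
\<close>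

lemma fine_tagging:
  assumes W: "compact W" and u: "u \<in> compactly_supported" and v: "v \<in> compactly_supported" and d: "d > 0"
  shows "\<exists>\<tau> T. tagging W \<tau> T \<and> close_tags W \<tau> d u \<and> close_tags W \<tau> d v"
proof -
  obtain V1 where V1: "open V1" "0 \<in> V1" "\<forall>x\<in>V1. \<forall>z. cmod (u (z + x) - u z) < d"
    using uniformly_continuous_right[OF u d] by blast
  obtain V2 where V2: "open V2" "0 \<in> V2" "\<forall>x\<in>V2. \<forall>z. cmod (v (z + x) - v z) < d"
    using uniformly_continuous_right[OF v d] by blast
  define A where "A t = {w. - t + w \<in> V1 \<inter> V2}" for t
  have A: "open (A t)" "t \<in> A t" for t
    unfolding A_def using translate_open[OF open_Int[OF V1(1) V2(1)]] V1(2) V2(2) by auto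
  obtain T where T: "T \<subseteq> W" "finite T" "W \<subseteq> (\<Union>t\<in>T. A t)"
    by (rule compactE_image[OF W, of W A]) (use A in auto)
  have "\<exists>\<tau>. (\<forall>t. {w. \<tau> w = t} \<in> sets borel) \<and> (\<forall>w\<in>(\<Union>t\<in>T. A t). \<tau> w \<in> T \<and> w \<in> A (\<tau> w))"
    by (rule finite_tags[OF T(2)]) (use A(1) in auto)
  then obtain \<tau> where \<tau>: "\<And>t. {w. \<tau> w = t} \<in> sets borel"
    "\<And>w. w \<in> (\<Union>t\<in>T. A t) \<Longrightarrow> \<tau> w \<in> T \<and> w \<in> A (\<tau> w)" by blast
  have "tagging W \<tau> T" unfolding tagging_def using W T(2,3) \<tau> by blast
  moreover have "cmod (u (z + w) - u (z + \<tau> w)) \<le> d \<and> cmod (v (z + w) - v (z + \<tau> w)) \<le> d" if w: "w \<in> W" for w z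
  proof -
    have x: "- \<tau> w + w \<in> V1" "- \<tau> w + w \<in> V2" using \<tau>(2)[of w] w T(3) by (auto simp: A_def)
    have "z + w = (z + \<tau> w) + (- \<tau> w + w)" by (simp add: add.assoc[symmetric])
    moreover have "cmod (u ((z + \<tau> w) + (- \<tau> w + w)) - u (z + \<tau> w)) < d" using V1(3) x(1) by blast
    moreover have "cmod (v ((z + \<tau> w) + (- \<tau> w + w)) - v (z + \<tau> w)) < d" using V2(3) x(2) by blast
    ultimately show ?thesis by simp
  qed
  ultimately show ?thesis unfolding close_tags_def by blast
qed

lemma indicator_integrable: "compact W \<Longrightarrow> integrable m (indicator W :: 'g \<Rightarrow> real)"
  using compact_finite borel_compact by (intro integrable_real_indicator) (auto simp: sets_haar)

text \<open>
  Replacing the tag by the point itself costs \<open>d\<close>, and \<open>(p + d)\<^sup>2 \<le>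
  2 * p\<^sup>2 + 2 * d\<^sup>2\<close>. By left invariance of Haar measure the bound does not
  depend on \<open>y\<close>.
\<close>

lemma tag_square:
  assumes W: "tagging W \<tau> T" and u: "u \<in> compactly_supported" and close_tags: "close_tags W \<tau> d u" and d: "d \<ge> 0"
  shows "(\<Sum>t\<in>T. cell W \<tau> t * (cmod (u (y + t)))\<^sup>2) \<le> 2 * (L2_norm m u)\<^sup>2 + 2 * d\<^sup>2 * measure m W"
proof -
  have cW: "compact W" using W by (simp add: tagging_def)
  note uL = translate_L2(1)[OF compactly_supported_L2[OF u], of y]
  have "(\<Sum>t\<in>T. cell W \<tau> t * (cmod (u (y + t)))\<^sup>2) = (\<integral>w. indicator W w * (cmod (u (y + \<tau> w)))\<^sup>2 \<partial>m)"
    using tag_integral(2)[OF W, of "\<lambda>t. (cmod (u (y + t)))\<^sup>2"] by simp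
  also have "\<dots> \<le> (\<integral>w. 2 * (cmod (u (y + w)))\<^sup>2 + 2 * d\<^sup>2 * indicator W w \<partial>m)"
  proof (rule integral_mono)
    show "integrable m (\<lambda>w. indicator W w * (cmod (u (y + \<tau> w)))\<^sup>2)"
      using tag_integral(1)[OF W, of "\<lambda>t. (cmod (u (y + t)))\<^sup>2"] by simp
    show "integrable m (\<lambda>w. 2 * (cmod (u (y + w)))\<^sup>2 + 2 * d\<^sup>2 * indicator W w)"
      using L2_functionsD(2)[OF uL] indicator_integrable[OF cW] by simp
    fix w
    show "indicator W w * (cmod (u (y + \<tau> w)))\<^sup>2 \<le> 2 * (cmod (u (y + w)))\<^sup>2 + 2 * d\<^sup>2 * indicator W w"
    proof (cases "w \<in> W")
      case True
      have "cmod (u (y + \<tau> w)) \<le> cmod (u (y + w)) + d"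
        using close_tags True norm_triangle_ineq2[of "u (y + \<tau> w)" "u (y + w)"]
        by (auto simp: close_tags_def norm_minus_commute dest!: bspec spec[of _ y])
      then have "(cmod (u (y + \<tau> w)))\<^sup>2 \<le> (cmod (u (y + w)) + d)\<^sup>2" by (intro power_mono) auto
      also have "\<dots> \<le> 2 * (cmod (u (y + w)))\<^sup>2 + 2 * d\<^sup>2"
        using sum_squares_bound[of "cmod (u (y + w))" d] by (simp add: power2_sum)
      finally show ?thesis using True by simp
    qed simp
  qed
  also have "\<dots> = 2 * (L2_norm m u)\<^sup>2 + 2 * d\<^sup>2 * measure m W"
    using L2_functionsD(2)[OF uL] indicator_integrable[OF cW] translate_L2(2)[OF compactly_supported_L2[OF u], of y]
    by (simp add: L2_norm_square[symmetric] space_haar)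
  finally show ?thesis .
qed

text \<open>
  These functions express a product of two coefficient functions as an integral of coefficient
  functions, see \<open>coefficient_product\<close>.
\<close>

definition shifted_product :: "('g \<Rightarrow> complex) \<Rightarrow> ('g \<Rightarrow> complex) \<Rightarrow> 'g \<Rightarrow> 'g \<Rightarrow> complex" where
  "shifted_product f u t = (\<lambda>y. f y * u (y + t))"

lemma shifted_product_supported:
  assumes "f \<in> compactly_supported" "u \<in> compactly_supported"
  shows "shifted_product f u t \<in> compactly_supported"
  unfolding shifted_product_def
proof (rule compactly_supported_mult[OF assms(1)])
  have "continuous_on UNIV u" using assms(2) by (simp add: compactly_supported_def)
  then show "continuous_on UNIV (\<lambda>y. u (y + t))"
    by (rule continuous_on_compose2) (auto intro!: continuous_intros)
qed

lemma shifted_product_norm: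
  assumes f: "f \<in> compactly_supported" and u: "u \<in> compactly_supported" and B: "B \<ge> 0" "\<And>x. cmod (u x) \<le> B"
  shows "L2_norm m (shifted_product f u t) \<le> B * L2_norm m f"
proof (rule L2_dominated(2)[OF compactly_supported_L2[OF f] _ B(1)])
  show "shifted_product f u t \<in> borel_measurable m"
    by (rule compactly_supported_measurable[OF shifted_product_supported[OF f u]])
  show "cmod (shifted_product f u t x) \<le> B * cmod (f x)" for x
    using mult_left_mono[OF B(2), of "cmod (f x)"] by (simp add: shifted_product_def norm_mult mult.commute)
qed

lemma shifted_product_diff:
  assumes f: "f \<in> compactly_supported" and u: "u \<in> compactly_supported"
    and d: "d \<ge> 0" "\<And>z. cmod (u (z + s) - u (z + t)) \<le> d"
  shows "L2_norm m (\<lambda>y. shifted_product f u s y - shifted_product f u t y) \<le> d * L2_norm m f"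
proof (rule L2_dominated(2)[OF compactly_supported_L2[OF f] _ d(1)])
  show "(\<lambda>y. shifted_product f u s y - shifted_product f u t y) \<in> borel_measurable m"
    using compactly_supported_measurable[OF shifted_product_supported[OF f u]] by (intro borel_measurable_diff) auto
  show "cmod (shifted_product f u s x - shifted_product f u t x) \<le> d * cmod (f x)" for x
    using mult_left_mono[OF d(2), of "cmod (f x)" x]
    by (simp add: shifted_product_def norm_mult mult.commute flip: right_diff_distrib)
qed

text \<open>
  This is \<open>tag_square\<close> integrated against the square of the modulus of
  \<open>f\<close>.
\<close>

lemma tag_norms:
  assumes W: "tagging W \<tau> T" and f: "f \<in> compactly_supported" and u: "u \<in> compactly_supported"
    and close_tags: "close_tags W \<tau> d u" and d: "d \<ge> 0"
  shows "(\<Sum>t\<in>T. cell W \<tau> t * (L2_norm m (shifted_product f u t))\<^sup>2) \<le>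
    (L2_norm m f)\<^sup>2 * (2 * (L2_norm m u)\<^sup>2 + 2 * d\<^sup>2 * measure m W)"
proof -
  let ?c = "2 * (L2_norm m u)\<^sup>2 + 2 * d\<^sup>2 * measure m W"
  note fL = L2_functionsD(2)[OF compactly_supported_L2[OF f]]
  have i: "integrable m (\<lambda>y. cell W \<tau> t * ((cmod (f y))\<^sup>2 * (cmod (u (y + t)))\<^sup>2))" for t
    using L2_functionsD(2)[OF compactly_supported_L2[OF shifted_product_supported[OF f u, of t]]]
    by (intro integrable_mult_right) (simp add: shifted_product_def norm_mult power_mult_distrib)
  have "(\<Sum>t\<in>T. cell W \<tau> t * (L2_norm m (shifted_product f u t))\<^sup>2) =
      (\<integral>y. (\<Sum>t\<in>T. cell W \<tau> t * ((cmod (f y))\<^sup>2 * (cmod (u (y + t)))\<^sup>2)) \<partial>m)"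
    using i by (subst Bochner_Integration.integral_sum)
      (auto simp: L2_norm_square shifted_product_def norm_mult power_mult_distrib)
  also have "\<dots> \<le> (\<integral>y. (cmod (f y))\<^sup>2 * ?c \<partial>m)"
  proof (rule integral_mono)
    show "integrable m (\<lambda>y. \<Sum>t\<in>T. cell W \<tau> t * ((cmod (f y))\<^sup>2 * (cmod (u (y + t)))\<^sup>2))"
      using i by (rule Bochner_Integration.integrable_sum)
    show "integrable m (\<lambda>y. (cmod (f y))\<^sup>2 * ?c)" by (rule integrable_mult_left[OF fL])
    fix y
    have "(\<Sum>t\<in>T. cell W \<tau> t * ((cmod (f y))\<^sup>2 * (cmod (u (y + t)))\<^sup>2)) =
        (cmod (f y))\<^sup>2 * (\<Sum>t\<in>T. cell W \<tau> t * (cmod (u (y + t)))\<^sup>2)"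
      by (simp add: sum_distrib_left mult_ac)
    also have "\<dots> \<le> (cmod (f y))\<^sup>2 * ?c"
      by (rule mult_left_mono[OF tag_square[OF W u close_tags d]]) simp
    finally show "(\<Sum>t\<in>T. cell W \<tau> t * ((cmod (f y))\<^sup>2 * (cmod (u (y + t)))\<^sup>2)) \<le> (cmod (f y))\<^sup>2 * ?c" .
  qed
  also have "\<dots> = (L2_norm m f)\<^sup>2 * ?c" by (simp add: L2_norm_square)
  finally show ?thesis .
qed

end

subsection \<open>Products of coefficient functions\<close>

lemma norm_integral_le:
  fixes f :: "'a \<Rightarrow> 'b::{banach, second_countable_topology}"
  assumes "integrable M f" "integrable M g" "\<And>x. norm (f x) \<le> g x"
  shows "norm (\<integral>x. f x \<partial>M) \<le> (\<integral>x. g x \<partial>M)"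
  by (rule order_trans[OF integral_norm_bound integral_mono[OF integrable_norm[OF assms(1)] assms(2)]])
     (rule assms(3))

context locally_compact_group
begin

text \<open>
  The tensor square of the regular representation is a multiple of the regular representation
  (Fell's absorption principle). For coefficient functions, the substitution \<open>z = y +
  w\<close> in the second integral of \<open>(\<integral>y. f (- x + y) * cnj (h y)) *
  (\<integral>z. u (- x + z) * cnj (v z))\<close> gives the integral over \<open>w\<close> of
  the coefficient functions of \<open>F w = (\<lambda>y. f y * u (y + w))\<close> and \<open>H w
  = (\<lambda>y. h y * v (y + w))\<close>.

  The integral over \<open>w\<close> is realised as a limit of Riemann sums \<open>R k\<close>
  of coefficient functions. Their successive differences are summable in norm, they converge
  pointwise to the product, and the Cauchy-Schwarz inequality with \<open>tag_norms\<close>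
  bounds their norms; the factor 2 is the one in \<open>tag_square\<close>.
\<close>

lemma coefficient_product:
  assumes f: "f \<in> compactly_supported" and h: "h \<in> compactly_supported"
    and u: "u \<in> compactly_supported" and v: "v \<in> compactly_supported"
  shows "(\<lambda>x. regular_coefficient m f h x * regular_coefficient m u v x) \<in> carrier C.space \<and>
    vnorm C.space (\<lambda>x. regular_coefficient m f h x * regular_coefficient m u v x) \<le>
      2 * ((L2_norm m f * L2_norm m h) * (L2_norm m u * L2_norm m v))"
proof -
  obtain K where K: "compact K" "\<And>x. x \<notin> K \<Longrightarrow> h x = 0" by (rule compactly_supportedE[OF h]) blast
  obtain L where L: "compact L" "\<And>x. x \<notin> L \<Longrightarrow> v x = 0" by (rule compactly_supportedE[OF v]) blast
  obtain Bu where Bu: "Bu \<ge> 0" "\<And>x. cmod (u x) \<le> Bu" by (rule compactly_supported_bounded[OF u]) blast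
  obtain Bv where Bv: "Bv \<ge> 0" "\<And>x. cmod (v x) \<le> Bv" by (rule compactly_supported_bounded[OF v]) blast
  (* The integrand vanishes for w outside W: h y = 0 unless y \<in> K, and v (y + w) = 0 unless y
     + w \<in> L. *)
  define W where "W = (\<lambda>(x, y). - x + y) ` (K \<times> L)"
  have "continuous_on (K \<times> L) (\<lambda>(x, y). - x + y)"
    unfolding case_prod_beta by (intro continuous_intros)
  then have W: "compact W" unfolding W_def by (rule compact_continuous_image[OF _ compact_Times[OF K(1) L(1)]])
  define mW where "mW = measure m W"
  have mW: "mW \<ge> 0" by (simp add: mW_def)
  define F where "F = shifted_product f u"
  define H where "H = shifted_product h v"
  define \<gamma> where "\<gamma> t = regular_coefficient m (F t) (H t)" for t
  have Fc: "F t \<in> compactly_supported" and Hc: "H t \<in> compactly_supported" for t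
    unfolding F_def H_def by (intro shifted_product_supported f h u v)+
  note FL = compactly_supported_L2[OF Fc] and HL = compactly_supported_L2[OF Hc]
  (* Any summable sequence of mesh sizes will do. *)
  define \<epsilon> where "\<epsilon> k = (1/2::real) ^ k" for k :: nat
  have \<epsilon>: "\<epsilon> k > 0" for k by (simp add: \<epsilon>_def)
  have "\<forall>k. \<exists>\<tau> T. tagging W \<tau> T \<and> close_tags W \<tau> (\<epsilon> k) u \<and> close_tags W \<tau> (\<epsilon> k) v"
    using fine_tagging[OF W u v \<epsilon>] by blast
  from choice[OF this] obtain \<tau> where
    "\<forall>k. \<exists>T. tagging W (\<tau> k) T \<and> close_tags W (\<tau> k) (\<epsilon> k) u \<and> close_tags W (\<tau> k) (\<epsilon> k) v" by blast
  from choice[OF this] obtain T where tag: "\<And>k. tagging W (\<tau> k) (T k)"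
    and cu: "\<And>k. close_tags W (\<tau> k) (\<epsilon> k) u" and cv: "\<And>k. close_tags W (\<tau> k) (\<epsilon> k) v" by blast
  have finT: "finite (T k)" for k using tag[of k] by (simp add: tagging_def)
  define R where "R k x = (\<Sum>t\<in>T k. of_real (cell W (\<tau> k) t) * \<gamma> t x)" for k x
  have \<gamma>C: "\<gamma> t \<in> carrier C.space" "vnorm C.space (\<gamma> t) \<le> L2_norm m (F t) * L2_norm m (H t)" for t
    using C.atom_closed_norm[of "(F t, H t)"] Fc Hc by (auto simp: \<gamma>_def)
  have RC: "R k \<in> carrier C.space"
    and Rn: "vnorm C.space (R k) \<le> (\<Sum>t\<in>T k. cell W (\<tau> k) t * (L2_norm m (F t) * L2_norm m (H t)))" for k
  proof -
    have a: "(\<lambda>x. of_real (cell W (\<tau> k) t) * \<gamma> t x) \<in> carrier C.space"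
      "vnorm C.space (\<lambda>x. of_real (cell W (\<tau> k) t) * \<gamma> t x) \<le> cell W (\<tau> k) t * (L2_norm m (F t) * L2_norm m (H t))" for t
      using C.scale_closed[OF \<gamma>C(1)] C.norm_scale[OF \<gamma>C(1)] mult_left_mono[OF \<gamma>C(2) cell_nonneg]
      by (simp_all add: cell_nonneg)
    note S = C.sum_closed_norm[of "T k" "\<lambda>t x. of_real (cell W (\<tau> k) t) * \<gamma> t x", OF finT a(1)]
    show "R k \<in> carrier C.space" unfolding R_def[abs_def] using S by blast
    show "vnorm C.space (R k) \<le> (\<Sum>t\<in>T k. cell W (\<tau> k) t * (L2_norm m (F t) * L2_norm m (H t)))"
      unfolding R_def[abs_def] by (rule order_trans[OF conjunct2[OF S]]) (rule sum_mono, rule a(2))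
  qed
  define c where "c = (Bu + Bv) * (L2_norm m f * L2_norm m h)"
  have c: "c \<ge> 0" using Bu(1) Bv(1) by (simp add: c_def)
  (* A coefficient function depends on both arguments, which are changed one after the other. *)
  have \<gamma>diff: "vnorm C.space (\<lambda>x. \<gamma> s x - \<gamma> t x) \<le> d * c"
    if d: "d \<ge> 0" "\<And>z. cmod (u (z + s) - u (z + t)) \<le> d" "\<And>z. cmod (v (z + s) - v (z + t)) \<le> d" for s t d
  proof -
    have dF: "(\<lambda>y. F s y - F t y) \<in> compactly_supported" and dH: "(\<lambda>y. H s y - H t y) \<in> compactly_supported"
      using compactly_supported_add[OF Fc[of s] compactly_supported_scale[OF Fc[of t], of "-1"]]
        compactly_supported_add[OF Hc[of s] compactly_supported_scale[OF Hc[of t], of "-1"]] by simp_all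
    have 1: "regular_coefficient m (\<lambda>y. F s y - F t y) (H s) \<in> carrier C.space"
      "vnorm C.space (regular_coefficient m (\<lambda>y. F s y - F t y) (H s)) \<le> L2_norm m (\<lambda>y. F s y - F t y) * L2_norm m (H s)"
      using C.atom_closed_norm[of "(\<lambda>y. F s y - F t y, H s)"] dF Hc by auto
    have 2: "regular_coefficient m (F t) (\<lambda>y. H s y - H t y) \<in> carrier C.space"
      "vnorm C.space (regular_coefficient m (F t) (\<lambda>y. H s y - H t y)) \<le> L2_norm m (F t) * L2_norm m (\<lambda>y. H s y - H t y)"
      using C.atom_closed_norm[of "(F t, \<lambda>y. H s y - H t y)"] dH Fc by auto
    have eq: "\<gamma> s x - \<gamma> t x = regular_coefficient m (\<lambda>y. F s y - F t y) (H s) x + regular_coefficient m (F t) (\<lambda>y. H s y - H t y) x" for x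
      using coefficient_diff_left[OF FL[of s] FL[of t] HL[of s], of x] coefficient_diff_right[OF FL[of t] HL[of s] HL[of t], of x]
      by (simp add: \<gamma>_def)
    have "vnorm C.space (\<lambda>x. \<gamma> s x - \<gamma> t x) \<le>
        L2_norm m (\<lambda>y. F s y - F t y) * L2_norm m (H s) + L2_norm m (F t) * L2_norm m (\<lambda>y. H s y - H t y)"
      unfolding eq using C.norm_triangle[OF 1(1) 2(1)] 1(2) 2(2) by linarith
    also have "\<dots> \<le> (d * L2_norm m f) * (Bv * L2_norm m h) + (Bu * L2_norm m f) * (d * L2_norm m h)"
      unfolding F_def H_def using d Bu Bv
      by (intro add_mono mult_mono shifted_product_diff shifted_product_norm f h u v) auto
    also have "\<dots> = d * c" by (simp add: c_def algebra_simps)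
    finally show ?thesis .
  qed
  have dist: "vnorm C.space (\<lambda>x. R (Suc k) x - R k x) \<le> (2 * c * mW) * (1/2) ^ k" for k
  proof -
    (* On the common refinement, both Riemann sums run over the same cells. *)
    let ?p = "\<lambda>w. (\<tau> (Suc k) w, \<tau> k w)" and ?P = "T (Suc k) \<times> T k"
    note tp = tagging_pair[OF tag[of "Suc k"] tag[of k]]
    have eq: "R (Suc k) x - R k x = (\<Sum>p\<in>?P. of_real (cell W ?p p) * (\<gamma> (fst p) x - \<gamma> (snd p) x))" for x
    proof -
      have r: "R j x = (\<integral>w. indicator W w *\<^sub>R \<gamma> (\<tau> j w) x \<partial>m)" for j
        unfolding R_def tag_integral(2)[OF tag, of "\<lambda>t. \<gamma> t x"] by (simp add: scaleR_conv_of_real)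
      have "R (Suc k) x - R k x = (\<integral>w. indicator W w *\<^sub>R \<gamma> (\<tau> (Suc k) w) x - indicator W w *\<^sub>R \<gamma> (\<tau> k w) x \<partial>m)"
        unfolding r by (rule Bochner_Integration.integral_diff[symmetric])
          (rule tag_integral(1)[OF tag, of "\<lambda>t. \<gamma> t x"])+
      also have "\<dots> = (\<integral>w. indicator W w *\<^sub>R (\<gamma> (fst (?p w)) x - \<gamma> (snd (?p w)) x) \<partial>m)"
        by (simp add: scaleR_diff_right)
      also have "\<dots> = (\<Sum>p\<in>?P. cell W ?p p *\<^sub>R (\<gamma> (fst p) x - \<gamma> (snd p) x))"
        by (rule tag_integral(2)[OF tp, of "\<lambda>p. \<gamma> (fst p) x - \<gamma> (snd p) x"])
      finally show ?thesis by (simp add: scaleR_conv_of_real)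
    qed
    have dc: "(\<lambda>x. \<gamma> s x - \<gamma> t x) \<in> carrier C.space" for s t by (rule C.diff_closed[OF \<gamma>C(1) \<gamma>C(1)])
    have a: "(\<lambda>x. of_real (cell W ?p p) * (\<gamma> (fst p) x - \<gamma> (snd p) x)) \<in> carrier C.space" for p
      by (rule C.scale_closed[OF dc])
    have b: "vnorm C.space (\<lambda>x. of_real (cell W ?p p) * (\<gamma> (fst p) x - \<gamma> (snd p) x)) \<le> cell W ?p p * (2 * \<epsilon> k * c)" for p
    proof (cases "cell W ?p p = 0")
      case True
      then show ?thesis using C.norm_zero by simp
    next
      case False
      (* A cell of non-zero measure contains a point w, to which both tags are close. *)
      then have "{w \<in> W. ?p w = p} \<noteq> {}" unfolding cell_def by (metis measure_empty)
      then obtain w where w: "w \<in> W" "\<tau> (Suc k) w = fst p" "\<tau> k w = snd p" by auto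
      have tri: "cmod (g (z + fst p) - g (z + snd p)) \<le> 2 * \<epsilon> k"
        if g: "close_tags W (\<tau> (Suc k)) (\<epsilon> (Suc k)) g" "close_tags W (\<tau> k) (\<epsilon> k) g" for g z
      proof -
        have "cmod (g (z + w) - g (z + fst p)) \<le> \<epsilon> (Suc k)" "cmod (g (z + w) - g (z + snd p)) \<le> \<epsilon> k"
          using g w by (auto simp: close_tags_def)
        moreover have "\<epsilon> (Suc k) \<le> \<epsilon> k" by (simp add: \<epsilon>_def)
        ultimately show ?thesis
          using norm_triangle_ineq4[of "g (z + w) - g (z + snd p)" "g (z + w) - g (z + fst p)"] by simp
      qed
      have "vnorm C.space (\<lambda>x. \<gamma> (fst p) x - \<gamma> (snd p) x) \<le> (2 * \<epsilon> k) * c"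
        by (rule \<gamma>diff) (use \<epsilon>[of k] tri cu cv in auto)
      then show ?thesis
        unfolding C.norm_scale[OF dc] using cell_nonneg[of W ?p p] by (simp add: mult_left_mono)
    qed
    have "vnorm C.space (\<lambda>x. R (Suc k) x - R k x) \<le>
        (\<Sum>p\<in>?P. vnorm C.space (\<lambda>x. of_real (cell W ?p p) * (\<gamma> (fst p) x - \<gamma> (snd p) x)))"
      unfolding eq using C.sum_closed_norm[of ?P "\<lambda>p x. of_real (cell W ?p p) * (\<gamma> (fst p) x - \<gamma> (snd p) x)"] finT a
      by blast
    also have "\<dots> \<le> (\<Sum>p\<in>?P. cell W ?p p * (2 * \<epsilon> k * c))" by (rule sum_mono) (rule b)
    also have "\<dots> = mW * (2 * \<epsilon> k * c)"
      by (simp only: sum_distrib_right[symmetric] cell_total[OF tp] mW_def)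
    finally show ?thesis by (simp add: \<epsilon>_def mult_ac)
  qed
  have lim: "(\<lambda>k. R k x) \<longlonglongrightarrow> regular_coefficient m f h x * regular_coefficient m u v x" for x
  proof -
    define a where "a y = f (- x + y) * cnj (h y)" for y
    define b where "b y = u (- x + y) * cnj (v y)" for y
    note uL = compactly_supported_L2[OF u] and vL = compactly_supported_L2[OF v]
    have ai: "integrable m a" unfolding a_def[abs_def]
      by (rule coefficient_integrable[OF compactly_supported_L2[OF f] compactly_supported_L2[OF h]])
    have bi: "integrable m b" unfolding b_def[abs_def] by (rule coefficient_integrable[OF uL vL])
    define I where "I = (\<integral>y. b y \<partial>m)"
    have \<gamma>x: "\<gamma> t x = (\<integral>y. a y * b (y + t) \<partial>m)" for t
      by (simp add: \<gamma>_def regular_coefficient_def F_def H_def shifted_product_def a_def b_def add.assoc mult_ac)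
    have abi: "integrable m (\<lambda>y. a y * b (y + t))" for t
    proof -
      have "integrable m (\<lambda>y. F t (- x + y) * cnj (H t y))" by (rule coefficient_integrable[OF FL HL])
      then show ?thesis by (simp add: F_def H_def shifted_product_def a_def b_def add.assoc mult_ac)
    qed
    have Rx: "R k x = (\<integral>y. a y * (\<Sum>t\<in>T k. of_real (cell W (\<tau> k) t) * b (y + t)) \<partial>m)"
      and Ri: "integrable m (\<lambda>y. a y * (\<Sum>t\<in>T k. of_real (cell W (\<tau> k) t) * b (y + t)))" for k
    proof -
      have i: "integrable m (\<lambda>y. of_real (cell W (\<tau> k) t) * (a y * b (y + t)))" for t
        by (intro integrable_mult_right abi)
      have e: "a y * (\<Sum>t\<in>T k. of_real (cell W (\<tau> k) t) * b (y + t)) =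
          (\<Sum>t\<in>T k. of_real (cell W (\<tau> k) t) * (a y * b (y + t)))" for y
        by (simp add: sum_distrib_left mult.left_commute)
      show "integrable m (\<lambda>y. a y * (\<Sum>t\<in>T k. of_real (cell W (\<tau> k) t) * b (y + t)))"
        unfolding e by (rule Bochner_Integration.integrable_sum[OF i])
      show "R k x = (\<integral>y. a y * (\<Sum>t\<in>T k. of_real (cell W (\<tau> k) t) * b (y + t)) \<partial>m)"
        unfolding e R_def \<gamma>x by (subst Bochner_Integration.integral_sum[OF i]) simp
    qed
    (* Left invariance lets the integral I of b be taken of w \<mapsto> b (y + w), whose Riemann
       sum this is. *)
    have close: "cmod ((\<Sum>t\<in>T k. of_real (cell W (\<tau> k) t) * b (y + t)) - I) \<le> mW * (\<epsilon> k * (Bu + Bv))"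
      if y: "y \<in> K" for k y
    proof -
      have bm: "b \<in> borel_measurable m" using bi by auto
      have out: "b (y + w) = 0" if "w \<notin> W" for w
      proof -
        have "y + w \<notin> L"
        proof
          assume "y + w \<in> L"
          then have "(\<lambda>(x, y). - x + y) (y, y + w) \<in> W" unfolding W_def using y by blast
          then show False using that by (simp add: add.assoc[symmetric])
        qed
        then show ?thesis by (simp add: b_def L(2))
      qed
      have I1: "I = (\<integral>w. b (y + w) \<partial>m)" unfolding I_def by (rule translate_integral[OF bm, symmetric])
      have byi: "integrable m (\<lambda>w. b (y + w))" using translate_integrable_iff[OF bm] bi by simp
      have S1: "(\<Sum>t\<in>T k. of_real (cell W (\<tau> k) t) * b (y + t)) = (\<integral>w. indicator W w *\<^sub>R b (y + \<tau> k w) \<partial>m)"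
        unfolding tag_integral(2)[OF tag, of "\<lambda>t. b (y + t)"] by (simp add: scaleR_conv_of_real)
      note ti = tag_integral(1)[OF tag[of k], of "\<lambda>t. b (y + t)"]
      have "cmod ((\<Sum>t\<in>T k. of_real (cell W (\<tau> k) t) * b (y + t)) - I) =
          cmod (\<integral>w. indicator W w *\<^sub>R b (y + \<tau> k w) - b (y + w) \<partial>m)"
        unfolding S1 I1 by (subst Bochner_Integration.integral_diff[OF ti byi]) simp
      also have "\<dots> \<le> (\<integral>w. indicator W w * (\<epsilon> k * (Bu + Bv)) \<partial>m)"
      proof (rule norm_integral_le)
        show "integrable m (\<lambda>w. indicator W w *\<^sub>R b (y + \<tau> k w) - b (y + w))"
          by (rule Bochner_Integration.integrable_diff[OF ti byi])
        show "integrable m (\<lambda>w. indicator W w * (\<epsilon> k * (Bu + Bv)))"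
          by (rule integrable_mult_left[OF indicator_integrable[OF W]])
        fix w
        show "cmod (indicator W w *\<^sub>R b (y + \<tau> k w) - b (y + w)) \<le> indicator W w * (\<epsilon> k * (Bu + Bv))"
        proof (cases "w \<in> W")
          case False
          then show ?thesis by (simp add: out)
        next
          case True
          let ?u = "\<lambda>t. u (- x + (y + t))" and ?v = "\<lambda>t. v (y + t)"
          have du: "cmod (?u w - ?u (\<tau> k w)) \<le> \<epsilon> k"
            using cu[of k] True by (auto simp: close_tags_def add.assoc[symmetric])
          have dv: "cmod (?v w - ?v (\<tau> k w)) \<le> \<epsilon> k"
            using cv[of k] True by (auto simp: close_tags_def)
          have "b (y + \<tau> k w) - b (y + w) = (?u (\<tau> k w) - ?u w) * cnj (?v (\<tau> k w)) + ?u w * cnj (?v (\<tau> k w) - ?v w)"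
            by (simp add: b_def algebra_simps)
          also have "cmod \<dots> \<le> cmod (?u (\<tau> k w) - ?u w) * cmod (?v (\<tau> k w)) + cmod (?u w) * cmod (?v (\<tau> k w) - ?v w)"
            by (rule order_trans[OF norm_triangle_ineq]) (simp add: norm_mult flip: complex_cnj_diff)
          also have "\<dots> \<le> \<epsilon> k * Bv + Bu * \<epsilon> k"
            using du dv Bu Bv \<epsilon>[of k] by (intro add_mono mult_mono) (auto simp: norm_minus_commute)
          finally show ?thesis using True by (simp add: algebra_simps)
        qed
      qed
      also have "\<dots> = mW * (\<epsilon> k * (Bu + Bv))" by (simp add: mW_def space_haar)
      finally show ?thesis .
    qed
    define Q where "Q = (\<integral>y. cmod (a y) \<partial>m)"
    have target: "regular_coefficient m f h x * regular_coefficient m u v x = (\<integral>y. a y * I \<partial>m)"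
      by (simp add: regular_coefficient_def a_def[abs_def] b_def[abs_def] I_def)
    have bd: "cmod (R k x - regular_coefficient m f h x * regular_coefficient m u v x) \<le> (Q * (mW * (Bu + Bv))) * \<epsilon> k" for k
    proof -
      let ?S = "\<lambda>y. \<Sum>t\<in>T k. of_real (cell W (\<tau> k) t) * b (y + t)"
      have aI: "integrable m (\<lambda>y. a y * I)" by (rule integrable_mult_left[OF ai])
      have "cmod (R k x - regular_coefficient m f h x * regular_coefficient m u v x) = cmod (\<integral>y. a y * ?S y - a y * I \<partial>m)"
        unfolding Rx target by (subst Bochner_Integration.integral_diff[OF Ri aI]) simp
      also have "\<dots> \<le> (\<integral>y. cmod (a y) * (mW * (\<epsilon> k * (Bu + Bv))) \<partial>m)"
      proof (rule norm_integral_le)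
        show "integrable m (\<lambda>y. a y * ?S y - a y * I)" by (rule Bochner_Integration.integrable_diff[OF Ri aI])
        show "integrable m (\<lambda>y. cmod (a y) * (mW * (\<epsilon> k * (Bu + Bv))))"
          by (rule integrable_mult_left[OF integrable_norm[OF ai]])
        fix y
        show "cmod (a y * ?S y - a y * I) \<le> cmod (a y) * (mW * (\<epsilon> k * (Bu + Bv)))"
        proof (cases "y \<in> K")
          case True
          have "cmod (a y * ?S y - a y * I) = cmod (a y) * cmod (?S y - I)"
            by (simp add: norm_mult flip: right_diff_distrib)
          then show ?thesis using mult_left_mono[OF close[OF True], of "cmod (a y)"] by simp
        next
          case False
          then show ?thesis by (simp add: a_def K(2))
        qed
      qed
      also have "\<dots> = (Q * (mW * (Bu + Bv))) * \<epsilon> k" by (simp add: Q_def mult_ac)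
      finally show ?thesis .
    qed
    have "(\<lambda>k. (Q * (mW * (Bu + Bv))) * \<epsilon> k) \<longlonglongrightarrow> (Q * (mW * (Bu + Bv))) * 0"
      unfolding \<epsilon>_def by (intro tendsto_mult tendsto_const LIMSEQ_power_zero) simp
    then have z: "(\<lambda>k. (Q * (mW * (Bu + Bv))) * \<epsilon> k) \<longlonglongrightarrow> 0" by simp
    have "\<forall>\<^sub>F k in sequentially. cmod (R k x - regular_coefficient m f h x * regular_coefficient m u v x) \<le> (Q * (mW * (Bu + Bv))) * \<epsilon> k"
      by (intro always_eventually allI bd)
    from Lim_null_comparison[OF this z]
    show ?thesis by (simp add: LIM_zero_iff)
  qed
  (* The Cauchy-Schwarz bound for R k; the error terms with \<epsilon> disappear in the limit. *)
  define B where "B k = sqrt (((L2_norm m f)\<^sup>2 * (2 * (L2_norm m u)\<^sup>2 + 2 * (\<epsilon> k)\<^sup>2 * mW)) *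
      ((L2_norm m h)\<^sup>2 * (2 * (L2_norm m v)\<^sup>2 + 2 * (\<epsilon> k)\<^sup>2 * mW)))" for k
  have RB: "vnorm C.space (R k) \<le> B k" for k
  proof -
    let ?c = "cell W (\<tau> k)"
    have PF: "(\<Sum>t\<in>T k. ?c t * (L2_norm m (F t))\<^sup>2) \<le> (L2_norm m f)\<^sup>2 * (2 * (L2_norm m u)\<^sup>2 + 2 * (\<epsilon> k)\<^sup>2 * mW)"
      unfolding F_def mW_def by (rule tag_norms[OF tag f u cu less_imp_le[OF \<epsilon>]])
    have PH: "(\<Sum>t\<in>T k. ?c t * (L2_norm m (H t))\<^sup>2) \<le> (L2_norm m h)\<^sup>2 * (2 * (L2_norm m v)\<^sup>2 + 2 * (\<epsilon> k)\<^sup>2 * mW)"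
      unfolding H_def mW_def by (rule tag_norms[OF tag h v cv less_imp_le[OF \<epsilon>]])
    have split: "?c t * (a * b) = (sqrt (?c t) * a) * (sqrt (?c t) * b)" for t a b
    proof -
      have "(sqrt (?c t) * a) * (sqrt (?c t) * b) = (sqrt (?c t) * sqrt (?c t)) * (a * b)" by (simp only: mult_ac)
      also have "sqrt (?c t) * sqrt (?c t) = ?c t" using cell_nonneg[of W "\<tau> k" t] by simp
      finally show ?thesis by (rule sym)
    qed
    have "(\<Sum>t\<in>T k. ?c t * (L2_norm m (F t) * L2_norm m (H t)))\<^sup>2 =
        (\<Sum>t\<in>T k. (sqrt (?c t) * L2_norm m (F t)) * (sqrt (?c t) * L2_norm m (H t)))\<^sup>2"
      by (simp only: split)
    also have "\<dots> \<le> (\<Sum>t\<in>T k. (sqrt (?c t) * L2_norm m (F t))\<^sup>2) * (\<Sum>t\<in>T k. (sqrt (?c t) * L2_norm m (H t))\<^sup>2)"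
      by (rule Cauchy_Schwarz_ineq_sum)
    also have "\<dots> = (\<Sum>t\<in>T k. ?c t * (L2_norm m (F t))\<^sup>2) * (\<Sum>t\<in>T k. ?c t * (L2_norm m (H t))\<^sup>2)"
      by (simp add: power_mult_distrib real_sqrt_pow2[OF cell_nonneg])
    also have "\<dots> \<le> ((L2_norm m f)\<^sup>2 * (2 * (L2_norm m u)\<^sup>2 + 2 * (\<epsilon> k)\<^sup>2 * mW)) *
        ((L2_norm m h)\<^sup>2 * (2 * (L2_norm m v)\<^sup>2 + 2 * (\<epsilon> k)\<^sup>2 * mW))"
      using mW cell_nonneg by (intro mult_mono PF PH sum_nonneg mult_nonneg_nonneg add_nonneg_nonneg) auto
    finally have "(\<Sum>t\<in>T k. ?c t * (L2_norm m (F t) * L2_norm m (H t))) \<le> B k"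
      unfolding B_def by (rule real_le_rsqrt)
    with Rn[of k] show ?thesis by linarith
  qed
  have \<epsilon>0: "\<epsilon> \<longlonglongrightarrow> 0" unfolding \<epsilon>_def[abs_def] by (intro LIMSEQ_power_zero) simp
  have "B \<longlonglongrightarrow> sqrt (((L2_norm m f)\<^sup>2 * (2 * (L2_norm m u)\<^sup>2 + 2 * 0\<^sup>2 * mW)) *
      ((L2_norm m h)\<^sup>2 * (2 * (L2_norm m v)\<^sup>2 + 2 * 0\<^sup>2 * mW)))"
    unfolding B_def[abs_def] by (intro tendsto_intros \<epsilon>0)
  also have "((L2_norm m f)\<^sup>2 * (2 * (L2_norm m u)\<^sup>2 + 2 * 0\<^sup>2 * mW)) *
      ((L2_norm m h)\<^sup>2 * (2 * (L2_norm m v)\<^sup>2 + 2 * 0\<^sup>2 * mW)) =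
      (2 * ((L2_norm m f * L2_norm m h) * (L2_norm m u * L2_norm m v)))\<^sup>2"
    by (simp add: power_mult_distrib)
  also have "sqrt \<dots> = 2 * ((L2_norm m f * L2_norm m h) * (L2_norm m u * L2_norm m v))"
    by (rule real_sqrt_unique) simp_all
  finally have Blim: "B \<longlonglongrightarrow> 2 * ((L2_norm m f * L2_norm m h) * (L2_norm m u * L2_norm m v))" .
  have "summable (\<lambda>k. (2 * c * mW) * (1/2::real) ^ k)"
    by (intro summable_mult summable_geometric) simp
  from C.limit_closed_norm[of R, OF RC dist this lim RB Blim] show ?thesis .
qed

lemma fourier_space: "banach_function_space (fourier_algebra m)"
  using A.banach_function_space_axioms
  unfolding banach_function_space_def fourier_algebra_simps .

text \<open>
  For compactly supported functions the constant is 2; each of the two factors is brought into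
  that form with a factor 9, and \<open>162 = 2 * 9 * 9\<close>.
\<close>

lemma fourier_mult_closed_norm:
  assumes "s \<in> carrier A.space" "t \<in> carrier A.space"
  shows "(\<lambda>x. s x * t x) \<in> carrier A.space \<and> vnorm A.space (\<lambda>x. s x * t x) \<le> 162 * vnorm A.space s * vnorm A.space t"
proof (rule A.product_closed_norm[OF _ _ assms])
  fix p q assume "p \<in> L2_functions m \<times> L2_functions m" "q \<in> L2_functions m \<times> L2_functions m"
  then obtain f h u v where pq: "p = (f, h)" "q = (u, v)" and L: "f \<in> L2_functions m" "h \<in> L2_functions m"
    "u \<in> L2_functions m" "v \<in> L2_functions m" by auto
  have CC: "(\<lambda>x. s x * t x) \<in> carrier C.space \<and> vnorm C.space (\<lambda>x. s x * t x) \<le> 2 * vnorm C.space s * vnorm C.space t"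
    if "s \<in> carrier C.space" "t \<in> carrier C.space" for s t
    by (rule C.product_closed_norm[OF _ _ that]) (use coefficient_product in \<open>auto simp: mult.assoc\<close>)
  let ?g = "\<lambda>x. regular_coefficient m f h x * regular_coefficient m u v x"
  note c1 = coefficient_in_C[OF L(1,2)] and c2 = coefficient_in_C[OF L(3,4)]
  have g: "?g \<in> carrier C.space" using CC c1 c2 by blast
  have "vnorm C.space ?g \<le> 2 * vnorm C.space (regular_coefficient m f h) * vnorm C.space (regular_coefficient m u v)"
    using CC c1 c2 by blast
  also have "\<dots> \<le> 2 * (9 * (L2_norm m f * L2_norm m h)) * (9 * (L2_norm m u * L2_norm m v))"
    using c1 c2 C.norm_nonneg by (intro mult_mono) auto
  finally have n: "vnorm C.space ?g \<le> 162 * (L2_norm m f * L2_norm m h) * (L2_norm m u * L2_norm m v)" by simp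
  have "?g \<in> carrier A.space \<and> vnorm A.space ?g \<le> 1 * vnorm C.space ?g"
  proof (rule C.inclusion[OF A.banach_function_space_axioms _ _ g])
    fix p :: "('g \<Rightarrow> complex) \<times> ('g \<Rightarrow> complex)" assume "p \<in> compactly_supported \<times> compactly_supported"
    then have "p \<in> L2_functions m \<times> L2_functions m" using compactly_supported_L2 by auto
    from A.atom_closed_norm[OF this]
    show "atom_value p \<in> carrier A.space \<and> vnorm A.space (atom_value p) \<le> 1 * atom_weight p" by simp
  qed simp
  then show "(\<lambda>z. atom_value p z * atom_value q z) \<in> carrier A.space \<and>
      vnorm A.space (\<lambda>z. atom_value p z * atom_value q z) \<le> 162 * atom_weight p * atom_weight q"
    using n by (auto simp: pq)
qed simp

lemma fourier_banach_algebra: "banach_function_algebra (fourier_algebra m)"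
proof -
  interpret banach_function_space "fourier_algebra m" by (rule fourier_space)
  show ?thesis
  proof
    show "vmult (fourier_algebra m) \<in> bounded_bilinear_maps (fourier_algebra m) (fourier_algebra m) (fourier_algebra m)"
      unfolding bounded_bilinear_maps_def linear_maps_def
      by (intro CollectI conjI exI[of _ 162])
         (auto simp: fourier_algebra_simps A.vadd_eq A.vscale_eq fourier_mult_closed_norm[unfolded mult.assoc]
           distrib_left distrib_right mult.assoc mult.left_commute)
  qed
qed

lemma coefficient_in_fourier:
  "f \<in> L2_functions m \<Longrightarrow> h \<in> L2_functions m \<Longrightarrow> regular_coefficient m f h \<in> carrier (fourier_algebra m)"
  using A.atom_closed_norm[of "(f, h)"] by (simp add: fourier_algebra_simps)

lemma coefficient_continuous:
  assumes f: "f \<in> compactly_supported" and h: "h \<in> compactly_supported"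
  shows "continuous_on UNIV (regular_coefficient m f h)"
proof -
  note fL = compactly_supported_L2[OF f] and hL = compactly_supported_L2[OF h]
  note hi = compactly_supported_integrable[OF h]
  define Q where "Q = (\<integral>y. cmod (h y) \<partial>m)"
  have "isCont (regular_coefficient m f h) x" for x
    unfolding isCont_def
  proof (rule tendstoI)
    fix e :: real assume e: "e > 0"
    have Q0: "Q \<ge> 0" unfolding Q_def by simp
    have "e / (Q + 1) > 0" using e Q0 by simp
    from uniformly_continuous_left[OF f this] obtain V where
      V: "open V" "0 \<in> V" "\<forall>v\<in>V. \<forall>z. cmod (f (v + z) - f z) < e / (Q + 1)" by blast
    have "continuous_on UNIV (\<lambda>z. - z + x)" by (intro continuous_intros)
    from open_vimage[OF V(1) this] have o: "open {z. - z + x \<in> V}" by (simp add: vimage_def)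
    have "dist (regular_coefficient m f h z) (regular_coefficient m f h x) < e" if z: "- z + x \<in> V" for z
    proof -
      have "regular_coefficient m f h z - regular_coefficient m f h x = (\<integral>y. f (- z + y) * cnj (h y) - f (- x + y) * cnj (h y) \<partial>m)"
        unfolding regular_coefficient_def
        by (rule Bochner_Integration.integral_diff[symmetric]) (rule coefficient_integrable[OF fL hL])+
      also have "cmod \<dots> \<le> (\<integral>y. e / (Q + 1) * cmod (h y) \<partial>m)"
      proof (rule norm_integral_le)
        show "integrable m (\<lambda>y. f (- z + y) * cnj (h y) - f (- x + y) * cnj (h y))"
          by (intro Bochner_Integration.integrable_diff coefficient_integrable fL hL)
        show "integrable m (\<lambda>y. e / (Q + 1) * cmod (h y))" by (intro integrable_mult_right integrable_norm hi)
        fix y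
        have "- z + y = (- z + x) + (- x + y)" by (simp add: add.assoc)
        moreover have "cmod (f ((- z + x) + (- x + y)) - f (- x + y)) < e / (Q + 1)" using V(3) z by blast
        ultimately have "cmod (f (- z + y) - f (- x + y)) \<le> e / (Q + 1)" by simp
        then have "cmod (f (- z + y) - f (- x + y)) * cmod (h y) \<le> e / (Q + 1) * cmod (h y)"
          by (rule mult_right_mono) simp
        then show "cmod (f (- z + y) * cnj (h y) - f (- x + y) * cnj (h y)) \<le> e / (Q + 1) * cmod (h y)"
          by (simp add: norm_mult flip: left_diff_distrib)
      qed
      also have "\<dots> = e / (Q + 1) * Q" unfolding Q_def by simp
      also have "\<dots> < e" using e Q0 by (simp add: divide_simps)
      finally show ?thesis by (simp add: dist_norm)
    qed
    then show "\<forall>\<^sub>F z in at x. dist (regular_coefficient m f h z) (regular_coefficient m f h x) < e"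
      using o V(2) by (intro eventually_at_topological[THEN iffD2] exI[of _ "{z. - z + x \<in> V}"]) auto
  qed
  then show ?thesis by (simp add: continuous_at_imp_continuous_on)
qed

text \<open>
  Rewritten with compactly supported functions, an element of the Fourier algebra is a uniformly
  convergent series of continuous functions.
\<close>

lemma fourier_continuous:
  assumes "t \<in> carrier (fourier_algebra m)"
  shows "continuous_on UNIV t"
proof -
  have "t \<in> carrier A.space" using assms by (simp add: fourier_algebra_simps)
  from A.inclusion[OF C.banach_function_space_axioms _ _ this, of 9] coefficient_in_C
  have "t \<in> carrier C.space" by auto
  then obtain p where p: "C.represents p t" by (auto simp: C.space_def)
  have pC: "fst (p n) \<in> compactly_supported" "snd (p n) \<in> compactly_supported" for n
    using C.representsD(1)[OF p, of n] by auto
  have "uniform_limit UNIV (\<lambda>n x. \<Sum>i<n. atom_value (p i) x) (\<lambda>x. \<Sum>i. atom_value (p i) x) sequentially"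
  proof (rule Weierstrass_m_test[OF _ C.representsD(2)[OF p]])
    show "cmod (atom_value (p n) x) \<le> atom_weight (p n)" for n x
      using coefficient_bound[OF compactly_supported_L2[OF pC(1)[of n]] compactly_supported_L2[OF pC(2)[of n]], of x]
      by (simp add: case_prod_beta)
  qed
  moreover have "continuous_on UNIV (\<lambda>x. \<Sum>i<n. atom_value (p i) x)" for n
    using coefficient_continuous[OF pC] by (intro continuous_on_sum) (simp add: case_prod_beta)
  ultimately have "continuous_on UNIV (\<lambda>x. \<Sum>i. atom_value (p i) x)"
    by (intro uniform_limit_theorem[OF always_eventually]) auto
  moreover have "t = (\<lambda>x. \<Sum>i. atom_value (p i) x)" using C.representsD(3)[OF p] by auto
  ultimately show ?thesis by simp
qed

text \<open>
  Finitely many translates of a non-empty open set cover a given compact set, and a measure that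
  vanishes on compact sets is zero by inner regularity.
\<close>

lemma open_positive:
  assumes V: "open V" "V \<noteq> {}"
  shows "emeasure m V \<noteq> 0"
proof
  assume z: "emeasure m V = 0"
  obtain v where v: "v \<in> V" using V(2) by blast
  have tr: "emeasure m {y. x + y \<in> V} = 0" for x
  proof -
    have "emeasure (distr m m ((+) x)) V = emeasure m {y. x + y \<in> V}"
      using emeasure_distr[OF translate_measurable_fun, of V x] V(1) by (simp add: sets_haar space_haar vimage_def)
    then show ?thesis using z by (simp add: translate_haar)
  qed
  have "emeasure m K = 0" if K: "compact K" for K
  proof -
    define U where "U k = {y. (v + - k) + y \<in> V}" for k
    have U: "open (U k)" "k \<in> U k" "U k \<in> null_sets m" for k
      unfolding U_def using translate_open[OF V(1), of "v + - k"] v tr[of "v + - k"]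
      by (auto simp: add.assoc sets_haar)
    obtain D where D: "D \<subseteq> K" "finite D" "K \<subseteq> (\<Union>x\<in>D. U x)"
      by (rule compactE_image[OF K, of K U]) (use U in auto)
    have "(\<Union>x\<in>D. U x) \<in> null_sets m" using D(2) U(3) by (intro null_sets.finite_UN) auto
    then have "emeasure m (\<Union>x\<in>D. U x) = 0" by auto
    moreover have "emeasure m K \<le> emeasure m (\<Union>x\<in>D. U x)"
      using D(2) U(1) by (intro emeasure_mono[OF D(3)]) (auto simp: sets_haar)
    ultimately show ?thesis by simp
  qed
  then have "emeasure m UNIV = 0" unfolding haar_inner[OF open_UNIV]
    by (intro antisym SUP_least) auto
  then show False using haar by (simp add: left_haar_measure_def)
qed

text \<open>
  The coefficient function of the indicators of \<open>O1\<close> and \<open>x + O1\<close> at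
  \<open>z\<close> is the measure of \<open>(z + O1) \<inter> (x + O1)\<close>. For a small open
  neighbourhood \<open>O1\<close> of 0 it is positive at \<open>x\<close>, while \<open>y +
  O1\<close> and \<open>x + O1\<close> are disjoint.
\<close>

lemma fourier_separates:
  assumes "x \<noteq> y"
  shows "\<exists>g\<in>carrier (fourier_algebra m). g x \<noteq> 0 \<and> g y = 0"
proof -
  obtain X Y where XY: "open X" "open Y" "x \<in> X" "y \<in> Y" "X \<inter> Y = {}" using hausdorff[OF assms] by blast
  obtain V L where VL: "open V" "compact L" "{0::'g} \<subseteq> V" "V \<subseteq> L"
    by (rule compact_neighbourhood[of "{0}"]) auto
  define O1 where "O1 = {z. x + z \<in> X} \<inter> {z. y + z \<in> Y} \<inter> V"
  define O2 where "O2 = {z. - x + z \<in> O1}"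
  have o1: "open O1" "0 \<in> O1" unfolding O1_def using translate_open XY VL by (auto intro!: open_Int)
  have o2: "open O2" unfolding O2_def by (rule translate_open[OF o1(1)])
  have fin: "emeasure m A < \<infinity>" if "A \<subseteq> K" "compact K" for A K
  proof -
    have "emeasure m A \<le> emeasure m K" using that borel_compact by (intro emeasure_mono) (auto simp: sets_haar)
    then show ?thesis using compact_finite[OF that(2)] by (rule le_less_trans)
  qed
  have f1: "emeasure m O1 < \<infinity>" by (rule fin[OF _ VL(2)]) (use VL(4) in \<open>auto simp: O1_def\<close>)
  have f2: "emeasure m O2 < \<infinity>"
  proof -
    have "emeasure (distr m m ((+) (- x))) O1 = emeasure m O2"
      using emeasure_distr[OF translate_measurable_fun, of O1 "- x"] o1(1)
      by (simp add: sets_haar space_haar vimage_def O2_def)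
    then show ?thesis using f1 by (simp add: translate_haar)
  qed
  let ?f = "\<lambda>z. complex_of_real (indicator O1 z)" and ?h = "\<lambda>z. complex_of_real (indicator O2 z)"
  have L2: "?f \<in> L2_functions m" "?h \<in> L2_functions m"
    by (intro L2_indicator f1 f2; simp add: sets_haar o1 o2)+
  have val: "regular_coefficient m ?f ?h z = of_real (measure m ({w. - z + w \<in> O1} \<inter> O2))" for z
  proof -
    have "regular_coefficient m ?f ?h z = (\<integral>w. complex_of_real (indicator ({w. - z + w \<in> O1} \<inter> O2) w) \<partial>m)"
      unfolding regular_coefficient_def by (intro Bochner_Integration.integral_cong) (auto simp: indicator_def)
    then show ?thesis by (simp add: space_haar)
  qed
  have "{w. - x + w \<in> O1} \<inter> O2 = O2" unfolding O2_def by auto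
  moreover have "measure m O2 \<noteq> 0"
  proof -
    have "x \<in> O2" unfolding O2_def using o1(2) by simp
    then have "emeasure m O2 \<noteq> 0" using open_positive[OF o2] by blast
    then show ?thesis using f2 by (simp add: measure_def enn2real_eq_0_iff)
  qed
  ultimately have "regular_coefficient m ?f ?h x \<noteq> 0" unfolding val by simp
  moreover have "{w. - y + w \<in> O1} \<inter> O2 = {}"
  proof -
    have False if "- y + w \<in> O1" "- x + w \<in> O1" for w
    proof -
      have "y + (- y + w) \<in> Y" "x + (- x + w) \<in> X" using that unfolding O1_def by auto
      then show False using XY(5) by (auto simp: add.assoc[symmetric])
    qed
    then show ?thesis unfolding O2_def by auto
  qed
  then have "regular_coefficient m ?f ?h y = 0" unfolding val by simp
  ultimately show ?thesis using coefficient_in_fourier[OF L2] by blast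
qed

lemma fourier_nonzero: "\<exists>g\<in>carrier (fourier_algebra m). g x \<noteq> 0"
proof (cases "\<exists>y. x \<noteq> y")
  case True
  then show ?thesis using fourier_separates by blast
next
  case False
  then have U: "UNIV = {x}" by auto
  have "emeasure m UNIV < \<infinity>" unfolding U by (rule compact_finite) simp
  then have L2: "(\<lambda>z. complex_of_real (indicator UNIV z)) \<in> L2_functions m"
    by (intro L2_indicator) (auto simp: sets_haar)
  let ?i = "\<lambda>z. complex_of_real (indicator UNIV z)"
  have "regular_coefficient m ?i ?i x = of_real (measure m UNIV)"
    by (simp add: regular_coefficient_def space_haar scaleR_conv_of_real)
  moreover have "measure m UNIV \<noteq> 0"
    using open_positive[OF open_UNIV] \<open>emeasure m UNIV < \<infinity>\<close> by (simp add: measure_def enn2real_eq_0_iff)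
  ultimately have "regular_coefficient m ?i ?i x \<noteq> 0" by simp
  then show ?thesis using coefficient_in_fourier[OF L2 L2] by (rule bexI)
qed

end

section \<open>Left biprojectivity forces finiteness, and conversely\<close>

lemma (in banach_function_space) linear_functional_sum:
  assumes L: "L \<in> linear_maps X complex_space" and I: "finite I" "\<And>i. i \<in> I \<Longrightarrow> a i \<in> carrier X"
  shows "L (\<lambda>z. \<Sum>i\<in>I. c i * a i z) = (\<Sum>i\<in>I. c i * L (a i))"
  using I
proof (induction I rule: finite_induct)
  case empty
  show ?case using linear_maps_from(3)[OF L zero_closed zero_closed, of 0] by simp
next
  case (insert i I)
  have a: "(\<lambda>z. c i * a i z) \<in> carrier X" using insert.prems by (intro scale_closed) auto
  have b: "(\<lambda>z. \<Sum>i\<in>I. c i * a i z) \<in> carrier X"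
    using sum_closed_norm[of I "\<lambda>i z. c i * a i z"] insert scale_closed by auto
  show ?case
    using insert linear_maps_from(2)[OF L a b] linear_maps_from(3)[OF L, of "a i" "a i" "c i"] by simp
qed

lemma discrete_borel:
  assumes "\<And>x::'g::t2_space. open {x}"
  shows "open (E :: 'g set)" "E \<in> sets borel"
proof -
  have "open (\<Union>x\<in>E. {x})" using assms by (intro open_UN) auto
  then show "open E" by simp
  then show "E \<in> sets borel" by simp
qed

lemma discrete_compact_finite:
  assumes "\<And>x::'g::t2_space. open {x}" "compact (K :: 'g set)"
  shows "finite K"
proof -
  obtain D where "D \<subseteq> K" "finite D" "K \<subseteq> (\<Union>x\<in>D. {x})"
    by (rule compactE_image[OF assms(2), of K "\<lambda>x. {x}"]) (use assms(1) in auto)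
  then show ?thesis by (metis UN_singleton finite_subset)
qed

lemma complex_measure_finite_sum:
  assumes "complex_measure \<mu>" "finite E" "\<And>x. x \<in> E \<Longrightarrow> {x} \<in> sets borel"
  shows "\<mu> E = (\<Sum>x\<in>E. \<mu> {x})"
  using assms(2,3)
proof (induction E rule: finite_induct)
  case empty
  then show ?case using complex_measureD(3)[OF assms(1)] by simp
next
  case (insert x E)
  have "E \<in> sets borel"
    using insert.prems sets.finite_UN[of E "\<lambda>x. {x}" borel] insert.hyps(1) by simp
  then have "\<mu> ({x} \<union> E) = \<mu> {x} + \<mu> E"
    using insert by (intro complex_measureD(4)[OF assms(1)]) auto
  then show ?case using insert by simp
qed

text \<open>
  The identity reads \<open>f x * g x * n x = \<psi> g * f x * n x\<close>. Hence \<open>g x =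
  \<psi> g\<close> at every point where \<open>n\<close> does not vanish, and since the Fourier
  algebra separates points there is exactly one such point. It is open because \<open>n\<close>
  is continuous, and translations carry it to all points.
\<close>

lemma absorbs_imp_discrete:
  fixes m :: "'g::{topological_group_add, t2_space} measure"
  assumes lcg: "locally_compact_group m" and \<psi>: "\<psi> \<in> characters (fourier_algebra m)"
    and n: "banach_function_algebra.absorbs (fourier_algebra m) \<psi> n"
  shows "open {x :: 'g}"
proof -
  interpret locally_compact_group m by fact
  interpret F: banach_function_algebra "fourier_algebra m" by (rule fourier_banach_algebra)
  have nF: "n \<in> carrier (fourier_algebra m)" and n1: "\<psi> n = 1"
    and abs: "\<And>f g. f \<in> carrier (fourier_algebra m) \<Longrightarrow> g \<in> carrier (fourier_algebra m) \<Longrightarrow>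
      (\<lambda>x. f x * g x * n x) = (\<lambda>x. \<psi> g * (f x * n x))"
    using n unfolding F.absorbs_def fourier_algebra_simps(5) by blast+
  have ab: "f x * g x * n x = \<psi> g * (f x * n x)"
    if "f \<in> carrier (fourier_algebra m)" "g \<in> carrier (fourier_algebra m)" for f g x
    using fun_cong[OF abs[OF that], of x] .
  have ev: "g x = \<psi> g" if "n x \<noteq> 0" "g \<in> carrier (fourier_algebra m)" for x g
  proof -
    obtain f where "f \<in> carrier (fourier_algebra m)" "f x \<noteq> 0" using fourier_nonzero by blast
    then show ?thesis using ab[of f g x] that by simp
  qed
  have "\<exists>y. n y \<noteq> 0"
  proof (rule ccontr)
    assume "\<nexists>y. n y \<noteq> 0"
    then have "n = (\<lambda>z. 0 * n z)" by auto
    then have "\<psi> n = 0 * \<psi> n" using F.characterD(3)[OF \<psi> nF, of 0] by simp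
    then show False using n1 by simp
  qed
  then obtain y where y: "n y \<noteq> 0" by blast
  have only: "z = y" if "n z \<noteq> 0" for z
  proof (rule ccontr)
    assume "z \<noteq> y"
    from fourier_separates[OF this] obtain g where g: "g \<in> carrier (fourier_algebra m)" "g z \<noteq> 0" "g y = 0" by blast
    have "g z = g y" by (rule trans[OF ev[OF that g(1)] ev[OF y g(1), symmetric]])
    with g(2,3) show False by simp
  qed
  have "n -` (- {0}) = {y}"
  proof (rule set_eqI)
    show "z \<in> n -` (- {0}) \<longleftrightarrow> z \<in> {y}" for z using only[of z] y by (cases "z = y") auto
  qed
  moreover have "open (n -` (- {0}))" by (rule open_vimage[OF _ fourier_continuous[OF nF]]) auto
  ultimately have "open {y}" by simp
  then have "open {z. (y + - x) + z \<in> {y}}" by (rule translate_open)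
  moreover have "{z. (y + - x) + z \<in> {y}} = {x}"
  proof -
    have "z = x" if "(y + - x) + z = y" for z
    proof -
      have "y + (- x + z) = y + 0" using that by (simp only: add.assoc add_0_right)
      then have "- x + z = 0" by (simp only: add_left_cancel)
      then have "x + (- x + z) = x + 0" by simp
      then show ?thesis by simp
    qed
    then show ?thesis by (auto simp: add.assoc)
  qed
  ultimately show ?thesis by simp
qed

text \<open>
  Convolution with a point mass translates \<open>n\<close>, so the identity says that
  translating \<open>n\<close> by \<open>x\<close> multiplies it by the value of
  \<open>\<phi>\<close> at the point mass. These values are bounded, because
  \<open>\<phi>\<close> is and point masses have norm at most 1. Therefore the atoms of
  \<open>n\<close> are bounded away from 0, and finite total variation leaves room for finitely
  many.
\<close>

lemma absorbs_imp_finite: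
  fixes \<phi> :: "('g::{topological_group_add, t2_space} set \<Rightarrow> complex) \<Rightarrow> complex"
  assumes disc: "\<And>x::'g. open {x}" and \<phi>: "\<phi> \<in> characters measure_algebra"
    and n: "banach_function_algebra.absorbs measure_algebra \<phi> n"
  shows "finite (UNIV :: 'g set)"
proof -
  interpret M: banach_function_algebra "measure_algebra :: ('g set \<Rightarrow> complex) nalgebra"
    by (rule measure_banach_algebra)
  note borel = discrete_borel(2)[OF disc]
  have nM: "regular_complex_measure n" and n1: "\<phi> n = 1"
    and ab: "\<And>\<mu> \<nu>. regular_complex_measure \<mu> \<Longrightarrow> regular_complex_measure \<nu> \<Longrightarrow>
      convolution (convolution \<mu> \<nu>) n = (\<lambda>E. \<phi> \<nu> * convolution \<mu> n E)"
    using n unfolding M.absorbs_def by auto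
  have unit: "convolution (dirac 0) \<nu> = \<nu>" if "regular_complex_measure \<nu>" for \<nu> :: "'g set \<Rightarrow> complex"
    using dirac_convolution[OF that borel, of 0] by auto
  have shift: "n {0} = \<phi> (dirac x) * n {x}" for x
  proof -
    have "convolution (dirac x) n {x} = \<phi> (dirac x) * n {x}"
      using ab[OF dirac_regular(1) dirac_regular(1), of 0 x] by (simp add: unit dirac_regular(1) nM)
    moreover have "{y. x + y \<in> {x}} = {0}" using add_left_cancel[of x _ 0] by auto
    ultimately show ?thesis using dirac_convolution[OF nM borel, of x "{x}"] by simp
  qed
  have shift': "n {z} = \<phi> (dirac (- z)) * n {0}" for z
  proof -
    have "convolution (dirac (- z)) n {0} = \<phi> (dirac (- z)) * n {0}"
      using ab[OF dirac_regular(1) dirac_regular(1), of 0 "- z"] by (simp add: unit dirac_regular(1) nM)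
    moreover have "{y. - z + y \<in> {0}} = {z}"
      by (auto simp: neg_eq_iff_add_eq_0[symmetric] eq_neg_iff_add_eq_0)
    ultimately show ?thesis using dirac_convolution[OF nM borel, of "- z" "{0}"] by simp
  qed
  (* Otherwise n vanishes on all points, hence on compact sets, which are finite, and by
     regularity on all sets. *)
  have n0: "n {0} \<noteq> 0"
  proof
    assume "n {0} = 0"
    then have z: "n {z} = 0" for z using shift'[of z] by simp
    let ?V = "variation_measure n"
    note V = regularD(2)[OF nM]
    interpret V: finite_measure ?V by (rule finite_radonD(3)[OF V])
    have "n E = 0" for E
    proof -
      have "cmod (n E) \<le> 0 + e" if e: "e > 0" for e :: real
      proof -
        from finite_radonD(4)[OF V borel[of E] e] obtain K U where
          KU: "compact K" "K \<subseteq> E" "E \<subseteq> U" "emeasure ?V (U - K) < ennreal e" by blast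
        have "n (K \<union> (E - K)) = n K + n (E - K)"
          by (rule complex_measureD(4)[OF regularD(1)[OF nM] borel borel]) auto
        moreover have "n K = 0"
          using complex_measure_finite_sum[OF regularD(1)[OF nM] discrete_compact_finite[OF disc KU(1)]] borel z by simp
        moreover have "K \<union> (E - K) = E" using KU(2) by auto
        ultimately have "cmod (n E) \<le> measure ?V (E - K)" using regularD(4)[OF nM, of "E - K"] by simp
        also have "\<dots> \<le> measure ?V (U - K)"
          using KU(3) borel by (intro V.finite_measure_mono) (auto simp: finite_radonD(1)[OF V])
        also have "\<dots> < e" using KU(4) e by (simp add: V.emeasure_eq_measure ennreal_less_iff)
        finally show ?thesis by simp
      qed
      then have "cmod (n E) \<le> 0" by (rule field_le_epsilon)
      then show ?thesis by simp
    qed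
    then have "n = (\<lambda>E. 0 * n E)" by auto
    then have "\<phi> n = 0 * \<phi> n" using M.characterD(3)[OF \<phi>, of n 0] nM by simp
    then show False using n1 by simp
  qed
  obtain K where K: "K \<ge> 0" "\<And>\<mu>. regular_complex_measure \<mu> \<Longrightarrow> cmod (\<phi> \<mu>) \<le> K * enn2real (total_variation \<mu> UNIV)"
    by (rule M.bounded_mapE[OF M.character_bounded[OF \<phi>]]) auto
  have \<phi>K: "cmod (\<phi> (dirac x)) \<le> K" for x
    using K(2)[OF dirac_regular(1)[of x]] mult_left_mono[OF dirac_regular(2)[of x] K(1)] by simp
  have K0: "K > 0"
  proof (rule ccontr)
    assume "\<not> K > 0"
    then have "\<phi> (dirac 0) = 0" using \<phi>K[of 0] K(1) by simp
    then show False using shift[of 0] n0 by simp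
  qed
  define \<delta> where "\<delta> = cmod (n {0}) / K"
  have \<delta>: "\<delta> > 0" using n0 K0 by (simp add: \<delta>_def)
  have low: "\<delta> \<le> cmod (n {x})" for x
  proof -
    have "cmod (n {0}) \<le> K * cmod (n {x})"
      unfolding shift[of x] norm_mult by (rule mult_right_mono[OF \<phi>K]) simp
    then show ?thesis using K0 by (simp add: \<delta>_def divide_le_eq mult.commute)
  qed
  let ?V = "variation_measure n"
  note V = regularD(2)[OF nM]
  interpret V: finite_measure ?V by (rule finite_radonD(3)[OF V])
  have card: "real (card F) \<le> measure ?V UNIV / \<delta>" if F: "finite F" for F :: "'g set"
  proof -
    have "real (card F) * \<delta> = (\<Sum>x\<in>F. \<delta>)" by simp
    also have "\<dots> \<le> (\<Sum>x\<in>F. measure ?V {x})"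
      by (rule sum_mono) (use low regularD(4)[OF nM] order_trans in blast)
    also have "\<dots> = measure ?V F"
      by (rule V.finite_measure_eq_sum_singleton[OF F, symmetric]) (simp add: finite_radonD(1)[OF V] borel)
    also have "\<dots> \<le> measure ?V UNIV"
      using V.bounded_measure finite_radonD(2)[OF V] by simp
    finally show ?thesis using \<delta> by (simp add: pos_le_divide_eq)
  qed
  show ?thesis
  proof (rule ccontr)
    assume "infinite (UNIV :: 'g set)"
    then obtain F :: "'g set" where F: "finite F" "card F = nat \<lfloor>measure ?V UNIV / \<delta>\<rfloor> + 1"
      using infinite_arbitrarily_large by blast
    then show False using card[OF F(1)] by linarith
  qed
qed

text \<open>
  The element is the average of \<open>\<phi> (dirac (- x)) dirac x\<close> over the group.
  Translation by \<open>x\<close> multiplies it by \<open>\<phi> (dirac x)\<close> because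
  \<open>\<phi>\<close> is multiplicative on point masses, and point masses span the measure
  algebra.
\<close>

lemma finite_measure_absorber:
  fixes \<phi> :: "('g::{topological_group_add, t2_space} set \<Rightarrow> complex) \<Rightarrow> complex"
  assumes fin: "finite (UNIV :: 'g set)" and \<phi>: "\<phi> \<in> characters measure_algebra"
  shows "\<exists>n. regular_complex_measure n \<and> \<phi> n = 1 \<and>
    (\<forall>\<mu>. regular_complex_measure \<mu> \<longrightarrow> convolution \<mu> n = (\<lambda>E. \<phi> \<mu> * n E))"
proof -
  interpret M: banach_function_algebra "measure_algebra :: ('g set \<Rightarrow> complex) nalgebra"
    by (rule measure_banach_algebra)
  have "closed (- {x})" for x :: 'g by (rule finite_imp_closed) (rule finite_subset[OF subset_UNIV fin])
  then have disc: "open {x}" for x :: 'g by (simp add: closed_def)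
  note borel = discrete_borel(2)[OF disc]
  note lin = M.characterD(1)[OF \<phi>]
  have dM: "dirac x \<in> carrier measure_algebra" for x :: 'g by (simp add: dirac_regular(1))
  have dd: "convolution (dirac x) (dirac y) = dirac (x + y)" for x y :: 'g
    using dirac_convolution[OF dirac_regular(1) borel, of x y] by (auto simp: dirac_def borel)
  have \<phi>mult: "\<phi> (dirac (x + y)) = \<phi> (dirac x) * \<phi> (dirac y)" for x y
    using M.characterD(2)[OF \<phi> dM dM, of x y] by (simp add: dd)
  have expand: "\<mu> = (\<lambda>E. \<Sum>x\<in>UNIV. \<mu> {x} * dirac x E)" if \<mu>: "regular_complex_measure \<mu>" for \<mu> :: "'g set \<Rightarrow> complex"
  proof
    fix E :: "'g set"
    have "\<mu> E = (\<Sum>x\<in>E. \<mu> {x})"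
      by (rule complex_measure_finite_sum[OF regularD(1)[OF \<mu>] finite_subset[OF subset_UNIV fin]]) (rule borel)
    also have "\<dots> = (\<Sum>x\<in>UNIV. \<mu> {x} * dirac x E)"
      by (rule sum.mono_neutral_cong_left[OF fin]) (auto simp: dirac_def borel)
    finally show "\<mu> E = (\<Sum>x\<in>UNIV. \<mu> {x} * dirac x E)" .
  qed
  have \<phi>0: "\<phi> (dirac 0) = 1"
  proof -
    obtain \<mu> where \<mu>: "regular_complex_measure \<mu>" "\<phi> \<mu> = 1" using M.characterD(4)[OF \<phi>] by auto
    have "convolution (dirac 0) \<mu> = \<mu>" using dirac_convolution[OF \<mu>(1) borel, of 0] by auto
    then show ?thesis using M.characterD(2)[OF \<phi> dM, of \<mu> 0] \<mu> by simp
  qed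
  define N where "N = complex_of_nat (card (UNIV :: 'g set))"
  have N: "N \<noteq> 0" unfolding N_def using fin by (simp add: card_eq_0_iff)
  define c where "c x = \<phi> (dirac (- x)) / N" for x
  define n where "n = (\<lambda>E. \<Sum>x\<in>UNIV. c x * dirac x E)"
  have nM: "regular_complex_measure n"
    using M.sum_closed_norm[OF fin, of "\<lambda>x E. c x * dirac x E"] M.scale_closed[OF dM] by (simp add: n_def)
  have inv: "\<phi> (dirac (- x)) * \<phi> (dirac x) = 1" for x
    using \<phi>mult[of "- x" x] \<phi>0 by simp
  have "\<phi> n = (\<Sum>x\<in>UNIV. c x * \<phi> (dirac x))"
    unfolding n_def by (rule M.linear_functional_sum[OF lin fin dM])
  also have "\<dots> = (\<Sum>x\<in>(UNIV :: 'g set). 1 / N)" by (simp add: c_def inv)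
  also have "\<dots> = 1" using N by (simp add: N_def)
  finally have n1: "\<phi> n = 1" .
  have nE: "n E = (\<Sum>x\<in>E. c x)" for E
    unfolding n_def by (rule sum.mono_neutral_cong_right[OF fin]) (auto simp: dirac_def borel)
  have translate: "convolution (dirac x) n E = \<phi> (dirac x) * n E" for x E
  proof -
    have "convolution (dirac x) n E = (\<Sum>y\<in>{y. x + y \<in> E}. c y)"
      using dirac_convolution[OF nM borel, of x E] nE by simp
    also have "\<dots> = (\<Sum>z\<in>E. c (- x + z))"
    proof (rule sum.reindex_bij_witness[of _ "\<lambda>z. - x + z" "\<lambda>y. x + y"])
    qed (auto simp: add.assoc[symmetric])
    also have "\<dots> = (\<Sum>z\<in>E. \<phi> (dirac x) * c z)"
    proof (rule sum.cong[OF refl])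
      fix z
      have "- (- x + z) = - z + x" by (simp add: minus_add)
      then show "c (- x + z) = \<phi> (dirac x) * c z" by (simp add: c_def \<phi>mult)
    qed
    also have "\<dots> = \<phi> (dirac x) * n E" by (simp add: nE sum_distrib_left)
    finally show ?thesis .
  qed
  have "convolution \<mu> n = (\<lambda>E. \<phi> \<mu> * n E)" if \<mu>: "regular_complex_measure \<mu>" for \<mu>
  proof
    fix E
    have L: "(\<lambda>\<mu>. convolution \<mu> n E) \<in> linear_maps measure_algebra complex_space"
      using bounded_linear_mapsD(1)[OF M.right_mult_eval[of n E]] nM by simp
    have "convolution (\<lambda>E. \<Sum>x\<in>UNIV. \<mu> {x} * dirac x E) n E = (\<Sum>x\<in>UNIV. \<mu> {x} * convolution (dirac x) n E)"
      by (rule M.linear_functional_sum[OF L fin dM])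
    also have "\<dots> = (\<Sum>x\<in>UNIV. \<mu> {x} * \<phi> (dirac x)) * n E"
      by (simp add: translate sum_distrib_right mult.assoc)
    also have "(\<Sum>x\<in>UNIV. \<mu> {x} * \<phi> (dirac x)) = \<phi> (\<lambda>E. \<Sum>x\<in>UNIV. \<mu> {x} * dirac x E)"
      by (rule M.linear_functional_sum[OF lin fin dM, symmetric])
    finally show "convolution \<mu> n E = \<phi> \<mu> * n E" by (simp only: expand[OF \<mu>, symmetric])
  qed
  then show ?thesis using nM n1 by blast
qed

text \<open>
  On a finite group the Fourier algebra contains the indicators of all points, which span it.
  The character does not vanish on one of them, the indicator of \<open>y\<close>; it is then
  evaluation at \<open>y\<close>, and this indicator absorbs.
\<close>

lemma finite_fourier_absorber:
  fixes m :: "'g::{topological_group_add, t2_space} measure"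
  assumes lcg: "locally_compact_group m" and fin: "finite (UNIV :: 'g set)"
    and \<psi>: "\<psi> \<in> characters (fourier_algebra m)"
  shows "\<exists>k\<in>carrier (fourier_algebra m). \<psi> k = 1 \<and>
    (\<forall>g\<in>carrier (fourier_algebra m). (\<lambda>x. g x * k x) = (\<lambda>x. \<psi> g * k x))"
proof -
  interpret locally_compact_group m by fact
  interpret F: banach_function_algebra "fourier_algebra m" by (rule fourier_banach_algebra)
  have "closed (- {x})" for x :: 'g by (rule finite_imp_closed) (rule finite_subset[OF subset_UNIV fin])
  then have disc: "open {x}" for x :: 'g by (simp add: closed_def)
  note borel = discrete_borel(2)[OF disc]
  define \<eta> where "\<eta> y = (\<lambda>x::'g. if x = y then 1 else 0 :: complex)" for y
  have \<eta>F: "\<eta> y \<in> carrier (fourier_algebra m)" for y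
  proof -
    have fin1: "emeasure m {z} < \<infinity>" for z by (rule compact_finite) simp
    let ?i = "\<lambda>z w. complex_of_real (indicator {z} w)"
    have L2: "?i z \<in> L2_functions m" for z by (rule L2_indicator[OF _ fin1]) (simp add: sets_haar borel)
    have "regular_coefficient m (?i 0) (?i y) x = of_real (measure m {y}) * \<eta> y x" for x
    proof -
      have "(\<lambda>w. ?i 0 (- x + w) * cnj (?i y w)) = (\<lambda>w. of_real (indicator {y} w) * \<eta> y x)"
      proof
        fix w
        show "?i 0 (- x + w) * cnj (?i y w) = of_real (indicator {y} w) * \<eta> y x"
          by (cases "w = y") (auto simp: \<eta>_def indicator_def neg_eq_iff_add_eq_0[symmetric] add_eq_0_iff2)
      qed
      then show ?thesis by (simp add: regular_coefficient_def space_haar scaleR_conv_of_real)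
    qed
    moreover have "measure m {y} \<noteq> 0"
      using open_positive[OF disc[of y]] fin1[of y] by (simp add: measure_def enn2real_eq_0_iff)
    ultimately have "\<eta> y = (\<lambda>x. inverse (of_real (measure m {y})) * regular_coefficient m (?i 0) (?i y) x)"
      by (auto simp: fun_eq_iff)
    then show ?thesis using F.scale_closed[OF coefficient_in_fourier[OF L2 L2]] by metis
  qed
  note lin = F.characterD(1)[OF \<psi>]
  have expand: "g = (\<lambda>x. \<Sum>y\<in>UNIV. g y * \<eta> y x)" for g :: "'g \<Rightarrow> complex"
    using fin by (auto simp: \<eta>_def fun_eq_iff if_distrib cong: if_cong)
  have mult: "\<psi> (\<lambda>x. g x * h x) = \<psi> g * \<psi> h"
    if "g \<in> carrier (fourier_algebra m)" "h \<in> carrier (fourier_algebra m)" for g h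
    using F.characterD(2)[OF \<psi> that] by (simp add: fourier_algebra_simps)
  have "\<exists>y. \<psi> (\<eta> y) \<noteq> 0"
  proof (rule ccontr)
    assume "\<nexists>y. \<psi> (\<eta> y) \<noteq> 0"
    then have "\<psi> (\<lambda>x. \<Sum>y\<in>UNIV. g y * \<eta> y x) = 0" for g
      using F.linear_functional_sum[OF lin fin \<eta>F] by simp
    then show False using F.characterD(4)[OF \<psi>] expand by (metis zero_neq_one)
  qed
  then obtain y where y: "\<psi> (\<eta> y) \<noteq> 0" by blast
  have "(\<lambda>x. \<eta> y x * \<eta> y x) = \<eta> y" by (auto simp: \<eta>_def)
  then have y1: "\<psi> (\<eta> y) = 1" using mult[OF \<eta>F \<eta>F, of y y] y by simp
  have "(\<lambda>x. g x * \<eta> y x) = (\<lambda>x. \<psi> g * \<eta> y x)" if g: "g \<in> carrier (fourier_algebra m)" for g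
  proof -
    have e: "(\<lambda>x. g x * \<eta> y x) = (\<lambda>x. g y * \<eta> y x)" by (auto simp: \<eta>_def)
    have "\<psi> g = g y" using mult[OF g \<eta>F[of y]] F.characterD(3)[OF \<psi> \<eta>F[of y], of "g y"] y1 by (simp add: e)
    then show ?thesis using e by simp
  qed
  then show ?thesis using \<eta>F y1 by blast
qed

theorem theorem3p5:
  fixes m :: "'g::{topological_group_add, t2_space} measure"
    and \<phi>\<^sub>0 \<phi> :: "('g set \<Rightarrow> complex) \<Rightarrow> complex"
    and \<psi> :: "('g \<Rightarrow> complex) \<Rightarrow> complex"
  assumes "locally_compact_space (euclidean :: 'g topology)"
    and "left_haar_measure m"
    and "\<phi>\<^sub>0 \<in> characters (L1_algebra m)"
    and "\<phi> \<in> characters (measure_algebra :: ('g set \<Rightarrow> complex) nalgebra)"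
    and "\<forall>\<mu>\<in>carrier (L1_algebra m). \<phi> \<mu> = \<phi>\<^sub>0 \<mu>"
    and "\<psi> \<in> characters (fourier_algebra m)"
  shows "left_biprojective (measure_algebra \<otimes>\<^sub>p fourier_algebra m)
           (tensor_functional measure_algebra (fourier_algebra m) \<phi> \<psi>)
         \<longleftrightarrow> finite (UNIV :: 'g set)"
proof -
  note \<phi> = assms(4) and \<psi> = assms(6)
  have lcg: "locally_compact_group m" using assms(1,2) by unfold_locales
  interpret locally_compact_group m by (rule lcg)
  interpret tensor_algebra_pair "measure_algebra :: ('g set \<Rightarrow> complex) nalgebra" "fourier_algebra m"
    by (intro tensor_algebra_pair.intro measure_banach_algebra fourier_banach_algebra)
  show ?thesis
  proof
    assume "left_biprojective (measure_algebra \<otimes>\<^sub>p fourier_algebra m)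
      (tensor_functional measure_algebra (fourier_algebra m) \<phi> \<psi>)"
    from biprojective_imp_factors_absorb[OF \<phi> \<psi> this] obtain n k where
      n: "banach_function_algebra.absorbs measure_algebra \<phi> n"
      and k: "banach_function_algebra.absorbs (fourier_algebra m) \<psi> k" by blast
    show "finite (UNIV :: 'g set)"
      by (rule absorbs_imp_finite[OF absorbs_imp_discrete[OF lcg \<psi> k] \<phi> n])
  next
    assume fin: "finite (UNIV :: 'g set)"
    obtain n where n: "regular_complex_measure n" "\<phi> n = 1"
      "\<And>\<mu>. regular_complex_measure \<mu> \<Longrightarrow> convolution \<mu> n = (\<lambda>E. \<phi> \<mu> * n E)"
      using finite_measure_absorber[OF fin \<phi>] by blast
    obtain k where k: "k \<in> carrier (fourier_algebra m)" "\<psi> k = 1"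
      "\<And>g. g \<in> carrier (fourier_algebra m) \<Longrightarrow> (\<lambda>x. g x * k x) = (\<lambda>x. \<psi> g * k x)"
      using finite_fourier_absorber[OF lcg fin \<psi>] by blast
    show "left_biprojective (measure_algebra \<otimes>\<^sub>p fourier_algebra m)
      (tensor_functional measure_algebra (fourier_algebra m) \<phi> \<psi>)"
    proof (rule tensor_biprojectiveI[OF \<phi> \<psi>])
      show "vmult measure_algebra \<mu> n = (\<lambda>z. \<phi> \<mu> * n z)" if "\<mu> \<in> carrier measure_algebra" for \<mu>
        using n(3) that by simp
      show "vmult (fourier_algebra m) g k = (\<lambda>z. \<psi> g * k z)" if "g \<in> carrier (fourier_algebra m)" for g
        using k(3)[OF that] by (simp add: fourier_algebra_simps(5))
    qed (use n k in auto)
  qed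
qed

end
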